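(* Let $d\ge1$ and let $G\subset\mathbb R^{2d}$ be a non-empty bounded convex open set. Define $$\mathcal L(f_1,f_2)(x)=\Big(\sum_{k\in\mathbb Z}\big|\mathbf A_{2^k}^G(f_1,f_2)(x)-\mathcal E_kf_1(x)\cdot\mathcal E_kf_2(x)\big|^2\Big)^{1/2},\qquad x\in\mathbb R^d .$$ Then: (a) $\mathcal L$ is bounded from $L^{p_1}(\mathbb R^d)\times L^{p_2}(\mathbb R^d)$ to $L^p(\mathbb R^d)$ for all $1<p_1,p_2<\infty$ and $1/p=1/p_1+1/p_2$; that is, there is a constant $C$ with $\|\mathcal L(f_1,f_2)\|_{L^p}\le C\|f_1\|_{L^{p_1}}\|f_2\|_{L^{p_2}}$ for all $f_1\in L^{p_1}$, $f_2\in L^{p_2}$; (b) $\mathcal L$ is bounded from $L^\infty_c(\mathbb R^d)\times L^\infty_c(\mathbb R^d)$ to $BMO_{\mathrm d}$; that is, there is a constant $C$ with $\|\mathcal L(f_1,f_2)\|_{BMO_{\mathrm d}}\le C\|f_1\|_{L^\infty}\|f_2\|_{L^\infty}$ for all $f_1,f_2\in L^\infty_c$; (c) $\mathcal L$ is bounded from $L^1(\mathbb R^d)\times L^{p_2}(\mathbb R^d)$ to $L^{p,\infty}(\mathbb R^d)$ for all $1\le p_2\le\infty$ and $1/p=1+1/p_2$; that is, there is a constant $C$ with $\sup_{\alpha>0}\alpha\,|\{\mathcal L(f_1,f_2)>\alpha\}|^{1/p}\le C\|f_1\|_{L^1}\|f_2\|_{L^{p_2}}$ for all $f_1\in L^1$,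 $f_2\in L^{p_2}$.
   Context: For $t>0$, $G_t=\{z\in\mathbb R^{2d}:t^{-1}z\in G\}$ and $\mathbf A_t^G(f_1,f_2)(x)=\frac1{|G_t|}\int_{G_t}f_1(x+y_1)f_2(x+y_2)\,dy_1dy_2$. For $k\in\mathbb Z$, $\mathscr D_k$ is the set of dyadic cubes of side length $2^k$ in $\mathbb R^d$ and $\mathcal E_kf(x)=\sum_{Q\in\mathscr D_k}\big(\frac1{|Q|}\int_Qf\big)\mathbf 1_Q(x)$ is the conditional expectation. $L^\infty_c(\mathbb R^d)$ is the space of compactly supported $L^\infty$ functions. $\|f\|_{BMO_{\mathrm d}}=\sup_Q\inf_a\frac1{|Q|}\int_Q|f-a|$, the supremum over dyadic cubes $Q\subset\mathbb R^d$ and the infimum over constants $a$. The body $G$ is fixed; constants do not depend on $f_1,f_2$. *)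

theory Defs
  imports "HOL-Analysis.Analysis" "HOL-Probability.Essential_Supremum"
begin

text \<open>
  The Euclidean space of dimension \<open>d\<close> is \<^typ>\<open>real^'n\<close> with \<open>d = CARD('n)\<close>, and the one of
  dimension \<open>2d\<close> is the product \<^typ>\<open>(real^'n) \<times> (real^'n)\<close>, so that \<open>z = (y\<^sub>1, y\<^sub>2)\<close>.
  Measurability and integrals refer to Lebesgue measure (the completion of \<^const>\<open>lborel\<close>).
\<close>

definition average :: "'a::euclidean_space set \<Rightarrow> ('a \<Rightarrow> complex) \<Rightarrow> complex"
  where "average S f = (LINT y:S|lebesgue. f y) /\<^sub>R measure lebesgue S"

definition dilate :: "real \<Rightarrow> 'a::real_vector set \<Rightarrow> 'a set"
  where "dilate t G = {z. inverse t *\<^sub>R z \<in> G}"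

definition bilinear_avg ::
    "((real^'n) \<times> (real^'n)) set \<Rightarrow> real \<Rightarrow> (real^'n \<Rightarrow> complex) \<Rightarrow> (real^'n \<Rightarrow> complex)
      \<Rightarrow> real^'n \<Rightarrow> complex"
  where "bilinear_avg G t f1 f2 x = average (dilate t G) (\<lambda>(y1, y2). f1 (x + y1) * f2 (x + y2))"

definition dyadic_cubes :: "int \<Rightarrow> (real^'n) set set"
  where "dyadic_cubes k =
    {Q. \<exists>m :: 'n \<Rightarrow> int.
        Q = {x. \<forall>i. 2 powi k * of_int (m i) \<le> x $ i \<and> x $ i < 2 powi k * of_int (m i + 1)}}"

definition dyadic_expectation :: "int \<Rightarrow> (real^'n \<Rightarrow> complex) \<Rightarrow> real^'n \<Rightarrow> complex"
  where "dyadic_expectation k f x = (\<Sum>\<^sub>\<infinity>Q\<in>dyadic_cubes k. average Q f * indicator Q x)"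

text \<open>Only used with exponents \<open>r > 0\<close>.\<close>

definition ennreal_powr :: "ennreal \<Rightarrow> real \<Rightarrow> ennreal"
  where "ennreal_powr x r = (if x = top then top else ennreal (enn2real x powr r))"

text \<open>The sum over the integers may diverge at some points, hence the values in \<^typ>\<open>ennreal\<close>.\<close>

definition square_fun ::
    "((real^'n) \<times> (real^'n)) set \<Rightarrow> (real^'n \<Rightarrow> complex) \<Rightarrow> (real^'n \<Rightarrow> complex) \<Rightarrow> real^'n \<Rightarrow> ennreal"
  where "square_fun G f1 f2 x =
    ennreal_powr
      (\<Sum>\<^sub>\<infinity>k::int. ennreal ((norm (bilinear_avg G (2 powi k) f1 f2 x
          - dyadic_expectation k f1 x * dyadic_expectation k f2 x))\<^sup>2))
      (1/2)"

text \<open>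
  The (quasi-)norms are defined on functions with values in \<open>[0, \<infinity>]\<close>; the exponent \<open>p\<close> ranges
  over \<open>(0, \<infinity>]\<close>, with \<open>1 / \<infinity> = 0\<close> in \<^typ>\<open>ennreal\<close>.
\<close>

definition Lp_norm :: "ennreal \<Rightarrow> ('a::euclidean_space \<Rightarrow> ennreal) \<Rightarrow> ennreal"
  where "Lp_norm p g =
    (if p = top then esssup lebesgue g
     else ennreal_powr (\<integral>\<^sup>+x. ennreal_powr (g x) (enn2real p) \<partial>lebesgue) (1 / enn2real p))"

definition weak_Lp_norm :: "ennreal \<Rightarrow> ('a::euclidean_space \<Rightarrow> ennreal) \<Rightarrow> ennreal"
  where "weak_Lp_norm p g =
    (SUP \<alpha>\<in>{0::real<..}.
      ennreal \<alpha> * ennreal_powr (emeasure lebesgue {x. g x > ennreal \<alpha>}) (1 / enn2real p))"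

abbreviation Lp_norm_complex :: "ennreal \<Rightarrow> ('a::euclidean_space \<Rightarrow> complex) \<Rightarrow> ennreal"
  where "Lp_norm_complex p f \<equiv> Lp_norm p (\<lambda>x. ennreal (norm (f x)))"

definition Lp_space :: "ennreal \<Rightarrow> ('a::euclidean_space \<Rightarrow> complex) set"
  where "Lp_space p = {f \<in> borel_measurable lebesgue. Lp_norm_complex p f < top}"

definition Linf_c :: "('a::euclidean_space \<Rightarrow> complex) set"
  where "Linf_c =
    {f \<in> Lp_space top. \<exists>K. compact K \<and> (AE x in lebesgue. x \<notin> K \<longrightarrow> f x = 0)}"

text \<open>
  The functions are extended real valued, with \<open>\<bar>\<infinity> - a\<bar> = \<infinity>\<close> for every constant \<open>a\<close>.
  A finite norm thus forces finiteness almost everywhere.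
\<close>

definition BMO_dyadic_norm :: "(real^'n \<Rightarrow> ereal) \<Rightarrow> ennreal"
  where "BMO_dyadic_norm f =
    (SUP Q\<in>(\<Union>k. dyadic_cubes k). INF a::real.
      (\<integral>\<^sup>+x\<in>Q. e2ennreal \<bar>f x - ereal a\<bar> \<partial>lebesgue) / emeasure lebesgue Q)"

end

theory Submission
  imports Defs
begin

text \<open>
  Write \<open>A k\<close> for the average at scale \<open>2 powi k\<close> and \<open>DD k\<close> for its difference with the product of the
  conditional expectations.  The functions are first assumed constant on the dyadic cubes of some
  level \<open>m\<close>, and only finitely many scales are summed; no constant depends on these choices.

  On \<open>L\<^sup>2\<close>, the tensor product of \<open>f1\<close> and \<open>f2\<close> is expanded into martingale differences.  The integral
  of a difference over a product of cubes inside the region of integration vanishes, so finer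
  differences only see the boundary layer of the dilated body, which is thin by convexity, and
  coarser ones are constant on most cubes; both effects give geometric decay in the difference of the levels.
  A bilinear Calderon-Zygmund decomposition on stopping cubes, again with boundary layers only,
  gives the weak endpoint bound for \<open>L\<^sup>1 \<times> L\<^sup>1\<close>.  Localised to one cube, that bound controls the dyadic
  oscillation of the fourth root of the square function by maximal functions, and the
  Garsia-Neveu inequality turns this control into the strong bounds.  These are then fed back into the
  Calderon-Zygmund decomposition (other weak bounds) and into a single cube (BMO).  The general
  case follows by approximation, Fatou's lemma and homogeneity.
\<close>

text \<open>The weak endpoint is L^(1/2), outside the Banach range, and this shapes the proof. A
  weak bound there makes only powers below 1/2 of the square function locally integrable, so
  oscillation is measured for a smaller power. The strong bounds, whose exponent p may be close to
  1/2, come from one inequality with exponent 4p > 1 instead of from duality or interpolation. The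
  functions are not split into good and bad parts, which would produce mixed terms. The tensor
  product \<open>f1 (fst z) * f2 (snd z)\<close> is compared at once with that of the stopped
  averages: the integrals agree over products of selected cubes inside the region, and a product
  crossing the boundary is charged to the larger of its two cubes. Step functions have a finest
  level, on which averaging is the identity; with finitely many scales all quantities are finite,
  which the absorption in \<open>garsia\<close> requires. Estimates use fixed heights and sums of
  p-th powers of norms; scaling each function separately turns them into products of norms.\<close>

abbreviation nn_lint :: "('a::euclidean_space \<Rightarrow> ennreal) \<Rightarrow> ennreal" (binder "NN " 10)
  where "nn_lint \<equiv> nn_integral lborel"

abbreviation borel_funs :: "('a::topological_space \<Rightarrow> 'b::topological_space) set" ("\<B>")
  where "\<B> \<equiv> borel_measurable borel"

subsection \<open>The dyadic grid\<close>

text \<open>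
  \<open>gr k x\<close> indexes the cube of side \<open>2 powi k\<close> containing \<open>x\<close>, so that two points lie in the same cube of
  level \<open>k\<close> iff \<open>gr k\<close> agrees on them.
\<close>

definition gr :: "int \<Rightarrow> real^'n \<Rightarrow> int^'n" where
  "gr k x = (\<chi> i. \<lfloor>x $ i / 2 powi k\<rfloor>)"

text \<open>Plays the role of a ball of radius about N 2^k. It depends only on the cubes of level
  \<open>k\<close>, so the sets it defines are unions of such cubes, and it passes to coarser levels
  with the same \<open>N\<close>.\<close>

definition near :: "int \<Rightarrow> int \<Rightarrow> real^'n \<Rightarrow> real^'n \<Rightarrow> bool" where
  "near N k x y \<longleftrightarrow> (\<forall>i. \<bar>gr k x $ i - gr k y $ i\<bar> \<le> N)"

text \<open>Nesting of the grid: the floor of a quotient can be taken in two stages, so passing to a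
  coarser level is integer division of the index.\<close>

lemma gr_div:
  assumes "j \<le> k"
  shows "gr k x $ i = gr j x $ i div 2 ^ nat (k - j)"
proof -
  have "(2::real) powi k = 2 powi j * 2 powi (k - j)"
    by (subst power_int_add[symmetric]) auto
  also have "(2::real) powi (k - j) = real_of_int (2 ^ nat (k - j))"
    using assms by (simp add: power_int_def)
  finally have "x $ i / 2 powi k = (x $ i / 2 powi j) / real_of_int (2 ^ nat (k - j))"
    by (simp add: divide_divide_eq_left)
  moreover have "\<lfloor>(x $ i / 2 powi j) / real_of_int (2 ^ nat (k - j))\<rfloor> = \<lfloor>x $ i / 2 powi j\<rfloor> div 2 ^ nat (k - j)"
    by (rule floor_divide_real_eq_div) simp
  ultimately show ?thesis by (simp only: gr_def vec_lambda_beta)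
qed

lemma gr_mono: "gr j x = gr j y \<Longrightarrow> j \<le> k \<Longrightarrow> gr k x = gr k y"
  by (simp add: vec_eq_iff gr_div)

lemma near_refl [simp]: "0 \<le> N \<Longrightarrow> near N k x x"
  by (simp add: near_def)

lemma near_sym: "near N k x y \<longleftrightarrow> near N k y x"
  by (simp add: near_def abs_minus_commute)

lemma near_cong: "gr k x = gr k x' \<Longrightarrow> gr k y = gr k y' \<Longrightarrow> near N k x y = near N k x' y'"
  by (simp add: near_def)

lemma div_diff_le:
  fixes a b N m :: int
  assumes "a - b \<le> N" "0 \<le> N" "1 \<le> m"
  shows "a div m - b div m \<le> N"
proof -
  have "N * 1 \<le> N * m" using assms by (intro mult_left_mono) auto
  then have "a div m \<le> (b + N * m) div m"
    using assms by (intro zdiv_mono1) auto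
  also have "\<dots> = b div m + N" using assms by simp
  finally show ?thesis by simp
qed

lemma near_mono:
  assumes "near N j x y" "j \<le> k" "0 \<le> N"
  shows "near N k x y"
  unfolding near_def
proof
  fix i
  have "\<bar>gr j x $ i - gr j y $ i\<bar> \<le> N" using assms by (simp add: near_def)
  then have *: "gr j x $ i - gr j y $ i \<le> N" "gr j y $ i - gr j x $ i \<le> N" by linarith+
  have "1 \<le> (2::int) ^ nat (k - j)" by simp
  then show "\<bar>gr k x $ i - gr k y $ i\<bar> \<le> N"
    using div_diff_le[OF *(1) assms(3)] div_diff_le[OF *(2) assms(3)]
    by (simp add: gr_div[OF assms(2)] abs_le_iff)
qed

text \<open>Floors can differ by almost 1 more than the numbers themselves; hence
  \<open>N - 1\<close> here and \<open>N + 1\<close> in the converse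
  \<open>near_bound\<close>.\<close>

lemma nearI:
  assumes "\<And>i. \<bar>x $ i - y $ i\<bar> \<le> (of_int N - 1) * 2 powi k"
  shows "near N k x y"
  unfolding near_def gr_def
proof (simp, intro allI)
  fix i
  have p: "(2::real) powi k > 0" by simp
  have "\<bar>x $ i / 2 powi k - y $ i / 2 powi k\<bar> = \<bar>x $ i - y $ i\<bar> / 2 powi k"
    by (simp add: abs_divide diff_divide_distrib[symmetric])
  also have "\<dots> \<le> of_int N - 1" using assms[of i] p by (simp add: divide_le_eq)
  finally show "\<bar>\<lfloor>x $ i / 2 powi k\<rfloor> - \<lfloor>y $ i / 2 powi k\<rfloor>\<bar> \<le> N" by linarith
qed

lemma near_bound:
  assumes "near N k x y"
  shows "\<bar>x $ i - y $ i\<bar> \<le> (of_int N + 1) * 2 powi k"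
proof -
  have p: "(2::real) powi k > 0" by simp
  have "\<bar>\<lfloor>x $ i / 2 powi k\<rfloor> - \<lfloor>y $ i / 2 powi k\<rfloor>\<bar> \<le> N"
    using assms by (simp add: near_def gr_def)
  then have "\<bar>x $ i / 2 powi k - y $ i / 2 powi k\<bar> \<le> of_int N + 1" by linarith
  moreover have "\<bar>x $ i / 2 powi k - y $ i / 2 powi k\<bar> = \<bar>x $ i - y $ i\<bar> / 2 powi k"
    by (simp add: abs_divide diff_divide_distrib[symmetric])
  ultimately show ?thesis using p by (simp add: divide_le_eq)
qed

lemma near_trans:
  "near N k x y \<Longrightarrow> near M k y z \<Longrightarrow> near (N + M) k x z"
  unfolding near_def
proof
  fix i assume "\<forall>i. \<bar>gr k x $ i - gr k y $ i\<bar> \<le> N" "\<forall>i. \<bar>gr k y $ i - gr k z $ i\<bar> \<le> M"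
  then have "\<bar>gr k x $ i - gr k y $ i\<bar> \<le> N" "\<bar>gr k y $ i - gr k z $ i\<bar> \<le> M" by blast+
  then show "\<bar>gr k x $ i - gr k z $ i\<bar> \<le> N + M" by linarith
qed

lemma gr_bound:
  assumes "gr k x = gr k y"
  shows "\<bar>x $ i - y $ i\<bar> \<le> 2 powi k"
  using near_bound[of 0 k x y i] assms by (simp add: near_def)

lemma norm_vec_le:
  fixes x :: "real^'n"
  assumes "\<And>i. \<bar>x $ i\<bar> \<le> c"
  shows "norm x \<le> real CARD('n) * c"
proof -
  have "norm x \<le> (\<Sum>i\<in>UNIV. \<bar>x $ i\<bar>)" by (rule norm_le_l1_cart)
  also have "\<dots> \<le> (\<Sum>i\<in>(UNIV::'n set). c)" by (intro sum_mono assms)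
  finally show ?thesis by simp
qed

lemma gr_dist:
  fixes x y :: "real^'n"
  assumes "gr k x = gr k y"
  shows "norm (x - y) \<le> real CARD('n) * 2 powi k"
  by (intro norm_vec_le) (simp add: gr_bound[OF assms])

section \<open>Volumes of cubes, and measurability of maps constant on cubes\<close>

lemma gr_measurable [measurable]: "gr k \<in> borel \<rightarrow>\<^sub>M count_space UNIV"
proof -
  have "gr k -` {g} \<inter> space borel \<in> sets borel" for g :: "int^'n"
  proof -
    have "gr k -` {g} \<inter> space borel = {x \<in> space borel. \<forall>i. \<lfloor>x $ i / 2 powi k\<rfloor> = g $ i}"
      by (auto simp: gr_def vec_eq_iff)
    also have "\<dots> \<in> sets borel" by measurable
    finally show ?thesis .
  qed
  then show ?thesis
    by (subst measurable_count_space_eq2_countable) auto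
qed

text \<open>The sides may differ because \<open>boundary_measure\<close> applies this to slabs along
  the faces of a cube.\<close>

lemma emeasure_le_cube:
  fixes a :: "real^'n"
  assumes "S \<subseteq> {x. \<forall>i. a $ i \<le> x $ i \<and> x $ i \<le> a $ i + c i}" "\<And>i. 0 \<le> c i"
  shows "emeasure lborel S \<le> ennreal (\<Prod>i\<in>UNIV. c i)"
proof -
  let ?b = "\<chi> i. a $ i + c i"
  have "S \<subseteq> cbox a ?b" using assms(1) by (auto simp: mem_box_cart)
  then have "emeasure lborel S \<le> emeasure lborel (cbox a ?b)"
    by (intro emeasure_mono) auto
  also have "\<dots> = ennreal (measure lborel (cbox a ?b))"
    by (subst emeasure_eq_ennreal_measure) (auto simp: emeasure_lborel_cbox_eq)
  also have "measure lborel (cbox a ?b) = (\<Prod>i\<in>UNIV. c i)"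
    using content_cbox_cart[of a ?b] assms(2) by (auto simp: interval_ne_empty_cart)
  finally show ?thesis .
qed

lemma near_measure:
  fixes x :: "real^'n"
  assumes "0 \<le> N"
  shows "emeasure lborel {y. near N k x y} \<le> ennreal ((2 * of_int N + 1) ^ CARD('n) * (2 powi k) ^ CARD('n))"
proof -
  let ?c = "(2 * of_int N + 1) * 2 powi k :: real"
  let ?a = "(\<chi> i. 2 powi k * of_int (gr k x $ i - N)) :: real^'n"
  have p: "(2::real) powi k > 0" by simp
  have "{y. near N k x y} \<subseteq> {y. \<forall>i. ?a $ i \<le> y $ i \<and> y $ i \<le> ?a $ i + ?c}"
  proof (clarify, intro conjI)
    fix y i assume "near N k x y"
    then have "\<bar>gr k x $ i - gr k y $ i\<bar> \<le> N" by (simp add: near_def)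
    then have *: "gr k x $ i - N \<le> gr k y $ i" "gr k y $ i \<le> gr k x $ i + N" by linarith+
    have 1: "of_int (gr k y $ i) \<le> y $ i / 2 powi k" "y $ i / 2 powi k < of_int (gr k y $ i) + 1"
      by (simp_all add: gr_def)
    have "of_int (gr k x $ i - N) \<le> y $ i / 2 powi k" using 1 * by linarith
    then show "?a $ i \<le> y $ i" using p by (simp add: pos_le_divide_eq mult.commute)
    have "y $ i / 2 powi k \<le> of_int (gr k x $ i - N) + (2 * of_int N + 1)" using 1 * by linarith
    then have "y $ i \<le> (of_int (gr k x $ i - N) + (2 * of_int N + 1)) * 2 powi k"
      using p by (simp add: pos_divide_le_eq)
    then show "y $ i \<le> ?a $ i + ?c" by (simp add: algebra_simps)
  qed
  from emeasure_le_cube[OF this] show ?thesis using assms by (simp add: power_mult_distrib)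
qed

lemma cell_measure:
  fixes g :: "int^'n"
  shows "emeasure lborel {y. gr k y = g} = ennreal ((2 powi k) ^ CARD('n))"
proof (rule antisym)
  have p: "(2::real) powi k > 0" by simp
  define x :: "real^'n" where "x = (\<chi> i. 2 powi k * of_int (g $ i))"
  have gx: "gr k x = g" by (simp add: x_def gr_def vec_eq_iff)
  have "{y. gr k y = g} = {y. near 0 k x y}" by (auto simp: near_def gx[symmetric] vec_eq_iff)
  then show "emeasure lborel {y. gr k y = g} \<le> ennreal ((2 powi k) ^ CARD('n))"
    using near_measure[of 0 k x] by simp
  let ?b = "\<chi> i. x $ i + 2 powi k"
  have "box x ?b \<subseteq> {y. gr k y = g}"
  proof
    fix y assume "y \<in> box x ?b"
    then have "2 powi k * of_int (g $ i) < y $ i \<and> y $ i < 2 powi k * of_int (g $ i) + 2 powi k" for i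
      by (auto simp: mem_box_cart x_def)
    then have "of_int (g $ i) \<le> y $ i / 2 powi k \<and> y $ i / 2 powi k < of_int (g $ i) + 1" for i
      using p by (simp add: pos_le_divide_eq pos_divide_less_eq algebra_simps less_imp_le)
    then have "\<lfloor>y $ i / 2 powi k\<rfloor> = g $ i" for i by (simp add: floor_eq_iff)
    then show "y \<in> {y. gr k y = g}" by (simp add: gr_def vec_eq_iff)
  qed
  then have "emeasure lborel (box x ?b) \<le> emeasure lborel {y. gr k y = g}"
    by (intro emeasure_mono) (auto simp: vimage_def[symmetric] intro!: measurable_sets[OF gr_measurable, simplified])
  moreover have "emeasure lborel (box x ?b) = ennreal ((2 powi k) ^ CARD('n))"
  proof -
    have "(?b - x) \<bullet> b = 2 powi k" if "b \<in> Basis" for b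
    proof -
      obtain i where "b = axis i 1" using \<open>b \<in> Basis\<close> by (auto simp: Basis_vec_def)
      then show ?thesis by (simp add: inner_axis)
    qed
    moreover have "x \<bullet> b \<le> ?b \<bullet> b" if "b \<in> Basis" for b
      using calculation[OF that] p by (simp add: inner_diff_left del: zero_less_power_int)
    ultimately show ?thesis by (subst emeasure_lborel_box) (auto simp: DIM_cart)
  qed
  ultimately show "ennreal ((2 powi k) ^ CARD('n)) \<le> emeasure lborel {y. gr k y = g}" by simp
qed

text \<open>The function factors through the countable set of cube indices, on which every map is
  measurable.\<close>

lemma measurable_const_cells:
  fixes f :: "real^'n \<Rightarrow> 'a"
  assumes "\<And>x y. gr m x = gr m y \<Longrightarrow> f x = f y" "\<And>x. f x \<in> space M"
  shows "f \<in> borel \<rightarrow>\<^sub>M M"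
proof -
  define h where "h g = f (SOME x. gr m x = g)" for g
  have "f x = h (gr m x)" for x
    unfolding h_def by (rule assms(1)[symmetric], rule someI) simp
  then have "f = h \<circ> gr m" by auto
  moreover have "h \<in> count_space UNIV \<rightarrow>\<^sub>M M" by (auto simp: h_def assms(2))
  ultimately show ?thesis by (simp add: measurable_comp[OF gr_measurable])
qed

lemma measurable_const_cells2:
  fixes f :: "(real^'n) \<times> (real^'n) \<Rightarrow> 'a"
  assumes "\<And>x y x' y'. gr m x = gr m x' \<Longrightarrow> gr m y = gr m y' \<Longrightarrow> f (x, y) = f (x', y')" "\<And>x. f x \<in> space M"
  shows "f \<in> borel \<rightarrow>\<^sub>M M"
proof -
  define h where "h g g' = f ((SOME x. gr m x = g), (SOME x. gr m x = g'))" for g g'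
  have "f (x, y) = h (gr m x) (gr m y)" for x y
    unfolding h_def by (rule assms(1)) (rule sym, rule someI, simp)+
  then have eq: "f = (\<lambda>z. h (gr m (fst z)) (gr m (snd z)))" by auto
  have 1: "(\<lambda>z. (gr m (fst z), gr m (snd z))) \<in> borel \<Otimes>\<^sub>M borel \<rightarrow>\<^sub>M count_space UNIV \<Otimes>\<^sub>M (count_space UNIV :: (int^'n) measure)"
    by measurable
  have "(\<lambda>p. h (fst p) (snd p)) \<in> count_space UNIV \<Otimes>\<^sub>M (count_space UNIV :: (int^'n) measure) \<rightarrow>\<^sub>M M"
    by (subst pair_measure_countable) (auto simp: h_def assms(2))
  from measurable_comp[OF 1 this] show ?thesis
    by (subst eq) (simp add: borel_prod[symmetric] comp_def)
qed

lemma sat_sets: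
  fixes S :: "(real^'n) set"
  assumes "\<And>x y. gr m x = gr m y \<Longrightarrow> x \<in> S \<longleftrightarrow> y \<in> S"
  shows "S \<in> sets borel"
proof -
  have "(\<lambda>x. x \<in> S) \<in> borel \<rightarrow>\<^sub>M count_space UNIV"
    by (rule measurable_const_cells[of m], rule assms) auto
  then show ?thesis by (simp add: pred_def)
qed

lemma sat_sets2:
  fixes S :: "((real^'n) \<times> (real^'n)) set"
  assumes "\<And>x y x' y'. gr m x = gr m x' \<Longrightarrow> gr m y = gr m y' \<Longrightarrow> (x, y) \<in> S \<longleftrightarrow> (x', y') \<in> S"
  shows "S \<in> sets borel"
proof -
  have "(\<lambda>x. x \<in> S) \<in> borel \<rightarrow>\<^sub>M count_space UNIV"
    by (rule measurable_const_cells2[of m], rule assms) auto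
  then show ?thesis by (simp add: pred_def)
qed

subsection \<open>Averages over cubes of variable level\<close>

text \<open>
  A function \<open>\<kappa>\<close> with \<open>stp m \<kappa>\<close> selects the cube of level \<open>\<kappa> x \<ge> m\<close> around each point \<open>x\<close>; the selected cubes
  partition the space.  The predicates \<open>sat\<close> and \<open>sat2\<close> mean constancy on selected cubes and on products of them.
\<close>

definition stp :: "int \<Rightarrow> (real^'n \<Rightarrow> int) \<Rightarrow> bool" where
  "stp m \<kappa> \<longleftrightarrow> (\<forall>x. m \<le> \<kappa> x \<and> (\<forall>y. gr (\<kappa> x) y = gr (\<kappa> x) x \<longrightarrow> \<kappa> y = \<kappa> x))"

text \<open>The kernel of the conditional expectation for the partition into selected cubes;
  \<open>av\<close> and \<open>nav\<close> are that expectation for integrable and for nonnegative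
  functions.\<close>

definition ker :: "(real^'n \<Rightarrow> int) \<Rightarrow> real^'n \<Rightarrow> real^'n \<Rightarrow> real" where
  "ker \<kappa> x y = (if gr (\<kappa> x) y = gr (\<kappa> x) x then 1 / (2 powi \<kappa> x) ^ CARD('n) else 0)"

definition av :: "(real^'n \<Rightarrow> int) \<Rightarrow> (real^'n \<Rightarrow> complex) \<Rightarrow> real^'n \<Rightarrow> complex" where
  "av \<kappa> f x = (\<integral>y. of_real (ker \<kappa> x y) * f y \<partial>lborel)"

definition nav :: "(real^'n \<Rightarrow> int) \<Rightarrow> (real^'n \<Rightarrow> ennreal) \<Rightarrow> real^'n \<Rightarrow> ennreal" where
  "nav \<kappa> g x = (NN y. ennreal (ker \<kappa> x y) * g y)"

definition sat :: "(real^'n \<Rightarrow> int) \<Rightarrow> (real^'n \<Rightarrow> 'b) \<Rightarrow> bool" where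
  "sat \<kappa> \<phi> \<longleftrightarrow> (\<forall>x y. gr (\<kappa> x) y = gr (\<kappa> x) x \<longrightarrow> \<phi> y = \<phi> x)"

definition sat2 :: "(real^'n \<Rightarrow> int) \<Rightarrow> ((real^'n) \<times> (real^'n)) set \<Rightarrow> bool" where
  "sat2 \<kappa> S \<longleftrightarrow> (\<forall>x y x' y'. gr (\<kappa> x) x' = gr (\<kappa> x) x \<longrightarrow> gr (\<kappa> y) y' = gr (\<kappa> y) y \<longrightarrow>
     ((x', y') \<in> S \<longleftrightarrow> (x, y) \<in> S))"

lemma stp_const [simp]: "stp k (\<lambda>_. k)"
  by (simp add: stp_def)

lemma stpD: "stp m \<kappa> \<Longrightarrow> gr (\<kappa> x) y = gr (\<kappa> x) x \<Longrightarrow> \<kappa> y = \<kappa> x"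
  and stp_ge: "stp m \<kappa> \<Longrightarrow> m \<le> \<kappa> x"
  unfolding stp_def by blast+

lemma stp_fine:
  assumes "stp m \<kappa>" "gr m x = gr m y"
  shows "gr (\<kappa> x) y = gr (\<kappa> x) x" "\<kappa> y = \<kappa> x"
proof -
  show 1: "gr (\<kappa> x) y = gr (\<kappa> x) x"
    using gr_mono[OF assms(2) stp_ge[OF assms(1)], of x] by simp
  show "\<kappa> y = \<kappa> x" by (rule stpD[OF assms(1) 1])
qed

lemma sat_measurable:
  assumes "stp m \<kappa>" "sat \<kappa> \<phi>" "\<And>x. \<phi> x \<in> space M"
  shows "\<phi> \<in> borel \<rightarrow>\<^sub>M M"
proof (rule measurable_const_cells[of m])
  show "\<phi> x = \<phi> y" if "gr m x = gr m y" for x y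
    using assms(2) stp_fine(1)[OF assms(1) that] unfolding sat_def by metis
qed (rule assms(3))

lemma sat2_sets:
  assumes "stp m \<kappa>" "sat2 \<kappa> S"
  shows "S \<in> sets borel"
proof (rule sat_sets2[of m])
  fix x y x' y' :: "real^'a" assume *: "gr m x = gr m x'" "gr m y = gr m y'"
  show "((x, y) \<in> S) = ((x', y') \<in> S)"
    using assms(2) stp_fine(1)[OF assms(1) *(1)] stp_fine(1)[OF assms(1) *(2)]
    unfolding sat2_def by blast
qed

lemma ker_nonneg [simp]: "0 \<le> ker \<kappa> x y"
  by (simp add: ker_def)

text \<open>All points of a selected cube select that cube, so sharing a selected cube is a
  symmetric relation. Through Fubini this makes averaging self-adjoint.\<close>

lemma ker_sym:
  assumes "stp m \<kappa>"
  shows "ker \<kappa> x y = ker \<kappa> y x"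
proof (cases "gr (\<kappa> x) y = gr (\<kappa> x) x")
  case True
  with stpD[OF assms True] show ?thesis by (simp add: ker_def)
next
  case False
  have "gr (\<kappa> y) x \<noteq> gr (\<kappa> y) y"
  proof
    assume *: "gr (\<kappa> y) x = gr (\<kappa> y) y"
    with stpD[OF assms *] False show False by simp
  qed
  with False show ?thesis by (simp add: ker_def)
qed

lemma ker_cong:
  assumes "stp m \<kappa>" "gr (\<kappa> x) y = gr (\<kappa> x) x"
  shows "ker \<kappa> y = ker \<kappa> x"
  using stpD[OF assms] assms(2) by (auto simp: ker_def fun_eq_iff)

lemma ker_measurable:
  assumes "stp m \<kappa>"
  shows "(\<lambda>p. ker \<kappa> (fst p) (snd p)) \<in> \<B>"
proof (rule measurable_const_cells2[of m])
  fix x y x' y' :: "real^'a" assume *: "gr m x = gr m x'" "gr m y = gr m y'"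
  have "gr (\<kappa> x) y' = gr (\<kappa> x) y"
    using gr_mono[OF *(2) stp_ge[OF assms], of x] by simp
  with stp_fine[OF assms *(1)]
  show "ker \<kappa> (fst (x, y)) (snd (x, y)) = ker \<kappa> (fst (x', y')) (snd (x', y'))"
    by (simp add: ker_def)
qed auto

lemma ker_measurable' [measurable (raw)]:
  assumes "stp m \<kappa>" "f \<in> M \<rightarrow>\<^sub>M borel" "g \<in> M \<rightarrow>\<^sub>M borel"
  shows "(\<lambda>x. ker \<kappa> (f x) (g x)) \<in> borel_measurable M"
proof -
  have "(\<lambda>x. (f x, g x)) \<in> M \<rightarrow>\<^sub>M borel"
    using assms(2,3) by (simp add: borel_prod[symmetric])
  from measurable_compose[OF this ker_measurable[OF assms(1)]] show ?thesis by simp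
qed

lemma nn_ker:
  fixes x :: "real^'n"
  shows "(NN y. ennreal (ker \<kappa> x y)) = 1"
proof -
  have "(NN y. ennreal (ker \<kappa> x y)) =
    (NN y. ennreal (1 / (2 powi \<kappa> x) ^ CARD('n)) * indicator {y. gr (\<kappa> x) y = gr (\<kappa> x) x} y)"
    by (intro nn_integral_cong) (auto simp: ker_def)
  also have "\<dots> = ennreal (1 / (2 powi \<kappa> x) ^ CARD('n)) * ennreal ((2 powi \<kappa> x) ^ CARD('n))"
    by (subst nn_integral_cmult_indicator) (auto simp: cell_measure)
  also have "\<dots> = 1" by (subst ennreal_mult[symmetric]) auto
  finally show ?thesis .
qed

lemma ker_meas1 [measurable]: "ker \<kappa> x \<in> \<B>"
  unfolding ker_def by measurable

lemma has_bochner_integral_ker: "has_bochner_integral lborel (ker \<kappa> x) 1"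
  by (rule has_bochner_integral_nn_integral) (auto simp: nn_ker)

lemma nav_const: "nav \<kappa> (\<lambda>_. c) x = c"
  unfolding nav_def by (subst nn_integral_multc) (auto simp: nn_ker)

lemma nav_mono: "(\<And>y. g y \<le> h y) \<Longrightarrow> nav \<kappa> g x \<le> nav \<kappa> h x"
  unfolding nav_def by (intro nn_integral_mono mult_left_mono) auto

lemma nav_mono_cell: "(\<And>y. gr (\<kappa> x) y = gr (\<kappa> x) x \<Longrightarrow> g y \<le> h y) \<Longrightarrow> nav \<kappa> g x \<le> nav \<kappa> h x"
  unfolding nav_def by (intro nn_integral_mono) (auto simp: ker_def intro!: mult_left_mono)

lemma nav_cell:
  assumes "stp m \<kappa>"
  shows "sat \<kappa> (nav \<kappa> g)"
  unfolding sat_def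
proof (intro allI impI)
  fix x y assume "gr (\<kappa> x) y = gr (\<kappa> x) x"
  from ker_cong[OF assms this] show "nav \<kappa> g y = nav \<kappa> g x" by (simp only: nav_def)
qed

lemma av_cell:
  assumes "stp m \<kappa>"
  shows "sat \<kappa> (av \<kappa> f)"
  unfolding sat_def
proof (intro allI impI)
  fix x y assume "gr (\<kappa> x) y = gr (\<kappa> x) x"
  from ker_cong[OF assms this] show "av \<kappa> f y = av \<kappa> f x" by (simp only: av_def)
qed

text \<open>Taking out a known factor: where the kernel is nonzero,
  \<open>\<phi> y = \<phi> x\<close>, so the two integrands differ by a constant factor.\<close>

lemma av_sat_mult:
  assumes "sat \<kappa> \<phi>"
  shows "av \<kappa> (\<lambda>y. \<phi> y * f y) x = \<phi> x * av \<kappa> f x"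
proof -
  have "of_real (ker \<kappa> x y) * (\<phi> y * f y) = \<phi> x * (of_real (ker \<kappa> x y) * f y)" for y
  proof (cases "gr (\<kappa> x) y = gr (\<kappa> x) x")
    case True
    then have "\<phi> y = \<phi> x" using assms unfolding sat_def by blast
    then show ?thesis by simp
  qed (simp add: ker_def)
  then show ?thesis by (simp only: av_def integral_mult_right_zero)
qed

lemma av_one: "av \<kappa> (\<lambda>_. 1) x = 1"
proof -
  have "has_bochner_integral lborel (\<lambda>y. complex_of_real (ker \<kappa> x y)) (of_real 1)"
    by (intro has_bochner_integral_of_real has_bochner_integral_ker)
  then show ?thesis by (simp add: av_def has_bochner_integral_iff)
qed

lemma av_idem:
  assumes "sat \<kappa> f"
  shows "av \<kappa> f x = f x"
  using av_sat_mult[OF assms, of "\<lambda>_. 1" x] by (simp add: av_one)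

lemma nav_measurable [measurable (raw)]: "stp m \<kappa> \<Longrightarrow> nav \<kappa> g \<in> \<B>"
  by (rule sat_measurable[OF _ nav_cell]) auto

lemma av_measurable [measurable (raw)]: "stp m \<kappa> \<Longrightarrow> av \<kappa> f \<in> \<B>"
  by (rule sat_measurable[OF _ av_cell]) auto

lemma norm_av_le: "ennreal (norm (av \<kappa> f x)) \<le> nav \<kappa> (\<lambda>y. ennreal (norm (f y))) x"
proof (cases "integrable lborel (\<lambda>y. of_real (ker \<kappa> x y) * f y)")
  case True
  have "ennreal (norm (av \<kappa> f x)) \<le> (NN y. norm (of_real (ker \<kappa> x y) * f y))"
    unfolding av_def by (rule integral_norm_bound_ennreal[OF True])
  also have "\<dots> = nav \<kappa> (\<lambda>y. ennreal (norm (f y))) x"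
    by (simp add: nav_def norm_mult ennreal_mult)
  finally show ?thesis .
next
  case False
  \<comment> \<open>The integral of a non-integrable function is 0 by convention.\<close>
  then show ?thesis by (simp add: av_def not_integrable_integral_eq)
qed

section \<open>Fubini and the self-adjointness of averages\<close>

lemma nn_integral_lborel_pair:
  fixes f :: "(real^'n) \<times> (real^'n) \<Rightarrow> ennreal"
  assumes [measurable]: "f \<in> \<B>"
  shows "(NN z. f z) = (NN x. NN y. f (x, y))"
    and "(NN z. f z) = (NN y. NN x. f (x, y))"
proof -
  have m: "f \<in> borel_measurable (lborel \<Otimes>\<^sub>M lborel)" by (simp add: lborel_prod)
  have 1: "(NN z. f z) = (\<integral>\<^sup>+z. f z \<partial>(lborel \<Otimes>\<^sub>M lborel))" by (simp add: lborel_prod)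
  show "(NN z. f z) = (NN x. NN y. f (x, y))"
    unfolding 1 using lborel.nn_integral_fst[OF m] by simp
  show "(NN z. f z) = (NN y. NN x. f (x, y))"
    unfolding 1 using lborel_pair.nn_integral_snd[OF m] by simp
qed

text \<open>Self-adjointness: exchanging the integrals transposes the kernel, which is symmetric,
  and wherever it is nonzero \<open>\<phi> x = \<phi> y\<close>, so \<open>\<phi>\<close> moves to
  the other variable.\<close>

lemma nn_integral_sat:
  assumes st: "stp m \<kappa>" and s: "sat \<kappa> \<phi>" and [measurable]: "g \<in> \<B>" "\<phi> \<in> \<B>"
  shows "(NN x. \<phi> x * nav \<kappa> g x) = (NN x. \<phi> x * g x)"
proof -
  note [measurable (raw)] = ker_measurable'[OF st]
  have "(NN x. \<phi> x * nav \<kappa> g x) = (NN x. NN y. \<phi> x * (ennreal (ker \<kappa> x y) * g y))"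
    unfolding nav_def by (intro nn_integral_cong nn_integral_cmult[symmetric]) auto
  also have "\<dots> = (NN y. NN x. \<phi> x * (ennreal (ker \<kappa> x y) * g y))"
    by (rule lborel_pair.Fubini'[symmetric]) measurable
  also have "\<dots> = (NN y. NN x. (\<phi> y * g y) * ennreal (ker \<kappa> y x))"
  proof (intro nn_integral_cong)
    fix x y :: "real^'a"
    show "\<phi> x * (ennreal (ker \<kappa> x y) * g y) = (\<phi> y * g y) * ennreal (ker \<kappa> y x)"
    proof (cases "gr (\<kappa> x) y = gr (\<kappa> x) x")
      case True
      then have "\<phi> y = \<phi> x" using s unfolding sat_def by blast
      then show ?thesis using ker_sym[OF st, of x y] by (simp add: ac_simps)
    next
      case False
      then have "ker \<kappa> x y = 0" by (simp add: ker_def)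
      then show ?thesis using ker_sym[OF st, of x y] by simp
    qed
  qed
  also have "\<dots> = (NN y. \<phi> y * g y)"
    by (intro nn_integral_cong) (simp add: nn_integral_cmult nn_ker)
  finally show ?thesis .
qed

lemma nn_integral_nav:
  assumes "stp m \<kappa>" "g \<in> \<B>"
  shows "(NN x. nav \<kappa> g x) = (NN x. g x)"
  using nn_integral_sat[OF assms(1) _ assms(2), of "\<lambda>_. 1"] by (simp add: sat_def)

lemma integrable_av:
  assumes st: "stp m \<kappa>" and f: "integrable lborel f"
  shows "integrable lborel (av \<kappa> f)"
proof (rule integrableI_bounded)
  show "av \<kappa> f \<in> borel_measurable lborel" using av_measurable[OF st, of f] by simp
  have [measurable]: "f \<in> \<B>" using f by auto
  have "(NN x. ennreal (norm (av \<kappa> f x))) \<le> (NN x. nav \<kappa> (\<lambda>y. ennreal (norm (f y))) x)"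
    by (intro nn_integral_mono norm_av_le)
  also have "\<dots> = (NN x. ennreal (norm (f x)))"
    by (rule nn_integral_nav[OF st]) measurable
  also have "\<dots> < \<infinity>" using f by (simp add: integrable_iff_bounded)
  finally show "(NN x. ennreal (norm (av \<kappa> f x))) < \<infinity>" .
qed

lemma integral_sat:
  assumes st: "stp m \<kappa>" and s: "sat \<kappa> \<phi>" and f: "integrable lborel f"
    and [measurable]: "\<phi> \<in> \<B>" and B: "\<And>x. norm (\<phi> x) \<le> B"
  shows "(\<integral>x. \<phi> x * av \<kappa> f x \<partial>lborel) = (\<integral>x. \<phi> x * f x \<partial>lborel)"
proof -
  note [measurable (raw)] = ker_measurable'[OF st]
  have [measurable]: "f \<in> \<B>" using f by auto
  define F where "F x y = \<phi> x * (of_real (ker \<kappa> x y) * f y)" for x y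
  have F2: "F x y = of_real (ker \<kappa> y x) * (\<phi> y * f y)" for x y
  proof (cases "gr (\<kappa> x) y = gr (\<kappa> x) x")
    case True
    then have "\<phi> y = \<phi> x" using s unfolding sat_def by blast
    then show ?thesis unfolding F_def using ker_sym[OF st, of x y] by (simp add: ac_simps)
  next
    case False
    then have "ker \<kappa> x y = 0" by (simp add: ker_def)
    then show ?thesis unfolding F_def using ker_sym[OF st, of x y] by simp
  qed
  have B0: "0 \<le> B" using B[of undefined] norm_ge_zero order_trans by blast
  \<comment> \<open>The double integral converges absolutely, because \<open>\<phi>\<close> is
    bounded and the kernel has total mass 1 in \<open>x\<close>.\<close>
  have int: "integrable (lborel \<Otimes>\<^sub>M lborel) (\<lambda>(x, y). F x y)"
  proof (rule integrableI_bounded)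
    show m: "(\<lambda>(x, y). F x y) \<in> borel_measurable (lborel \<Otimes>\<^sub>M lborel)" unfolding F_def by measurable
    have "(\<integral>\<^sup>+z. ennreal (norm (case z of (x, y) \<Rightarrow> F x y)) \<partial>(lborel \<Otimes>\<^sub>M lborel))
       = (NN y. NN x. ennreal (norm (F x y)))"
      using m by (subst lborel_pair.nn_integral_snd[symmetric]) (simp_all add: case_prod_beta)
    also have "\<dots> \<le> (NN y. NN x. ennreal (B * norm (f y)) * ennreal (ker \<kappa> y x))"
    proof (intro nn_integral_mono)
      fix x y :: "real^'a"
      have "norm (F x y) = norm (\<phi> y) * norm (f y) * ker \<kappa> y x" by (simp add: F2 norm_mult)
      also have "\<dots> \<le> B * norm (f y) * ker \<kappa> y x" by (intro mult_right_mono B) auto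
      finally show "ennreal (norm (F x y)) \<le> ennreal (B * norm (f y)) * ennreal (ker \<kappa> y x)"
        using B0 by (subst ennreal_mult[symmetric]) (auto intro: ennreal_leI)
    qed
    also have "\<dots> = (NN y. ennreal (B * norm (f y)))"
      by (intro nn_integral_cong) (simp add: nn_integral_cmult nn_ker)
    also have "\<dots> < \<infinity>"
      using f B0 by (simp add: ennreal_mult nn_integral_cmult integrable_iff_bounded ennreal_mult_less_top)
    finally show "(\<integral>\<^sup>+z. ennreal (norm (case z of (x, y) \<Rightarrow> F x y)) \<partial>(lborel \<Otimes>\<^sub>M lborel)) < \<infinity>" .
  qed
  have "(\<integral>x. \<phi> x * av \<kappa> f x \<partial>lborel) = (\<integral>x. \<integral>y. F x y \<partial>lborel \<partial>lborel)"
    unfolding av_def F_def by simp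
  also have "\<dots> = (\<integral>y. \<integral>x. F x y \<partial>lborel \<partial>lborel)"
    by (rule lborel_pair.Fubini_integral[OF int, symmetric])
  also have "\<dots> = (\<integral>y. \<phi> y * f y \<partial>lborel)"
  proof (intro Bochner_Integration.integral_cong refl)
    fix y
    have "(\<integral>x. F x y \<partial>lborel) = av \<kappa> (\<lambda>_. 1) y * (\<phi> y * f y)"
      unfolding F2 av_def by simp
    then show "(\<integral>x. F x y \<partial>lborel) = \<phi> y * f y" by (simp add: av_one)
  qed
  finally show ?thesis .
qed

text \<open>Only the selected cubes inside the level-\<open>k\<close> cube of \<open>x\<close>
  matter, and on each of them the averaging kernel of that cube is constant. The hypothesis is local
  because it is available only outside a stopping set, where \<open>coarse\<close> provides
  it.\<close>

lemma av_tower: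
  fixes x :: "real^'n"
  assumes st: "stp m \<kappa>" and f: "integrable lborel f" and k: "\<And>y. gr k y = gr k x \<Longrightarrow> \<kappa> y \<le> k"
  shows "av (\<lambda>_. k) (av \<kappa> f) x = av (\<lambda>_. k) f x"
proof -
  let ?\<phi> = "\<lambda>y. complex_of_real (ker (\<lambda>_. k) x y)"
  have "sat \<kappa> ?\<phi>"
    unfolding sat_def
  proof (intro allI impI)
    fix y z assume yz: "gr (\<kappa> y) z = gr (\<kappa> y) y"
    have "gr k z = gr k x \<longleftrightarrow> gr k y = gr k x"
    proof
      assume z: "gr k z = gr k x"
      have "\<kappa> z = \<kappa> y" by (rule stpD[OF st yz])
      with k[OF z] gr_mono[OF yz, of k] z show "gr k y = gr k x" by simp
    next
      assume z: "gr k y = gr k x"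
      with k[OF z] gr_mono[OF yz, of k] show "gr k z = gr k x" by simp
    qed
    then show "?\<phi> z = ?\<phi> y" by (simp add: ker_def)
  qed
  from integral_sat[OF st this f, of "1 / (2 powi k) ^ CARD('n)"]
  show ?thesis by (simp add: av_def ker_def)
qed

lemma av_av:
  "j \<le> k \<Longrightarrow> integrable lborel f \<Longrightarrow> av (\<lambda>_. k) (av (\<lambda>_. j) f) x = av (\<lambda>_. k) f x"
  by (rule av_tower[of j]) auto

lemma sat2_slice:
  assumes "sat2 \<kappa> S"
  shows "sat \<kappa> (\<lambda>y. indicator S (x, y) :: 'b::zero_neq_one)" "sat \<kappa> (\<lambda>x. indicator S (x, y) :: 'b)"
  unfolding sat_def
proof (safe)
  fix a b assume ab: "gr (\<kappa> a) b = gr (\<kappa> a) a"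
  have "(x, b) \<in> S \<longleftrightarrow> (x, a) \<in> S" "(b, y) \<in> S \<longleftrightarrow> (a, y) \<in> S"
    using assms ab unfolding sat2_def by blast+
  then show "indicator S (x, b) = (indicator S (x, a) :: 'b)" "indicator S (b, y) = (indicator S (a, y) :: 'b)"
    by (simp_all add: indicator_def)
qed

lemma pair_borel_sets:
  fixes S :: "('a::second_countable_topology \<times> 'b::second_countable_topology) set"
  shows "S \<in> sets borel \<Longrightarrow> S \<in> sets (borel \<Otimes>\<^sub>M borel)"
  by (subst borel_prod)

text \<open>The slices of a union of products of selected cubes are unions of selected cubes, so the
  averages can be removed one variable at a time.\<close>

lemma nn_integral_sat2:
  assumes st: "stp m \<kappa>" and s: "sat2 \<kappa> S" and [measurable]: "g \<in> \<B>" "h \<in> \<B>"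
  shows "(NN z. indicator S z * (nav \<kappa> g (fst z) * nav \<kappa> h (snd z)))
       = (NN z. indicator S z * (g (fst z) * h (snd z)))"
proof -
  have S [measurable]: "S \<in> sets (borel \<Otimes>\<^sub>M borel)"
    by (rule pair_borel_sets[OF sat2_sets[OF st s]])
  have [measurable]: "nav \<kappa> g \<in> \<B>" "nav \<kappa> h \<in> \<B>"
    by (rule nav_measurable[OF st])+
  have "(NN z. indicator S z * (nav \<kappa> g (fst z) * nav \<kappa> h (snd z)))
     = (NN x. NN y. indicator S (x, y) * (nav \<kappa> g x * nav \<kappa> h y))"
    by (subst nn_integral_lborel_pair(1)) (auto simp: borel_prod[symmetric])
  also have "\<dots> = (NN x. nav \<kappa> g x * (NN y. indicator S (x, y) * nav \<kappa> h y))"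
    by (intro nn_integral_cong) (subst nn_integral_cmult[symmetric], auto simp: ac_simps)
  also have "\<dots> = (NN x. nav \<kappa> g x * (NN y. indicator S (x, y) * h y))"
    by (intro nn_integral_cong) (subst nn_integral_sat[OF st sat2_slice(1)[OF s]], auto)
  also have "\<dots> = (NN x. NN y. indicator S (x, y) * (nav \<kappa> g x * h y))"
    by (intro nn_integral_cong) (subst nn_integral_cmult[symmetric], auto simp: ac_simps)
  also have "\<dots> = (NN y. NN x. indicator S (x, y) * (nav \<kappa> g x * h y))"
    by (rule lborel_pair.Fubini'[symmetric]) measurable
  also have "\<dots> = (NN y. h y * (NN x. indicator S (x, y) * nav \<kappa> g x))"
    by (intro nn_integral_cong) (subst nn_integral_cmult[symmetric], auto simp: ac_simps)
  also have "\<dots> = (NN y. h y * (NN x. indicator S (x, y) * g x))"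
    by (intro nn_integral_cong) (subst nn_integral_sat[OF st sat2_slice(2)[OF s]], auto)
  also have "\<dots> = (NN y. NN x. indicator S (x, y) * (g x * h y))"
    by (intro nn_integral_cong) (subst nn_integral_cmult[symmetric], auto simp: ac_simps)
  also have "\<dots> = (NN z. indicator S z * (g (fst z) * h (snd z)))"
    by (subst nn_integral_lborel_pair(2)) (auto simp: borel_prod[symmetric])
  finally show ?thesis .
qed

lemma integrable_tensor:
  fixes f g :: "real^'n \<Rightarrow> complex"
  assumes f: "integrable lborel f" and g: "integrable lborel g" and S: "S \<in> sets borel"
  shows "integrable (lborel \<Otimes>\<^sub>M lborel) (\<lambda>z. indicator S z * (f (fst z) * g (snd z)))"
proof (rule integrableI_bounded)
  have [measurable]: "f \<in> \<B>" "g \<in> \<B>" using f g by auto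
  have [measurable]: "S \<in> sets (borel \<Otimes>\<^sub>M borel)" by (rule pair_borel_sets[OF S])
  show "(\<lambda>z. indicator S z * (f (fst z) * g (snd z))) \<in> borel_measurable (lborel \<Otimes>\<^sub>M lborel)" by measurable
  have "(\<integral>\<^sup>+z. ennreal (norm (indicator S z * (f (fst z) * g (snd z)))) \<partial>(lborel \<Otimes>\<^sub>M lborel))
     \<le> (\<integral>\<^sup>+z. ennreal (norm (f (fst z))) * ennreal (norm (g (snd z))) \<partial>(lborel \<Otimes>\<^sub>M lborel))"
    by (intro nn_integral_mono) (auto simp: indicator_def norm_mult ennreal_mult[symmetric])
  also have "\<dots> = (NN x. NN y. ennreal (norm (f x)) * ennreal (norm (g y)))"
    by (subst lborel.nn_integral_fst[symmetric]) auto
  also have "\<dots> = (NN x. ennreal (norm (f x))) * (NN y. ennreal (norm (g y)))"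
    by (simp add: nn_integral_cmult nn_integral_multc)
  also have "\<dots> < \<infinity>" using f g by (simp add: integrable_iff_bounded ennreal_mult_less_top)
  finally show "(\<integral>\<^sup>+z. ennreal (norm (indicator S z * (f (fst z) * g (snd z)))) \<partial>(lborel \<Otimes>\<^sub>M lborel)) < \<infinity>" .
qed

text \<open>All cancellation comes from here: a tensor product minus that of the averages has
  integral zero over every product of selected cubes. One variable is averaged at a time, by
  \<open>integral_sat\<close>.\<close>

lemma integral_sat2:
  fixes f g :: "real^'n \<Rightarrow> complex"
  assumes st: "stp m \<kappa>" and s: "sat2 \<kappa> S" and f: "integrable lborel f" and g: "integrable lborel g"
  shows "(\<integral>z. indicator S z * (av \<kappa> f (fst z) * av \<kappa> g (snd z)) \<partial>lborel)
       = (\<integral>z. indicator S z * (f (fst z) * g (snd z)) \<partial>lborel)"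
proof -
  have S: "S \<in> sets borel" by (rule sat2_sets[OF st s])
  have [measurable]: "S \<in> sets (borel \<Otimes>\<^sub>M borel)" by (rule pair_borel_sets[OF S])
  have af: "integrable lborel (av \<kappa> f)" and ag: "integrable lborel (av \<kappa> g)"
    using integrable_av[OF st] f g by auto
  have fst: "(\<integral>z. indicator S z * (f (fst z) * g (snd z)) \<partial>lborel)
     = (\<integral>x. f x * (\<integral>y. indicator S (x, y) * g y \<partial>lborel) \<partial>lborel)"
    if "integrable lborel f" "integrable lborel g" for f g :: "real^'n \<Rightarrow> complex"
    using lborel_pair.integral_fst'[OF integrable_tensor[OF that S]]
    by (simp add: lborel_prod integral_mult_right_zero[symmetric] ac_simps del: integral_mult_right_zero)
  have snd: "(\<integral>z. indicator S z * (f (fst z) * g (snd z)) \<partial>lborel)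
     = (\<integral>y. g y * (\<integral>x. indicator S (x, y) * f x \<partial>lborel) \<partial>lborel)"
    if "integrable lborel f" "integrable lborel g" for f g :: "real^'n \<Rightarrow> complex"
    using lborel_pair.integral_snd[of "\<lambda>x y. indicator S (x, y) * (f x * g y)"] integrable_tensor[OF that S]
    by (simp add: lborel_prod integral_mult_right_zero[symmetric] ac_simps case_prod_unfold del: integral_mult_right_zero)
  have b: "norm (indicator S z :: complex) \<le> 1" for z by (simp add: indicator_def)
  have "(\<integral>z. indicator S z * (av \<kappa> f (fst z) * av \<kappa> g (snd z)) \<partial>lborel)
     = (\<integral>x. av \<kappa> f x * (\<integral>y. indicator S (x, y) * g y \<partial>lborel) \<partial>lborel)"
    unfolding fst[OF af ag] by (subst integral_sat[OF st sat2_slice(1)[OF s] g _ b]) auto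
  also have "\<dots> = (\<integral>y. g y * (\<integral>x. indicator S (x, y) * av \<kappa> f x \<partial>lborel) \<partial>lborel)"
    using fst[OF af g] snd[OF af g] by simp
  also have "\<dots> = (\<integral>z. indicator S z * (f (fst z) * g (snd z)) \<partial>lborel)"
    unfolding snd[OF f g] by (subst integral_sat[OF st sat2_slice(2)[OF s] f _ b]) auto
  finally show ?thesis .
qed

text \<open>The graph of t^p lies above its tangent at \<open>a\<close>; this is Young's inequality
  with weights 1/p and 1 - 1/p.\<close>

lemma tangent_powr:
  fixes a t p :: real
  assumes "0 < a" "0 \<le> t" "1 \<le> p"
  shows "p * a powr (p - 1) * t \<le> t powr p + (p - 1) * a powr p"
proof (cases "t = 0")
  case True then show ?thesis using assms by simp
next
  case False
  then have t: "t > 0" using assms by simp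
  have "(t powr p) powr (1 / p) * (a powr p) powr (1 - 1 / p) \<le> (1 / p) * t powr p + (1 - 1 / p) * a powr p"
    by (rule Youngs_inequality_0) (use assms t in auto)
  moreover have "p * (1 - 1 / p) = p - 1" using assms by (simp add: field_simps)
  ultimately have "t * a powr (p - 1) \<le> (1 / p) * t powr p + (1 - 1 / p) * a powr p"
    using assms t by (simp add: powr_powr)
  then have "p * (t * a powr (p - 1)) \<le> p * ((1 / p) * t powr p + (1 - 1 / p) * a powr p)"
    using assms by (intro mult_left_mono) auto
  also have "\<dots> = t powr p + (p - 1) * a powr p" using assms by (simp add: field_simps)
  finally show ?thesis by (simp add: ac_simps)
qed

lemma nav_add:
  assumes [measurable]: "f \<in> \<B>" "g \<in> \<B>"
  shows "nav \<kappa> (\<lambda>y. f y + g y) x = nav \<kappa> f x + nav \<kappa> g x"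
  unfolding nav_def distrib_left by (subst nn_integral_add) auto

lemma nav_cmult:
  assumes [measurable]: "f \<in> \<B>"
  shows "nav \<kappa> (\<lambda>y. c * f y) x = c * nav \<kappa> f x"
  unfolding nav_def by (subst nn_integral_cmult[symmetric]) (auto simp: ac_simps)

text \<open>The tangent inequality at \<open>a\<close> is averaged. A real lower bound
  \<open>a\<close> stands in for the average, which may be infinite.\<close>

lemma nav_jensen:
  fixes f :: "real^'n \<Rightarrow> real"
  assumes [measurable]: "f \<in> \<B>" and "\<And>y. 0 \<le> f y" and p: "1 \<le> p" and a: "0 \<le> a"
    and le: "ennreal a \<le> nav \<kappa> (\<lambda>y. ennreal (f y)) x"
  shows "ennreal (a powr p) \<le> nav \<kappa> (\<lambda>y. ennreal (f y powr p)) x"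
proof (cases "a = 0")
  case True then show ?thesis by simp
next
  case False
  with a have a: "a > 0" by simp
  have "ennreal (p * a powr p) = ennreal (p * a powr (p - 1)) * ennreal a"
    using a p by (subst ennreal_mult[symmetric]) (auto simp: powr_diff)
  also have "\<dots> \<le> ennreal (p * a powr (p - 1)) * nav \<kappa> (\<lambda>y. ennreal (f y)) x"
    by (intro mult_left_mono le) auto
  also have "\<dots> = nav \<kappa> (\<lambda>y. ennreal (p * a powr (p - 1)) * ennreal (f y)) x"
    by (simp add: nav_cmult)
  also have "\<dots> \<le> nav \<kappa> (\<lambda>y. ennreal (f y powr p) + ennreal ((p - 1) * a powr p)) x"
    using tangent_powr[OF a _ p] assms(2) p a
    by (intro nav_mono) (simp add: ennreal_mult[symmetric] ennreal_plus[symmetric] ennreal_leI del: ennreal_plus)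
  also have "\<dots> = nav \<kappa> (\<lambda>y. ennreal (f y powr p)) x + ennreal ((p - 1) * a powr p)"
    by (subst nav_add) (auto simp: nav_const)
  finally have *: "ennreal (p * a powr p) \<le> nav \<kappa> (\<lambda>y. ennreal (f y powr p)) x + ennreal ((p - 1) * a powr p)" .
  show ?thesis
  proof (cases "nav \<kappa> (\<lambda>y. ennreal (f y powr p)) x")
    case (real r)
    have "0 \<le> (p - 1) * a powr p" using p by simp
    with * real have "p * a powr p \<le> r + (p - 1) * a powr p"
      by (simp add: ennreal_plus[symmetric] del: ennreal_plus)
    with real show ?thesis by (simp add: algebra_simps ennreal_leI)
  qed simp
qed

subsection \<open>The boundary layer of a convex body\<close>

lemma lborel_affine_nn:
  fixes f :: "'a::euclidean_space \<Rightarrow> ennreal"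
  assumes [measurable]: "f \<in> \<B>" and c: "c \<noteq> 0"
  shows "(NN x. f x) = ennreal (\<bar>c\<bar> ^ DIM('a)) * (NN x. f (t + c *\<^sub>R x))"
  by (subst lborel_affine[OF c, of t]) (simp add: nn_integral_density nn_integral_distr nn_integral_cmult)

lemma nn_integral_shift:
  fixes f :: "'a::euclidean_space \<Rightarrow> ennreal"
  assumes "f \<in> \<B>"
  shows "(NN x. f (x + t)) = (NN x. f x)"
    and "(NN x. f (t + x)) = (NN x. f x)"
    and "(NN x. f (x - t)) = (NN x. f x)"
    and "(NN x. f (t - x)) = (NN x. f x)"
  using lborel_affine_nn[OF assms, of 1 t] lborel_affine_nn[OF assms, of 1 "- t"] lborel_affine_nn[OF assms, of "-1" t]
  by (simp_all add: add.commute)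

lemma emeasure_lborel_affine:
  fixes S :: "'a::euclidean_space set"
  assumes [measurable]: "S \<in> sets borel" and c: "c \<noteq> 0"
  shows "emeasure lborel S = ennreal (\<bar>c\<bar> ^ DIM('a)) * emeasure lborel {x. t + c *\<^sub>R x \<in> S}"
proof -
  have [measurable]: "{x. t + c *\<^sub>R x \<in> S} \<in> sets borel"
    using measurable_sets[of "\<lambda>x. t + c *\<^sub>R x" borel borel S] by (simp add: vimage_def)
  have "(NN x. indicator S (t + c *\<^sub>R x)) = (NN x. indicator {x. t + c *\<^sub>R x \<in> S} x)"
    by (intro nn_integral_cong) (auto simp: indicator_def)
  also have "\<dots> = emeasure lborel {x. t + c *\<^sub>R x \<in> S}" by simp
  finally show ?thesis using lborel_affine_nn[of "indicator S" c t] c by simp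
qed

lemma scaleR_cancel:
  fixes y z :: "'a::real_vector"
  shows "y = a *\<^sub>R z \<Longrightarrow> a \<noteq> 0 \<Longrightarrow> (1 / a) *\<^sub>R y = z"
  by simp

lemma frac_bounds:
  fixes a :: real
  assumes "0 < a"
  shows "a < 1 \<Longrightarrow> 0 \<le> (1 - a) / (1 + a)" "a < 1 \<Longrightarrow> (1 - a) / (1 + a) \<le> 1"
    "0 \<le> a / (1 + a)" "a / (1 + a) \<le> 1" "1 - a / (1 + a) = 1 / (1 + a)"
  using assms by (auto simp: divide_le_eq field_simps)

lemma power_diff_le:
  fixes a b M :: real
  assumes "0 \<le> b" "b \<le> a" "a \<le> M" "1 \<le> M"
  shows "a ^ n - b ^ n \<le> real n * (a - b) * M ^ n"
proof (induction n)
  case (Suc n)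
  have "a ^ Suc n - b ^ Suc n = a * (a ^ n - b ^ n) + b ^ n * (a - b)" by (simp add: algebra_simps)
  also have "\<dots> \<le> M * (real n * (a - b) * M ^ n) + M ^ n * (a - b)"
    using assms Suc by (intro add_mono mult_mono power_mono) (auto intro: power_mono)
  also have "\<dots> \<le> M * (real n * (a - b) * M ^ n) + (M * M ^ n) * (a - b)"
    using assms by (intro add_left_mono mult_right_mono) (auto simp: mult_le_cancel_right1)
  finally show ?case by (simp add: algebra_simps)
qed simp

text \<open>Let the ball of radius \<rho> about \<open>c\<close> lie in \<open>G\<close>. By
  convexity a point at distance at most \<open>s\<close> from \<open>G\<close> lies in the dilate of
  \<open>G\<close> about \<open>c\<close> by 1 + s/\<rho>, and a point at distance at most
  \<open>s\<close> from the complement lies outside the dilate by 1 - s/\<rho>. The layer is the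
  difference of these dilates, so its volume is a difference of two powers and of order
  \<open>s\<close>.\<close>

lemma layer_exists:
  fixes G :: "'a::euclidean_space set" and S :: real
  assumes G: "G \<noteq> {}" "bounded G" "convex G" "open G" and S: "0 < S"
  shows "\<exists>K C. 0 \<le> C \<and> (\<forall>s. K s \<in> sets borel) \<and>
    (\<forall>s. 0 < s \<longrightarrow> s \<le> S \<longrightarrow> emeasure lborel (K s) \<le> ennreal (C * s)) \<and>
    (\<forall>s u v w. 0 < s \<longrightarrow> u \<in> G \<longrightarrow> v \<notin> G \<longrightarrow> dist w u \<le> s \<longrightarrow> dist w v \<le> s \<longrightarrow> w \<in> (K s :: 'a set))"
proof -
  obtain c where "c \<in> G" using G by auto
  then obtain \<rho> where \<rho>: "\<rho> > 0" "cball c \<rho> \<subseteq> G"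
    using \<open>open G\<close> open_contains_cball by blast
  define D where "D = DIM('a)"
  define P where "P s = {w. c + (1 / (1 + s / \<rho>)) *\<^sub>R (w - c) \<in> G}" for s
  \<comment> \<open>Empty for s >= \<rho>, where the inner dilate degenerates.\<close>
  define Q where "Q s = {w. s / \<rho> < 1 \<and> c + (1 / (1 - s / \<rho>)) *\<^sub>R (w - c) \<in> G}" for s
  define K where "K s = P s - Q s" for s
  define M where "M = 1 + S / \<rho>"
  define v where "v = measure lborel G"
  have [measurable]: "G \<in> sets borel" using \<open>open G\<close> by simp
  have fin: "emeasure lborel G = ennreal v"
    unfolding v_def using emeasure_bounded_finite[OF \<open>bounded G\<close>] by (intro emeasure_eq_ennreal_measure) auto
  have [measurable]: "P s \<in> sets borel" "Q s \<in> sets borel" for s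
    unfolding P_def Q_def by measurable
  have M1: "1 \<le> M" "0 \<le> v" using S \<rho> by (auto simp: M_def v_def)
  have P: "emeasure lborel (P s) = ennreal ((1 + s / \<rho>) ^ D * v)" if "0 < s" for s
  proof -
    have pos: "1 + s / \<rho> > 0" using that \<rho> by (simp add: add_pos_pos)
    have "{x. (c - (1 + s / \<rho>) *\<^sub>R c) + (1 + s / \<rho>) *\<^sub>R x \<in> P s} = G"
    proof -
      have "(1 / (1 + s / \<rho>)) *\<^sub>R (c - (1 + s / \<rho>) *\<^sub>R c + (1 + s / \<rho>) *\<^sub>R x - c) = x - c" for x
      proof -
        have "c - (1 + s / \<rho>) *\<^sub>R c + (1 + s / \<rho>) *\<^sub>R x - c = (1 + s / \<rho>) *\<^sub>R (x - c)"
          by (simp add: scaleR_diff_right)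
        then show ?thesis using pos by simp
      qed
      then show ?thesis by (simp add: P_def)
    qed
    with emeasure_lborel_affine[of "P s" "1 + s / \<rho>" "c - (1 + s / \<rho>) *\<^sub>R c"] pos M1
    show ?thesis by (simp add: fin D_def ennreal_mult)
  qed
  have Q: "emeasure lborel (Q s) = ennreal ((1 - s / \<rho>) ^ D * v)" if "0 < s" "s / \<rho> < 1" for s
  proof -
    have pos: "1 - s / \<rho> > 0" using that by simp
    have "{x. (c - (1 - s / \<rho>) *\<^sub>R c) + (1 - s / \<rho>) *\<^sub>R x \<in> Q s} = G"
    proof -
      have "(1 / (1 - s / \<rho>)) *\<^sub>R (c - (1 - s / \<rho>) *\<^sub>R c + (1 - s / \<rho>) *\<^sub>R x - c) = x - c" for x
      proof -
        have "c - (1 - s / \<rho>) *\<^sub>R c + (1 - s / \<rho>) *\<^sub>R x - c = (1 - s / \<rho>) *\<^sub>R (x - c)"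
          by (simp add: scaleR_diff_right)
        from scaleR_cancel[OF this] show ?thesis using pos by linarith
      qed
      then show ?thesis using that by (simp add: Q_def)
    qed
    moreover have "\<rho> \<noteq> s" "\<rho> \<noteq> 0" using that \<rho> by auto
    ultimately show ?thesis
      using emeasure_lborel_affine[of "Q s" "1 - s / \<rho>" "c - (1 - s / \<rho>) *\<^sub>R c"] pos M1
      by (simp add: fin D_def ennreal_mult)
  qed
  have QP: "Q s \<subseteq> P s" if "0 < s" for s
  proof
    fix w assume "w \<in> Q s"
    then have 1: "1 - s / \<rho> > 0" and g: "c + (1 / (1 - s / \<rho>)) *\<^sub>R (w - c) \<in> G" by (auto simp: Q_def)
    have sp: "0 < s / \<rho>" using that \<rho> by simp
    define t where "t = (1 - s / \<rho>) / (1 + s / \<rho>)"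
    have t: "0 \<le> t" "t \<le> 1" unfolding t_def using 1 frac_bounds[OF sp] by (linarith, linarith)
    have "t * (1 / (1 - s / \<rho>)) = 1 / (1 + s / \<rho>)"
      using that \<rho> 1 unfolding t_def times_divide_times_eq by (metis divide_self_if less_irrefl mult.commute mult_1 nonzero_divide_mult_cancel_right)
    then have "c + (1 / (1 + s / \<rho>)) *\<^sub>R (w - c) = (1 - t) *\<^sub>R c + t *\<^sub>R (c + (1 / (1 - s / \<rho>)) *\<^sub>R (w - c))"
      by (simp add: algebra_simps)
    also have "\<dots> \<in> G" using \<open>convex G\<close> \<open>c \<in> G\<close> g t by (simp add: convex_alt)
    finally show "w \<in> P s" by (simp add: P_def)
  qed
  \<comment> \<open>\<open>M\<close> bounds 1 + s/\<rho> for all \<open>s\<close> up to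
    \<open>S\<close>. For s < \<rho> the factor 2 D comes from \<open>power_diff_le\<close>; for s
    >= \<rho> the whole outer dilate is counted, and s/\<rho> >= 1 makes the bound linear in
    \<open>s\<close>.\<close>
  define C where "C = v * (2 * real D + 1) * M ^ D / \<rho>"
  have meas: "emeasure lborel (K s) \<le> ennreal (C * s)" if s: "0 < s" "s \<le> S" for s
  proof (cases "s / \<rho> < 1")
    case True
    have sM: "1 + s / \<rho> \<le> M" using s \<rho> by (simp add: M_def divide_right_mono)
    have sp: "0 < s / \<rho>" using s \<rho> by simp
    have "emeasure lborel (K s) = emeasure lborel (P s) - emeasure lborel (Q s)"
      unfolding K_def using QP[OF s(1)] Q[OF s(1) True] by (intro emeasure_Diff) auto
    also have "\<dots> = ennreal ((1 + s / \<rho>) ^ D * v - (1 - s / \<rho>) ^ D * v)"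
      unfolding P[OF s(1)] Q[OF s(1) True] using M1 True by (intro ennreal_minus) auto
    also have "\<dots> \<le> ennreal (C * s)"
    proof (rule ennreal_leI)
      have "(1 + s / \<rho>) ^ D - (1 - s / \<rho>) ^ D \<le> real D * ((1 + s / \<rho>) - (1 - s / \<rho>)) * M ^ D"
        using True sp sM M1 by (intro power_diff_le) auto
      also have "\<dots> \<le> (2 * real D + 1) * M ^ D / \<rho> * s"
        using M1 s \<rho> by (simp add: field_simps)
      finally have "((1 + s / \<rho>) ^ D - (1 - s / \<rho>) ^ D) * v \<le> (2 * real D + 1) * M ^ D / \<rho> * s * v"
        using M1 by (intro mult_right_mono) auto
      then show "(1 + s / \<rho>) ^ D * v - (1 - s / \<rho>) ^ D * v \<le> C * s"
        by (simp add: C_def algebra_simps)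
    qed
    finally show ?thesis .
  next
    case False
    have sM: "1 + s / \<rho> \<le> M" using s \<rho> by (simp add: M_def divide_right_mono)
    have "emeasure lborel (K s) \<le> emeasure lborel (P s)" unfolding K_def by (intro emeasure_mono) auto
    also have "\<dots> \<le> ennreal (C * s)"
      unfolding P[OF s(1)]
    proof (rule ennreal_leI)
      have "(1 + s / \<rho>) ^ D \<le> M ^ D" using sM s \<rho> by (intro power_mono) auto
      also have "\<dots> \<le> M ^ D * ((2 * real D + 1) * (s / \<rho>))"
      proof -
        have "1 * 1 \<le> (2 * real D + 1) * (s / \<rho>)" using False by (intro mult_mono) auto
        then have "M ^ D * 1 \<le> M ^ D * ((2 * real D + 1) * (s / \<rho>))" using M1 by (intro mult_left_mono) auto
        then show ?thesis by simp
      qed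
      finally have "(1 + s / \<rho>) ^ D * v \<le> M ^ D * ((2 * real D + 1) * (s / \<rho>)) * v"
        using M1 by (intro mult_right_mono) auto
      then show "(1 + s / \<rho>) ^ D * v \<le> C * s" by (simp add: C_def ac_simps)
    qed
    finally show ?thesis .
  qed
  have in_K: "w \<in> K s" if s: "0 < s" and u: "u \<in> G" and x: "x \<notin> G" and wu: "dist w u \<le> s" and wx: "dist w x \<le> s" for s u x w
  proof -
    have sp: "0 < s / \<rho>" using s \<rho> by simp
    have ball: "c + (\<rho> / s) *\<^sub>R h \<in> G" if "norm h \<le> s" for h
    proof -
      have "norm ((\<rho> / s) *\<^sub>R h) \<le> \<rho>" using that s \<rho> by (simp add: field_simps)
      then show ?thesis using \<rho>(2) by (auto simp: dist_norm subset_iff)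
    qed
    \<comment> \<open>The contracted point is a convex combination of \<open>u\<close>, with weight
      1/(1 + s/\<rho>), and of the point of the ball about \<open>c\<close> in the direction
      \<open>w - u\<close>.\<close>
    have "w \<in> P s"
    proof -
      define t where "t = (s / \<rho>) / (1 + s / \<rho>)"
      have t: "0 \<le> t" "t \<le> 1" unfolding t_def using frac_bounds[OF sp] by blast+
      have t1: "1 - t = 1 / (1 + s / \<rho>)" unfolding t_def by (rule frac_bounds(5)[OF sp])
      have t2: "t * (\<rho> / s) = 1 / (1 + s / \<rho>)"
      proof -
        have "t * (\<rho> / s) = ((s / \<rho>) * (\<rho> / s)) / (1 + s / \<rho>)" by (simp add: t_def)
        also have "(s / \<rho>) * (\<rho> / s) = 1" using s \<rho> by simp
        finally show ?thesis .
      qed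
      have "norm (w - u) \<le> s" using wu by (simp add: dist_norm)
      have "(1 - t) *\<^sub>R u + t *\<^sub>R (c + (\<rho> / s) *\<^sub>R (w - u)) = (1 - t) *\<^sub>R u + t *\<^sub>R c + (1 - t) *\<^sub>R (w - u)"
        using t1 t2 by (simp add: scaleR_add_right)
      also have "\<dots> = c + (1 - t) *\<^sub>R (w - c)" by (simp add: algebra_simps)
      finally have "c + (1 - t) *\<^sub>R (w - c) = (1 - t) *\<^sub>R u + t *\<^sub>R (c + (\<rho> / s) *\<^sub>R (w - u))" by simp
      also have "\<dots> \<in> G" using \<open>convex G\<close> u ball[OF \<open>norm (w - u) \<le> s\<close>] t by (simp add: convex_alt)
      finally show ?thesis by (simp add: P_def t1)
    qed
    \<comment> \<open>Otherwise \<open>x\<close> would be a convex combination of the expanded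
      point, which lies in \<open>G\<close>, and of a point of the ball about \<open>c\<close> with
      weight s/\<rho>, and would lie in \<open>G\<close> itself.\<close>
    moreover have "w \<notin> Q s"
    proof
      assume "w \<in> Q s"
      then have 1: "1 - s / \<rho> > 0" and g: "c + (1 / (1 - s / \<rho>)) *\<^sub>R (w - c) \<in> G" by (auto simp: Q_def)
      define t where "t = s / \<rho>"
      have t: "0 \<le> t" "t \<le> 1" "1 - t \<noteq> 0" using sp 1 by (auto simp: t_def)
      have t2: "t * (\<rho> / s) = 1" using s \<rho> by (simp add: t_def)
      have "norm (x - w) \<le> s" using wx by (simp add: dist_norm norm_minus_commute)
      have "(1 - t) *\<^sub>R (c + (1 / (1 - t)) *\<^sub>R (w - c)) + t *\<^sub>R (c + (\<rho> / s) *\<^sub>R (x - w))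
          = (1 - t) *\<^sub>R c + (w - c) + t *\<^sub>R c + (x - w)"
      proof -
        have "(1 - t) *\<^sub>R (1 / (1 - t)) *\<^sub>R (w - c) = w - c" using t(3) by simp
        moreover have "t *\<^sub>R (\<rho> / s) *\<^sub>R (x - w) = x - w" by (simp only: scaleR_scaleR t2 scaleR_one)
        ultimately show ?thesis by (simp only: scaleR_add_right) (simp add: add.assoc)
      qed
      also have "\<dots> = x" by (simp add: algebra_simps)
      finally have "x = (1 - t) *\<^sub>R (c + (1 / (1 - t)) *\<^sub>R (w - c)) + t *\<^sub>R (c + (\<rho> / s) *\<^sub>R (x - w))" by simp
      also have "\<dots> \<in> G" using \<open>convex G\<close> g ball[OF \<open>norm (x - w) \<le> s\<close>] t by (simp add: convex_alt t_def)
      finally show False using x by simp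
    qed
    ultimately show ?thesis by (simp add: K_def)
  qed
  have "0 \<le> C" using M1 \<rho> by (simp add: C_def)
  moreover have "\<forall>s. K s \<in> sets borel" unfolding K_def by measurable
  ultimately show ?thesis using meas in_K by blast
qed

section \<open>Averages over neighbouring cubes\<close>

definition nker :: "int \<Rightarrow> int \<Rightarrow> real^'n \<Rightarrow> real^'n \<Rightarrow> real" where
  "nker N k x y = (if near N k x y then 1 / (2 powi k) ^ CARD('n) else 0)"

text \<open>Normalised by the volume of one cube although up to (2N+1)^d cubes are charged;
  constants are therefore reproduced only up to that factor.\<close>

definition tav :: "int \<Rightarrow> int \<Rightarrow> (real^'n \<Rightarrow> ennreal) \<Rightarrow> real^'n \<Rightarrow> ennreal" where
  "tav N k g x = (NN y. ennreal (nker N k x y) * g y)"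

lemma nker_nonneg [simp]: "0 \<le> nker N k x y" by (simp add: nker_def)

lemma nker_sym: "nker N k x y = nker N k y x" by (simp add: nker_def near_sym)

lemma nker_measurable' [measurable (raw)]:
  assumes "f \<in> M \<rightarrow>\<^sub>M borel" "g \<in> M \<rightarrow>\<^sub>M borel"
  shows "(\<lambda>x. nker N k (f x) (g x)) \<in> borel_measurable M"
proof -
  have 1: "(\<lambda>p. nker N k (fst p) (snd p)) \<in> \<B>"
    by (rule measurable_const_cells2[of k]) (auto simp: nker_def near_def)
  have "(\<lambda>x. (f x, g x)) \<in> M \<rightarrow>\<^sub>M borel"
    using assms by (simp add: borel_prod[symmetric])
  from measurable_compose[OF this 1] show ?thesis by simp
qed

lemma near_sets [measurable]: "{y. near N k x y} \<in> sets borel"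
  by (rule sat_sets[of k]) (auto simp: near_def)

lemma nn_nker:
  fixes x :: "real^'n"
  assumes "0 \<le> N"
  shows "(NN y. ennreal (nker N k x y)) \<le> ennreal ((2 * of_int N + 1) ^ CARD('n))"
proof -
  have "(NN y. ennreal (nker N k x y)) =
    (NN y. ennreal (1 / (2 powi k) ^ CARD('n)) * indicator {y. near N k x y} y)"
    by (intro nn_integral_cong) (auto simp: nker_def)
  also have "\<dots> = ennreal (1 / (2 powi k) ^ CARD('n)) * emeasure lborel {y. near N k x y}"
    by (subst nn_integral_cmult_indicator) auto
  also have "\<dots> \<le> ennreal (1 / (2 powi k) ^ CARD('n)) * ennreal ((2 * of_int N + 1) ^ CARD('n) * (2 powi k) ^ CARD('n))"
    by (intro mult_left_mono near_measure assms) auto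
  also have "\<dots> = ennreal ((2 * of_int N + 1) ^ CARD('n))"
    using assms by (subst ennreal_mult[symmetric]) auto
  finally show ?thesis .
qed

lemma tav_cong: "gr k x = gr k x' \<Longrightarrow> tav N k g x = tav N k g x'"
  by (simp add: tav_def nker_def near_def)

lemma tav_measurable [measurable]: "tav N k g \<in> \<B>"
  by (rule measurable_const_cells[of k]) (auto intro: tav_cong)

lemma tav_mono: "(\<And>y. near N k x y \<Longrightarrow> g y \<le> h y) \<Longrightarrow> tav N k g x \<le> tav N k h x"
  unfolding tav_def by (intro nn_integral_mono) (auto simp: nker_def intro!: mult_left_mono)

lemma tav_const: "0 \<le> N \<Longrightarrow> tav N k (\<lambda>_. c) (x::real^'n) \<le> ennreal ((2 * of_int N + 1) ^ CARD('n)) * c"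
  unfolding tav_def by (subst nn_integral_multc) (auto intro!: mult_right_mono nn_nker)

lemma tav_add:
  assumes [measurable]: "f \<in> \<B>" "g \<in> \<B>"
  shows "tav N k (\<lambda>y. f y + g y) x = tav N k f x + tav N k g x"
  unfolding tav_def distrib_left by (subst nn_integral_add) auto

lemma tav_cmult:
  assumes [measurable]: "f \<in> \<B>"
  shows "tav N k (\<lambda>y. c * f y) x = c * tav N k f x"
  unfolding tav_def by (subst nn_integral_cmult[symmetric]) (auto simp: ac_simps)

lemma nn_integral_tav:
  fixes g :: "real^'n \<Rightarrow> ennreal"
  assumes [measurable]: "g \<in> \<B>" and N: "0 \<le> N"
  shows "(NN x. tav N k g x) \<le> ennreal ((2 * of_int N + 1) ^ CARD('n)) * (NN x. g x)"
proof -
  have "(NN x. tav N k g x) = (NN y. NN x. ennreal (nker N k x y) * g y)"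
    unfolding tav_def by (rule lborel_pair.Fubini'[symmetric]) measurable
  also have "\<dots> = (NN y. (NN x. ennreal (nker N k y x)) * g y)"
    by (intro nn_integral_cong) (simp add: nn_integral_multc nker_sym)
  also have "\<dots> \<le> (NN y. ennreal ((2 * of_int N + 1) ^ CARD('n)) * g y)"
    by (intro nn_integral_mono mult_right_mono nn_nker N) auto
  finally show ?thesis by (simp add: nn_integral_cmult)
qed

lemma CS_nn:
  fixes f :: "'a \<Rightarrow> ennreal"
  assumes [measurable]: "f \<in> borel_measurable M" "A \<in> sets M"
  shows "(\<integral>\<^sup>+x. indicator A x * f x \<partial>M)\<^sup>2 \<le> emeasure M A * (\<integral>\<^sup>+x. indicator A x * (f x)\<^sup>2 \<partial>M)"
proof -
  have "(\<integral>\<^sup>+x. indicator A x * (indicator A x * f x) \<partial>M)\<^sup>2 \<le>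
      (\<integral>\<^sup>+x. (indicator A x)\<^sup>2 \<partial>M) * (\<integral>\<^sup>+x. (indicator A x * f x)\<^sup>2 \<partial>M)"
    by (rule Cauchy_Schwarz_nn_integral) measurable
  moreover have "indicator A x * (indicator A x * f x) = indicator A x * f x"
    "(indicator A x :: ennreal)\<^sup>2 = indicator A x" "(indicator A x * f x)\<^sup>2 = indicator A x * (f x)\<^sup>2" for x
    by (auto simp: indicator_def)
  ultimately show ?thesis by simp
qed

subsection \<open>Martingale differences\<close>

lemma ennreal_power2: "0 \<le> a \<Longrightarrow> (ennreal a)\<^sup>2 = ennreal (a\<^sup>2)"
  by (simp add: ennreal_power)

lemma square_sum_le:
  fixes a b :: real
  shows "(a + b)\<^sup>2 \<le> 2 * (a\<^sup>2 + b\<^sup>2)"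
  using sum_squares_ge_zero[of "a - b" 0] by (simp add: power2_eq_square algebra_simps)

lemma ennreal_square_sum_le: "(a + b :: ennreal)\<^sup>2 \<le> 2 * (a\<^sup>2 + b\<^sup>2)"
proof (cases a; cases b)
  fix x y assume *: "a = ennreal x" "0 \<le> x" "b = ennreal y" "0 \<le> y"
  have "ennreal ((x + y)\<^sup>2) \<le> ennreal (x\<^sup>2 + y\<^sup>2) + ennreal (x\<^sup>2 + y\<^sup>2)"
    using square_sum_le[of x y] by (simp add: ennreal_plus[symmetric] ennreal_leI del: ennreal_plus)
  also have "\<dots> = 2 * (a\<^sup>2 + b\<^sup>2)" using * by (simp add: mult_2 ennreal_power2)
  finally show ?thesis
    using * by (simp add: ennreal_power2 ennreal_plus[symmetric] del: ennreal_plus)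
qed (auto simp: power2_eq_square ennreal_mult_top)

lemma ennreal_norm_diff_square_le:
  fixes a b :: "'a::real_normed_vector"
  shows "ennreal ((norm (a - b))\<^sup>2) \<le> 2 * (ennreal ((norm a)\<^sup>2) + ennreal ((norm b)\<^sup>2))"
proof -
  have "(ennreal (norm (a - b)))\<^sup>2 \<le> (ennreal (norm a) + ennreal (norm b))\<^sup>2"
    by (intro power_mono) (auto simp: ennreal_plus[symmetric] norm_triangle_ineq4 intro!: ennreal_leI simp del: ennreal_plus)
  also note ennreal_square_sum_le
  finally show ?thesis by (simp add: ennreal_power2)
qed

lemma norm_av_bound:
  assumes "\<And>x. norm (f x) \<le> B"
  shows "norm (av \<kappa> f x) \<le> B"
proof -
  have B: "0 \<le> B" using assms norm_ge_zero order_trans by blast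
  have "ennreal (norm (av \<kappa> f x)) \<le> nav \<kappa> (\<lambda>y. ennreal (norm (f y))) x" by (rule norm_av_le)
  also have "\<dots> \<le> nav \<kappa> (\<lambda>_. ennreal B) x" by (intro nav_mono ennreal_leI assms)
  finally show ?thesis using B by (simp add: nav_const)
qed

lemma integrable_square_bounded:
  fixes v :: "'a \<Rightarrow> complex"
  assumes "integrable M v" "\<And>x. norm (v x) \<le> B"
  shows "integrable M (\<lambda>x. (norm (v x))\<^sup>2)"
proof (rule Bochner_Integration.integrable_bound[of _ "\<lambda>x. B * norm (v x)"])
  have [measurable]: "v \<in> borel_measurable M" using assms(1) by auto
  show "integrable M (\<lambda>x. B * norm (v x))" using assms by simp
  show "(\<lambda>x. (norm (v x))\<^sup>2) \<in> borel_measurable M" by measurable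
  have "norm (v x) * norm (v x) \<le> \<bar>B * norm (v x)\<bar>" for x
    using assms(2)[of x] mult_right_mono[OF assms(2)[of x] norm_ge_zero[of "v x"]] by linarith
  then show "AE x in M. norm ((norm (v x))\<^sup>2) \<le> norm (B * norm (v x))"
    by (simp add: power2_eq_square)
qed

text \<open>Pythagoras: by self-adjointness the inner product of \<open>v\<close> with its average
  is the squared norm of the average. Integrability and boundedness of \<open>v\<close> together
  make every term finite.\<close>

lemma orth_av:
  fixes v :: "real^'n \<Rightarrow> complex"
  assumes st: "stp m \<kappa>" and v: "integrable lborel v" and B: "\<And>x. norm (v x) \<le> B"
  shows "(NN x. ennreal ((norm (v x - av \<kappa> v x))\<^sup>2)) + (NN x. ennreal ((norm (av \<kappa> v x))\<^sup>2))
    = (NN x. ennreal ((norm (v x))\<^sup>2))"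
proof -
  define w where "w = av \<kappa> v"
  have w: "integrable lborel w" unfolding w_def by (rule integrable_av[OF st v])
  have wB: "norm (w x) \<le> B" for x unfolding w_def by (rule norm_av_bound[OF B])
  have [measurable]: "v \<in> \<B>" "w \<in> \<B>" using v w by auto
  have s: "sat \<kappa> (\<lambda>x. cnj (w x))" using av_cell[OF st, of v] unfolding sat_def w_def by metis
  have [measurable]: "(\<lambda>x. cnj (w x)) \<in> \<B>" by (rule sat_measurable[OF st s]) auto
  have cross: "(\<integral>x. cnj (w x) * w x \<partial>lborel) = (\<integral>x. cnj (w x) * v x \<partial>lborel)"
    using integral_sat[OF st s v sat_measurable[OF st s], of B] wB by (simp add: w_def)
  have i1: "integrable lborel (\<lambda>x. (norm (v x))\<^sup>2)" and i2: "integrable lborel (\<lambda>x. (norm (w x))\<^sup>2)"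
    and i3: "integrable lborel (\<lambda>x. (norm (v x - w x))\<^sup>2)"
    using integrable_square_bounded[OF v B] integrable_square_bounded[OF w wB]
      integrable_square_bounded[OF Bochner_Integration.integrable_diff[OF v w], of "B + B"]
      norm_triangle_le_diff[OF add_mono[OF B wB]] by auto
  have i4: "integrable lborel (\<lambda>x. cnj (w x) * v x)"
  proof (rule Bochner_Integration.integrable_bound[of _ "\<lambda>x. B * norm (v x)"])
    show "integrable lborel (\<lambda>x. B * norm (v x))" using v by simp
    have "0 \<le> B" using B norm_ge_zero order_trans by blast
    then show "AE x in lborel. norm (cnj (w x) * v x) \<le> norm (B * norm (v x))"
      using wB by (auto simp: norm_mult intro!: mult_right_mono)
  qed simp
  define c where "c x = Re (cnj (w x) * v x)" for x
  have i5: "integrable lborel c" unfolding c_def using integrable_Re[OF i4] .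
  have e: "(norm (v x - w x))\<^sup>2 = (norm (v x))\<^sup>2 - 2 * c x + (norm (w x))\<^sup>2" for x
    unfolding c_def cmod_power2 by (simp add: power2_eq_square algebra_simps)
  have "(\<integral>x. (norm (v x - w x))\<^sup>2 \<partial>lborel)
      = (\<integral>x. (norm (v x))\<^sup>2 \<partial>lborel) - 2 * (\<integral>x. c x \<partial>lborel) + (\<integral>x. (norm (w x))\<^sup>2 \<partial>lborel)"
    unfolding e using i1 i2 i5 by simp
  also have "(\<integral>x. c x \<partial>lborel) = Re (\<integral>x. cnj (w x) * w x \<partial>lborel)"
    unfolding cross c_def by (rule integral_Re[OF i4])
  also have "(\<lambda>x. cnj (w x) * w x) = (\<lambda>x. complex_of_real ((norm (w x))\<^sup>2))"
    by (simp add: complex_norm_square[symmetric] mult.commute fun_eq_iff)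
  also have "Re (\<integral>x. complex_of_real ((norm (w x))\<^sup>2) \<partial>lborel) = (\<integral>x. (norm (w x))\<^sup>2 \<partial>lborel)"
    by (simp only: integral_complex_of_real Re_complex_of_real)
  finally have "(\<integral>x. (norm (v x - w x))\<^sup>2 \<partial>lborel) + (\<integral>x. (norm (w x))\<^sup>2 \<partial>lborel) = (\<integral>x. (norm (v x))\<^sup>2 \<partial>lborel)"
    by simp
  then show ?thesis unfolding w_def[symmetric]
    using i1 i2 i3 by (simp add: nn_integral_eq_integral ennreal_plus[symmetric] del: ennreal_plus)
qed

text \<open>Index \<open>J + 1\<close> holds the coarsest average itself, so a step function is the
  finite sum of its differences and no remainder is left at the coarse end. Like the others, this
  term is constant on cubes of level \<open>j - 1\<close>.\<close>

definition dif :: "int \<Rightarrow> (real^'n \<Rightarrow> complex) \<Rightarrow> int \<Rightarrow> real^'n \<Rightarrow> complex" where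
  "dif J f j x = (if j = J + 1 then av (\<lambda>_. J) f x else av (\<lambda>_. j - 1) f x - av (\<lambda>_. j) f x)"

lemma sum_telescope_int:
  fixes g :: "int \<Rightarrow> 'a::ab_group_add"
  assumes "k \<le> J"
  shows "(\<Sum>j\<in>{k+1..J}. g (j - 1) - g j) = g k - g J"
  using assms
proof (induction J rule: int_ge_induct)
  case (step J)
  have "{k+1..J+1} = insert (J + 1) {k+1..J}" using step by auto
  then show ?case using step by simp
qed simp

lemma sum_dif:
  assumes "k \<le> J"
  shows "(\<Sum>j\<in>{k+1..J+1}. dif J f j x) = av (\<lambda>_. k) f x"
proof -
  have "{k+1..J+1} = insert (J + 1) {k+1..J}" using assms by auto
  then have "(\<Sum>j\<in>{k+1..J+1}. dif J f j x) = av (\<lambda>_. J) f x + (\<Sum>j\<in>{k+1..J}. dif J f j x)"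
    by (simp add: dif_def)
  also have "(\<Sum>j\<in>{k+1..J}. dif J f j x) = (\<Sum>j\<in>{k+1..J}. av (\<lambda>_. j - 1) f x - av (\<lambda>_. j) f x)"
    by (intro sum.cong) (auto simp: dif_def)
  also have "\<dots> = av (\<lambda>_. k) f x - av (\<lambda>_. J) f x"
    using sum_telescope_int[OF assms, of "\<lambda>j. av (\<lambda>_. j) f x"] by simp
  finally show ?thesis by simp
qed

lemma dif_cell:
  assumes "gr (j - 1) x = gr (j - 1) y"
  shows "dif J f j x = dif J f j y"
proof -
  have "av (\<lambda>_. i) f x = av (\<lambda>_. i) f y" if "j - 1 \<le> i" for i
  proof -
    have "gr i y = gr i x" using gr_mono[OF assms that] by simp
    then show ?thesis using av_cell[OF stp_const, of i f] unfolding sat_def by metis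
  qed
  from this[of J] this[of j] this[of "j - 1"] show ?thesis by (simp add: dif_def)
qed

lemma dif_measurable [measurable]: "dif J f j \<in> \<B>"
  by (rule measurable_const_cells[of "j - 1"]) (auto intro: dif_cell)

text \<open>Pythagoras level by level, with induction on \<open>J\<close>: the average at level
  \<open>J\<close> splits orthogonally into the difference of level \<open>J + 1\<close> and the
  next average.\<close>

lemma sum_dif_L2:
  fixes f :: "real^'n \<Rightarrow> complex"
  assumes f: "integrable lborel f" and B: "\<And>x. norm (f x) \<le> B" and m: "\<And>x y. gr m x = gr m y \<Longrightarrow> f x = f y" and J: "m \<le> J"
  shows "(\<Sum>j\<in>{m+1..J+1}. \<integral>\<^sup>+x. ennreal ((norm (dif J f j x))\<^sup>2) \<partial>lborel) = (NN x. ennreal ((norm (f x))\<^sup>2))"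
proof -
  define n where "n g = (NN x. ennreal ((norm (g x))\<^sup>2))" for g :: "real^'n \<Rightarrow> complex"
  let ?E = "\<lambda>j. av (\<lambda>_. j) f"
  have "(\<Sum>j\<in>{m+1..J}. n (\<lambda>x. ?E (j - 1) x - ?E j x)) + n (?E J) = n f"
    using J
  proof (induction J rule: int_ge_induct)
    case base
    have "av (\<lambda>_. m) f = f"
    proof
      fix x
      have "sat (\<lambda>_. m) f" unfolding sat_def by (metis m)
      then show "av (\<lambda>_. m) f x = f x" by (rule av_idem)
    qed
    then show ?case by simp
  next
    case (step J)
    define X where "X = n (\<lambda>x. ?E J x - ?E (J + 1) x)"
    define Y where "Y = (\<Sum>j\<in>{m+1..J}. n (\<lambda>x. ?E (j - 1) x - ?E j x))"
    have 1: "{m+1..J+1} = insert (J + 1) {m+1..J}" using step by auto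
    have 2: "X + n (?E (J + 1)) = n (?E J)"
      using orth_av[OF stp_const integrable_av[OF stp_const f] norm_av_bound[OF B, of "\<lambda>_. J"], of "J + 1"]
      by (simp add: n_def X_def av_av f)
    have "(\<Sum>j\<in>{m+1..J+1}. n (\<lambda>x. ?E (j - 1) x - ?E j x)) = X + Y"
      unfolding 1 X_def Y_def by simp
    then have "(\<Sum>j\<in>{m+1..J+1}. n (\<lambda>x. ?E (j - 1) x - ?E j x)) + n (?E (J + 1)) = Y + (X + n (?E (J + 1)))"
      by (simp only: ac_simps)
    also have "\<dots> = n f" unfolding 2 using step(2) by (simp only: Y_def)
    finally show ?case .
  qed
  moreover have "{m+1..J+1} = insert (J + 1) {m+1..J}" using J by auto
  moreover have "(\<Sum>j\<in>{m+1..J}. n (dif J f j)) = (\<Sum>j\<in>{m+1..J}. n (\<lambda>x. ?E (j - 1) x - ?E j x))"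
    by (intro sum.cong refl) (auto simp: n_def dif_def)
  moreover have "n (dif J f (J + 1)) = n (?E J)" by (simp add: n_def dif_def)
  ultimately show ?thesis by (simp add: n_def[symmetric] add.commute)
qed

text \<open>A point with such a neighbour lies within (N+1) 2^k of a face of its cube of level
  \<open>a\<close>. Each of the 2d slabs along the faces has volume at most (N+1) 2^k 2^(a(d-1));
  dividing by the volume of the cube leaves the factor 2^(k-a).\<close>

lemma boundary_measure:
  fixes x0 :: "real^'n"
  assumes N: "0 \<le> N" and ka: "k \<le> a"
  shows "nav (\<lambda>_. a) (indicator {x. \<exists>z. near N k x z \<and> gr a z \<noteq> gr a x}) x0
     \<le> ennreal (2 * real CARD('n) * (of_int N + 1) * 2 powi (k - a))"
proof -
  define \<eta> :: real where "\<eta> = (of_int N + 1) * 2 powi k"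
  define g where "g = gr a x0"
  define lo :: "real^'n" where "lo = (\<chi> i. 2 powi a * of_int (g $ i))"
  have p: "(2::real) powi a > 0" by simp
  have \<eta>: "0 \<le> \<eta>" using N by (simp add: \<eta>_def)
  define S1 where "S1 i = {x. gr a x = g \<and> x $ i \<le> lo $ i + \<eta>}" for i
  define S2 where "S2 i = {x. gr a x = g \<and> lo $ i + 2 powi a - \<eta> \<le> x $ i}" for i
  have cell: "lo $ i \<le> x $ i \<and> x $ i < lo $ i + 2 powi a \<longleftrightarrow> gr a x $ i = g $ i" for x i
  proof -
    have "gr a x $ i = g $ i \<longleftrightarrow> of_int (g $ i) \<le> x $ i / 2 powi a \<and> x $ i / 2 powi a < of_int (g $ i) + 1"
      by (simp add: gr_def floor_eq_iff)
    then show ?thesis using p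
      by (simp add: lo_def pos_le_divide_eq pos_divide_less_eq algebra_simps)
  qed
  have [measurable]: "S1 i \<in> sets borel" "S2 i \<in> sets borel" for i unfolding S1_def S2_def by measurable
  define c where "c i j = (if j = i then \<eta> else 2 powi a :: real)" for i j :: 'n
  have prodc: "(\<Prod>j\<in>UNIV. c i j) = \<eta> * (2 powi a) ^ (CARD('n) - 1)" for i
    by (subst prod.remove[of _ i]) (auto simp: c_def)
  have m1: "emeasure lborel (S1 i) \<le> ennreal (\<eta> * (2 powi a) ^ (CARD('n) - 1))" for i
  proof -
    have "S1 i \<subseteq> {x. \<forall>j. lo $ j \<le> x $ j \<and> x $ j \<le> lo $ j + c i j}"
    proof (intro subsetI CollectI allI)
      fix x j assume x: "x \<in> S1 i"
      then have "lo $ j \<le> x $ j \<and> x $ j < lo $ j + 2 powi a" by (simp add: S1_def cell)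
      with x show "lo $ j \<le> x $ j \<and> x $ j \<le> lo $ j + c i j" by (auto simp: S1_def c_def)
    qed
    from emeasure_le_cube[OF this] show ?thesis using \<eta> by (simp add: prodc) (simp add: c_def)
  qed
  have m2: "emeasure lborel (S2 i) \<le> ennreal (\<eta> * (2 powi a) ^ (CARD('n) - 1))" for i
  proof -
    let ?l = "\<chi> j. if j = i then lo $ j + 2 powi a - \<eta> else lo $ j"
    have "S2 i \<subseteq> {x. \<forall>j. ?l $ j \<le> x $ j \<and> x $ j \<le> ?l $ j + c i j}"
    proof (intro subsetI CollectI allI)
      fix x j assume x: "x \<in> S2 i"
      then have "lo $ j \<le> x $ j \<and> x $ j < lo $ j + 2 powi a" by (simp add: S2_def cell)
      with x show "?l $ j \<le> x $ j \<and> x $ j \<le> ?l $ j + c i j" by (auto simp: S2_def c_def)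
    qed
    from emeasure_le_cube[OF this] show ?thesis using \<eta> by (simp add: prodc) (simp add: c_def)
  qed
  have sub: "{x. gr a x = g} \<inter> {x. \<exists>z. near N k x z \<and> gr a z \<noteq> gr a x} \<subseteq> (\<Union>i. S1 i \<union> S2 i)"
  proof
    fix x assume "x \<in> {x. gr a x = g} \<inter> {x. \<exists>z. near N k x z \<and> gr a z \<noteq> gr a x}"
    then obtain z where x: "gr a x = g" and z: "near N k x z" "gr a z \<noteq> g" by auto
    then obtain i where i: "gr a z $ i \<noteq> g $ i" by (auto simp: vec_eq_iff)
    have "\<bar>x $ i - z $ i\<bar> \<le> \<eta>" using near_bound[OF z(1)] by (simp add: \<eta>_def)
    moreover have "\<not> (lo $ i \<le> z $ i \<and> z $ i < lo $ i + 2 powi a)" using i cell by blast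
    ultimately have "x $ i \<le> lo $ i + \<eta> \<or> lo $ i + 2 powi a - \<eta> \<le> x $ i" by linarith
    then show "x \<in> (\<Union>i. S1 i \<union> S2 i)" using x by (auto simp: S1_def S2_def)
  qed
  have "nav (\<lambda>_. a) (indicator {x. \<exists>z. near N k x z \<and> gr a z \<noteq> gr a x}) x0
     \<le> (NN y. ennreal (1 / (2 powi a) ^ CARD('n)) * indicator (\<Union>i. S1 i \<union> S2 i) y)"
    unfolding nav_def using sub by (intro nn_integral_mono) (auto simp: ker_def g_def split: split_indicator)
  also have "\<dots> = ennreal (1 / (2 powi a) ^ CARD('n)) * emeasure lborel (\<Union>i. S1 i \<union> S2 i)"
    by (subst nn_integral_cmult_indicator) auto
  also have "emeasure lborel (\<Union>i. S1 i \<union> S2 i) \<le> (\<Sum>i\<in>UNIV. emeasure lborel (S1 i \<union> S2 i))"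
    by (intro emeasure_subadditive_finite) auto
  also have "\<dots> \<le> (\<Sum>i\<in>(UNIV::'n set). ennreal (\<eta> * (2 powi a) ^ (CARD('n) - 1)) + ennreal (\<eta> * (2 powi a) ^ (CARD('n) - 1)))"
    by (intro sum_mono order_trans[OF emeasure_subadditive] add_mono m1 m2) auto
  also have "\<dots> = ennreal (2 * real CARD('n) * \<eta> * (2 powi a) ^ (CARD('n) - 1))"
    using \<eta> by (simp add: ennreal_plus[symmetric] ennreal_of_nat_eq_real_of_nat ennreal_mult[symmetric] algebra_simps del: ennreal_plus)
  also have "ennreal (1 / (2 powi a) ^ CARD('n)) * \<dots> = ennreal (1 / (2 powi a) ^ CARD('n) * (2 * real CARD('n) * \<eta> * (2 powi a) ^ (CARD('n) - 1)))"
    using \<eta> by (intro ennreal_mult[symmetric]) auto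
  also have "1 / (2 powi a) ^ CARD('n) * (2 * real CARD('n) * \<eta> * (2 powi a) ^ (CARD('n) - 1)) = 2 * real CARD('n) * (of_int N + 1) * 2 powi (k - a)"
  proof -
    obtain n where n: "CARD('n) = Suc n" by (metis Suc_pred zero_less_card_finite)
    have "(2::real) powi k = 2 powi a * 2 powi (k - a)" by (subst power_int_add[symmetric]) auto
    then have *: "\<eta> = (of_int N + 1) * (2 powi a * 2 powi (k - a))" by (simp add: \<eta>_def)
    show ?thesis unfolding * n by simp
  qed
  finally show ?thesis by (simp add: mult_left_mono)
qed

text \<open>\<open>d\<close> is constant on cubes of level \<open>a\<close>, so it can differ at two
  neighbours of scale \<open>k\<close> only if both lie in the strip \<open>Bd\<close> along the
  faces, whose share of each cube is of order 2^(k-a).\<close>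

lemma osc_L2:
  fixes d :: "real^'n \<Rightarrow> complex"
  assumes N: "0 \<le> N" and ka: "k \<le> a" and d: "\<And>x y. gr a x = gr a y \<Longrightarrow> d x = d y"
  defines "M \<equiv> (2 * of_int N + 1 :: real) ^ CARD('n)"
  shows "(NN x. (tav N k (\<lambda>z. ennreal (norm (d z - d x))) x)\<^sup>2)
    \<le> ennreal (8 * M\<^sup>2 * real CARD('n) * (of_int N + 1) * 2 powi (k - a)) * (NN x. ennreal ((norm (d x))\<^sup>2))"
proof -
  have [measurable]: "d \<in> \<B>" by (rule measurable_const_cells[of a]) (auto intro: d)
  define Bd where "Bd = {x::real^'n. \<exists>z. near N k x z \<and> gr a z \<noteq> gr a x}"
  have [measurable]: "Bd \<in> sets borel"
  proof (rule sat_sets[of k])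
    fix x y :: "real^'n" assume xy: "gr k x = gr k y"
    have "gr a x = gr a y" by (rule gr_mono[OF xy ka])
    then show "(x \<in> Bd) = (y \<in> Bd)" using xy by (simp add: Bd_def near_def)
  qed
  have M0: "0 \<le> M" using N by (simp add: M_def)
  let ?n = "\<lambda>x. ennreal ((norm (d x))\<^sup>2)"
  define q :: real where "q = 1 / (2 powi k) ^ CARD('n)"
  have q: "q \<ge> 0" by (simp add: q_def)
  have ind: "indicator {z. near N k x z} z = (indicator {z. near N k z x} z :: ennreal)" for x z :: "real^'n"
    by (simp add: near_sym[of N k x])
  have nk: "ennreal (nker N k x z) = ennreal q * indicator {z. near N k x z} z" for x z :: "real^'n"
    by (simp add: nker_def q_def)
  have T: "(tav N k (\<lambda>z. ennreal (norm (d z - d x))) x)\<^sup>2 \<le> ennreal M * (NN z. ennreal (nker N k x z) * ennreal ((norm (d z - d x))\<^sup>2))" for x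
  proof -
    let ?A = "{z. near N k x z}"
    have "(tav N k (\<lambda>z. ennreal (norm (d z - d x))) x)\<^sup>2 = (ennreal q)\<^sup>2 * (NN z. indicator ?A z * ennreal (norm (d z - d x)))\<^sup>2"
      unfolding tav_def nk by (simp add: mult.assoc nn_integral_cmult power_mult_distrib)
    also have "\<dots> \<le> (ennreal q)\<^sup>2 * (emeasure lborel ?A * (NN z. indicator ?A z * (ennreal (norm (d z - d x)))\<^sup>2))"
      by (intro mult_left_mono CS_nn) auto
    also have "\<dots> = (NN z. ennreal (nker N k x z)) * (NN z. ennreal (nker N k x z) * ennreal ((norm (d z - d x))\<^sup>2))"
      unfolding nk by (simp add: mult.assoc nn_integral_cmult ennreal_power2 power2_eq_square[of "ennreal q"] ac_simps)
    also have "\<dots> \<le> ennreal M * (NN z. ennreal (nker N k x z) * ennreal ((norm (d z - d x))\<^sup>2))"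
      unfolding M_def by (intro mult_right_mono nn_nker N) auto
    finally show ?thesis .
  qed
  have pw: "ennreal (nker N k x z) * ennreal ((norm (d z - d x))\<^sup>2)
      \<le> 2 * (ennreal (nker N k x z) * (indicator Bd z * ?n z)) + 2 * (ennreal (nker N k x z) * (indicator Bd x * ?n x))" for x z
  proof (cases "gr a z = gr a x \<or> \<not> near N k x z")
    case True then show ?thesis using d[of z x] by (auto simp: nker_def)
  next
    case False
    then have "x \<in> Bd" "z \<in> Bd" unfolding Bd_def using near_sym[of N k x z] by (auto intro: exI[of _ z] exI[of _ x])
    moreover have "ennreal ((norm (d z - d x))\<^sup>2) \<le> 2 * (?n z + ?n x)"
      by (rule ennreal_norm_diff_square_le)
    from mult_left_mono[OF this, of "ennreal (nker N k x z)"] calculation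
    show ?thesis by (simp add: distrib_left ac_simps)
  qed
  let ?I = "\<integral>\<^sup>+x. indicator Bd x * ?n x \<partial>lborel"
  have in1: "(NN x. NN z. ennreal (nker N k x z) * (indicator Bd z * ?n z)) \<le> ennreal M * ?I"
    using nn_integral_tav[OF _ N, of "\<lambda>z. indicator Bd z * ?n z" k] by (simp add: tav_def M_def)
  have in2: "(NN x. NN z. ennreal (nker N k x z) * (indicator Bd x * ?n x)) \<le> ennreal M * ?I"
  proof -
    have "(NN x. NN z. ennreal (nker N k x z) * (indicator Bd x * ?n x))
       = (NN x. (NN z. ennreal (nker N k x z)) * (indicator Bd x * ?n x))"
      by (intro nn_integral_cong nn_integral_multc) auto
    also have "\<dots> \<le> (NN x. ennreal M * (indicator Bd x * ?n x))"
      unfolding M_def by (intro nn_integral_mono mult_right_mono nn_nker N) auto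
    finally show ?thesis by (simp add: nn_integral_cmult)
  qed
  \<comment> \<open>\<open>?n\<close> is constant on cubes of level \<open>a\<close>, so the
    indicator of the strip may be replaced by its average, which \<open>boundary_measure\<close>
    bounds.\<close>
  have bd: "?I \<le> ennreal (2 * real CARD('n) * (of_int N + 1) * 2 powi (k - a)) * (NN x. ?n x)"
  proof -
    have s: "sat (\<lambda>_. a) ?n" unfolding sat_def using d by metis
    have "?I = (NN x. ?n x * indicator Bd x)" by (simp add: mult.commute)
    also have "\<dots> = (NN x. ?n x * nav (\<lambda>_. a) (indicator Bd) x)"
      by (rule nn_integral_sat[OF stp_const s, symmetric]) auto
    also have "\<dots> \<le> (NN x. ?n x * ennreal (2 * real CARD('n) * (of_int N + 1) * 2 powi (k - a)))"
      unfolding Bd_def by (intro nn_integral_mono mult_left_mono boundary_measure[OF N ka]) auto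
    also have "\<dots> = (NN x. ?n x) * ennreal (2 * real CARD('n) * (of_int N + 1) * 2 powi (k - a))"
      by (rule nn_integral_multc) auto
    finally show ?thesis by (simp add: mult.commute)
  qed
  have "(NN x. (tav N k (\<lambda>z. ennreal (norm (d z - d x))) x)\<^sup>2)
     \<le> (NN x. ennreal M * (NN z. 2 * (ennreal (nker N k x z) * (indicator Bd z * ?n z)) + 2 * (ennreal (nker N k x z) * (indicator Bd x * ?n x))))"
    by (intro nn_integral_mono order_trans[OF T] mult_left_mono pw) auto
  also have "\<dots> = ennreal M * (2 * (NN x. NN z. ennreal (nker N k x z) * (indicator Bd z * ?n z))
      + 2 * (NN x. NN z. ennreal (nker N k x z) * (indicator Bd x * ?n x)))"
    by (simp add: nn_integral_cmult nn_integral_add)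
  also have "\<dots> \<le> ennreal M * (2 * (ennreal M * ?I) + 2 * (ennreal M * ?I))"
    by (intro mult_left_mono add_mono in1 in2) auto
  also have "\<dots> = ennreal (4 * M\<^sup>2) * ?I"
  proof -
    have "ennreal (4 * M\<^sup>2) = 2 * (ennreal M * ennreal M) + 2 * (ennreal M * ennreal M)"
      using M0 by (simp add: ennreal_mult[symmetric] ennreal_numeral[symmetric] ennreal_plus[symmetric] power2_eq_square del: ennreal_plus ennreal_numeral)
    then show ?thesis by (simp add: distrib_left distrib_right ac_simps)
  qed
  also have "\<dots> \<le> ennreal (4 * M\<^sup>2) * (ennreal (2 * real CARD('n) * (of_int N + 1) * 2 powi (k - a)) * (NN x. ?n x))"
    by (intro mult_left_mono bd) auto
  also have "\<dots> = ennreal (8 * M\<^sup>2 * real CARD('n) * (of_int N + 1) * 2 powi (k - a)) * (NN x. ?n x)"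
    using N by (simp add: mult.assoc[symmetric] ennreal_mult[symmetric])
  finally show ?thesis .
qed

lemma CS_sum:
  fixes f g :: "'a \<Rightarrow> ennreal"
  assumes "finite I"
  shows "(\<Sum>i\<in>I. f i * g i)\<^sup>2 \<le> (\<Sum>i\<in>I. (f i)\<^sup>2) * (\<Sum>i\<in>I. (g i)\<^sup>2)"
  using Cauchy_Schwarz_nn_integral[of f "count_space I" g] by (simp add: nn_integral_count_space_finite assms)

text \<open>The factor 2 accounts for the two sides of \<open>k\<close>, on each of which the
  distance to \<open>k\<close> is an injective function of \<open>j\<close>.\<close>

lemma geom_int_sum:
  fixes q :: real
  assumes q: "0 \<le> q" "q < 1" and I: "finite I"
  shows "(\<Sum>j\<in>I. q ^ nat \<bar>k - j\<bar>) \<le> 2 / (1 - q)"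
proof -
  have fin: "(\<Sum>n\<in>F. q ^ n) \<le> 1 / (1 - q)" if "finite F" for F
    using sum_le_suminf[OF summable_geometric that, of q] suminf_geometric[of q] q by auto
  have "(\<Sum>j\<in>I. q ^ nat \<bar>k - j\<bar>) = (\<Sum>j\<in>{j\<in>I. j \<le> k}. q ^ nat \<bar>k - j\<bar>) + (\<Sum>j\<in>{j\<in>I. \<not> j \<le> k}. q ^ nat \<bar>k - j\<bar>)"
    using I by (subst sum.union_disjoint[symmetric]) (auto intro!: sum.cong)
  also have "(\<Sum>j\<in>{j\<in>I. j \<le> k}. q ^ nat \<bar>k - j\<bar>) = (\<Sum>n\<in>(\<lambda>j. nat \<bar>k - j\<bar>) ` {j\<in>I. j \<le> k}. q ^ n)"
    by (subst sum.reindex) (auto intro!: inj_onI)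
  also have "(\<Sum>j\<in>{j\<in>I. \<not> j \<le> k}. q ^ nat \<bar>k - j\<bar>) = (\<Sum>n\<in>(\<lambda>j. nat \<bar>k - j\<bar>) ` {j\<in>I. \<not> j \<le> k}. q ^ n)"
    by (subst sum.reindex) (auto intro!: inj_onI)
  finally show ?thesis using fin[of "(\<lambda>j. nat \<bar>k - j\<bar>) ` {j\<in>I. j \<le> k}"] fin[of "(\<lambda>j. nat \<bar>k - j\<bar>) ` {j\<in>I. \<not> j \<le> k}"] I
    by simp
qed

subsection \<open>Averages over dilates of the body\<close>

lemma norm_pair_cell:
  fixes z z' :: "(real^'n) \<times> (real^'n)"
  assumes "gr a (fst z) = gr a (fst z')" "gr a (snd z) = gr a (snd z')"
  shows "norm (z - z') \<le> 2 * real CARD('n) * 2 powi a"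
proof -
  have "norm (z - z') \<le> norm (fst z - fst z') + norm (snd z - snd z')"
    using norm_Pair_le[of "fst z - fst z'" "snd z - snd z'"] by (cases z; cases z') simp
  with gr_dist[OF assms(1)] gr_dist[OF assms(2)] show ?thesis by linarith
qed

lemma diff_diff_cancel_right: "(a - c) - (b - c) = (a - b :: 'a::ab_group_add)"
  by simp

lemma borel_measurable_fst_snd [measurable (raw)]:
  fixes f :: "'a::second_countable_topology \<Rightarrow> 'b::topological_space" and g :: "'c::second_countable_topology \<Rightarrow> 'b"
  shows "f \<in> \<B> \<Longrightarrow> (\<lambda>z::'a \<times> 'c. f (fst z)) \<in> \<B>"
    and "g \<in> \<B> \<Longrightarrow> (\<lambda>z::'a \<times> 'c. g (snd z)) \<in> \<B>"
  by (auto simp: borel_prod[symmetric])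

text \<open>
  The geometry of \<open>G\<close> enters only through its size, measured by \<open>N\<close>, and through the layers \<open>K s\<close>, which
  contain every point at distance at most \<open>s\<close> from both \<open>G\<close> and its complement.
\<close>

locale body =
  fixes G :: "((real^'n) \<times> (real^'n)) set" and N :: int and K :: "real \<Rightarrow> ((real^'n) \<times> (real^'n)) set" and C0 :: real
  assumes G: "G \<noteq> {}" "bounded G" "convex G" "open G"
    and N: "2 \<le> N"
    and GN: "\<And>z i. z \<in> G \<Longrightarrow> \<bar>fst z $ i\<bar> \<le> of_int N - 1" "\<And>z i. z \<in> G \<Longrightarrow> \<bar>snd z $ i\<bar> \<le> of_int N - 1"
    and C0: "0 \<le> C0"
    and K_sets: "\<And>s. K s \<in> sets borel"
    and K_meas: "\<And>s. 0 < s \<Longrightarrow> s \<le> 2 * real CARD('n) \<Longrightarrow> emeasure lborel (K s) \<le> ennreal (C0 * s)"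
    and K_I: "\<And>s u v w. 0 < s \<Longrightarrow> u \<in> G \<Longrightarrow> v \<notin> G \<Longrightarrow> dist w u \<le> s \<Longrightarrow> dist w v \<le> s \<Longrightarrow> w \<in> K s"
begin

lemma N0: "0 \<le> N" using N by simp

definition vG :: real where "vG = measure lborel G"
definition R :: "int \<Rightarrow> ((real^'n) \<times> (real^'n)) set" where "R k = dilate (2 powi k) G"
definition wt :: "int \<Rightarrow> real" where "wt k = 1 / (vG * (2 powi k) ^ (2 * CARD('n)))"
text \<open>A product of two cubes of level \<open>j\<close> has diameter at most 2d 2^j; the layer
  of that width for the dilate \<open>R k\<close> is obtained by rescaling to
  \<open>G\<close>.\<close>

definition L :: "int \<Rightarrow> int \<Rightarrow> ((real^'n) \<times> (real^'n)) set" where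
  "L k j = {u. inverse (2 powi k) *\<^sub>R u \<in> K (2 * real CARD('n) * 2 powi (j - k))}"
definition C1 :: real where "C1 = C0 * (2 * real CARD('n)) / vG"
definition MN :: real where "MN = (2 * of_int N + 1) ^ CARD('n)"

lemma MN: "0 \<le> MN" "1 \<le> MN" using N by (auto simp: MN_def intro!: one_le_power)

text \<open>The functions are not translated: \<open>z\<close> stands for (x + y1, x + y2), so the
  integrand is a fixed tensor product and only the region moves with \<open>x\<close>. All base
  points then share one grid.\<close>

definition A :: "int \<Rightarrow> (real^'n \<Rightarrow> complex) \<Rightarrow> (real^'n \<Rightarrow> complex) \<Rightarrow> real^'n \<Rightarrow> complex" where
  "A k f1 f2 x = of_real (wt k) * (\<integral>z. indicator {z. z - (x, x) \<in> R k} z * (f1 (fst z) * f2 (snd z)) \<partial>lborel)"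

definition DD :: "int \<Rightarrow> (real^'n \<Rightarrow> complex) \<Rightarrow> (real^'n \<Rightarrow> complex) \<Rightarrow> real^'n \<Rightarrow> complex" where
  "DD k f1 f2 x = A k f1 f2 x - av (\<lambda>_. k) f1 x * av (\<lambda>_. k) f2 x"

lemma G_borel [measurable]: "G \<in> sets borel" using G by simp

lemma vG: "0 < vG" "emeasure lborel G = ennreal vG"
proof -
  show *: "emeasure lborel G = ennreal vG"
    unfolding vG_def using emeasure_bounded_finite[OF G(2)] by (intro emeasure_eq_ennreal_measure) auto
  have "\<not> negligible G" using open_not_negligible[OF G(4,1)] .
  then have "emeasure lborel G \<noteq> 0"
    by (auto simp: negligible_iff_null_sets null_sets_completion_iff null_sets_def)
  with * show "0 < vG" by (auto simp: vG_def zero_less_measure_iff)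
qed

lemma C1: "0 \<le> C1" using C0 vG(1) by (simp add: C1_def)

lemma wt: "0 < wt k" using vG by (simp add: wt_def)

lemma R_eq: "R k = {z. inverse (2 powi k) *\<^sub>R z \<in> G}" by (simp add: R_def dilate_def)

lemma scale_sets: "S \<in> sets borel \<Longrightarrow> {z::(real^'n) \<times> (real^'n). c *\<^sub>R z \<in> S} \<in> sets borel"
  using measurable_sets[of "\<lambda>z. c *\<^sub>R z" borel borel S] by (simp add: vimage_def)

lemma R_sets [measurable]: "R k \<in> sets borel" unfolding R_eq by (rule scale_sets) simp
lemma L_sets [measurable]: "L k j \<in> sets borel" unfolding L_def by (rule scale_sets) (rule K_sets)

lemma emeasure_scale:
  fixes S :: "((real^'n) \<times> (real^'n)) set"
  assumes "S \<in> sets borel"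
  shows "emeasure lborel {z. inverse (2 powi k) *\<^sub>R z \<in> S} = ennreal ((2 powi k) ^ (2 * CARD('n))) * emeasure lborel S"
  using emeasure_lborel_affine[OF scale_sets[OF assms], of "2 powi k" "inverse (2 powi k)" 0]
  by (simp add: mult_2)

lemma R_measure: "ennreal (wt k) * emeasure lborel (R k) = 1"
  unfolding R_eq using vG by (simp add: emeasure_scale ennreal_mult[symmetric] wt_def)

lemma L_measure:
  assumes "j \<le> k"
  shows "ennreal (wt k) * emeasure lborel (L k j) \<le> ennreal (C1 * 2 powi (j - k))"
proof -
  let ?s = "2 * real CARD('n) * 2 powi (j - k)"
  have "(2::real) powi (j - k) \<le> 1" using assms power_int_increasing[of "j - k" 0 "2::real"] by simp
  then have s: "0 < ?s" "?s \<le> 2 * real CARD('n)" by (auto simp: mult_left_le)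
  have "ennreal (wt k) * emeasure lborel (L k j) = ennreal (wt k) * (ennreal ((2 powi k) ^ (2 * CARD('n))) * emeasure lborel (K ?s))"
    unfolding L_def by (subst emeasure_scale[OF K_sets]) simp
  also have "\<dots> \<le> ennreal (wt k) * (ennreal ((2 powi k) ^ (2 * CARD('n))) * ennreal (C0 * ?s))"
    by (intro mult_left_mono K_meas s) auto
  also have "\<dots> = ennreal (C1 * 2 powi (j - k))"
    using vG C0 by (simp add: ennreal_mult[symmetric] wt_def C1_def)
  finally show ?thesis .
qed

lemma L_I:
  assumes "u \<in> R k" "v \<notin> R k" "norm (w - u) \<le> 2 * real CARD('n) * 2 powi j" "norm (w - v) \<le> 2 * real CARD('n) * 2 powi j"
  shows "w \<in> L k j"
proof -
  let ?c = "inverse (2 powi k) :: real"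
  have "dist (?c *\<^sub>R w) (?c *\<^sub>R u) \<le> 2 * real CARD('n) * 2 powi (j - k)" if "norm (w - u) \<le> 2 * real CARD('n) * 2 powi j" for u
  proof -
    have "dist (?c *\<^sub>R w) (?c *\<^sub>R u) = norm (w - u) * ?c"
      by (simp add: dist_norm scaleR_diff_right[symmetric])
    also have "\<dots> \<le> 2 * real CARD('n) * 2 powi j * ?c" using that by (intro mult_right_mono) auto
    also have "\<dots> = 2 * real CARD('n) * 2 powi (j - k)" by (simp add: power_int_diff field_simps)
    finally show ?thesis .
  qed
  from K_I[OF _ _ _ this[OF assms(3)] this[OF assms(4)]] assms(1,2) show ?thesis
    by (simp add: R_eq L_def)
qed

lemma R_near:
  assumes "z - (x, x) \<in> R k"
  shows "near N k x (fst z)" "near N k x (snd z)"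
proof -
  have g: "inverse (2 powi k) *\<^sub>R (z - (x, x)) \<in> G" using assms by (simp add: R_eq)
  have p: "(2::real) powi k > 0" by simp
  have *: "\<bar>x $ i - y $ i\<bar> \<le> (of_int N - 1) * 2 powi k" if "\<bar>(inverse (2 powi k) *\<^sub>R (y - x)) $ i\<bar> \<le> of_int N - 1" for y i
  proof -
    have "\<bar>(inverse (2 powi k) *\<^sub>R (y - x)) $ i\<bar> = \<bar>x $ i - y $ i\<bar> / 2 powi k"
      by (simp add: abs_mult divide_inverse abs_minus_commute mult.commute)
    with that p show ?thesis by (simp add: divide_le_eq)
  qed
  show "near N k x (fst z)" using GN(1)[OF g] by (intro nearI *) simp
  show "near N k x (snd z)" using GN(2)[OF g] by (intro nearI *) simp
qed

text \<open>The largest union of products of selected cubes inside the region of integration, hence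
  the part of it on which \<open>integral_sat2\<close> applies.\<close>

definition In :: "(real^'n \<Rightarrow> int) \<Rightarrow> int \<Rightarrow> real^'n \<Rightarrow> ((real^'n) \<times> (real^'n)) set" where
  "In \<kappa> k x = {z. \<forall>y1 y2. gr (\<kappa> (fst z)) y1 = gr (\<kappa> (fst z)) (fst z) \<longrightarrow> gr (\<kappa> (snd z)) y2 = gr (\<kappa> (snd z)) (snd z) \<longrightarrow>
     (y1, y2) - (x, x) \<in> R k}"

lemma In_sat2:
  assumes "stp m \<kappa>"
  shows "sat2 \<kappa> (In \<kappa> k x)"
  unfolding sat2_def
proof (intro allI impI)
  fix a b a' b' :: "real^'n"
  assume 1: "gr (\<kappa> a) a' = gr (\<kappa> a) a" and 2: "gr (\<kappa> b) b' = gr (\<kappa> b) b"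
  have e: "\<kappa> a' = \<kappa> a" "\<kappa> b' = \<kappa> b" using stpD[OF assms 1] stpD[OF assms 2] by auto
  show "((a', b') \<in> In \<kappa> k x) = ((a, b) \<in> In \<kappa> k x)"
    unfolding In_def by (simp add: 1 2 e)
qed

lemma In_sub: "In \<kappa> k x \<subseteq> {z. z - (x, x) \<in> R k}"
  by (auto simp: In_def)

lemma In_compl:
  assumes "z - (x, x) \<in> R k" "z \<notin> In (\<lambda>_. j) k x"
  shows "z - (x, x) \<in> L k j"
proof -
  obtain y1 y2 where y: "gr j y1 = gr j (fst z)" "gr j y2 = gr j (snd z)" "(y1, y2) - (x, x) \<notin> R k"
    using assms(2) by (auto simp: In_def)
  have "norm (z - (y1, y2)) \<le> 2 * real CARD('n) * 2 powi j" by (rule norm_pair_cell) (use y in auto)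
  then have "norm (z - (x, x) - ((y1, y2) - (x, x))) \<le> 2 * real CARD('n) * 2 powi j"
    by (simp only: diff_diff_cancel_right)
  with L_I[OF assms(1) y(3)] show ?thesis by simp
qed

lemma integrable_tensor':
  fixes f g :: "real^'n \<Rightarrow> complex"
  assumes "integrable lborel f" "integrable lborel g" "S \<in> sets borel"
  shows "integrable lborel (\<lambda>z. indicator S z * (f (fst z) * g (snd z)))"
  using integrable_tensor[OF assms] by (simp add: lborel_prod)

text \<open>The contributions of \<open>S\<close> cancel, so only the rest of the region counts. In
  the applications \<open>S\<close> is a set \<open>In\<close>, and the equality of integrals is
  \<open>integral_sat2\<close>.\<close>

lemma A_cmp:
  assumes f: "integrable lborel f1" "integrable lborel f2" and g: "integrable lborel g1" "integrable lborel g2"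
    and S: "S \<in> sets borel" "S \<subseteq> {z. z - (x, x) \<in> R k}"
    and eq: "(\<integral>z. indicator S z * (f1 (fst z) * f2 (snd z)) \<partial>lborel) = (\<integral>z. indicator S z * (g1 (fst z) * g2 (snd z)) \<partial>lborel)"
  shows "ennreal (norm (A k f1 f2 x - A k g1 g2 x)) \<le>
    ennreal (wt k) * (NN z. indicator ({z. z - (x, x) \<in> R k} - S) z *
      ennreal (norm (f1 (fst z) * f2 (snd z) - g1 (fst z) * g2 (snd z))))"
proof -
  let ?W = "{z. z - (x, x) \<in> R k}"
  let ?F = "\<lambda>z. f1 (fst z) * f2 (snd z)" and ?H = "\<lambda>z. g1 (fst z) * g2 (snd z)"
  have W: "?W \<in> sets borel" by measurable
  have ind: "indicator ?W z = (indicator (?W - S) z + indicator S z :: complex)" for z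
    using S(2) by (auto simp: indicator_def)
  note i = integrable_tensor'
  have "(\<integral>z. indicator ?W z * ?F z \<partial>lborel) = (\<integral>z. indicator (?W - S) z * ?F z \<partial>lborel) + (\<integral>z. indicator S z * ?F z \<partial>lborel)"
    unfolding ind distrib_right using W S(1) by (intro Bochner_Integration.integral_add i f) auto
  moreover have "(\<integral>z. indicator ?W z * ?H z \<partial>lborel) = (\<integral>z. indicator (?W - S) z * ?H z \<partial>lborel) + (\<integral>z. indicator S z * ?H z \<partial>lborel)"
    unfolding ind distrib_right using W S(1) by (intro Bochner_Integration.integral_add i g) auto
  ultimately have "(\<integral>z. indicator ?W z * ?F z \<partial>lborel) - (\<integral>z. indicator ?W z * ?H z \<partial>lborel)
     = (\<integral>z. indicator (?W - S) z * ?F z \<partial>lborel) - (\<integral>z. indicator (?W - S) z * ?H z \<partial>lborel)"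
    using eq by simp
  also have "\<dots> = (\<integral>z. indicator (?W - S) z * (?F z - ?H z) \<partial>lborel)"
    unfolding right_diff_distrib using W S(1) by (intro Bochner_Integration.integral_diff[symmetric] i f g) auto
  finally have eq2: "A k f1 f2 x - A k g1 g2 x = of_real (wt k) * (\<integral>z. indicator (?W - S) z * (?F z - ?H z) \<partial>lborel)"
    by (simp add: A_def right_diff_distrib[symmetric])
  have int: "integrable lborel (\<lambda>z. indicator (?W - S) z * (?F z - ?H z))"
    unfolding right_diff_distrib using W S(1) by (intro Bochner_Integration.integrable_diff i f g) auto
  have "ennreal (norm (A k f1 f2 x - A k g1 g2 x)) = ennreal (wt k) * ennreal (norm (\<integral>z. indicator (?W - S) z * (?F z - ?H z) \<partial>lborel))"
    unfolding eq2 using wt[of k] by (simp add: norm_mult ennreal_mult)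
  also have "\<dots> \<le> ennreal (wt k) * (NN z. ennreal (norm (indicator (?W - S) z * (?F z - ?H z))))"
    by (intro mult_left_mono integral_norm_bound_ennreal int) auto
  also have "(NN z. ennreal (norm (indicator (?W - S) z * (?F z - ?H z))))
     = (NN z. indicator (?W - S) z * ennreal (norm (?F z - ?H z)))"
    by (intro nn_integral_cong) (auto simp: indicator_def)
  finally show ?thesis .
qed

definition lop :: "int \<Rightarrow> int \<Rightarrow> ((real^'n) \<times> (real^'n) \<Rightarrow> ennreal) \<Rightarrow> real^'n \<Rightarrow> ennreal" where
  "lop k j g x = ennreal (wt k) * (NN z. indicator (L k j) (z - (x, x)) * g z)"

lemma lop_shift:
  assumes [measurable]: "g \<in> \<B>"
  shows "lop k j g x = ennreal (wt k) * (NN z. indicator (L k j) z * g (z + (x, x)))"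
  unfolding lop_def
  using nn_integral_shift(3)[of "\<lambda>z. indicator (L k j) z * g (z + (x, x))" "(x, x)"] by simp

lemma lop_add:
  assumes [measurable]: "g \<in> \<B>" "h \<in> \<B>"
  shows "lop k j (\<lambda>z. g z + h z) x = lop k j g x + lop k j h x"
  unfolding lop_def distrib_left by (subst nn_integral_add) (auto simp: distrib_left)

text \<open>Cauchy-Schwarz on the layer gives one factor of its measure, Fubini and invariance under
  diagonal translations a second one; each is of order 2^(j-k) after normalisation.
  \<open>\<pi>\<close> stands for a coordinate projection.\<close>

lemma lop_L2:
  fixes h :: "real^'n \<Rightarrow> ennreal"
  assumes h [measurable]: "h \<in> \<B>" and \<pi> [measurable]: "\<pi> \<in> borel \<rightarrow>\<^sub>M borel"
    and \<pi>2: "\<And>z x. \<pi> (z + (x, x)) = \<pi> z + x" and jk: "j \<le> k"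
  shows "(NN x. (lop k j (\<lambda>z. h (\<pi> z)) x)\<^sup>2) \<le> ennreal ((C1 * 2 powi (j - k))\<^sup>2) * (NN x. (h x)\<^sup>2)"
proof -
  let ?w = "ennreal (wt k)" and ?e = "emeasure lborel (L k j)"
  have [measurable]: "\<pi> \<in> borel \<Otimes>\<^sub>M borel \<rightarrow>\<^sub>M borel" using \<pi> by (simp add: borel_prod)
  have [measurable]: "L k j \<in> sets (borel \<Otimes>\<^sub>M borel)" by (rule pair_borel_sets[OF L_sets])
  have "(lop k j (\<lambda>z. h (\<pi> z)) x)\<^sup>2 \<le> ?w\<^sup>2 * ?e * (NN z. indicator (L k j) z * (h (\<pi> z + x))\<^sup>2)" for x
  proof -
    have "(lop k j (\<lambda>z. h (\<pi> z)) x)\<^sup>2 = ?w\<^sup>2 * (NN z. indicator (L k j) z * h (\<pi> z + x))\<^sup>2"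
      by (subst lop_shift) (simp_all add: \<pi>2 power_mult_distrib)
    also have "\<dots> \<le> ?w\<^sup>2 * (?e * (NN z. indicator (L k j) z * (h (\<pi> z + x))\<^sup>2))"
      by (intro mult_left_mono CS_nn) auto
    finally show ?thesis by (simp add: mult.assoc)
  qed
  then have "(NN x. (lop k j (\<lambda>z. h (\<pi> z)) x)\<^sup>2)
     \<le> (NN x. ?w\<^sup>2 * ?e * (NN z. indicator (L k j) z * (h (\<pi> z + x))\<^sup>2))"
    by (intro nn_integral_mono)
  also have "\<dots> = ?w\<^sup>2 * ?e * (NN x. NN z. indicator (L k j) z * (h (\<pi> z + x))\<^sup>2)"
    by (intro nn_integral_cmult) measurable
  also have "(NN x. NN z. indicator (L k j) z * (h (\<pi> z + x))\<^sup>2)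
     = (NN z. NN x. indicator (L k j) z * (h (\<pi> z + x))\<^sup>2)"
    by (rule lborel_pair.Fubini') measurable
  also have "\<dots> = (NN z. indicator (L k j) z * (NN x. (h x)\<^sup>2))"
    using nn_integral_shift(2)[of "\<lambda>x. (h x)\<^sup>2"] by (intro nn_integral_cong) (simp add: nn_integral_cmult)
  also have "\<dots> = ?e * (NN x. (h x)\<^sup>2)" by (simp add: nn_integral_multc)
  also have "?w\<^sup>2 * ?e * \<dots> = (?w * ?e)\<^sup>2 * (NN x. (h x)\<^sup>2)" by (simp add: power2_eq_square ac_simps)
  also have "\<dots> \<le> (ennreal (C1 * 2 powi (j - k)))\<^sup>2 * (NN x. (h x)\<^sup>2)"
    by (intro mult_right_mono power_mono L_measure jk) auto
  finally show ?thesis using C1 by (simp add: ennreal_power2)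
qed

text \<open>The region lies in the product of two neighbourhoods of \<open>x\<close>, and the
  coordinate that \<open>\<phi>\<close> does not see contributes at most the volume of one of
  them.\<close>

lemma R_tav:
  assumes [measurable]: "\<phi> \<in> \<B>" and \<pi>: "\<pi> = fst \<or> \<pi> = snd"
  shows "ennreal (wt k) * (NN z. indicator {z. z - (x, x) \<in> R k} z * \<phi> (\<pi> z)) \<le> ennreal (MN / vG) * tav N k \<phi> x"
proof -
  let ?A = "{y. near N k x y}"
  have eA: "emeasure lborel ?A \<le> ennreal (MN * (2 powi k) ^ CARD('n))"
    unfolding MN_def by (rule near_measure[OF N0])
  have t: "tav N k \<phi> x = ennreal (1 / (2 powi k) ^ CARD('n)) * (NN y. indicator ?A y * \<phi> y)"
    unfolding tav_def by (subst nn_integral_cmult[symmetric]) (auto intro!: nn_integral_cong simp: nker_def)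
  have "(NN z. indicator {z. z - (x, x) \<in> R k} z * \<phi> (\<pi> z))
      \<le> (NN z. indicator ?A (fst z) * (indicator ?A (snd z) * \<phi> (\<pi> z)))"
    using R_near by (intro nn_integral_mono) (auto simp: indicator_def)
  also have "\<dots> = emeasure lborel ?A * (NN y. indicator ?A y * \<phi> y)"
    using \<pi>
  proof
    assume e: "\<pi> = fst"
    have "(NN z. indicator ?A (fst z) * (indicator ?A (snd z) * \<phi> (\<pi> z)))
       = (NN y. NN y'. indicator ?A y * (indicator ?A y' * \<phi> y))"
      unfolding e by (subst nn_integral_lborel_pair(1)) (auto simp: borel_prod[symmetric])
    also have "\<dots> = (NN y. (indicator ?A y * \<phi> y) * emeasure lborel ?A)"
      by (intro nn_integral_cong) (simp add: nn_integral_cmult nn_integral_multc ac_simps)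
    also have "\<dots> = (NN y. indicator ?A y * \<phi> y) * emeasure lborel ?A"
      by (rule nn_integral_multc) measurable
    finally show ?thesis by (simp only: mult.commute)
  next
    assume e: "\<pi> = snd"
    have "(NN z. indicator ?A (fst z) * (indicator ?A (snd z) * \<phi> (\<pi> z)))
       = (NN y. NN y'. indicator ?A y * (indicator ?A y' * \<phi> y'))"
      unfolding e by (subst nn_integral_lborel_pair(1)) (auto simp: borel_prod[symmetric])
    also have "\<dots> = (NN y. indicator ?A y * (NN y'. indicator ?A y' * \<phi> y'))"
      by (intro nn_integral_cong nn_integral_cmult) measurable
    finally show ?thesis by (simp add: nn_integral_multc)
  qed
  also have "\<dots> \<le> ennreal (MN * (2 powi k) ^ CARD('n)) * (NN y. indicator ?A y * \<phi> y)"
    by (intro mult_right_mono eA) auto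
  finally have "ennreal (wt k) * (NN z. indicator {z. z - (x, x) \<in> R k} z * \<phi> (\<pi> z))
    \<le> ennreal (wt k) * (ennreal (MN * (2 powi k) ^ CARD('n)) * (NN y. indicator ?A y * \<phi> y))"
    by (intro mult_left_mono) auto
  also have "\<dots> = ennreal (MN / vG) * tav N k \<phi> x"
    unfolding t using vG MN by (simp add: mult.assoc[symmetric] ennreal_mult[symmetric] wt_def mult_2 power_add)
  finally show ?thesis .
qed

end

subsection \<open>The square function on bounded step functions\<close>

text \<open>Holds because (9/10)^4 > 1/2. The fourth power is there because \<open>L2_bound\<close>
  splits the decay into two squares.\<close>

lemma half_power_le: "(2::real) powi (- \<bar>k - j\<bar>) \<le> (9 / 10) ^ (4 * nat \<bar>k - j\<bar>)"
proof -
  have "(2::real) powi (- \<bar>k - j\<bar>) = (1 / 2) ^ nat \<bar>k - j\<bar>"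
    by (simp add: power_int_def inverse_eq_divide power_one_over)
  also have "\<dots> \<le> ((9 / 10) ^ 4) ^ nat \<bar>k - j\<bar>" by (intro power_mono) (auto simp: eval_nat_numeral)
  finally show ?thesis by (simp add: power_mult)
qed

context body
begin

lemma A_measurable [measurable]:
  assumes [measurable]: "f1 \<in> \<B>" "f2 \<in> \<B>"
  shows "A k f1 f2 \<in> \<B>"
proof -
  have [measurable]: "R k \<in> sets (borel \<Otimes>\<^sub>M borel)" by (rule pair_borel_sets[OF R_sets])
  have "(\<lambda>x. \<integral>z. indicator (R k) (fst z - x, snd z - x) * (f1 (fst z) * f2 (snd z)) \<partial>(lborel \<Otimes>\<^sub>M lborel)) \<in> \<B>"
    by (rule sigma_finite_measure.borel_measurable_lebesgue_integral)
      (auto intro!: lborel_pair.sigma_finite_measure_axioms simp: case_prod_unfold)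
  moreover have "indicator {z. z - (x, x) \<in> R k} z = (indicator (R k) (fst z - x, snd z - x) :: complex)" for x and z :: "(real^'n) \<times> (real^'n)"
    by (cases z) (simp add: indicator_def)
  ultimately show ?thesis unfolding A_def by (simp add: lborel_prod)
qed

lemma DD_measurable [measurable]:
  assumes [measurable]: "f1 \<in> \<B>" "f2 \<in> \<B>"
  shows "DD k f1 f2 \<in> \<B>"
  using av_measurable[OF stp_const] unfolding DD_def by measurable

text \<open>Passing from averages of level \<open>j - 1\<close> to level \<open>j\<close> changes
  nothing over products of level-\<open>j\<close> cubes inside the region. The rest of the region
  lies in the layer \<open>L k j\<close>, and there the difference of the two products is expanded
  by the product rule.\<close>

lemma near_part:
  assumes f: "integrable lborel f1" "integrable lborel f2" and B: "\<And>x. norm (f1 x) \<le> B" "\<And>x. norm (f2 x) \<le> B"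
  defines "E \<equiv> \<lambda>j. av (\<lambda>_. j)"
  shows "ennreal (norm (A k (E (j - 1) f1) (E (j - 1) f2) x - A k (E j f1) (E j f2) x)) \<le>
    ennreal B * (lop k j (\<lambda>z. ennreal (norm (E (j - 1) f1 (fst z) - E j f1 (fst z)))) x
      + lop k j (\<lambda>z. ennreal (norm (E (j - 1) f2 (snd z) - E j f2 (snd z)))) x)"
proof -
  have i: "integrable lborel (E i f1)" "integrable lborel (E i f2)" for i
    unfolding E_def by (intro integrable_av[OF stp_const] f)+
  have [measurable]: "E i f1 \<in> \<B>" "E i f2 \<in> \<B>" for i
    using i[of i] by auto
  have b: "norm (E i f1 x) \<le> B" "norm (E i f2 x) \<le> B" for i x
    unfolding E_def by (intro norm_av_bound B)+
  have B0: "0 \<le> B" using B(1) norm_ge_zero order_trans by blast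
  let ?W = "{z. z - (x, x) \<in> R k}" and ?S = "In (\<lambda>_. j) k x"
  let ?d1 = "\<lambda>z. ennreal (norm (E (j - 1) f1 (fst z) - E j f1 (fst z)))"
  let ?d2 = "\<lambda>z. ennreal (norm (E (j - 1) f2 (snd z) - E j f2 (snd z)))"
  have s: "sat2 (\<lambda>_. j) ?S" by (rule In_sat2[OF stp_const])
  have e: "av (\<lambda>_. j) (E (j - 1) f1) = E j f1" "av (\<lambda>_. j) (E (j - 1) f2) = E j f2"
    unfolding E_def by (auto simp: fun_eq_iff av_av f)
  have "ennreal (norm (A k (E (j - 1) f1) (E (j - 1) f2) x - A k (E j f1) (E j f2) x)) \<le>
    ennreal (wt k) * (NN z. indicator (?W - ?S) z *
      ennreal (norm (E (j - 1) f1 (fst z) * E (j - 1) f2 (snd z) - E j f1 (fst z) * E j f2 (snd z))))"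
    using integral_sat2[OF stp_const s i, of "j - 1" "j - 1"]
    by (intro A_cmp i sat2_sets[OF stp_const s] In_sub) (simp add: e)
  also have "\<dots> \<le> ennreal (wt k) * (NN z. ennreal B * (indicator (L k j) (z - (x, x)) * (?d1 z + ?d2 z)))"
  proof (intro mult_left_mono nn_integral_mono)
    fix z :: "(real^'n) \<times> (real^'n)"
    have "norm (E (j - 1) f1 (fst z) * E (j - 1) f2 (snd z) - E j f1 (fst z) * E j f2 (snd z))
      = norm ((E (j - 1) f1 (fst z) - E j f1 (fst z)) * E (j - 1) f2 (snd z) + E j f1 (fst z) * (E (j - 1) f2 (snd z) - E j f2 (snd z)))"
      by (simp add: algebra_simps)
    also have "\<dots> \<le> norm (E (j - 1) f1 (fst z) - E j f1 (fst z)) * B + B * norm (E (j - 1) f2 (snd z) - E j f2 (snd z))"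
      using b B0 by (intro order_trans[OF norm_triangle_ineq] add_mono) (auto simp: norm_mult intro!: mult_mono)
    finally have "ennreal (norm (E (j - 1) f1 (fst z) * E (j - 1) f2 (snd z) - E j f1 (fst z) * E j f2 (snd z))) \<le> ennreal B * (?d1 z + ?d2 z)"
      using B0 by (simp add: ennreal_plus[symmetric] ennreal_mult[symmetric] algebra_simps ennreal_leI del: ennreal_plus)
    moreover have "z - (x, x) \<in> L k j" if "z \<in> ?W - ?S" using that In_compl by auto
    ultimately show "indicator (?W - ?S) z * ennreal (norm (E (j - 1) f1 (fst z) * E (j - 1) f2 (snd z) - E j f1 (fst z) * E j f2 (snd z)))
       \<le> ennreal B * (indicator (L k j) (z - (x, x)) * (?d1 z + ?d2 z))"
      by (auto simp: indicator_def)
  qed auto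
  also have "\<dots> = ennreal B * lop k j (\<lambda>z. ?d1 z + ?d2 z) x"
    unfolding lop_def by (subst nn_integral_cmult) (auto simp: ac_simps)
  also have "lop k j (\<lambda>z. ?d1 z + ?d2 z) x = lop k j ?d1 x + lop k j ?d2 x"
    by (rule lop_add) measurable
  finally show ?thesis .
qed

lemma shift_R_measure: "emeasure lborel {z. z - (x, x) \<in> R k} = emeasure lborel (R k)"
proof -
  have "emeasure lborel {z. z - (x, x) \<in> R k} = (NN z. indicator {z. z - (x, x) \<in> R k} z)" by simp
  also have "\<dots> = (NN z. indicator (R k) (z - (x, x)))" by (intro nn_integral_cong) (simp add: indicator_def)
  also have "\<dots> = emeasure lborel (R k)" by (subst nn_integral_shift(3)) auto
  finally show ?thesis .
qed

lemma shift_R_has_integral: "has_bochner_integral lborel (\<lambda>z. indicator {z. z - (x, x) \<in> R k} z * (c::complex)) (c / of_real (wt k))"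
proof -
  let ?W = "{z. z - (x, x) \<in> R k}"
  have e: "emeasure lborel (R k) = ennreal (1 / wt k)"
  proof -
    have "ennreal (wt k) * emeasure lborel (R k) = 1" by (rule R_measure)
    then have "ennreal (1 / wt k) * (ennreal (wt k) * emeasure lborel (R k)) = ennreal (1 / wt k)" by simp
    then show ?thesis using wt[of k] by (simp add: mult.assoc[symmetric] ennreal_mult[symmetric])
  qed
  then have "has_bochner_integral lborel (indicator ?W :: _ \<Rightarrow> real) (measure lborel ?W)"
    by (intro has_bochner_integral_real_indicator) (auto simp: shift_R_measure e)
  moreover have "measure lborel ?W = 1 / wt k" using e wt[of k] by (simp add: measure_def shift_R_measure)
  ultimately have "has_bochner_integral lborel (\<lambda>z. complex_of_real (indicator ?W z) * c) (of_real (1 / wt k) * c)"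
    by (intro has_bochner_integral_mult_left has_bochner_integral_of_real) auto
  moreover have "complex_of_real (indicator ?W z) = indicator ?W z" for z by (simp add: indicator_def)
  ultimately show ?thesis by (simp add: mult.commute)
qed

text \<open>The weight \<open>wt k\<close> makes the average of a constant exact, so
  \<open>w1 x * w2 x\<close> can be put under the integral; the product rule then leaves one
  oscillation in each variable.\<close>

lemma far_part:
  assumes w: "integrable lborel w1" "integrable lborel w2" and B: "\<And>x. norm (w1 x) \<le> B" "\<And>x. norm (w2 x) \<le> B"
  shows "ennreal (norm (A k w1 w2 x - w1 x * w2 x)) \<le>
    ennreal (B * MN / vG) * (tav N k (\<lambda>z. ennreal (norm (w1 z - w1 x))) x + tav N k (\<lambda>z. ennreal (norm (w2 z - w2 x))) x)"
proof -
  have [measurable]: "w1 \<in> \<B>" "w2 \<in> \<B>" using w by auto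
  have B0: "0 \<le> B" using B(1) norm_ge_zero order_trans by blast
  let ?W = "{z. z - (x, x) \<in> R k}"
  let ?F = "\<lambda>z. w1 (fst z) * w2 (snd z)"
  have W: "?W \<in> sets borel" by measurable
  note c = shift_R_has_integral[of x k "w1 x * w2 x", unfolded has_bochner_integral_iff]
  have iF: "integrable lborel (\<lambda>z. indicator ?W z * ?F z)" by (rule integrable_tensor'[OF w W])
  have int: "integrable lborel (\<lambda>z. indicator ?W z * (?F z - w1 x * w2 x))"
    unfolding right_diff_distrib using iF c by (intro Bochner_Integration.integrable_diff) auto
  have "(\<integral>z. indicator ?W z * (?F z - w1 x * w2 x) \<partial>lborel) = (\<integral>z. indicator ?W z * ?F z \<partial>lborel) - w1 x * w2 x / of_real (wt k)"
    unfolding right_diff_distrib using iF c by (subst Bochner_Integration.integral_diff) auto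
  then have "of_real (wt k) * (\<integral>z. indicator ?W z * (?F z - w1 x * w2 x) \<partial>lborel) = A k w1 w2 x - w1 x * w2 x"
    using wt[of k] by (simp add: A_def right_diff_distrib)
  then have "ennreal (norm (A k w1 w2 x - w1 x * w2 x)) = ennreal (norm (of_real (wt k) * (\<integral>z. indicator ?W z * (?F z - w1 x * w2 x) \<partial>lborel)))"
    by simp
  also have "\<dots> = ennreal (wt k) * ennreal (norm (\<integral>z. indicator ?W z * (?F z - w1 x * w2 x) \<partial>lborel))"
    using wt[of k] by (simp add: norm_mult ennreal_mult)
  also have "\<dots> \<le> ennreal (wt k) * (NN z. ennreal (norm (indicator ?W z * (?F z - w1 x * w2 x))))"
    by (intro mult_left_mono integral_norm_bound_ennreal int) auto
  also have "\<dots> \<le> ennreal (wt k) * (NN z. ennreal B * (indicator ?W z * ennreal (norm (w1 (fst z) - w1 x)))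
       + ennreal B * (indicator ?W z * ennreal (norm (w2 (snd z) - w2 x))))"
  proof (intro mult_left_mono nn_integral_mono)
    fix z :: "(real^'n) \<times> (real^'n)"
    have "norm (?F z - w1 x * w2 x) = norm ((w1 (fst z) - w1 x) * w2 (snd z) + w1 x * (w2 (snd z) - w2 x))"
      by (simp add: algebra_simps)
    also have "\<dots> \<le> norm (w1 (fst z) - w1 x) * B + B * norm (w2 (snd z) - w2 x)"
      using B B0 by (intro order_trans[OF norm_triangle_ineq] add_mono) (auto simp: norm_mult intro!: mult_mono)
    finally have "ennreal (norm (?F z - w1 x * w2 x)) \<le> ennreal B * ennreal (norm (w1 (fst z) - w1 x)) + ennreal B * ennreal (norm (w2 (snd z) - w2 x))"
      using B0 by (simp add: ennreal_plus[symmetric] ennreal_mult[symmetric] algebra_simps ennreal_leI del: ennreal_plus)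
    then show "ennreal (norm (indicator ?W z * (?F z - w1 x * w2 x))) \<le> ennreal B * (indicator ?W z * ennreal (norm (w1 (fst z) - w1 x)))
       + ennreal B * (indicator ?W z * ennreal (norm (w2 (snd z) - w2 x)))"
      by (auto simp: indicator_def)
  qed auto
  also have "\<dots> = ennreal B * (ennreal (wt k) * (NN z. indicator ?W z * ennreal (norm (w1 (fst z) - w1 x))))
       + ennreal B * (ennreal (wt k) * (NN z. indicator ?W z * ennreal (norm (w2 (snd z) - w2 x))))"
    using W by (subst nn_integral_add) (auto simp: nn_integral_cmult distrib_left ac_simps)
  also have "\<dots> \<le> ennreal B * (ennreal (MN / vG) * tav N k (\<lambda>z. ennreal (norm (w1 z - w1 x))) x)
       + ennreal B * (ennreal (MN / vG) * tav N k (\<lambda>z. ennreal (norm (w2 z - w2 x))) x)"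
    using R_tav[of "\<lambda>z. ennreal (norm (w1 z - w1 x))" fst k x] R_tav[of "\<lambda>z. ennreal (norm (w2 z - w2 x))" snd k x]
    by (intro add_mono mult_left_mono) auto
  also have "\<dots> = ennreal (B * MN / vG) * (tav N k (\<lambda>z. ennreal (norm (w1 z - w1 x))) x + tav N k (\<lambda>z. ennreal (norm (w2 z - w2 x))) x)"
    using B0 MN vG by (simp add: distrib_left mult.assoc[symmetric] ennreal_mult[symmetric])
  finally show ?thesis .
qed

lemma tav_sum:
  assumes "\<And>i. i \<in> I \<Longrightarrow> f i \<in> \<B>"
  shows "tav N k (\<lambda>z. \<Sum>i\<in>I. f i z) x = (\<Sum>i\<in>I. tav N k (f i) x)"
  unfolding tav_def sum_distrib_left by (rule nn_integral_sum) (use assms in measurable)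

lemma osc_sum:
  assumes "k \<le> J"
  shows "tav N k (\<lambda>z. ennreal (norm (av (\<lambda>_. k) f z - av (\<lambda>_. k) f x))) x
    \<le> (\<Sum>j\<in>{k+1..J+1}. tav N k (\<lambda>z. ennreal (norm (dif J f j z - dif J f j x))) x)"
proof -
  have "tav N k (\<lambda>z. ennreal (norm (av (\<lambda>_. k) f z - av (\<lambda>_. k) f x))) x
     \<le> tav N k (\<lambda>z. \<Sum>j\<in>{k+1..J+1}. ennreal (norm (dif J f j z - dif J f j x))) x"
  proof (rule tav_mono)
    fix z
    have "norm (av (\<lambda>_. k) f z - av (\<lambda>_. k) f x) = norm (\<Sum>j\<in>{k+1..J+1}. dif J f j z - dif J f j x)"
      by (simp only: sum_dif[OF assms, symmetric] sum_subtractf)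
    also have "\<dots> \<le> (\<Sum>j\<in>{k+1..J+1}. norm (dif J f j z - dif J f j x))" by (rule norm_sum)
    finally show "ennreal (norm (av (\<lambda>_. k) f z - av (\<lambda>_. k) f x)) \<le> (\<Sum>j\<in>{k+1..J+1}. ennreal (norm (dif J f j z - dif J f j x)))"
      by (simp add: sum_ennreal ennreal_leI)
  qed
  also have "\<dots> = (\<Sum>j\<in>{k+1..J+1}. tav N k (\<lambda>z. ennreal (norm (dif J f j z - dif J f j x))) x)"
    by (rule tav_sum) measurable
  finally show ?thesis .
qed

text \<open>
  Bounds the contribution of the martingale differences of level \<open>j\<close> to \<open>DD k\<close>: a boundary layer for
  \<open>j \<le> k\<close>, an oscillation for \<open>k < j\<close>.
\<close>

definition Y :: "real \<Rightarrow> int \<Rightarrow> (real^'n \<Rightarrow> complex) \<Rightarrow> (real^'n \<Rightarrow> complex) \<Rightarrow> int \<Rightarrow> int \<Rightarrow> real^'n \<Rightarrow> ennreal" where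
  "Y B J f1 f2 k j x = (if j \<le> k
    then ennreal B * (lop k j (\<lambda>z. ennreal (norm (dif J f1 j (fst z)))) x + lop k j (\<lambda>z. ennreal (norm (dif J f2 j (snd z)))) x)
    else ennreal (B * MN / vG) * (tav N k (\<lambda>z. ennreal (norm (dif J f1 j z - dif J f1 j x))) x
      + tav N k (\<lambda>z. ennreal (norm (dif J f2 j z - dif J f2 j x))) x))"

text \<open>Between level \<open>m\<close>, where averaging does nothing, and level \<open>k\<close>
  the difference telescopes into boundary layer terms. At level \<open>k\<close> the average is
  compared with the product of the averages at \<open>x\<close>, whose oscillation is a sum of
  differences of levels above \<open>k\<close>.\<close>

lemma DD_le_Y:
  assumes f: "integrable lborel f1" "integrable lborel f2" and B: "\<And>x. norm (f1 x) \<le> B" "\<And>x. norm (f2 x) \<le> B"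
    and m: "\<And>x y. gr m x = gr m y \<Longrightarrow> f1 x = f1 y" "\<And>x y. gr m x = gr m y \<Longrightarrow> f2 x = f2 y"
    and k: "m \<le> k" "k \<le> J"
  shows "ennreal (norm (DD k f1 f2 x)) \<le> (\<Sum>j\<in>{m+1..J+1}. Y B J f1 f2 k j x)"
proof -
  define E where "E j = av (\<lambda>_::real^'n. j)" for j
  have id: "E m f1 = f1" "E m f2 = f2"
  proof -
    have "sat (\<lambda>_. m) f1" "sat (\<lambda>_. m) f2" unfolding sat_def by (metis m)+
    then show "E m f1 = f1" "E m f2 = f2" unfolding E_def by (auto simp: fun_eq_iff intro: av_idem)
  qed
  have i: "integrable lborel (E i f1)" "integrable lborel (E i f2)" for i
    unfolding E_def by (intro integrable_av[OF stp_const] f)+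
  have b: "norm (E i f1 x) \<le> B" "norm (E i f2 x) \<le> B" for i x
    unfolding E_def by (intro norm_av_bound B)+
  have B0: "0 \<le> B" using B(1) norm_ge_zero order_trans by blast
  have tel: "A k f1 f2 x - A k (E k f1) (E k f2) x = (\<Sum>j\<in>{m+1..k}. A k (E (j - 1) f1) (E (j - 1) f2) x - A k (E j f1) (E j f2) x)"
    using sum_telescope_int[OF k(1), of "\<lambda>j. A k (E j f1) (E j f2) x"] by (simp add: id)
  have n: "ennreal (norm (A k (E (j - 1) f1) (E (j - 1) f2) x - A k (E j f1) (E j f2) x)) \<le> Y B J f1 f2 k j x" if "j \<in> {m+1..k}" for j
  proof -
    have "j \<noteq> J + 1" "j \<le> k" using that k by auto
    then show ?thesis using near_part[OF f B, of k j x] by (simp add: Y_def dif_def E_def)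
  qed
  have fr: "ennreal (norm (A k (E k f1) (E k f2) x - E k f1 x * E k f2 x)) \<le> (\<Sum>j\<in>{k+1..J+1}. Y B J f1 f2 k j x)"
  proof -
    have "ennreal (norm (A k (E k f1) (E k f2) x - E k f1 x * E k f2 x))
      \<le> ennreal (B * MN / vG) * (tav N k (\<lambda>z. ennreal (norm (E k f1 z - E k f1 x))) x + tav N k (\<lambda>z. ennreal (norm (E k f2 z - E k f2 x))) x)"
      by (rule far_part[OF i b])
    also have "\<dots> \<le> ennreal (B * MN / vG) * ((\<Sum>j\<in>{k+1..J+1}. tav N k (\<lambda>z. ennreal (norm (dif J f1 j z - dif J f1 j x))) x)
      + (\<Sum>j\<in>{k+1..J+1}. tav N k (\<lambda>z. ennreal (norm (dif J f2 j z - dif J f2 j x))) x))"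
      unfolding E_def by (intro mult_left_mono add_mono osc_sum k) auto
    also have "\<dots> = (\<Sum>j\<in>{k+1..J+1}. Y B J f1 f2 k j x)"
      unfolding sum.distrib[symmetric] sum_distrib_left by (intro sum.cong) (auto simp: Y_def)
    finally show ?thesis .
  qed
  have "norm (DD k f1 f2 x) = norm ((A k f1 f2 x - A k (E k f1) (E k f2) x) + (A k (E k f1) (E k f2) x - E k f1 x * E k f2 x))"
    by (simp add: DD_def E_def)
  also have "\<dots> \<le> (\<Sum>j\<in>{m+1..k}. norm (A k (E (j - 1) f1) (E (j - 1) f2) x - A k (E j f1) (E j f2) x))
     + norm (A k (E k f1) (E k f2) x - E k f1 x * E k f2 x)"
    unfolding tel by (intro order_trans[OF norm_triangle_ineq] add_mono norm_sum order_refl)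
  finally have "ennreal (norm (DD k f1 f2 x)) \<le> (\<Sum>j\<in>{m+1..k}. ennreal (norm (A k (E (j - 1) f1) (E (j - 1) f2) x - A k (E j f1) (E j f2) x)))
     + ennreal (norm (A k (E k f1) (E k f2) x - E k f1 x * E k f2 x))"
    by (simp add: sum_ennreal ennreal_plus[symmetric] sum_nonneg ennreal_leI del: ennreal_plus)
  also have "\<dots> \<le> (\<Sum>j\<in>{m+1..k}. Y B J f1 f2 k j x) + (\<Sum>j\<in>{k+1..J+1}. Y B J f1 f2 k j x)"
    by (intro add_mono sum_mono n fr)
  also have "\<dots> = (\<Sum>j\<in>{m+1..J+1}. Y B J f1 f2 k j x)"
    using k by (subst sum.union_disjoint[symmetric]) (auto intro!: sum.cong)
  finally show ?thesis .
qed

text \<open>The first summand comes from the boundary layers, the second from the oscillations.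
  There 32 is 2 times 8 times 2: from the square of a sum, from \<open>osc_L2\<close>, and from
  differences of level \<open>j\<close> being constant on cubes of level
  \<open>j - 1\<close>.\<close>

definition C2 :: real where "C2 = 2 * C1\<^sup>2 + 32 * (MN / vG)\<^sup>2 * MN\<^sup>2 * real CARD('n) * (of_int N + 1)"

lemma C2: "0 \<le> C2" using N by (simp add: C2_def)

lemma osc_measurable [measurable]:
  fixes d :: "real^'n \<Rightarrow> complex"
  assumes [measurable]: "d \<in> \<B>"
  shows "(\<lambda>x. tav N k (\<lambda>z. ennreal (norm (d z - d x))) x) \<in> \<B>"
  unfolding tav_def by measurable

lemma lop_measurable [measurable]:
  assumes [measurable]: "g \<in> \<B>"
  shows "lop k j g \<in> \<B>"
proof -
  have [measurable]: "L k j \<in> sets (borel \<Otimes>\<^sub>M borel)" by (rule pair_borel_sets[OF L_sets])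
  have [measurable]: "g \<in> borel_measurable (borel \<Otimes>\<^sub>M borel)" using assms by (simp add: borel_prod)
  have "(\<lambda>x. \<integral>\<^sup>+z. indicator (L k j) (fst z - x, snd z - x) * g z \<partial>(lborel \<Otimes>\<^sub>M lborel)) \<in> \<B>"
    by (rule sigma_finite_measure.borel_measurable_nn_integral)
      (auto intro!: lborel_pair.sigma_finite_measure_axioms simp: case_prod_unfold)
  moreover have "z - (x, x) = (fst z - x, snd z - x)" for x and z :: "(real^'n) \<times> (real^'n)"
    by (cases z) simp
  ultimately show ?thesis unfolding lop_def by (simp add: lborel_prod)
qed

lemma Y_measurable [measurable]: "Y B J f1 f2 k j \<in> \<B>"
  unfolding Y_def by (cases "j \<le> k") simp_all

lemma Y_L2:
  assumes B: "0 \<le> B"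
  shows "(NN x. (Y B J f1 f2 k j x)\<^sup>2) \<le> ennreal (B\<^sup>2 * C2 * 2 powi (- \<bar>k - j\<bar>)) *
    ((NN x. ennreal ((norm (dif J f1 j x))\<^sup>2)) + (NN x. ennreal ((norm (dif J f2 j x))\<^sup>2)))"
proof -
  let ?n1 = "\<integral>\<^sup>+x. ennreal ((norm (dif J f1 j x))\<^sup>2) \<partial>lborel" and ?n2 = "\<integral>\<^sup>+x. ennreal ((norm (dif J f2 j x))\<^sup>2) \<partial>lborel"
  have gen: "(NN x. (ennreal b * (p x + q x))\<^sup>2) \<le> ennreal (2 * b\<^sup>2 * c) * (?n1 + ?n2)"
    if [measurable]: "p \<in> \<B>" "q \<in> \<B>" and b: "0 \<le> b" and c: "0 \<le> c"
      and p: "(NN x. (p x)\<^sup>2) \<le> ennreal c * ?n1" and q: "(NN x. (q x)\<^sup>2) \<le> ennreal c * ?n2" for b c and p q :: "real^'n \<Rightarrow> ennreal"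
  proof -
    have "(NN x. (ennreal b * (p x + q x))\<^sup>2) \<le> (NN x. ennreal (b\<^sup>2) * (2 * ((p x)\<^sup>2 + (q x)\<^sup>2)))"
    proof (intro nn_integral_mono)
      fix x
      have "(ennreal b * (p x + q x))\<^sup>2 = ennreal (b\<^sup>2) * (p x + q x)\<^sup>2"
        using b by (simp add: power_mult_distrib ennreal_power2)
      also have "\<dots> \<le> ennreal (b\<^sup>2) * (2 * ((p x)\<^sup>2 + (q x)\<^sup>2))"
        by (intro mult_left_mono ennreal_square_sum_le) auto
      finally show "(ennreal b * (p x + q x))\<^sup>2 \<le> ennreal (b\<^sup>2) * (2 * ((p x)\<^sup>2 + (q x)\<^sup>2))" .
    qed
    also have "\<dots> = ennreal (b\<^sup>2) * (2 * ((NN x. (p x)\<^sup>2) + (NN x. (q x)\<^sup>2)))"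
      by (simp add: nn_integral_cmult nn_integral_add)
    also have "\<dots> \<le> ennreal (b\<^sup>2) * (2 * (ennreal c * ?n1 + ennreal c * ?n2))"
      by (intro mult_left_mono add_mono p q) auto
    also have "\<dots> = ennreal (2 * b\<^sup>2 * c) * (?n1 + ?n2)"
      using c by (simp add: ennreal_mult distrib_left ac_simps)
    finally show ?thesis .
  qed
  have e: "(ennreal a)\<^sup>2 = ennreal (a\<^sup>2)" if "0 \<le> a" for a using that by (rule ennreal_power2)
  show ?thesis
  proof (cases "j \<le> k")
    case True
    let ?p = "\<lambda>x. lop k j (\<lambda>z. ennreal (norm (dif J f1 j (fst z)))) x" and ?q = "\<lambda>x. lop k j (\<lambda>z. ennreal (norm (dif J f2 j (snd z)))) x"
    have p: "(NN x. (?p x)\<^sup>2) \<le> ennreal ((C1 * 2 powi (j - k))\<^sup>2) * ?n1"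
      using lop_L2[of "\<lambda>y. ennreal (norm (dif J f1 j y))" fst j k] True by (simp add: e borel_prod[symmetric])
    have q: "(NN x. (?q x)\<^sup>2) \<le> ennreal ((C1 * 2 powi (j - k))\<^sup>2) * ?n2"
      using lop_L2[of "\<lambda>y. ennreal (norm (dif J f2 j y))" snd j k] True by (simp add: e borel_prod[symmetric])
    have "(NN x. (Y B J f1 f2 k j x)\<^sup>2) \<le> ennreal (2 * B\<^sup>2 * (C1 * 2 powi (j - k))\<^sup>2) * (?n1 + ?n2)"
      unfolding Y_def using True gen[OF _ _ B _ p q] by simp
    \<comment> \<open>The layers even decay like 4^(j-k); one factor 2^(j-k) is given away to share
      the rate of the oscillations.\<close>
    also have "\<dots> \<le> ennreal (B\<^sup>2 * C2 * 2 powi (- \<bar>k - j\<bar>)) * (?n1 + ?n2)"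
    proof (intro mult_right_mono ennreal_leI)
      have t: "(2::real) powi (j - k) \<le> 1" using True power_int_increasing[of "j - k" 0 "2::real"] by simp
      have "(C1 * 2 powi (j - k))\<^sup>2 = C1\<^sup>2 * (2 powi (j - k) * 2 powi (j - k))" by (simp add: power2_eq_square)
      also have "\<dots> \<le> C1\<^sup>2 * (1 * 2 powi (j - k))" using t by (intro mult_left_mono mult_right_mono) auto
      finally have "2 * B\<^sup>2 * (C1 * 2 powi (j - k))\<^sup>2 \<le> 2 * B\<^sup>2 * (C1\<^sup>2 * (1 * 2 powi (j - k)))" by (intro mult_left_mono) auto
      also have "\<dots> = B\<^sup>2 * (2 * C1\<^sup>2) * 2 powi (j - k)" by simp
      also have "\<dots> \<le> B\<^sup>2 * C2 * 2 powi (j - k)" using N by (intro mult_right_mono mult_left_mono) (auto simp: C2_def)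
      finally have 1: "2 * B\<^sup>2 * (C1 * 2 powi (j - k))\<^sup>2 \<le> B\<^sup>2 * C2 * 2 powi (j - k)" .
      have "j - k = - \<bar>k - j\<bar>" using True by simp
      with 1 show "2 * B\<^sup>2 * (C1 * 2 powi (j - k))\<^sup>2 \<le> B\<^sup>2 * C2 * 2 powi (- \<bar>k - j\<bar>)" by (simp only:)
    qed auto
    finally show ?thesis .
  next
    case False
    then have ka: "k \<le> j - 1" by simp
    let ?p = "\<lambda>x. tav N k (\<lambda>z. ennreal (norm (dif J f1 j z - dif J f1 j x))) x" and ?q = "\<lambda>x. tav N k (\<lambda>z. ennreal (norm (dif J f2 j z - dif J f2 j x))) x"
    let ?c = "8 * MN\<^sup>2 * real CARD('n) * (of_int N + 1) * 2 powi (k - (j - 1))"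
    have p: "(NN x. (?p x)\<^sup>2) \<le> ennreal ?c * ?n1"
      unfolding MN_def by (rule osc_L2[OF N0 ka]) (rule dif_cell)
    have q: "(NN x. (?q x)\<^sup>2) \<le> ennreal ?c * ?n2"
      unfolding MN_def by (rule osc_L2[OF N0 ka]) (rule dif_cell)
    have "0 \<le> ?c" using N by simp
    then have "(NN x. (Y B J f1 f2 k j x)\<^sup>2) \<le> ennreal (2 * (B * MN / vG)\<^sup>2 * ?c) * (?n1 + ?n2)"
      unfolding Y_def using False gen[OF _ _ _ _ p q, of "B * MN / vG"] B MN vG by simp
    also have "\<dots> \<le> ennreal (B\<^sup>2 * C2 * 2 powi (- \<bar>k - j\<bar>)) * (?n1 + ?n2)"
    proof (intro mult_right_mono ennreal_leI)
      have t: "(2::real) powi (k - (j - 1)) = 2 * 2 powi (- \<bar>k - j\<bar>)"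
      proof -
        have "k - (j - 1) = - \<bar>k - j\<bar> + 1" using False by simp
        moreover have "(2::real) powi (i + 1) = 2 * 2 powi i" for i by (simp add: power_int_add)
        ultimately show ?thesis by (simp only:)
      qed
      have "2 * (B * MN / vG)\<^sup>2 * ?c = B\<^sup>2 * (32 * (MN / vG)\<^sup>2 * MN\<^sup>2 * real CARD('n) * (of_int N + 1)) * 2 powi (- \<bar>k - j\<bar>)"
        unfolding t by (simp add: power_mult_distrib power_divide)
      also have "\<dots> \<le> B\<^sup>2 * C2 * 2 powi (- \<bar>k - j\<bar>)"
        by (intro mult_right_mono mult_left_mono) (auto simp: C2_def)
      finally show "2 * (B * MN / vG)\<^sup>2 * ?c \<le> B\<^sup>2 * C2 * 2 powi (- \<bar>k - j\<bar>)" .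
    qed auto
    finally show ?thesis .
  qed
qed

definition CI :: real where "CI = (2 / (1 - (9 / 10)\<^sup>2))\<^sup>2 * C2"

lemma CI: "0 \<le> CI" using C2 by (simp add: CI_def)

text \<open>Almost orthogonality: the decay 2^(-|k-j|) is at most s^(4|k-j|). One half of that
  exponent pays for the weights of the Cauchy-Schwarz inequality over \<open>j\<close>, the other
  half is summed over \<open>k\<close>; \<open>sum_dif_L2\<close> then adds up the
  differences.\<close>

lemma L2_bound:
  assumes f: "integrable lborel f1" "integrable lborel f2" and B: "\<And>x. norm (f1 x) \<le> B" "\<And>x. norm (f2 x) \<le> B"
    and m: "\<And>x y. gr m x = gr m y \<Longrightarrow> f1 x = f1 y" "\<And>x y. gr m x = gr m y \<Longrightarrow> f2 x = f2 y"
    and I: "finite I" "\<And>k. k \<in> I \<Longrightarrow> m \<le> k"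
  shows "(NN x. (\<Sum>k\<in>I. ennreal ((norm (DD k f1 f2 x))\<^sup>2)))
    \<le> ennreal (CI * B\<^sup>2) * ((NN x. ennreal ((norm (f1 x))\<^sup>2)) + (NN x. ennreal ((norm (f2 x))\<^sup>2)))"
proof -
  have [measurable]: "f1 \<in> \<B>" "f2 \<in> \<B>" using f by auto
  have B0: "0 \<le> B" using B(1) norm_ge_zero order_trans by blast
  define J where "J = Max (insert m I)"
  have J: "m \<le> J" "\<And>k. k \<in> I \<Longrightarrow> k \<le> J" using I by (auto simp: J_def)
  define s :: real where "s = 9 / 10"
  define S :: real where "S = 2 / (1 - s\<^sup>2)"
  have s: "0 < s" "0 \<le> s\<^sup>2" "s\<^sup>2 < 1" by (auto simp: s_def power2_eq_square)
  have S0: "0 \<le> S" using s by (simp add: S_def)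
  define Q where "Q = {m+1..J+1}"
  define n where "n k j = nat \<bar>k - j\<bar>" for k j :: int
  define X where "X j = (NN x. ennreal ((norm (dif J f1 j x))\<^sup>2)) + (NN x. ennreal ((norm (dif J f2 j x))\<^sup>2))" for j
  define y where "y = Y B J f1 f2"
  have [measurable]: "y k j \<in> \<B>" for k j unfolding y_def by measurable
  have geo1: "(\<Sum>j\<in>Q. (s\<^sup>2) ^ n k j) \<le> S" for k
    unfolding n_def S_def by (rule geom_int_sum) (use s in \<open>auto simp: Q_def\<close>)
  have geo2: "(\<Sum>k\<in>I. (s\<^sup>2) ^ n k j) \<le> S" for j
    using geom_int_sum[OF s(2,3) I(1), of j] by (simp add: n_def S_def abs_minus_commute)
  have pt: "ennreal ((norm (DD k f1 f2 x))\<^sup>2) \<le> ennreal S * (\<Sum>j\<in>Q. ennreal (1 / (s\<^sup>2) ^ n k j) * (y k j x)\<^sup>2)" if k: "k \<in> I" for k x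
  proof -
    have "ennreal (norm (DD k f1 f2 x)) \<le> (\<Sum>j\<in>Q. y k j x)"
      unfolding Q_def y_def by (rule DD_le_Y[OF f B m I(2)[OF k] J(2)[OF k]])
    also have "\<dots> = (\<Sum>j\<in>Q. ennreal (s ^ n k j) * (ennreal (1 / s ^ n k j) * y k j x))"
      using s by (intro sum.cong refl) (simp add: mult.assoc[symmetric] ennreal_mult[symmetric])
    finally have "(ennreal (norm (DD k f1 f2 x)))\<^sup>2 \<le> (\<Sum>j\<in>Q. ennreal (s ^ n k j) * (ennreal (1 / s ^ n k j) * y k j x))\<^sup>2"
      by (intro power_mono) auto
    also have "\<dots> \<le> (\<Sum>j\<in>Q. (ennreal (s ^ n k j))\<^sup>2) * (\<Sum>j\<in>Q. (ennreal (1 / s ^ n k j) * y k j x)\<^sup>2)"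
      by (rule CS_sum) (simp add: Q_def)
    also have "(\<Sum>j\<in>Q. (ennreal (s ^ n k j))\<^sup>2) = ennreal (\<Sum>j\<in>Q. (s\<^sup>2) ^ n k j)"
      using s by (subst sum_ennreal[symmetric]) (auto simp: ennreal_power2 power_mult[symmetric] mult.commute)
    also have "\<dots> \<le> ennreal S" by (rule ennreal_leI[OF geo1])
    also have "(\<Sum>j\<in>Q. (ennreal (1 / s ^ n k j) * y k j x)\<^sup>2) = (\<Sum>j\<in>Q. ennreal (1 / (s\<^sup>2) ^ n k j) * (y k j x)\<^sup>2)"
      using s by (intro sum.cong refl) (auto simp: ennreal_power2 power_mult_distrib power_divide power_mult[symmetric] mult.commute)
    finally show ?thesis by (simp add: ennreal_power2 mult_right_mono)
  qed
  have yL: "ennreal (1 / (s\<^sup>2) ^ n k j) * (NN x. (y k j x)\<^sup>2) \<le> ennreal (B\<^sup>2 * C2) * (ennreal ((s\<^sup>2) ^ n k j) * X j)" for k j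
  proof -
    have "ennreal (1 / (s\<^sup>2) ^ n k j) * (NN x. (y k j x)\<^sup>2)
       \<le> ennreal (1 / (s\<^sup>2) ^ n k j) * (ennreal (B\<^sup>2 * C2 * 2 powi (- \<bar>k - j\<bar>)) * X j)"
      unfolding y_def X_def by (intro mult_left_mono Y_L2[OF B0]) auto
    also have "\<dots> = ennreal (1 / (s\<^sup>2) ^ n k j * (B\<^sup>2 * C2 * 2 powi (- \<bar>k - j\<bar>))) * X j"
      using C2 s by (simp add: ennreal_mult[symmetric] mult.assoc[symmetric])
    also have "\<dots> \<le> ennreal (B\<^sup>2 * C2 * (s\<^sup>2) ^ n k j) * X j"
    proof (intro mult_right_mono ennreal_leI)
      have "2 powi (- \<bar>k - j\<bar>) \<le> (s ^ (4 * n k j) :: real)" unfolding s_def n_def by (rule half_power_le)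
      also have "s ^ (4 * n k j) = (s\<^sup>2) ^ n k j * (s\<^sup>2) ^ n k j"
        by (simp add: power_mult[symmetric] power_add[symmetric])
      finally have "1 / (s\<^sup>2) ^ n k j * (B\<^sup>2 * C2 * 2 powi (- \<bar>k - j\<bar>)) \<le> 1 / (s\<^sup>2) ^ n k j * (B\<^sup>2 * C2 * ((s\<^sup>2) ^ n k j * (s\<^sup>2) ^ n k j))"
        using C2 s by (intro mult_left_mono) auto
      then show "1 / (s\<^sup>2) ^ n k j * (B\<^sup>2 * C2 * 2 powi (- \<bar>k - j\<bar>)) \<le> B\<^sup>2 * C2 * (s\<^sup>2) ^ n k j"
        using s by simp
    qed auto
    also have "\<dots> = ennreal (B\<^sup>2 * C2) * (ennreal ((s\<^sup>2) ^ n k j) * X j)"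
      using C2 s by (simp add: ennreal_mult mult.assoc)
    finally show ?thesis .
  qed
  have "(NN x. (\<Sum>k\<in>I. ennreal ((norm (DD k f1 f2 x))\<^sup>2)))
      \<le> (NN x. (\<Sum>k\<in>I. ennreal S * (\<Sum>j\<in>Q. ennreal (1 / (s\<^sup>2) ^ n k j) * (y k j x)\<^sup>2)))"
    by (intro nn_integral_mono sum_mono pt)
  also have "\<dots> = (\<Sum>k\<in>I. ennreal S * (\<Sum>j\<in>Q. ennreal (1 / (s\<^sup>2) ^ n k j) * (NN x. (y k j x)\<^sup>2)))"
    by (simp add: nn_integral_sum nn_integral_cmult)
  also have "\<dots> \<le> (\<Sum>k\<in>I. ennreal S * (\<Sum>j\<in>Q. ennreal (B\<^sup>2 * C2) * (ennreal ((s\<^sup>2) ^ n k j) * X j)))"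
    by (intro sum_mono mult_left_mono yL) auto
  also have "\<dots> = ennreal S * (ennreal (B\<^sup>2 * C2) * (\<Sum>j\<in>Q. (\<Sum>k\<in>I. ennreal ((s\<^sup>2) ^ n k j)) * X j))"
    unfolding sum_distrib_left sum_distrib_right by (rule sum.swap)
  also have "\<dots> \<le> ennreal S * (ennreal (B\<^sup>2 * C2) * (\<Sum>j\<in>Q. ennreal S * X j))"
    using geo2 s by (intro mult_left_mono sum_mono mult_right_mono) (auto simp: sum_ennreal intro!: ennreal_leI)
  also have "\<dots> = ennreal (CI * B\<^sup>2) * (\<Sum>j\<in>Q. X j)"
  proof -
    have "CI = S * (S * C2)" by (simp add: CI_def S_def s_def power2_eq_square)
    then show ?thesis using S0 C2 by (simp add: sum_distrib_left[symmetric] ennreal_mult ac_simps)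
  qed
  also have "(\<Sum>j\<in>Q. X j) = (NN x. ennreal ((norm (f1 x))\<^sup>2)) + (NN x. ennreal ((norm (f2 x))\<^sup>2))"
    unfolding X_def Q_def sum.distrib using sum_dif_L2[OF f(1) B(1) m(1) J(1)] sum_dif_L2[OF f(2) B(2) m(2) J(1)] by simp
  finally show ?thesis .
qed

end

subsection \<open>Stopping cubes\<close>

definition stopped :: "int \<Rightarrow> (int \<Rightarrow> real^'n \<Rightarrow> bool) \<Rightarrow> (real^'n) set" where
  "stopped m P = {x. \<exists>k\<ge>m. P k x}"

text \<open>The maximal cube with the property. Outside the stopping set the finest level
  \<open>m\<close> is selected, so averaging leaves functions constant on cubes of level
  \<open>m\<close> unchanged there.\<close>

definition stoplev :: "int \<Rightarrow> (int \<Rightarrow> real^'n \<Rightarrow> bool) \<Rightarrow> real^'n \<Rightarrow> int" where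
  "stoplev m P x = (if x \<in> stopped m P then Max {k. m \<le> k \<and> P k x} else m)"

text \<open>\<open>bounded\<close> makes the maximal levels exist; when stopping means that an
  average exceeds a given height, it follows from integrability by \<open>nav_small\<close>.\<close>

locale stopping =
  fixes m :: int and P :: "int \<Rightarrow> real^'n \<Rightarrow> bool"
  assumes cell: "\<And>k x y. gr k x = gr k y \<Longrightarrow> P k x = P k y"
    and bounded: "\<exists>K. \<forall>k>K. \<forall>x. \<not> P k x"
begin

abbreviation "\<Omega> \<equiv> stopped m P"
abbreviation "\<kappa> \<equiv> stoplev m P"

lemma fin: "finite {k. m \<le> k \<and> P k x}"
proof -
  obtain K where "\<And>k x. k > K \<Longrightarrow> \<not> P k x" using bounded by blast
  then have "{k. m \<le> k \<and> P k x} \<subseteq> {m..K}" by (auto simp: not_less[symmetric])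
  then show ?thesis by (rule finite_subset) simp
qed

lemma lev_in:
  assumes "x \<in> \<Omega>"
  shows "m \<le> \<kappa> x" "P (\<kappa> x) x"
proof -
  have "{k. m \<le> k \<and> P k x} \<noteq> {}" using assms by (auto simp: stopped_def)
  from Max_in[OF fin this] show "m \<le> \<kappa> x" "P (\<kappa> x) x" using assms by (auto simp: stoplev_def)
qed

lemma lev_max:
  assumes "m \<le> k" "P k x"
  shows "k \<le> \<kappa> x" "x \<in> \<Omega>"
proof -
  show "x \<in> \<Omega>" using assms by (auto simp: stopped_def)
  then show "k \<le> \<kappa> x" using assms by (auto simp: stoplev_def intro!: Max_ge fin)
qed

lemma lev_out: "x \<notin> \<Omega> \<Longrightarrow> \<kappa> x = m"
  by (simp add: stoplev_def)

lemma lev_ge: "m \<le> \<kappa> x"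
  using lev_in(1) lev_out by (cases "x \<in> \<Omega>") auto

lemma not_above: "\<kappa> x < k \<Longrightarrow> \<not> P k x"
  using lev_max(1)[of k x] lev_ge[of x] by linarith

text \<open>From level \<open>\<kappa> x\<close> upwards the predicate takes the same values at all
  points of the selected cube, so they have the same maximal level.\<close>

lemma stp: "stp m \<kappa>"
  unfolding stp_def
proof (intro allI conjI impI)
  fix x y show "m \<le> \<kappa> x" by (rule lev_ge)
  assume xy: "gr (\<kappa> x) y = gr (\<kappa> x) x"
  have above: "P k y = P k x" if "\<kappa> x \<le> k" for k
    using cell[OF gr_mono[OF xy that]] .
  show "\<kappa> y = \<kappa> x"
  proof (cases "x \<in> \<Omega>")
    case True
    have "P (\<kappa> x) y" using above[of "\<kappa> x"] lev_in(2)[OF True] by simp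
    from lev_max[OF lev_ge this] have 1: "\<kappa> x \<le> \<kappa> y" "y \<in> \<Omega>" by auto
    have "P (\<kappa> y) x" using above[OF 1(1)] lev_in(2)[OF 1(2)] by simp
    from lev_max(1)[OF lev_ge this] 1 show ?thesis by simp
  next
    case False
    then have m: "\<kappa> x = m" by (rule lev_out)
    have "y \<notin> \<Omega>"
    proof
      assume y: "y \<in> \<Omega>"
      have "P (\<kappa> y) x" using above[of "\<kappa> y"] lev_in(2)[OF y] lev_ge[of y] m by simp
      with False lev_max(2)[OF lev_ge this] show False by simp
    qed
    with m show ?thesis by (simp add: lev_out)
  qed
qed

lemma stopped_sat: "gr (\<kappa> x) y = gr (\<kappa> x) x \<Longrightarrow> y \<in> \<Omega> \<longleftrightarrow> x \<in> \<Omega>"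
proof -
  have *: "y \<in> \<Omega>" if "gr (\<kappa> x) y = gr (\<kappa> x) x" "x \<in> \<Omega>" for x y
    using cell[OF that(1)] lev_in[OF that(2)] lev_max(2) by blast
  assume xy: "gr (\<kappa> x) y = gr (\<kappa> x) x"
  have "\<kappa> y = \<kappa> x" by (rule stpD[OF stp xy])
  then have "gr (\<kappa> y) x = gr (\<kappa> y) y" using xy by simp
  with *[OF xy] *[of y x] show ?thesis by blast
qed

lemma sat_stopped: "sat \<kappa> (\<lambda>x. indicator \<Omega> x :: 'b::zero_neq_one)"
  unfolding sat_def by (auto simp: indicator_def dest: stopped_sat)

lemma stopped_sets [measurable]: "\<Omega> \<in> sets borel"
proof (rule sat_sets[of m])
  fix x y :: "real^'n" assume "gr m x = gr m y"
  from stp_fine(1)[OF stp this] show "(x \<in> \<Omega>) = (y \<in> \<Omega>)" using stopped_sat by blast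
qed

lemma lev_measurable [measurable]: "\<kappa> \<in> borel \<rightarrow>\<^sub>M count_space UNIV"
proof (rule measurable_const_cells[of m])
  fix x y :: "real^'n" assume "gr m x = gr m y"
  from stp_fine(2)[OF stp this] show "\<kappa> x = \<kappa> y" by (rule sym)
qed simp

text \<open>A selected cube strictly larger than the level-\<open>k\<close> cube of \<open>x\<close>
  would contain \<open>x\<close> and put it into the stopping set. This supplies the hypothesis of
  \<open>av_tower\<close>.\<close>

lemma coarse:
  assumes "x \<notin> \<Omega>" "m \<le> k" "gr k y = gr k x"
  shows "\<kappa> y \<le> k"
proof (rule ccontr)
  assume "\<not> \<kappa> y \<le> k"
  then have k: "k < \<kappa> y" by simp
  then have y: "y \<in> \<Omega>" using lev_out[of y] assms(2) by (cases "y \<in> \<Omega>") auto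
  have "gr (\<kappa> y) y = gr (\<kappa> y) x" using gr_mono[OF assms(3)] k by simp
  from cell[OF this] lev_in[OF y] have "P (\<kappa> y) x" by simp
  with lev_max(2)[OF lev_ge this] assms(1) show False by simp
qed

end

lemma nav_level: "nav \<kappa> g x = nav (\<lambda>_. \<kappa> x) g x"
  by (simp add: nav_def ker_def)

lemma nav_const_cell: "gr k x = gr k y \<Longrightarrow> nav (\<lambda>_. k) g x = nav (\<lambda>_. k) g y"
  by (simp add: nav_def ker_def)

lemma nav_le_integral:
  assumes [measurable]: "g \<in> \<B>"
  shows "nav (\<lambda>_. k) g (x::real^'n) \<le> ennreal (1 / (2 powi k) ^ CARD('n)) * (NN y. g y)"
  unfolding nav_def by (subst nn_integral_cmult[symmetric]) (auto intro!: nn_integral_mono mult_right_mono simp: ker_def)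

text \<open>An average is at most the total integral divided by the volume of the cube, which tends
  to infinity with the level.\<close>

lemma nav_small:
  fixes g :: "real^'n \<Rightarrow> ennreal"
  assumes g: "g \<in> \<B>" "(NN y. g y) < \<infinity>" and l: "0 < l"
  shows "\<exists>K. \<forall>k>K. \<forall>x. nav (\<lambda>_. k) g x \<le> ennreal l"
proof -
  obtain c where c: "(NN y. g y) = ennreal c" "0 \<le> c"
    using g(2) by (cases "\<integral>\<^sup>+y. g y \<partial>lborel") auto
  obtain n where n: "c / l < 2 ^ n" using real_arch_pow[of 2 "c / l"] by auto
  show ?thesis
  proof (intro exI[of _ "int n"] allI impI)
    fix k and x :: "real^'n" assume k: "int n < k"
    have "(2::real) ^ n = 2 powi (int n)" by simp
    also have "\<dots> \<le> 2 powi k" using k by (intro power_int_increasing) auto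
    also have "\<dots> \<le> (2 powi k) ^ CARD('n)"
    proof (rule self_le_power)
      show "(1::real) \<le> 2 powi k" using power_int_increasing[of 0 k "2::real"] k by simp
    qed simp
    finally have "c / l \<le> (2 powi k) ^ CARD('n)" using n by simp
    then have *: "1 / (2 powi k) ^ CARD('n) * c \<le> l" using l by (simp add: field_simps)
    have "nav (\<lambda>_. k) g x \<le> ennreal (1 / (2 powi k) ^ CARD('n)) * ennreal c"
      using nav_le_integral[OF g(1)] c by simp
    also have "\<dots> = ennreal (1 / (2 powi k) ^ CARD('n) * c)" using c by (intro ennreal_mult[symmetric]) auto
    also have "\<dots> \<le> ennreal l" by (rule ennreal_leI[OF *])
    finally show "nav (\<lambda>_. k) g x \<le> ennreal l" .
  qed
qed

text \<open>The parent contains the cube and has 2^d times its volume.\<close>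

lemma nav_parent:
  assumes [measurable]: "g \<in> \<B>"
  shows "nav (\<lambda>_. k) g (x::real^'n) \<le> ennreal (2 ^ CARD('n)) * nav (\<lambda>_. k + 1) g x"
proof -
  have "ker (\<lambda>_. k) x y \<le> 2 ^ CARD('n) * ker (\<lambda>_. k + 1) x y" for y
  proof -
    have "(2::real) powi (k + 1) = 2 * 2 powi k" by (simp add: power_int_add)
    then show ?thesis using gr_mono[of k y x "k + 1"] by (auto simp: ker_def power_mult_distrib)
  qed
  then have "nav (\<lambda>_. k) g x \<le> (NN y. ennreal (2 ^ CARD('n) * ker (\<lambda>_. k + 1) x y) * g y)"
    unfolding nav_def by (intro nn_integral_mono mult_right_mono ennreal_leI) auto
  also have "\<dots> = ennreal (2 ^ CARD('n)) * nav (\<lambda>_. k + 1) g x"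
    unfolding nav_def by (subst nn_integral_cmult[symmetric]) (auto simp: ennreal_mult ac_simps)
  finally show ?thesis .
qed

text \<open>On each maximal cube the average exceeds \<open>l\<close>, and averaging over these
  cubes preserves the integral over their union.\<close>

lemma weak_type:
  fixes g :: "real^'n \<Rightarrow> ennreal" and m :: int
  assumes g: "g \<in> \<B>" "(NN y. g y) < \<infinity>" and l: "0 < l"
  defines "S \<equiv> stopped m (\<lambda>k x. nav (\<lambda>_. k) g x > ennreal l)"
  shows "ennreal l * emeasure lborel S \<le> (NN x. indicator S x * g x)" "S \<in> sets borel"
proof -
  interpret stopping m "\<lambda>k x. nav (\<lambda>_. k) g x > ennreal l"
  proof
    show "\<exists>K. \<forall>k>K. \<forall>x. \<not> ennreal l < nav (\<lambda>_. k) g x" using nav_small[OF g l] by (simp add: not_less)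
  next
    fix k and x y :: "real^'n" assume "gr k x = gr k y"
    from nav_const_cell[OF this] show "(ennreal l < nav (\<lambda>_. k) g x) = (ennreal l < nav (\<lambda>_. k) g y)" by (simp only:)
  qed
  note g(1) [measurable]
  show S: "S \<in> sets borel" unfolding S_def by (rule stopped_sets)
  have "ennreal l * emeasure lborel S = (NN x. ennreal l * indicator S x)"
    using S by (simp add: nn_integral_cmult_indicator)
  also have "\<dots> \<le> (NN x. indicator S x * nav \<kappa> g x)"
  proof (intro nn_integral_mono)
    fix x show "ennreal l * indicator S x \<le> indicator S x * nav \<kappa> g x"
      using lev_in(2)[of x] nav_level[of \<kappa> g x] by (cases "x \<in> S") (auto simp: S_def less_imp_le)
  qed
  also have "\<dots> = (NN x. indicator S x * g x)"
    unfolding S_def by (rule nn_integral_sat[OF stp sat_stopped g(1)]) simp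
  finally show "ennreal l * emeasure lborel S \<le> (NN x. indicator S x * g x)" .
qed

text \<open>For fixed \<open>a\<close> the map from (x, b) to (a - x, b - x) preserves measure. One
  coordinate can thus be kept while the other one and the base point are integrated out.\<close>

lemma diag_measure:
  fixes S :: "((real^'n) \<times> (real^'n)) set"
  assumes S: "S \<in> sets borel"
  shows "(NN x. NN b. indicator S (a - x, b - x)) = emeasure lborel S"
    and "(NN x. NN b. indicator S (b - x, a - x)) = emeasure lborel S"
proof -
  have [measurable]: "S \<in> sets (borel \<Otimes>\<^sub>M borel)" by (rule pair_borel_sets[OF S])
  have "(NN b. indicator S (a - x, b - x)) = (NN b. indicator S (a - x, b))" for x
    by (rule nn_integral_shift(3)[of "\<lambda>b. indicator S (a - x, b)"]) measurable
  then have "(NN x. NN b. indicator S (a - x, b - x)) = (NN x. NN b. indicator S (a - x, b))"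
    by simp
  also have "\<dots> = (NN x. NN b. indicator S (x, b))"
    by (rule nn_integral_shift(4)[of "\<lambda>x. \<integral>\<^sup>+b. indicator S (x, b) \<partial>lborel"]) measurable
  also have "\<dots> = emeasure lborel S"
    using nn_integral_lborel_pair(1)[of "indicator S"] S by simp
  finally show "(NN x. NN b. indicator S (a - x, b - x)) = emeasure lborel S" .
  have "(NN b. indicator S (b - x, a - x)) = (NN b. indicator S (b, a - x))" for x
    by (rule nn_integral_shift(3)[of "\<lambda>b. indicator S (b, a - x)"]) measurable
  then have "(NN x. NN b. indicator S (b - x, a - x)) = (NN x. NN b. indicator S (b, a - x))"
    by simp
  also have "\<dots> = (NN x. NN b. indicator S (b, x))"
    by (rule nn_integral_shift(4)[of "\<lambda>x. \<integral>\<^sup>+b. indicator S (b, x) \<partial>lborel"]) measurable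
  also have "\<dots> = emeasure lborel S"
    using nn_integral_lborel_pair(2)[of "indicator S"] S by simp
  finally show "(NN x. NN b. indicator S (b - x, a - x)) = emeasure lborel S" .
qed

section \<open>Enlarged stopping cubes\<close>

context stopping
begin

definition enl :: "int \<Rightarrow> (real^'n) set" where
  "enl N = {x. \<exists>z\<in>\<Omega>. near N (\<kappa> z) x z}"

lemma enl_sets [measurable]: "enl N \<in> sets borel"
proof (rule sat_sets[of m])
  fix x y :: "real^'n" assume xy: "gr m x = gr m y"
  have "near N (\<kappa> z) x z = near N (\<kappa> z) y z" for z
    using gr_mono[OF xy lev_ge[of z]] by (intro near_cong) auto
  then show "(x \<in> enl N) = (y \<in> enl N)" by (simp add: enl_def)
qed

text \<open>A covering count without enumerating the cubes: integrated over \<open>z\<close> in the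
  stopping set, \<open>nker N (\<kappa> z) x z\<close> gives at least 1 for \<open>x\<close> in the
  enlargement, since the cube of one \<open>z0\<close> alone contributes 1. Integrated over
  \<open>x\<close> it gives at most (2N+1)^d for each \<open>z\<close>.\<close>

lemma enl_measure:
  assumes N: "0 \<le> N"
  shows "emeasure lborel (enl N) \<le> ennreal ((2 * of_int N + 1) ^ CARD('n)) * emeasure lborel \<Omega>"
proof -
  have [measurable]: "(\<lambda>p. nker N (\<kappa> (snd p)) (fst p) (snd p)) \<in> borel_measurable (borel \<Otimes>\<^sub>M borel)"
  proof -
    have "(\<lambda>p. nker N (\<kappa> (snd p)) (fst p) (snd p)) \<in> \<B>"
    proof (rule measurable_const_cells2[of m])
      fix x y x' y' :: "real^'n" assume *: "gr m x = gr m x'" "gr m y = gr m y'"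
      have e: "\<kappa> y' = \<kappa> y" by (rule stp_fine(2)[OF stp *(2)])
      have "near N (\<kappa> y) x y = near N (\<kappa> y) x' y'"
        using gr_mono[OF *(1) lev_ge[of y]] gr_mono[OF *(2) lev_ge[of y]] by (rule near_cong)
      then show "nker N (\<kappa> (snd (x, y))) (fst (x, y)) (snd (x, y)) = nker N (\<kappa> (snd (x', y'))) (fst (x', y')) (snd (x', y'))"
        by (simp add: nker_def e)
    qed auto
    then show ?thesis by (simp add: borel_prod)
  qed
  have m': "(\<lambda>(x, z). indicator \<Omega> z * ennreal (nker N (\<kappa> z) x z)) \<in> borel_measurable (lborel \<Otimes>\<^sub>M lborel)"
    unfolding case_prod_unfold by measurable
  have low: "indicator (enl N) x \<le> (NN z. indicator \<Omega> z * ennreal (nker N (\<kappa> z) x z))" for x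
  proof (cases "x \<in> enl N")
    case True
    then obtain z0 where z0: "z0 \<in> \<Omega>" "near N (\<kappa> z0) x z0" by (auto simp: enl_def)
    have "ennreal (ker \<kappa> z0 z) \<le> indicator \<Omega> z * ennreal (nker N (\<kappa> z) x z)" for z
    proof (cases "gr (\<kappa> z0) z = gr (\<kappa> z0) z0")
      case t: True
      have "\<kappa> z = \<kappa> z0" by (rule stpD[OF stp t])
      moreover have "z \<in> \<Omega>" using stopped_sat[OF t] z0 by simp
      moreover have "near N (\<kappa> z0) x z" using z0(2) t by (simp add: near_def)
      ultimately show ?thesis by (simp add: nker_def ker_def)
    qed (simp add: ker_def)
    then have "(NN z. ennreal (ker \<kappa> z0 z)) \<le> (NN z. indicator \<Omega> z * ennreal (nker N (\<kappa> z) x z))"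
      by (intro nn_integral_mono)
    with True show ?thesis by (simp add: nn_ker)
  qed simp
  have "emeasure lborel (enl N) = (NN x. indicator (enl N) x)" by simp
  also have "\<dots> \<le> (NN x. NN z. indicator \<Omega> z * ennreal (nker N (\<kappa> z) x z))"
    by (intro nn_integral_mono low)
  also have "\<dots> = (NN z. NN x. indicator \<Omega> z * ennreal (nker N (\<kappa> z) x z))"
    by (rule lborel_pair.Fubini'[OF m', symmetric])
  also have "\<dots> = (NN z. indicator \<Omega> z * (NN x. ennreal (nker N (\<kappa> z) z x)))"
    by (intro nn_integral_cong) (simp add: nn_integral_cmult nker_sym)
  also have "\<dots> \<le> (NN z. indicator \<Omega> z * ennreal ((2 * of_int N + 1) ^ CARD('n)))"
    by (intro nn_integral_mono mult_left_mono nn_nker N) auto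
  also have "\<dots> = ennreal ((2 * of_int N + 1) ^ CARD('n)) * emeasure lborel \<Omega>"
    by (simp add: nn_integral_multc mult.commute)
  finally show ?thesis .
qed

end

subsection \<open>The Calderon-Zygmund decomposition\<close>

lemma av_level: "av \<kappa> f x = av (\<lambda>_. \<kappa> x) f x"
  by (simp add: av_def ker_def)

lemma markov_nn:
  assumes "f \<in> borel_measurable M"
  shows "emeasure M {x\<in>space M. 1 \<le> f x} \<le> (\<integral>\<^sup>+x. f x \<partial>M)"
proof -
  have "(\<integral>\<^sup>+x. f x * indicator (space M) x \<partial>M) = (\<integral>\<^sup>+x. f x \<partial>M)"
    by (intro nn_integral_cong) simp
  with nn_integral_Markov_inequality[of f "space M" M 1] assms show ?thesis by simp
qed

text \<open>The height of averages over maximal cubes whose parents have average at most 1.\<close>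

definition (in body) dC :: real where "dC = 2 ^ CARD('n)"

lemma (in body) dC: "1 \<le> dC" "0 \<le> dC" by (auto simp: dC_def)

definition (in body) SF :: "int set \<Rightarrow> (real^'n \<Rightarrow> complex) \<Rightarrow> (real^'n \<Rightarrow> complex) \<Rightarrow> real^'n \<Rightarrow> real" where
  "SF I f1 f2 x = L2_set (\<lambda>k. norm (DD k f1 f2 x)) I"

lemma (in body) SF_nonneg [simp]: "0 \<le> SF I f1 f2 x"
  by (simp add: SF_def)

lemma (in body) SF_measurable [measurable]:
  assumes [measurable]: "f1 \<in> \<B>" "f2 \<in> \<B>"
  shows "SF I f1 f2 \<in> \<B>"
  unfolding SF_def L2_set_def by measurable

lemma (in body) SF_square: "(SF I f1 f2 x)\<^sup>2 = (\<Sum>k\<in>I. (norm (DD k f1 f2 x))\<^sup>2)"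
  by (simp add: SF_def L2_set_def sum_nonneg)

lemma L2_set_norm_le:
  fixes a b :: "'i \<Rightarrow> 'a::real_normed_vector"
  shows "L2_set (\<lambda>k. norm (a k)) I \<le> L2_set (\<lambda>k. norm (b k)) I + L2_set (\<lambda>k. norm (a k - b k)) I"
proof -
  have "L2_set (\<lambda>k. norm (a k)) I \<le> L2_set (\<lambda>k. norm (b k) + norm (a k - b k)) I"
    by (intro L2_set_mono) (auto intro: norm_triangle_sub)
  also have "\<dots> \<le> L2_set (\<lambda>k. norm (b k)) I + L2_set (\<lambda>k. norm (a k - b k)) I"
    by (rule L2_set_triangle_ineq)
  finally show ?thesis .
qed

text \<open>Over \<open>In\<close> the integrals agree, and elsewhere in the region the two products
  can differ only on \<open>V\<close>. As \<open>V\<close> is itself a union of products of selected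
  cubes, the averages cost as much there as the functions, whence the factor 2. Used for stopping
  cubes and for approximation alike.\<close>

lemma (in body) A_sat_le:
  assumes st: "stp m \<kappa>" and f: "integrable lborel f1" "integrable lborel f2" and V: "sat2 \<kappa> V"
    and WV: "\<And>z. z - (x, x) \<in> R k \<Longrightarrow> z \<notin> In \<kappa> k x \<Longrightarrow>
      z \<in> V \<or> f1 (fst z) * f2 (snd z) = av \<kappa> f1 (fst z) * av \<kappa> f2 (snd z)"
  shows "ennreal (norm (A k f1 f2 x - A k (av \<kappa> f1) (av \<kappa> f2) x)) \<le>
    ennreal (2 * wt k) * (NN z. indicator V z * (ennreal (norm (f1 (fst z))) * ennreal (norm (f2 (snd z)))))"
proof -
  let ?W = "{z. z - (x, x) \<in> R k}" and ?S = "In \<kappa> k x"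
  let ?n1 = "\<lambda>y. ennreal (norm (f1 y))" and ?n2 = "\<lambda>y. ennreal (norm (f2 y))"
  let ?F = "\<lambda>z. f1 (fst z) * f2 (snd z)" and ?H = "\<lambda>z. av \<kappa> f1 (fst z) * av \<kappa> f2 (snd z)"
  let ?f = "\<lambda>z. indicator V z * (?n1 (fst z) * ?n2 (snd z))"
  let ?h = "\<lambda>z. indicator V z * (nav \<kappa> ?n1 (fst z) * nav \<kappa> ?n2 (snd z))"
  have [measurable]: "f1 \<in> \<B>" "f2 \<in> \<B>" using f by auto
  have s: "sat2 \<kappa> ?S" by (rule In_sat2[OF st])
  have [measurable]: "V \<in> sets (borel \<Otimes>\<^sub>M borel)" by (rule pair_borel_sets[OF sat2_sets[OF st V]])
  have [measurable]: "nav \<kappa> ?n1 \<in> \<B>" "nav \<kappa> ?n2 \<in> \<B>"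
    by (rule nav_measurable[OF st])+
  have "?f \<in> borel_measurable (borel \<Otimes>\<^sub>M borel)" by measurable
  then have mF: "?f \<in> \<B>" by (simp add: borel_prod)
  have "?h \<in> borel_measurable (borel \<Otimes>\<^sub>M borel)" by measurable
  then have mH: "?h \<in> \<B>" by (simp add: borel_prod)
  have "ennreal (norm (A k f1 f2 x - A k (av \<kappa> f1) (av \<kappa> f2) x)) \<le>
    ennreal (wt k) * (NN z. indicator (?W - ?S) z * ennreal (norm (?F z - ?H z)))"
    by (intro A_cmp f integrable_av[OF st] sat2_sets[OF st s] In_sub)
      (rule integral_sat2[OF st s f, symmetric])
  also have "\<dots> \<le> ennreal (wt k) * (NN z. ?f z + ?h z)"
  proof (intro mult_left_mono nn_integral_mono)
    fix z :: "(real^'n) \<times> (real^'n)"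
    consider "z \<notin> ?W - ?S" | "?F z = ?H z" | "z \<in> V"
      using WV[of z] by blast
    then show "indicator (?W - ?S) z * ennreal (norm (?F z - ?H z)) \<le> ?f z + ?h z"
    proof cases
      case 3
      have "ennreal (norm (?F z - ?H z)) \<le> ennreal (norm (?F z)) + ennreal (norm (?H z))"
        by (simp add: ennreal_plus[symmetric] ennreal_leI norm_triangle_ineq4 del: ennreal_plus)
      also have "ennreal (norm (?F z)) = ?n1 (fst z) * ?n2 (snd z)" by (simp add: norm_mult ennreal_mult)
      also have "ennreal (norm (?H z)) = ennreal (norm (av \<kappa> f1 (fst z))) * ennreal (norm (av \<kappa> f2 (snd z)))"
        by (simp add: norm_mult ennreal_mult)
      also have "?n1 (fst z) * ?n2 (snd z) + \<dots> \<le> ?n1 (fst z) * ?n2 (snd z) + nav \<kappa> ?n1 (fst z) * nav \<kappa> ?n2 (snd z)"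
        by (intro add_left_mono mult_mono norm_av_le) auto
      finally show ?thesis using 3 by (simp add: indicator_def)
    qed auto
  qed auto
  also have "(NN z. ?f z + ?h z) = (NN z. ?f z) + (NN z. ?h z)"
    by (rule nn_integral_add) (simp_all add: mF mH)
  also have "(NN z. ?h z) = (NN z. ?f z)"
    by (rule nn_integral_sat2[OF st V]) measurable
  also have "ennreal (wt k) * ((NN z. ?f z) + (NN z. ?f z)) = ennreal (2 * wt k) * (NN z. ?f z)"
    using wt[of k] by (simp add: mult_2[symmetric] ennreal_mult ac_simps)
  finally show ?thesis .
qed

locale czd = body G N K C0 for G :: "((real^'n) \<times> (real^'n)) set" and N K C0 +
  fixes m :: int and f1 f2 :: "real^'n \<Rightarrow> complex"
  assumes f: "integrable lborel f1" "integrable lborel f2"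
    and const: "\<And>x y. gr m x = gr m y \<Longrightarrow> f1 x = f1 y" "\<And>x y. gr m x = gr m y \<Longrightarrow> f2 x = f2 y"
begin

abbreviation n1 :: "real^'n \<Rightarrow> ennreal" where "n1 y \<equiv> ennreal (norm (f1 y))"
abbreviation n2 :: "real^'n \<Rightarrow> ennreal" where "n2 y \<equiv> ennreal (norm (f2 y))"

text \<open>Both functions stop together, so that products of selected cubes come from one
  partition. Other heights than 1 are reached by scaling the functions.\<close>

definition Pst :: "int \<Rightarrow> real^'n \<Rightarrow> bool" where
  "Pst k x \<longleftrightarrow> nav (\<lambda>_. k) n1 x > 1 \<or> nav (\<lambda>_. k) n2 x > 1"

lemma fm [measurable]: "f1 \<in> \<B>" "f2 \<in> \<B>"
  using f by auto

sublocale st: stopping m Pst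
proof
  fix k and x y :: "real^'n" assume "gr k x = gr k y"
  then show "Pst k x = Pst k y" unfolding Pst_def using nav_const_cell[of k x y] by metis
next
  have i: "(NN y. n1 y) < \<infinity>" "(NN y. n2 y) < \<infinity>"
    using f by (auto simp: integrable_iff_bounded)
  obtain K1 where K1: "\<And>k x. k > K1 \<Longrightarrow> nav (\<lambda>_. k) n1 x \<le> 1"
    using nav_small[OF _ i(1), of 1] by auto
  obtain K2 where K2: "\<And>k x. k > K2 \<Longrightarrow> nav (\<lambda>_. k) n2 x \<le> 1"
    using nav_small[OF _ i(2), of 1] by auto
  show "\<exists>K. \<forall>k>K. \<forall>x. \<not> Pst k x"
    by (intro exI[of _ "max K1 K2"]) (auto simp: Pst_def not_less intro: K1 K2)
qed

abbreviation "\<Omega> \<equiv> stopped m Pst"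
abbreviation "\<kappa> \<equiv> stoplev m Pst"

text \<open>Maximality: the parent of a stopping cube has average at most 1, so doubling gives 2^d.
  Outside the stopping set the average at level \<open>m\<close> is itself at most 1.\<close>

lemma nav_bound:
  assumes h: "h = n1 \<or> h = n2"
  shows "nav \<kappa> h x \<le> ennreal dC"
proof (cases "x \<in> \<Omega>")
  case True
  have [measurable]: "h \<in> \<B>" using h by auto
  have "nav (\<lambda>_. \<kappa> x + 1) h x \<le> 1" using st.not_above[of x "\<kappa> x + 1"] h by (auto simp: Pst_def not_less)
  then have "ennreal (2 ^ CARD('n)) * nav (\<lambda>_. \<kappa> x + 1) h x \<le> ennreal (2 ^ CARD('n)) * 1"
    by (intro mult_left_mono) auto
  with nav_parent[of h "\<kappa> x" x] have "nav (\<lambda>_. \<kappa> x) h x \<le> ennreal dC"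
    by (simp add: dC_def)
  then show ?thesis by (subst nav_level) simp
next
  case False
  then have "\<not> Pst m x" using st.lev_max(2)[of m x] by auto
  then have "nav (\<lambda>_. m) h x \<le> 1" using h by (auto simp: Pst_def not_less)
  moreover have "1 \<le> ennreal dC" using dC(1) by simp
  ultimately have "nav (\<lambda>_. m) h x \<le> ennreal dC" by (rule order_trans)
  then show ?thesis using st.lev_out[OF False] by (subst nav_level) simp
qed

lemma av_bound: "norm (av \<kappa> f1 x) \<le> dC" "norm (av \<kappa> f2 x) \<le> dC"
  using order_trans[OF norm_av_le nav_bound[of n1]] order_trans[OF norm_av_le nav_bound[of n2]] dC by auto

lemma av_out:
  assumes "x \<notin> \<Omega>"
  shows "av \<kappa> f1 x = f1 x" "av \<kappa> f2 x = f2 x"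
proof -
  have "sat (\<lambda>_. m) f1" "sat (\<lambda>_. m) f2" unfolding sat_def by (metis const)+
  from this[THEN av_idem, of x] show "av \<kappa> f1 x = f1 x" "av \<kappa> f2 x = f2 x"
    using st.lev_out[OF assms] by (simp_all add: av_level[of \<kappa>])
qed

text \<open>Charges a boundary point \<open>z\<close> to its first coordinate, as \<open>q2\<close>
  does to its second: the layer has the thickness of the stopping cube of that coordinate.\<close>

definition q1 :: "int \<Rightarrow> real^'n \<Rightarrow> (real^'n) \<times> (real^'n) \<Rightarrow> ennreal" where
  "q1 k x z = indicator \<Omega> (fst z) * (if \<kappa> (fst z) < k then indicator (L k (\<kappa> (fst z))) (z - (x, x)) else 0)"
definition q2 :: "int \<Rightarrow> real^'n \<Rightarrow> (real^'n) \<times> (real^'n) \<Rightarrow> ennreal" where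
  "q2 k x z = indicator \<Omega> (snd z) * (if \<kappa> (snd z) < k then indicator (L k (\<kappa> (snd z))) (z - (x, x)) else 0)"

text \<open>The products that escape cancellation: they cross the boundary of the region and have a
  stopping cube as a factor. Without such a factor the functions equal their averages.\<close>

definition V :: "int \<Rightarrow> real^'n \<Rightarrow> ((real^'n) \<times> (real^'n)) set" where
  "V k x = {z. (fst z \<in> \<Omega> \<or> snd z \<in> \<Omega>) \<and> z \<notin> In \<kappa> k x \<and>
     (\<exists>y1 y2. gr (\<kappa> (fst z)) y1 = gr (\<kappa> (fst z)) (fst z) \<and> gr (\<kappa> (snd z)) y2 = gr (\<kappa> (snd z)) (snd z) \<and> (y1, y2) - (x, x) \<in> R k)}"

lemma V_sat2: "sat2 \<kappa> (V k x)"
  unfolding sat2_def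
proof (intro allI impI)
  fix a b a' b' :: "real^'n"
  assume 1: "gr (\<kappa> a) a' = gr (\<kappa> a) a" and 2: "gr (\<kappa> b) b' = gr (\<kappa> b) b"
  have e: "\<kappa> a' = \<kappa> a" "\<kappa> b' = \<kappa> b" using stpD[OF st.stp 1] stpD[OF st.stp 2] by auto
  have i: "(a', b') \<in> In \<kappa> k x \<longleftrightarrow> (a, b) \<in> In \<kappa> k x"
    using In_sat2[OF st.stp, of k x] 1 2 unfolding sat2_def by blast
  have o: "a' \<in> \<Omega> \<longleftrightarrow> a \<in> \<Omega>" "b' \<in> \<Omega> \<longleftrightarrow> b \<in> \<Omega>" using st.stopped_sat[OF 1] st.stopped_sat[OF 2] by auto
  show "((a', b') \<in> V k x) = ((a, b) \<in> V k x)"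
    unfolding V_def by (simp add: 1 2 e i o)
qed

text \<open>The larger of the two cubes determines the layer and takes the charge. It can be taken
  to be a stopping cube, because outside the stopping set the level has its minimum
  \<open>m\<close>. Its level is below \<open>k\<close>, because a cube of level at least
  \<open>k\<close> meeting the region would put \<open>x\<close> into the enlargement.\<close>

lemma V_q:
  assumes x: "x \<notin> st.enl N" and z: "z \<in> V k x"
  shows "1 \<le> q1 k x z + q2 k x z"
proof -
  obtain y1 y2 where y: "gr (\<kappa> (fst z)) y1 = gr (\<kappa> (fst z)) (fst z)" "gr (\<kappa> (snd z)) y2 = gr (\<kappa> (snd z)) (snd z)" "(y1, y2) - (x, x) \<in> R k"
    using z by (auto simp: V_def)
  obtain w1 w2 where w: "gr (\<kappa> (fst z)) w1 = gr (\<kappa> (fst z)) (fst z)" "gr (\<kappa> (snd z)) w2 = gr (\<kappa> (snd z)) (snd z)" "(w1, w2) - (x, x) \<notin> R k"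
    using z by (auto simp: V_def In_def)
  have inL: "z - (x, x) \<in> L k a" if a: "\<kappa> (fst z) \<le> a" "\<kappa> (snd z) \<le> a" for a
  proof (rule L_I[OF y(3) w(3)])
    have "norm (z - (y1, y2)) \<le> 2 * real CARD('n) * 2 powi a"
      by (rule norm_pair_cell) (use gr_mono[OF y(1) a(1)] gr_mono[OF y(2) a(2)] in simp_all)
    then show "norm (z - (x, x) - ((y1, y2) - (x, x))) \<le> 2 * real CARD('n) * 2 powi a" by (simp only: diff_diff_cancel_right)
    have "norm (z - (w1, w2)) \<le> 2 * real CARD('n) * 2 powi a"
      by (rule norm_pair_cell) (use gr_mono[OF w(1) a(1)] gr_mono[OF w(2) a(2)] in simp_all)
    then show "norm (z - (x, x) - ((w1, w2) - (x, x))) \<le> 2 * real CARD('n) * 2 powi a" by (simp only: diff_diff_cancel_right)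
  qed
  have lt: "\<kappa> u < k" if u: "u \<in> \<Omega>" and near: "near N k x y" and yu: "gr (\<kappa> u) y = gr (\<kappa> u) u" for u y
  proof (rule ccontr)
    assume "\<not> \<kappa> u < k"
    then have "near N (\<kappa> u) x y" by (intro near_mono[OF near] N0) simp
    then have "near N (\<kappa> u) x u" using yu by (simp add: near_def)
    with u x show False by (auto simp: st.enl_def)
  qed
  have n: "near N k x y1" "near N k x y2" using R_near[OF y(3)] by auto
  have "(fst z \<in> \<Omega> \<and> \<kappa> (snd z) \<le> \<kappa> (fst z)) \<or> (snd z \<in> \<Omega> \<and> \<kappa> (fst z) \<le> \<kappa> (snd z))"
  proof (cases "\<kappa> (snd z) \<le> \<kappa> (fst z)")
    case True
    show ?thesis
    proof (cases "fst z \<in> \<Omega>")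
      case False
      then have "snd z \<in> \<Omega>" using z by (auto simp: V_def)
      moreover have "\<kappa> (fst z) \<le> \<kappa> (snd z)" using st.lev_out[OF False] st.lev_ge by simp
      ultimately show ?thesis by simp
    qed (use True in simp)
  next
    case False
    then have "snd z \<in> \<Omega>" using st.lev_out[of "snd z"] st.lev_ge[of "fst z"] by force
    with False show ?thesis by simp
  qed
  then show ?thesis
  proof
    assume *: "fst z \<in> \<Omega> \<and> \<kappa> (snd z) \<le> \<kappa> (fst z)"
    then have "q1 k x z = 1" using inL[of "\<kappa> (fst z)"] lt[OF _ n(1) y(1)] by (simp add: q1_def)
    then show ?thesis by simp
  next
    assume *: "snd z \<in> \<Omega> \<and> \<kappa> (fst z) \<le> \<kappa> (snd z)"
    then have "q2 k x z = 1" using inL[of "\<kappa> (snd z)"] lt[OF _ n(2) y(2)] by (simp add: q2_def)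
    then show ?thesis by simp
  qed
qed

lemma q_measurable:
  "(\<lambda>p. q1 k (fst p) (fst (snd p), snd (snd p))) \<in> borel_measurable (borel \<Otimes>\<^sub>M (borel \<Otimes>\<^sub>M borel))"
  "(\<lambda>p. q2 k (fst p) (fst (snd p), snd (snd p))) \<in> borel_measurable (borel \<Otimes>\<^sub>M (borel \<Otimes>\<^sub>M borel))"
proof -
  have [measurable]: "L k j \<in> sets (borel \<Otimes>\<^sub>M borel)" for j by (rule pair_borel_sets[OF L_sets])
  have k: "(\<lambda>p::(real^'n) \<times> (real^'n) \<times> (real^'n). \<kappa> (fst (snd p))) \<in> borel \<Otimes>\<^sub>M (borel \<Otimes>\<^sub>M borel) \<rightarrow>\<^sub>M count_space UNIV"
    "(\<lambda>p::(real^'n) \<times> (real^'n) \<times> (real^'n). \<kappa> (snd (snd p))) \<in> borel \<Otimes>\<^sub>M (borel \<Otimes>\<^sub>M borel) \<rightarrow>\<^sub>M count_space UNIV"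
    by measurable
  have l: "(\<lambda>p. if j < k then indicator (L k j) (fst (snd p) - fst p, snd (snd p) - fst p) else (0::ennreal)) \<in> borel_measurable (borel \<Otimes>\<^sub>M (borel \<Otimes>\<^sub>M borel))" for j
    by measurable
  note c = measurable_compose_countable[OF l k(1)] measurable_compose_countable[OF l k(2)]
  show "(\<lambda>p. q1 k (fst p) (fst (snd p), snd (snd p))) \<in> borel_measurable (borel \<Otimes>\<^sub>M (borel \<Otimes>\<^sub>M borel))"
    "(\<lambda>p. q2 k (fst p) (fst (snd p), snd (snd p))) \<in> borel_measurable (borel \<Otimes>\<^sub>M (borel \<Otimes>\<^sub>M borel))"
    unfolding q1_def q2_def using c
    by (auto intro!: borel_measurable_times_ennreal)
qed

lemma q_measurable1 [measurable]: "q1 k x \<in> \<B>" "q2 k x \<in> \<B>"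
  using measurable_compose[OF _ q_measurable(1), of "\<lambda>z. (x, z)" "borel \<Otimes>\<^sub>M borel" k]
    measurable_compose[OF _ q_measurable(2), of "\<lambda>z. (x, z)" "borel \<Otimes>\<^sub>M borel" k]
  by (simp_all add: borel_prod)

text \<open>On \<open>V\<close> the functions are replaced by their averages before any height is
  used, since only the averages are bounded by \<open>dC\<close>. What remains is the measure of
  \<open>V\<close>, charged through \<open>V_q\<close>.\<close>

lemma A_diff_le:
  assumes x: "x \<notin> st.enl N"
  shows "ennreal (norm (A k f1 f2 x - A k (av \<kappa> f1) (av \<kappa> f2) x))
    \<le> ennreal (2 * dC\<^sup>2) * (ennreal (wt k) * (NN z. q1 k x z + q2 k x z))"
proof -
  have Vs: "V k x \<in> sets borel" by (rule sat2_sets[OF st.stp V_sat2])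
  have [measurable]: "nav \<kappa> n1 \<in> \<B>" "nav \<kappa> n2 \<in> \<B>"
    by (rule nav_measurable[OF st.stp])+
  have "ennreal (norm (A k f1 f2 x - A k (av \<kappa> f1) (av \<kappa> f2) x)) \<le>
    ennreal (2 * wt k) * (NN z. indicator (V k x) z * (n1 (fst z) * n2 (snd z)))"
  proof (rule A_sat_le[OF st.stp f V_sat2])
    fix z assume z: "z - (x, x) \<in> R k" "z \<notin> In \<kappa> k x"
    show "z \<in> V k x \<or> f1 (fst z) * f2 (snd z) = av \<kappa> f1 (fst z) * av \<kappa> f2 (snd z)"
    proof (cases "fst z \<in> \<Omega> \<or> snd z \<in> \<Omega>")
      case True
      have "(fst z, snd z) - (x, x) \<in> R k" using z(1) by (simp only: prod.collapse)
      then show ?thesis unfolding V_def using z True by blast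
    qed (simp add: av_out)
  qed
  also have "(NN z. indicator (V k x) z * (n1 (fst z) * n2 (snd z)))
      = (NN z. indicator (V k x) z * (nav \<kappa> n1 (fst z) * nav \<kappa> n2 (snd z)))"
    by (rule nn_integral_sat2[OF st.stp V_sat2, symmetric]) measurable
  also have "\<dots> \<le> (NN z. ennreal (dC\<^sup>2) * (q1 k x z + q2 k x z))"
  proof (intro nn_integral_mono)
    fix z
    have "nav \<kappa> n1 (fst z) * nav \<kappa> n2 (snd z) \<le> ennreal dC * ennreal dC"
      by (intro mult_mono nav_bound) auto
    also have "\<dots> = ennreal (dC\<^sup>2) * 1" using dC by (simp add: ennreal_mult[symmetric] power2_eq_square)
    finally have "z \<in> V k x \<Longrightarrow> nav \<kappa> n1 (fst z) * nav \<kappa> n2 (snd z) \<le> ennreal (dC\<^sup>2) * (q1 k x z + q2 k x z)"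
      using V_q[OF x, of z k] by (meson mult_left_mono order_trans zero_le)
    then show "indicator (V k x) z * (nav \<kappa> n1 (fst z) * nav \<kappa> n2 (snd z)) \<le> ennreal (dC\<^sup>2) * (q1 k x z + q2 k x z)"
      by (cases "z \<in> V k x") auto
  qed
  also have "\<dots> = ennreal (dC\<^sup>2) * (NN z. q1 k x z + q2 k x z)"
    by (rule nn_integral_cmult) measurable
  finally have "ennreal (norm (A k f1 f2 x - A k (av \<kappa> f1) (av \<kappa> f2) x)) \<le>
    ennreal (2 * wt k) * (ennreal (dC\<^sup>2) * (NN z. q1 k x z + q2 k x z))"
    by (simp add: mult_left_mono)
  also have "\<dots> = ennreal (2 * wt k * dC\<^sup>2) * (NN z. q1 k x z + q2 k x z)"
    using wt[of k] by (subst ennreal_mult) (auto simp: mult.assoc)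
  also have "2 * wt k * dC\<^sup>2 = 2 * dC\<^sup>2 * wt k" by simp
  also have "ennreal (2 * dC\<^sup>2 * wt k) = ennreal (2 * dC\<^sup>2) * ennreal (wt k)"
    using wt[of k] by (intro ennreal_mult) auto
  finally show ?thesis by (simp only: mult.assoc)
qed

definition qq :: "int \<Rightarrow> real^'n \<Rightarrow> ennreal" where
  "qq k x = ennreal (wt k) * (NN z. q1 k x z + q2 k x z)"

lemma qq_split:
  "(NN z. q1 k x z + q2 k x z) = (NN a. NN b. q1 k x (a, b)) + (NN b. NN a. q2 k x (a, b))"
proof -
  note m = q_measurable1[of k x]
  have "(NN z. q1 k x z + q2 k x z) = (NN z. q1 k x z) + (NN z. q2 k x z)"
    using m by (intro nn_integral_add) auto
  then show ?thesis using nn_integral_lborel_pair(1)[OF m(1)] nn_integral_lborel_pair(2)[OF m(2)] by simp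
qed

lemma qq_measurable [measurable]: "qq k \<in> \<B>"
proof -
  note [measurable] = q_measurable
  have [measurable]: "(\<lambda>p. q1 k (fst (fst p)) (snd (fst p), snd p)) \<in> borel_measurable ((borel \<Otimes>\<^sub>M borel) \<Otimes>\<^sub>M borel)"
    using measurable_compose[OF _ q_measurable(1), of "\<lambda>p. (fst (fst p), (snd (fst p), snd p))" "(borel \<Otimes>\<^sub>M borel) \<Otimes>\<^sub>M borel" k] by simp
  have [measurable]: "(\<lambda>p. q2 k (fst (fst p)) (snd p, snd (fst p))) \<in> borel_measurable ((borel \<Otimes>\<^sub>M borel) \<Otimes>\<^sub>M borel)"
    using measurable_compose[OF _ q_measurable(2), of "\<lambda>p. (fst (fst p), (snd p, snd (fst p)))" "(borel \<Otimes>\<^sub>M borel) \<Otimes>\<^sub>M borel" k] by simp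
  show ?thesis unfolding qq_def qq_split by measurable
qed

text \<open>For a fixed charged point \<open>u\<close>, integrating over the base point and the
  other coordinate gives the full measure of the layer of level \<open>\<kappa> u\<close>. The two
  coordinates account for the factor 2.\<close>

lemma nn_qq: "(NN x. qq k x) \<le> 2 * (NN u. indicator \<Omega> u * (if \<kappa> u < k then ennreal (C1 * 2 powi (\<kappa> u - k)) else 0))"
proof -
  let ?b = "\<integral>\<^sup>+u. indicator \<Omega> u * (if \<kappa> u < k then ennreal (C1 * 2 powi (\<kappa> u - k)) else 0) \<partial>lborel"
  have m1 [measurable]: "(\<lambda>p. q1 k (fst (fst p)) (snd (fst p), snd p)) \<in> borel_measurable ((borel \<Otimes>\<^sub>M borel) \<Otimes>\<^sub>M borel)"
    using measurable_compose[OF _ q_measurable(1), of "\<lambda>p. (fst (fst p), (snd (fst p), snd p))" "(borel \<Otimes>\<^sub>M borel) \<Otimes>\<^sub>M borel" k] by simp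
  have m2 [measurable]: "(\<lambda>p. q2 k (fst (fst p)) (snd p, snd (fst p))) \<in> borel_measurable ((borel \<Otimes>\<^sub>M borel) \<Otimes>\<^sub>M borel)"
    using measurable_compose[OF _ q_measurable(2), of "\<lambda>p. (fst (fst p), (snd p, snd (fst p)))" "(borel \<Otimes>\<^sub>M borel) \<Otimes>\<^sub>M borel" k] by simp
  have i1: "ennreal (wt k) * (NN x. NN b. q1 k x (u, b)) \<le> indicator \<Omega> u * (if \<kappa> u < k then ennreal (C1 * 2 powi (\<kappa> u - k)) else 0)" for u
    using diag_measure(1)[OF L_sets, of k "\<kappa> u" u] L_measure[of "\<kappa> u" k] by (auto simp: q1_def indicator_def)
  have i2: "ennreal (wt k) * (NN x. NN b. q2 k x (b, u)) \<le> indicator \<Omega> u * (if \<kappa> u < k then ennreal (C1 * 2 powi (\<kappa> u - k)) else 0)" for u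
    using diag_measure(2)[OF L_sets, of k "\<kappa> u" u] L_measure[of "\<kappa> u" k] by (auto simp: q2_def indicator_def)
  have "(NN x. qq k x) = ennreal (wt k) * ((NN x. NN a. NN b. q1 k x (a, b)) + (NN x. NN b. NN a. q2 k x (a, b)))"
  proof -
    have "(\<lambda>x. \<integral>\<^sup>+a. \<integral>\<^sup>+b. q1 k x (a, b) \<partial>lborel \<partial>lborel) \<in> borel_measurable lborel" by measurable
    moreover have "(\<lambda>x. \<integral>\<^sup>+b. \<integral>\<^sup>+a. q2 k x (a, b) \<partial>lborel \<partial>lborel) \<in> borel_measurable lborel" by measurable
    ultimately show ?thesis unfolding qq_def qq_split by (simp add: nn_integral_cmult nn_integral_add)
  qed
  also have "(NN x. NN a. NN b. q1 k x (a, b)) = (NN a. NN x. NN b. q1 k x (a, b))"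
    by (rule lborel_pair.Fubini'[symmetric]) (simp add: case_prod_unfold)
  also have "(NN x. NN b. NN a. q2 k x (a, b)) = (NN b. NN x. NN a. q2 k x (a, b))"
    by (rule lborel_pair.Fubini'[symmetric]) (simp add: case_prod_unfold)
  also have "ennreal (wt k) * ((NN a. NN x. NN b. q1 k x (a, b)) + (NN b. NN x. NN a. q2 k x (a, b)))
     = (NN a. ennreal (wt k) * (NN x. NN b. q1 k x (a, b))) + (NN b. ennreal (wt k) * (NN x. NN a. q2 k x (a, b)))"
  proof -
    have n1: "(\<lambda>p. q1 k (snd (fst p)) (fst (fst p), snd p)) \<in> borel_measurable ((borel \<Otimes>\<^sub>M borel) \<Otimes>\<^sub>M borel)"
      using measurable_compose[OF _ q_measurable(1), of "\<lambda>p. (snd (fst p), (fst (fst p), snd p))" "(borel \<Otimes>\<^sub>M borel) \<Otimes>\<^sub>M borel" k] by simp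
    have n2: "(\<lambda>p. q2 k (snd (fst p)) (snd p, fst (fst p))) \<in> borel_measurable ((borel \<Otimes>\<^sub>M borel) \<Otimes>\<^sub>M borel)"
      using measurable_compose[OF _ q_measurable(2), of "\<lambda>p. (snd (fst p), (snd p, fst (fst p)))" "(borel \<Otimes>\<^sub>M borel) \<Otimes>\<^sub>M borel" k] by simp
    note [measurable] = n1 n2
    have "(\<lambda>a. \<integral>\<^sup>+x. \<integral>\<^sup>+b. q1 k x (a, b) \<partial>lborel \<partial>lborel) \<in> borel_measurable lborel" by measurable
    moreover have "(\<lambda>b. \<integral>\<^sup>+x. \<integral>\<^sup>+a. q2 k x (a, b) \<partial>lborel \<partial>lborel) \<in> borel_measurable lborel" by measurable
    ultimately show ?thesis by (simp add: nn_integral_cmult distrib_left)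
  qed
  also have "\<dots> \<le> ?b + ?b"
    by (intro add_mono nn_integral_mono i1 i2)
  finally show ?thesis by (simp add: mult_2)
qed

lemma sum_qq:
  assumes I: "finite I"
  shows "(NN x. (\<Sum>k\<in>I. qq k x)) \<le> ennreal (8 * C1) * emeasure lborel \<Omega>"
proof -
  have "(NN x. (\<Sum>k\<in>I. qq k x)) = (\<Sum>k\<in>I. \<integral>\<^sup>+x. qq k x \<partial>lborel)"
    by (rule nn_integral_sum) measurable
  also have "\<dots> \<le> (\<Sum>k\<in>I. 2 * (NN u. indicator \<Omega> u * (if \<kappa> u < k then ennreal (C1 * 2 powi (\<kappa> u - k)) else 0)))"
    by (intro sum_mono nn_qq)
  also have "\<dots> = 2 * (NN u. (\<Sum>k\<in>I. indicator \<Omega> u * (if \<kappa> u < k then ennreal (C1 * 2 powi (\<kappa> u - k)) else 0)))"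
    by (subst nn_integral_sum) (auto simp: sum_distrib_left)
  also have "\<dots> \<le> 2 * (NN u. indicator \<Omega> u * ennreal (4 * C1))"
  proof (intro mult_left_mono nn_integral_mono)
    fix u
    have "(\<Sum>k\<in>I. (if \<kappa> u < k then ennreal (C1 * 2 powi (\<kappa> u - k)) else 0)) \<le> (\<Sum>k\<in>I. ennreal (C1 * (1 / 2) ^ nat \<bar>\<kappa> u - k\<bar>))"
    proof (intro sum_mono)
      fix k
      show "(if \<kappa> u < k then ennreal (C1 * 2 powi (\<kappa> u - k)) else 0) \<le> ennreal (C1 * (1 / 2) ^ nat \<bar>\<kappa> u - k\<bar>)"
        by (auto simp: power_int_def inverse_eq_divide power_one_over)
    qed
    also have "\<dots> = ennreal (C1 * (\<Sum>k\<in>I. (1 / 2) ^ nat \<bar>\<kappa> u - k\<bar>))"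
      using C1 by (simp add: sum_ennreal sum_distrib_left)
    also have "\<dots> \<le> ennreal (C1 * (2 / (1 - 1 / 2)))"
      using C1 by (intro ennreal_leI mult_left_mono geom_int_sum I) auto
    finally show "(\<Sum>k\<in>I. indicator \<Omega> u * (if \<kappa> u < k then ennreal (C1 * 2 powi (\<kappa> u - k)) else 0)) \<le> indicator \<Omega> u * ennreal (4 * C1)"
      unfolding sum_distrib_left[symmetric] by (intro mult_left_mono) (auto simp: mult.commute)
  qed auto
  also have "\<dots> = ennreal (8 * C1) * emeasure lborel \<Omega>"
  proof -
    have "ennreal (8 * C1) = 2 * ennreal (4 * C1)"
      using C1 by (simp add: mult_2 ennreal_plus[symmetric] del: ennreal_plus)
    then show ?thesis by (simp add: nn_integral_multc ac_simps)
  qed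
  finally show ?thesis .
qed

text \<open>Three exceptional sets suffice: the one where the averaged functions have a large square
  function, the enlargement of the stopping cubes, and the one where the charges are large, treated
  by Markov's inequality. The height 2 is split into 1 + 1.\<close>

lemma czd_bound:
  assumes I: "finite I" "\<And>k. k \<in> I \<Longrightarrow> m \<le> k"
  shows "emeasure lborel {x. SF I f1 f2 x > 2} \<le> emeasure lborel {x. SF I (av \<kappa> f1) (av \<kappa> f2) x > 1}
    + ennreal (MN + 16 * dC\<^sup>2 * C1) * emeasure lborel \<Omega>"
proof -
  have [measurable]: "av \<kappa> f1 \<in> \<B>" "av \<kappa> f2 \<in> \<B>"
    by (rule av_measurable[OF st.stp])+
  let ?d = "\<lambda>k x. A k f1 f2 x - A k (av \<kappa> f1) (av \<kappa> f2) x"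
  define D where "D x = ennreal (2 * dC\<^sup>2) * (\<Sum>k\<in>I. qq k x)" for x
  have [measurable]: "D \<in> \<B>" unfolding D_def by measurable
  have sub: "{x. SF I f1 f2 x > 2} \<subseteq> {x. SF I (av \<kappa> f1) (av \<kappa> f2) x > 1} \<union> st.enl N \<union> {x. 1 \<le> D x}"
  proof
    fix x assume "x \<in> {x. SF I f1 f2 x > 2}"
    then have big: "SF I f1 f2 x > 2" by simp
    show "x \<in> {x. SF I (av \<kappa> f1) (av \<kappa> f2) x > 1} \<union> st.enl N \<union> {x. 1 \<le> D x}"
    proof (cases "x \<in> st.enl N \<or> SF I (av \<kappa> f1) (av \<kappa> f2) x > 1")
      case False
      then have x: "x \<notin> st.enl N" and small: "SF I (av \<kappa> f1) (av \<kappa> f2) x \<le> 1" by auto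
      have "x \<notin> \<Omega>" using x N0 by (auto simp: st.enl_def)
      \<comment> \<open>No selected cube is larger than a cube of level \<open>k\<close> containing
        \<open>x\<close>, so by the tower property the original and the averaged functions have the
        same conditional expectations at \<open>x\<close>.\<close>
      then have E: "av (\<lambda>_. k) (av \<kappa> f1) x = av (\<lambda>_. k) f1 x" "av (\<lambda>_. k) (av \<kappa> f2) x = av (\<lambda>_. k) f2 x" if "k \<in> I" for k
        using av_tower[OF st.stp f(1), of k x] av_tower[OF st.stp f(2), of k x] st.coarse[OF _ I(2)[OF that]] by auto
      have "SF I f1 f2 x \<le> SF I (av \<kappa> f1) (av \<kappa> f2) x + L2_set (\<lambda>k. norm (DD k f1 f2 x - DD k (av \<kappa> f1) (av \<kappa> f2) x)) I"
        unfolding SF_def by (rule L2_set_norm_le)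
      also have "L2_set (\<lambda>k. norm (DD k f1 f2 x - DD k (av \<kappa> f1) (av \<kappa> f2) x)) I = L2_set (\<lambda>k. norm (?d k x)) I"
        by (intro L2_set_cong) (auto simp: DD_def E)
      also have "\<dots> \<le> (\<Sum>k\<in>I. norm (?d k x))" by (rule L2_set_le_sum) auto
      finally have "1 \<le> (\<Sum>k\<in>I. norm (?d k x))" using big small by simp
      then have "ennreal 1 \<le> (\<Sum>k\<in>I. ennreal (norm (?d k x)))"
        by (simp add: sum_ennreal)
      also have "\<dots> \<le> (\<Sum>k\<in>I. ennreal (2 * dC\<^sup>2) * qq k x)"
        unfolding qq_def by (intro sum_mono A_diff_le x)
      also have "\<dots> = D x" by (simp add: D_def sum_distrib_left)
      finally show ?thesis by simp
    qed auto
  qed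
  have "emeasure lborel {x. SF I f1 f2 x > 2} \<le> emeasure lborel ({x. SF I (av \<kappa> f1) (av \<kappa> f2) x > 1} \<union> st.enl N \<union> {x. 1 \<le> D x})"
    using sub by (rule emeasure_mono) simp
  also have "\<dots> \<le> emeasure lborel {x. SF I (av \<kappa> f1) (av \<kappa> f2) x > 1} + emeasure lborel (st.enl N) + emeasure lborel {x. 1 \<le> D x}"
    by (intro order_trans[OF emeasure_subadditive] add_mono) (auto intro!: order_trans[OF emeasure_subadditive])
  also have "\<dots> \<le> emeasure lborel {x. SF I (av \<kappa> f1) (av \<kappa> f2) x > 1} + ennreal MN * emeasure lborel \<Omega> + ennreal (2 * dC\<^sup>2) * (ennreal (8 * C1) * emeasure lborel \<Omega>)"
  proof (intro add_mono order_refl)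
    show "emeasure lborel (st.enl N) \<le> ennreal MN * emeasure lborel \<Omega>" unfolding MN_def by (rule st.enl_measure[OF N0])
    have "emeasure lborel {x. 1 \<le> D x} \<le> (NN x. D x)"
      using markov_nn[of D lborel] by simp
    also have "\<dots> = ennreal (2 * dC\<^sup>2) * (NN x. (\<Sum>k\<in>I. qq k x))"
      unfolding D_def by (rule nn_integral_cmult) measurable
    also have "\<dots> \<le> ennreal (2 * dC\<^sup>2) * (ennreal (8 * C1) * emeasure lborel \<Omega>)"
      by (intro mult_left_mono sum_qq I) auto
    finally show "emeasure lborel {x. 1 \<le> D x} \<le> \<dots>" .
  qed
  also have "\<dots> = emeasure lborel {x. SF I (av \<kappa> f1) (av \<kappa> f2) x > 1} + ennreal (MN + 16 * dC\<^sup>2 * C1) * emeasure lborel \<Omega>"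
    using MN C1 dC by (simp add: add.assoc distrib_right ennreal_mult[symmetric] mult.assoc[symmetric])
  finally show ?thesis .
qed

end

subsection \<open>Modulars and approximation by step functions\<close>

text \<open>
  For \<open>p = top\<close> the modular is \<open>0\<close> or \<open>\<infinity>\<close>, so that bounds by sums of modulars include this exponent.
\<close>

definition mdl :: "ennreal \<Rightarrow> (real^'n \<Rightarrow> complex) \<Rightarrow> ennreal" where
  "mdl p f = (if p = top then (if \<forall>x. norm (f x) \<le> 1 then 0 else top)
    else (NN x. ennreal (norm (f x) powr enn2real p)))"

lemma mdl_top_bound: "mdl top f < top \<Longrightarrow> norm (f x) \<le> 1"
  by (auto simp: mdl_def split: if_splits)

lemma enn2real_ge_1: "1 \<le> p \<Longrightarrow> p \<noteq> top \<Longrightarrow> 1 \<le> enn2real p"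
  by (metis enn2real_1 enn2real_mono top.not_eq_extremum)

text \<open>Where an average of |f| exceeds 1, so does that of |f|^p by Jensen, and
  \<open>weak_type\<close> applies to |f|^p. For \<open>p = top\<close> with finite modular no
  average exceeds 1.\<close>

lemma level_set_mdl:
  fixes f :: "real^'n \<Rightarrow> complex"
  assumes f [measurable]: "f \<in> \<B>" and p: "1 \<le> p"
  shows "emeasure lborel (stopped m (\<lambda>k x. nav (\<lambda>_. k) (\<lambda>y. ennreal (norm (f y))) x > 1)) \<le> mdl p f"
proof (cases "p = top")
  case True
  show ?thesis
  proof (cases "\<forall>x. norm (f x) \<le> 1")
    case b: True
    have "nav (\<lambda>_. k) (\<lambda>y. ennreal (norm (f y))) x \<le> 1" for k x
      using nav_mono[of "\<lambda>y. ennreal (norm (f y))" "\<lambda>_. 1" "\<lambda>_. k" x] b by (simp add: nav_const)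
    then have "stopped m (\<lambda>k x. nav (\<lambda>_. k) (\<lambda>y. ennreal (norm (f y))) x > 1) = {}"
      by (auto simp: stopped_def not_less[symmetric])
    then show ?thesis by simp
  next
    case b: False
    then have "mdl p f = top" using True by (auto simp: mdl_def)
    then show ?thesis by simp
  qed
next
  case False
  define r where "r = enn2real p"
  have r: "1 \<le> r" unfolding r_def by (rule enn2real_ge_1[OF p False])
  let ?g = "\<lambda>y. ennreal (norm (f y) powr r)"
  have e: "mdl p f = (NN y. ?g y)" using False by (simp add: mdl_def r_def)
  show ?thesis
  proof (cases "(NN y. ?g y) < \<infinity>")
    case fin: True
    let ?S = "stopped m (\<lambda>k x. nav (\<lambda>_. k) ?g x > ennreal 1)"
    have sub: "stopped m (\<lambda>k x. nav (\<lambda>_. k) (\<lambda>y. ennreal (norm (f y))) x > 1) \<subseteq> ?S"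
    proof
      fix x assume "x \<in> stopped m (\<lambda>k x. nav (\<lambda>_. k) (\<lambda>y. ennreal (norm (f y))) x > 1)"
      then obtain k where k: "m \<le> k" "1 < nav (\<lambda>_. k) (\<lambda>y. ennreal (norm (f y))) x" by (auto simp: stopped_def)
      \<comment> \<open>A finite value in between: the average may be infinite, and
        \<open>nav_jensen\<close> takes a real lower bound.\<close>
      obtain b where b: "1 < b" "b < nav (\<lambda>_. k) (\<lambda>y. ennreal (norm (f y))) x" using dense[OF k(2)] by auto
      then obtain a where a: "b = ennreal a" "0 \<le> a" by (cases b) auto
      have a1: "1 < a" using b(1) a by simp
      have "ennreal (a powr r) \<le> nav (\<lambda>_. k) ?g x"
        by (rule nav_jensen) (use b(2) a r in auto)
      moreover have "1 < a powr r" using a1 r by (simp add: gr_one_powr)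
      then have "ennreal 1 < ennreal (a powr r)" by (intro ennreal_lessI) auto
      ultimately have "nav (\<lambda>_. k) ?g x > ennreal 1" by (rule order_less_le_trans[rotated])
      with k show "x \<in> ?S" by (auto simp: stopped_def)
    qed
    have w: "ennreal 1 * emeasure lborel ?S \<le> (NN x. indicator ?S x * ?g x)" "?S \<in> sets borel"
      using weak_type[of ?g 1 m] fin by auto
    have "emeasure lborel (stopped m (\<lambda>k x. nav (\<lambda>_. k) (\<lambda>y. ennreal (norm (f y))) x > 1)) \<le> emeasure lborel ?S"
      by (rule emeasure_mono[OF sub]) (use w in simp)
    also have "\<dots> \<le> (NN x. indicator ?S x * ?g x)" using w(1) by simp
    also have "\<dots> \<le> (NN x. ?g x)" by (intro nn_integral_mono) (auto simp: indicator_def)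
    finally show ?thesis by (simp add: e)
  qed (simp add: e less_top[symmetric])
qed

lemma mdl_av:
  fixes f :: "real^'n \<Rightarrow> complex"
  assumes st: "stp m \<kappa>" and f [measurable]: "f \<in> \<B>" and p: "1 \<le> p"
  shows "mdl p (av \<kappa> f) \<le> mdl p f"
proof (cases "p = top")
  case True
  then show ?thesis using norm_av_bound[of f 1 \<kappa>] by (auto simp: mdl_def)
next
  case False
  have r: "1 \<le> enn2real p" by (rule enn2real_ge_1[OF p False])
  have "(NN x. ennreal (norm (av \<kappa> f x) powr enn2real p))
     \<le> (NN x. nav \<kappa> (\<lambda>y. ennreal (norm (f y) powr enn2real p)) x)"
    by (intro nn_integral_mono nav_jensen r norm_av_le) auto
  also have "\<dots> = (NN x. ennreal (norm (f x) powr enn2real p))"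
    by (rule nn_integral_nav[OF st]) measurable
  finally show ?thesis using False by (simp add: mdl_def)
qed

lemma mdl_1: "mdl 1 f = (NN x. ennreal (norm (f x)))"
  by (auto simp: mdl_def powr_one_gt_zero_iff intro!: nn_integral_cong)

section \<open>Reduction of weak bounds to bounded functions, and the weak endpoint\<close>

context body
begin

definition CZC :: real where "CZC = MN + 16 * dC\<^sup>2 * C1"

lemma CZC: "0 \<le> CZC" using MN C1 by (simp add: CZC_def)

text \<open>Leaves open a level bound for the averaged functions, which are bounded by
  \<open>dC\<close>, stay constant on cubes of level \<open>m\<close> and have no larger modulars.
  The L^2 bound fills it in \<open>star1\<close>, the strong bounds in \<open>weak\<close>.\<close>

lemma cz_cor:
  assumes f: "integrable lborel f1" "integrable lborel f2"
    and const: "\<And>x y. gr m x = gr m y \<Longrightarrow> f1 x = f1 y" "\<And>x y. gr m x = gr m y \<Longrightarrow> f2 x = f2 y"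
    and I: "finite I" "\<And>k. k \<in> I \<Longrightarrow> m \<le> k" and p: "1 \<le> p1" "1 \<le> p2"
    and hyp: "\<And>g1 g2. \<lbrakk>\<And>x. norm (g1 x) \<le> dC; \<And>x. norm (g2 x) \<le> dC; integrable lborel g1; integrable lborel g2;
      \<And>x y. gr m x = gr m y \<Longrightarrow> g1 x = g1 y; \<And>x y. gr m x = gr m y \<Longrightarrow> g2 x = g2 y;
      mdl p1 g1 \<le> mdl p1 f1; mdl p2 g2 \<le> mdl p2 f2\<rbrakk> \<Longrightarrow> emeasure lborel {x. SF I g1 g2 x > 1} \<le> X"
  shows "emeasure lborel {x. SF I f1 f2 x > 2} \<le> X + ennreal CZC * (mdl p1 f1 + mdl p2 f2)"
proof -
  interpret czd G N K C0 m f1 f2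
    by unfold_locales (fact f const)+
  have c: "g x = g y" if "sat \<kappa> g" "gr m x = gr m y" for g :: "real^'n \<Rightarrow> complex" and x y
    using that(1) stp_fine(1)[OF st.stp that(2)] unfolding sat_def by metis
  have "emeasure lborel {x. SF I (av \<kappa> f1) (av \<kappa> f2) x > 1} \<le> X"
    by (intro hyp av_bound integrable_av[OF st.stp] f mdl_av[OF st.stp] p c[OF av_cell[OF st.stp]]) auto
  moreover have "emeasure lborel \<Omega> \<le> mdl p1 f1 + mdl p2 f2"
  proof -
    let ?S1 = "stopped m (\<lambda>k x. nav (\<lambda>_. k) n1 x > 1)" and ?S2 = "stopped m (\<lambda>k x. nav (\<lambda>_. k) n2 x > 1)"
    have i: "(NN y. n1 y) < \<infinity>" "(NN y. n2 y) < \<infinity>"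
      using f by (auto simp: integrable_iff_bounded)
    have [measurable]: "?S1 \<in> sets borel" "?S2 \<in> sets borel"
      using weak_type(2)[OF _ i(1), of 1 m] weak_type(2)[OF _ i(2), of 1 m] by auto
    have "\<Omega> \<subseteq> ?S1 \<union> ?S2" by (auto simp: stopped_def Pst_def)
    then have "emeasure lborel \<Omega> \<le> emeasure lborel (?S1 \<union> ?S2)" by (rule emeasure_mono) simp
    also have "\<dots> \<le> emeasure lborel ?S1 + emeasure lborel ?S2" by (rule emeasure_subadditive) auto
    also have "\<dots> \<le> mdl p1 f1 + mdl p2 f2" by (intro add_mono level_set_mdl p) auto
    finally show ?thesis .
  qed
  ultimately show ?thesis
    using czd_bound[OF I] unfolding CZC_def
    by (meson add_mono mult_left_mono order_trans zero_le)
qed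

definition CS :: real where "CS = CI * dC ^ 3 + CZC"

lemma CS: "0 \<le> CS" using CI CZC dC by (simp add: CS_def)

lemma SF_L2:
  assumes f: "integrable lborel f1" "integrable lborel f2" and B: "\<And>x. norm (f1 x) \<le> B" "\<And>x. norm (f2 x) \<le> B"
    and m: "\<And>x y. gr m x = gr m y \<Longrightarrow> f1 x = f1 y" "\<And>x y. gr m x = gr m y \<Longrightarrow> f2 x = f2 y"
    and I: "finite I" "\<And>k. k \<in> I \<Longrightarrow> m \<le> k"
  shows "(NN x. ennreal ((SF I f1 f2 x)\<^sup>2))
    \<le> ennreal (CI * B\<^sup>2) * ((NN x. ennreal ((norm (f1 x))\<^sup>2)) + (NN x. ennreal ((norm (f2 x))\<^sup>2)))"
  using L2_bound[OF f B m I] by (simp add: SF_square sum_ennreal)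

text \<open>For functions bounded by \<open>dC\<close> one has |g|^2 <= dC |g|, which turns the L^2
  bound into one by L^1 modulars. With the factor \<open>dC\<^sup>2\<close> from
  \<open>SF_L2\<close> this is the origin of \<open>dC ^ 3\<close> in \<open>CS\<close>.\<close>

lemma star1:
  assumes f: "integrable lborel f1" "integrable lborel f2"
    and const: "\<And>x y. gr m x = gr m y \<Longrightarrow> f1 x = f1 y" "\<And>x y. gr m x = gr m y \<Longrightarrow> f2 x = f2 y"
    and I: "finite I" "\<And>k. k \<in> I \<Longrightarrow> m \<le> k"
  shows "emeasure lborel {x. SF I f1 f2 x > 2} \<le> ennreal CS * (mdl 1 f1 + mdl 1 f2)"
proof -
  have "emeasure lborel {x. SF I f1 f2 x > 2} \<le> ennreal (CI * dC ^ 3) * (mdl 1 f1 + mdl 1 f2) + ennreal CZC * (mdl 1 f1 + mdl 1 f2)"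
  proof (rule cz_cor[OF f const I])
    fix g1 g2 :: "real^'n \<Rightarrow> complex"
    assume b: "\<And>x. norm (g1 x) \<le> dC" "\<And>x. norm (g2 x) \<le> dC" and i: "integrable lborel g1" "integrable lborel g2"
      and c: "\<And>x y. gr m x = gr m y \<Longrightarrow> g1 x = g1 y" "\<And>x y. gr m x = gr m y \<Longrightarrow> g2 x = g2 y"
      and le: "mdl 1 g1 \<le> mdl 1 f1" "mdl 1 g2 \<le> mdl 1 f2"
    have [measurable]: "g1 \<in> \<B>" "g2 \<in> \<B>" using i by auto
    have sq: "(NN x. ennreal ((norm (g x))\<^sup>2)) \<le> ennreal dC * mdl 1 g"
      if [measurable]: "g \<in> \<B>" and "\<And>x. norm (g x) \<le> dC" for g :: "real^'n \<Rightarrow> complex"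
    proof -
      have "(NN x. ennreal ((norm (g x))\<^sup>2)) \<le> (NN x. ennreal dC * ennreal (norm (g x)))"
        using that(2) dC by (intro nn_integral_mono) (auto simp: ennreal_mult[symmetric] power2_eq_square intro!: ennreal_leI mult_right_mono)
      then show ?thesis by (simp add: mdl_1 nn_integral_cmult)
    qed
    have "emeasure lborel {x. SF I g1 g2 x > 1} \<le> emeasure lborel {x\<in>space lborel. 1 \<le> ennreal ((SF I g1 g2 x)\<^sup>2)}"
    proof (rule emeasure_mono)
      show "{x. SF I g1 g2 x > 1} \<subseteq> {x\<in>space lborel. 1 \<le> ennreal ((SF I g1 g2 x)\<^sup>2)}"
        by (auto simp: one_le_power less_imp_le)
    qed measurable
    also have "\<dots> \<le> (NN x. ennreal ((SF I g1 g2 x)\<^sup>2))" by (rule markov_nn) measurable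
    also have "\<dots> \<le> ennreal (CI * dC\<^sup>2) * ((NN x. ennreal ((norm (g1 x))\<^sup>2)) + (NN x. ennreal ((norm (g2 x))\<^sup>2)))"
      by (rule SF_L2[OF i b c I])
    also have "\<dots> \<le> ennreal (CI * dC\<^sup>2) * (ennreal dC * mdl 1 f1 + ennreal dC * mdl 1 f2)"
      by (intro mult_left_mono add_mono order_trans[OF sq] mult_left_mono le b) auto
    also have "\<dots> = ennreal (CI * dC ^ 3) * (mdl 1 f1 + mdl 1 f2)"
      using CI dC by (simp add: distrib_left[symmetric] mult.assoc[symmetric] ennreal_mult[symmetric] power2_eq_square power3_eq_cube)
    finally show "emeasure lborel {x. SF I g1 g2 x > 1} \<le> ennreal (CI * dC ^ 3) * (mdl 1 f1 + mdl 1 f2)" .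
  qed simp_all
  also have "\<dots> = ennreal CS * (mdl 1 f1 + mdl 1 f2)"
    using CI CZC dC by (simp add: CS_def distrib_right)
  finally show ?thesis .
qed

end

section \<open>Truncated conditional expectations\<close>

definition Zs :: "nat \<Rightarrow> (real^'n) set" where "Zs n = {y. near 2 (int n) 0 y}"

text \<open>The truncation set is a union of cubes of level n, hence also of cubes of the finer
  level -n, so the averaging does not enlarge the support.\<close>

definition appr :: "nat \<Rightarrow> (real^'n \<Rightarrow> complex) \<Rightarrow> real^'n \<Rightarrow> complex" where
  "appr n f = av (\<lambda>_. - int n) (\<lambda>y. indicator (Zs n) y * f y)"

definition locint :: "(real^'n \<Rightarrow> complex) \<Rightarrow> bool" where
  "locint f \<longleftrightarrow> f \<in> \<B> \<and> (\<forall>n. integrable lborel (\<lambda>y. indicator (Zs n) y * f y))"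

lemma Zs_sets [measurable]: "Zs n \<in> sets borel" by (simp add: Zs_def)

lemma Zs_finite: "emeasure lborel (Zs n :: (real^'n) set) < \<infinity>"
  unfolding Zs_def using near_measure[of 2 "int n" "0::real^'n"]
  by (auto intro: le_less_trans)

lemma Zs_ball: "(\<And>i. \<bar>y $ i\<bar> \<le> 2 ^ n) \<Longrightarrow> y \<in> Zs n"
  unfolding Zs_def by (auto intro!: nearI)

lemma near_in_Zs:
  fixes x :: "real^'n"
  shows "\<exists>n0. \<forall>n\<ge>n0. - int n \<le> k \<and> (\<forall>y. near N k x y \<longrightarrow> y \<in> Zs n)"
proof -
  obtain n1 where n1: "norm x + (of_int N + 1) * 2 powi k < 2 ^ n1" using real_arch_pow[of 2] by auto
  show ?thesis
  proof (intro exI[of _ "max n1 (nat \<bar>k\<bar>)"] allI impI conjI)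
    fix n assume n: "max n1 (nat \<bar>k\<bar>) \<le> n"
    then show "- int n \<le> k" by auto
    fix y assume y: "near N k x y"
    have "(2::real) ^ n1 \<le> 2 ^ n" using n by (intro power_increasing) auto
    moreover have "\<bar>y $ i\<bar> \<le> norm x + (of_int N + 1) * 2 powi k" for i
      using near_bound[OF y, of i] component_le_norm_cart[of x i] by linarith
    ultimately show "y \<in> Zs n" using n1 by (intro Zs_ball) (meson less_imp_le order_trans)
  qed
qed

lemma appr_props:
  assumes f: "locint f"
  shows "integrable lborel (appr n f)" "gr (- int n) x = gr (- int n) y \<Longrightarrow> appr n f x = appr n f y"
    "\<exists>B. \<forall>x. norm (appr n f x) \<le> B" "appr n f x \<noteq> 0 \<Longrightarrow> x \<in> Zs n"
proof -
  let ?f = "\<lambda>y. indicator (Zs n) y * f y"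
  have i: "integrable lborel ?f" using f by (simp add: locint_def)
  show "integrable lborel (appr n f)" unfolding appr_def by (rule integrable_av[OF stp_const i])
  show "gr (- int n) x = gr (- int n) y \<Longrightarrow> appr n f x = appr n f y"
    unfolding appr_def using av_cell[OF stp_const, of "- int n" ?f] unfolding sat_def by metis
  let ?c = "ennreal (1 / (2 powi (- int n)) ^ CARD('a)) * (NN y. ennreal (norm (?f y)))"
  have [measurable]: "f \<in> \<B>" using f by (simp add: locint_def)
  have "?c < \<infinity>" using i by (simp add: integrable_iff_bounded ennreal_mult_less_top)
  moreover have "ennreal (norm (appr n f x)) \<le> ?c" for x
    unfolding appr_def by (rule order_trans[OF norm_av_le nav_le_integral]) measurable
  ultimately show "\<exists>B. \<forall>x. norm (appr n f x) \<le> B"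
    by (cases ?c) (auto intro!: exI simp: ennreal_le_iff)
  show "appr n f x \<noteq> 0 \<Longrightarrow> x \<in> Zs n"
  proof (rule ccontr)
    assume a: "appr n f x \<noteq> 0" "x \<notin> Zs n"
    have "of_real (ker (\<lambda>_. - int n) x y) * ?f y = 0" for y
    proof (cases "gr (- int n) y = gr (- int n) x")
      case True
      have "gr (int n) y = gr (int n) x" by (rule gr_mono[OF True]) simp
      then have "y \<notin> Zs n" using a(2) by (simp add: Zs_def near_def)
      then show ?thesis by simp
    qed (simp add: ker_def)
    then have "appr n f x = (\<integral>y. 0 \<partial>(lborel :: (real^'a) measure))" unfolding appr_def av_def by (simp only:)
    with a show False by simp
  qed
qed

lemma mdl_appr:
  assumes [measurable]: "f \<in> \<B>" and p: "1 \<le> p"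
  shows "mdl p (appr n f) \<le> mdl p f"
proof -
  let ?f = "\<lambda>y. indicator (Zs n) y * f y"
  have "mdl p (appr n f) \<le> mdl p ?f" unfolding appr_def by (rule mdl_av[OF stp_const _ p]) measurable
  also have "\<dots> \<le> mdl p f"
  proof (cases "p = top")
    case True
    have "norm (?f x) \<le> 1" if "\<forall>x. norm (f x) \<le> 1" for x using that by (auto simp: indicator_def)
    then show ?thesis using True by (auto simp: mdl_def)
  next
    case False
    then show ?thesis unfolding mdl_def by (auto intro!: nn_integral_mono simp: indicator_def)
  qed
  finally show ?thesis .
qed

lemma locint_mdl:
  fixes f :: "real^'n \<Rightarrow> complex"
  assumes [measurable]: "f \<in> \<B>" and p: "1 \<le> p" and fin: "mdl p f < top"
  shows "locint f"
  unfolding locint_def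
proof (intro conjI allI)
  fix n
  show "integrable lborel (\<lambda>y. indicator (Zs n) y * f y)"
  proof (rule integrableI_bounded)
    show "(\<lambda>y. indicator (Zs n) y * f y) \<in> borel_measurable lborel" by measurable
    show "(NN y. ennreal (norm (indicator (Zs n) y * f y))) < \<infinity>"
    proof (cases "p = top")
      case True
      then have b: "norm (f x) \<le> 1" for x using fin mdl_top_bound by auto
      have "(NN y. ennreal (norm (indicator (Zs n) y * f y))) \<le> (NN y. indicator (Zs n) (y::real^'n))"
        using b by (intro nn_integral_mono) (auto simp: indicator_def)
      then show ?thesis using Zs_finite[of n, where 'n = 'n] by (auto intro: le_less_trans)
    next
      case False
      have r: "1 \<le> enn2real p" by (rule enn2real_ge_1[OF p False])
      have "(NN y. ennreal (norm (indicator (Zs n) y * f y)))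
         \<le> (NN y. indicator (Zs n) y + ennreal (norm (f y) powr enn2real p))"
      proof (intro nn_integral_mono)
        fix y
        have "norm (f y) \<le> 1 + norm (f y) powr enn2real p"
        proof (cases "norm (f y) \<le> 1")
          case False
          then have "norm (f y) powr 1 \<le> norm (f y) powr enn2real p" using r by (intro powr_mono) auto
          with False show ?thesis by simp
        qed (simp add: add_increasing2)
        then have "ennreal (norm (f y)) \<le> 1 + ennreal (norm (f y) powr enn2real p)"
          by (simp add: ennreal_plus[symmetric] ennreal_leI flip: ennreal_1 del: ennreal_plus ennreal_1)
        then show "ennreal (norm (indicator (Zs n) y * f y)) \<le> indicator (Zs n) y + ennreal (norm (f y) powr enn2real p)"
          by (auto simp: indicator_def)
      qed
      also have "\<dots> = emeasure lborel (Zs n :: (real^'n) set) + mdl p f"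
        using False by (subst nn_integral_add) (auto simp: mdl_def)
      also have "\<dots> < \<infinity>" using fin Zs_finite[of n] by (simp add: ennreal_add_eq_top less_top)
      finally show ?thesis .
    qed
  qed
qed simp

context body
begin

lemma shift_L_measure: "emeasure lborel {z. z - (x, x) \<in> L k j} = emeasure lborel (L k j)"
proof -
  have "emeasure lborel {z. z - (x, x) \<in> L k j} = (NN z. indicator {z. z - (x, x) \<in> L k j} z)" by simp
  also have "\<dots> = (NN z. indicator (L k j) (z - (x, x)))" by (intro nn_integral_cong) (simp add: indicator_def)
  also have "\<dots> = emeasure lborel (L k j)" by (subst nn_integral_shift(3)) auto
  finally show ?thesis .
qed

text \<open>The measures of the layers decay like 2^(-n), so by Borel-Cantelli almost every point
  lies in finitely many of them, and dominated convergence applies.\<close>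

lemma layer_vanish:
  assumes h [measurable]: "h \<in> \<B>" and fin: "(NN z. h z) < \<infinity>"
  shows "(\<lambda>n. \<integral>\<^sup>+z. indicator {z. z - (x, x) \<in> L k (- int n)} z * h z \<partial>lborel) \<longlonglongrightarrow> 0"
proof -
  let ?S = "\<lambda>n. {z. z - (x, x) \<in> L k (- int n)}"
  \<comment> \<open>From here on \<open>- int n \<le> k\<close>, the range of
    \<open>L_measure\<close>.\<close>
  obtain n0 where n0: "- int n0 \<le> k" using near_in_Zs[of k] by blast
  define c where "c = C1 * 2 powi (- k) / wt k"
  have c: "0 \<le> c" using C1 wt[of k] by (simp add: c_def)
  have e: "emeasure lborel (?S n) \<le> ennreal (c * (1 / 2) ^ n)" if "n0 \<le> n" for n
  proof -
    have nk: "- int n \<le> k" using n0 that by simp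
    have "emeasure lborel (?S n) = ennreal (1 / wt k) * (ennreal (wt k) * emeasure lborel (L k (- int n)))"
      using wt[of k] by (simp add: shift_L_measure mult.assoc[symmetric] ennreal_mult[symmetric])
    also have "\<dots> \<le> ennreal (1 / wt k) * ennreal (C1 * 2 powi (- int n - k))"
      by (intro mult_left_mono L_measure nk) auto
    also have "\<dots> = ennreal (c * (1 / 2) ^ n)"
    proof -
      have "(2::real) powi (- int n - k) = 2 powi (- k) * 2 powi (- int n)"
      proof -
        have "- int n - k = - k + - int n" by simp
        then show ?thesis by (simp only:) (rule power_int_add, simp)
      qed
      also have "(2::real) powi (- int n) = (1 / 2) ^ n" by (simp add: power_int_minus power_one_over inverse_eq_divide)
      finally show ?thesis using wt[of k] C1 by (simp add: ennreal_mult[symmetric] c_def)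
    qed
    finally show ?thesis .
  qed
  have "AE z in lborel. eventually (\<lambda>n. z \<in> space lborel - ?S (n + n0)) sequentially"
  proof (rule borel_cantelli_AE1)
    show "?S (n + n0) \<in> sets lborel" for n by measurable
    show "emeasure lborel (?S (n + n0)) < \<infinity>" for n using e[of "n + n0"] by (auto intro: le_less_trans)
    have m: "measure lborel (?S (n + n0)) \<le> c * (1 / 2) ^ (n + n0)" for n
    proof -
      have "measure lborel (?S (n + n0)) \<le> enn2real (ennreal (c * (1 / 2) ^ (n + n0)))"
        unfolding measure_def by (intro enn2real_mono e) auto
      then show ?thesis using c by simp
    qed
    show "summable (\<lambda>n. measure lborel (?S (n + n0)))"
    proof (rule summable_comparison_test')
      show "summable (\<lambda>n. c * (1 / 2) ^ (n + n0))"
        by (simp add: power_add mult.assoc[symmetric] summable_mult summable_mult2 summable_geometric)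
      show "norm (measure lborel (?S (n + n0))) \<le> c * (1 / 2) ^ (n + n0)" for n using m[of n] by simp
    qed
  qed
  then have ae: "AE z in lborel. (\<lambda>n. indicator (?S (n + n0)) z * h z) \<longlonglongrightarrow> 0"
  proof eventually_elim
    case (elim z)
    then have "eventually (\<lambda>n. indicator (?S (n + n0)) z * h z = 0) sequentially"
      by eventually_elim (auto simp: indicator_def)
    then show ?case by (rule tendsto_eventually)
  qed
  have "(\<lambda>n. \<integral>\<^sup>+z. indicator (?S (n + n0)) z * h z \<partial>lborel) \<longlonglongrightarrow> (\<integral>\<^sup>+z. 0 \<partial>(lborel :: ((real^'n) \<times> (real^'n)) measure))"
    by (rule nn_integral_dominated_convergence[where w = h]) (use fin ae in \<open>auto simp: indicator_def\<close>)
  then show ?thesis using LIMSEQ_offset[of "\<lambda>n. \<integral>\<^sup>+z. indicator (?S n) z * h z \<partial>lborel" n0] by simp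
qed

text \<open>Convergence holds at every \<open>x\<close>, without an exceptional null set: over
  products of small cubes inside the region the integrals agree exactly, and the products crossing
  its boundary lie in layers whose contribution vanishes in the limit.\<close>

lemma A_conv:
  assumes f: "locint f1" "locint f2"
  shows "(\<lambda>n. A k (appr n f1) (appr n f2) x) \<longlonglongrightarrow> A k f1 f2 x"
proof -
  have [measurable]: "f1 \<in> \<B>" "f2 \<in> \<B>" using f by (auto simp: locint_def)
  obtain n0 where n0: "\<And>n. n0 \<le> n \<Longrightarrow> - int n \<le> k" "\<And>n y. n0 \<le> n \<Longrightarrow> near N k x y \<Longrightarrow> y \<in> Zs n"
    using near_in_Zs[of k N x] by blast
  define F where "F f n = (\<lambda>y. indicator (Zs n) y * f y :: complex)" for f :: "real^'n \<Rightarrow> complex" and n :: nat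
  have F: "integrable lborel (F f1 n)" "integrable lborel (F f2 n)" for n using f by (auto simp: F_def locint_def)
  \<comment> \<open>A dominating function: for large \<open>n\<close> every product of small cubes
    that meets the region has both factors in the neighbourhood of \<open>x\<close> at level
    \<open>k\<close>.\<close>
  define h where "h z = (indicator {y. near N k x y} (fst z) * ennreal (norm (f1 (fst z)))) *
    (indicator {y. near N k x y} (snd z) * ennreal (norm (f2 (snd z))))" for z
  have "h \<in> borel_measurable (borel \<Otimes>\<^sub>M borel)" unfolding h_def by measurable
  then have h [measurable]: "h \<in> \<B>" by (simp add: borel_prod)
  have fin: "(NN z. h z) < \<infinity>"
  proof -
    have "(NN z. h z) = (NN a. NN b. h (a, b))" by (rule nn_integral_lborel_pair(1)[OF h])
    also have "\<dots> = (NN a. indicator {y. near N k x y} a * ennreal (norm (f1 a))) * (NN b. indicator {y. near N k x y} b * ennreal (norm (f2 b)))"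
      unfolding h_def by (simp add: nn_integral_cmult nn_integral_multc)
    also have "\<dots> \<le> (NN a. ennreal (norm (F f1 n0 a))) * (NN b. ennreal (norm (F f2 n0 b)))"
      using n0(2)[OF order_refl] by (intro mult_mono nn_integral_mono) (auto simp: F_def indicator_def)
    also have "\<dots> < \<infinity>" using F[of n0] by (simp add: integrable_iff_bounded ennreal_mult_less_top)
    finally show ?thesis .
  qed
  define V where "V n = {z. z \<notin> In (\<lambda>_. - int n) k x \<and>
    (\<exists>y1 y2. gr (- int n) y1 = gr (- int n) (fst z) \<and> gr (- int n) y2 = gr (- int n) (snd z) \<and> (y1, y2) - (x, x) \<in> R k)}" for n :: nat
  have V: "sat2 (\<lambda>_. - int n) (V n)" for n
    unfolding sat2_def V_def In_def by simp
  have VL: "z - (x, x) \<in> L k (- int n)" "near N k x (fst z)" "near N k x (snd z)" if z: "z \<in> V n" and n: "n0 \<le> n" for z n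
  proof -
    obtain y1 y2 where y: "gr (- int n) y1 = gr (- int n) (fst z)" "gr (- int n) y2 = gr (- int n) (snd z)" "(y1, y2) - (x, x) \<in> R k"
      using z by (auto simp: V_def)
    obtain w1 w2 where w: "gr (- int n) w1 = gr (- int n) (fst z)" "gr (- int n) w2 = gr (- int n) (snd z)" "(w1, w2) - (x, x) \<notin> R k"
      using z by (auto simp: V_def In_def)
    show "z - (x, x) \<in> L k (- int n)"
    proof (rule L_I[OF y(3) w(3)])
      have "norm (z - (y1, y2)) \<le> 2 * real CARD('n) * 2 powi (- int n)" by (rule norm_pair_cell) (use y in simp_all)
      then show "norm (z - (x, x) - ((y1, y2) - (x, x))) \<le> 2 * real CARD('n) * 2 powi (- int n)" by (simp only: diff_diff_cancel_right)
      have "norm (z - (w1, w2)) \<le> 2 * real CARD('n) * 2 powi (- int n)" by (rule norm_pair_cell) (use w in simp_all)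
      then show "norm (z - (x, x) - ((w1, w2) - (x, x))) \<le> 2 * real CARD('n) * 2 powi (- int n)" by (simp only: diff_diff_cancel_right)
    qed
    have nn: "near N k x y1" "near N k x y2" using R_near[OF y(3)] by auto
    have "gr k y1 = gr k (fst z)" "gr k y2 = gr k (snd z)" using gr_mono[OF y(1) n0(1)[OF n]] gr_mono[OF y(2) n0(1)[OF n]] by auto
    with nn show "near N k x (fst z)" "near N k x (snd z)" by (simp_all add: near_def)
  qed
  let ?S = "\<lambda>n. {z. z - (x, x) \<in> L k (- int n)}"
  have bound: "ennreal (norm (A k f1 f2 x - A k (appr n f1) (appr n f2) x)) \<le> ennreal (2 * wt k) * (NN z. indicator (?S n) z * h z)" if n: "n0 \<le> n" for n
  proof -
    have "A k f1 f2 x = A k (F f1 n) (F f2 n) x"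
      unfolding A_def F_def
    proof (rule arg_cong2[where f = "(*)"], rule refl, rule Bochner_Integration.integral_cong, rule refl)
      fix z :: "(real^'n) \<times> (real^'n)"
      show "indicator {z. z - (x, x) \<in> R k} z * (f1 (fst z) * f2 (snd z)) =
        indicator {z. z - (x, x) \<in> R k} z * (indicator (Zs n) (fst z) * f1 (fst z) * (indicator (Zs n) (snd z) * f2 (snd z)))"
        using R_near[of z x k] n0(2)[OF n] by (auto simp: indicator_def)
    qed
    moreover have "appr n f1 = av (\<lambda>_. - int n) (F f1 n)" "appr n f2 = av (\<lambda>_. - int n) (F f2 n)"
      by (simp_all add: appr_def F_def fun_eq_iff)
    moreover have "ennreal (norm (A k (F f1 n) (F f2 n) x - A k (av (\<lambda>_. - int n) (F f1 n)) (av (\<lambda>_. - int n) (F f2 n)) x)) \<le>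
      ennreal (2 * wt k) * (NN z. indicator (V n) z * (ennreal (norm (F f1 n (fst z))) * ennreal (norm (F f2 n (snd z)))))"
    proof (rule A_sat_le[OF stp_const F V])
      fix z assume z: "z - (x, x) \<in> R k" "z \<notin> In (\<lambda>_. - int n) k x"
      have "(fst z, snd z) - (x, x) \<in> R k" using z(1) by (simp only: prod.collapse)
      then show "z \<in> V n \<or> F f1 n (fst z) * F f2 n (snd z) = av (\<lambda>_. - int n) (F f1 n) (fst z) * av (\<lambda>_. - int n) (F f2 n) (snd z)"
        using z unfolding V_def by blast
    qed
    ultimately have "ennreal (norm (A k f1 f2 x - A k (appr n f1) (appr n f2) x)) \<le>
      ennreal (2 * wt k) * (NN z. indicator (V n) z * (ennreal (norm (F f1 n (fst z))) * ennreal (norm (F f2 n (snd z)))))"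
      by simp
    also have "\<dots> \<le> ennreal (2 * wt k) * (NN z. indicator (?S n) z * h z)"
      using VL[OF _ n] by (intro mult_left_mono nn_integral_mono) (auto simp: F_def h_def indicator_def)
    finally show ?thesis .
  qed
  have z: "(\<lambda>n. ennreal (norm (A k f1 f2 x - A k (appr n f1) (appr n f2) x))) \<longlonglongrightarrow> 0"
  proof (rule tendsto_sandwich[OF _ _ tendsto_const])
    show "\<forall>\<^sub>F n in sequentially. ennreal (norm (A k f1 f2 x - A k (appr n f1) (appr n f2) x)) \<le> ennreal (2 * wt k) * (NN z. indicator (?S n) z * h z)"
      using bound by (auto simp: eventually_sequentially)
    show "(\<lambda>n. ennreal (2 * wt k) * (NN z. indicator (?S n) z * h z)) \<longlonglongrightarrow> 0"
      using tendsto_mult_ennreal[OF tendsto_const layer_vanish[OF h fin, of x k], of "ennreal (2 * wt k)"] by simp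
  qed simp
  then have "(\<lambda>n. norm (A k f1 f2 x - A k (appr n f1) (appr n f2) x)) \<longlonglongrightarrow> 0"
    by (simp add: ennreal_tendsto_0_iff)
  then have "(\<lambda>n. A k f1 f2 x - A k (appr n f1) (appr n f2) x) \<longlonglongrightarrow> 0" by (simp add: tendsto_norm_zero_iff)
  from tendsto_diff[OF tendsto_const[of "A k f1 f2 x"] this] show ?thesis by simp
qed

text \<open>The sequence is eventually constant: the tower property applies once
  \<open>- int n \<le> k\<close> and the truncation set contains the cube of
  \<open>x\<close>.\<close>

lemma av_conv:
  assumes f: "locint f"
  shows "(\<lambda>n. av (\<lambda>_. k) (appr n f) x) \<longlonglongrightarrow> av (\<lambda>_. k) f x"
proof -
  obtain n0 where n0: "\<And>n. n0 \<le> n \<Longrightarrow> - int n \<le> k" "\<And>n y. n0 \<le> n \<Longrightarrow> near N k x y \<Longrightarrow> y \<in> Zs n"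
    using near_in_Zs[of k N x] by blast
  have "av (\<lambda>_. k) (appr n f) x = av (\<lambda>_. k) f x" if n: "n0 \<le> n" for n
  proof -
    have "av (\<lambda>_. k) (appr n f) x = av (\<lambda>_. k) (\<lambda>y. indicator (Zs n) y * f y) x"
      unfolding appr_def using f by (intro av_av n0 n) (auto simp: locint_def)
    also have "\<dots> = av (\<lambda>_. k) f x"
      unfolding av_def
    proof (intro Bochner_Integration.integral_cong refl)
      fix y
      have "y \<in> Zs n" if "gr k y = gr k x" by (rule n0(2)[OF n]) (use that N0 in \<open>simp add: near_def\<close>)
      then show "of_real (ker (\<lambda>_. k) x y) * (indicator (Zs n) y * f y) = of_real (ker (\<lambda>_. k) x y) * f y"
        by (auto simp: ker_def)
    qed
    finally show ?thesis .
  qed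
  then have "eventually (\<lambda>n. av (\<lambda>_. k) (appr n f) x = av (\<lambda>_. k) f x) sequentially"
    by (auto simp: eventually_sequentially)
  then show ?thesis by (rule tendsto_eventually)
qed

lemma SF_conv:
  assumes f: "locint f1" "locint f2"
  shows "(\<lambda>n. SF I (appr n f1) (appr n f2) x) \<longlonglongrightarrow> SF I f1 f2 x"
  unfolding SF_def L2_set_def DD_def
  by (intro tendsto_intros A_conv[OF f] av_conv[OF f(1)] av_conv[OF f(2)])

end

text \<open>Where the limit exceeds \<open>c\<close> strictly, so do all but finitely many terms;
  hence Fatou's lemma applies to the indicators.\<close>

lemma fatou_level:
  fixes u :: "nat \<Rightarrow> 'a \<Rightarrow> real"
  assumes [measurable]: "\<And>n. u n \<in> borel_measurable M" "v \<in> borel_measurable M"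
    and lim: "\<And>x. x \<in> space M \<Longrightarrow> (\<lambda>n. u n x) \<longlonglongrightarrow> v x"
    and le: "eventually (\<lambda>n. emeasure M {x\<in>space M. u n x > c} \<le> X) sequentially"
  shows "emeasure M {x\<in>space M. v x > c} \<le> X"
proof -
  let ?i = "\<lambda>n x. indicator {x\<in>space M. u n x > c} x :: ennreal"
  have "emeasure M {x\<in>space M. v x > c} = (\<integral>\<^sup>+x. indicator {x\<in>space M. v x > c} x \<partial>M)" by simp
  also have "\<dots> \<le> (\<integral>\<^sup>+x. liminf (\<lambda>n. ?i n x) \<partial>M)"
  proof (intro nn_integral_mono)
    fix x assume x: "x \<in> space M"
    show "indicator {x\<in>space M. v x > c} x \<le> liminf (\<lambda>n. ?i n x)"
    proof (cases "v x > c")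
      case True
      have "eventually (\<lambda>n. u n x > c) sequentially" using order_tendstoD(1)[OF lim[OF x] True] .
      then have "eventually (\<lambda>n. 1 \<le> ?i n x) sequentially" by eventually_elim (use x in simp)
      then have "1 \<le> liminf (\<lambda>n. ?i n x)" by (rule Liminf_bounded)
      then show ?thesis by (rule order_trans[rotated]) (simp add: indicator_def)
    qed simp
  qed
  also have "\<dots> \<le> liminf (\<lambda>n. \<integral>\<^sup>+x. ?i n x \<partial>M)" by (rule nn_integral_liminf) measurable
  also have "\<dots> \<le> X"
    using Liminf_le[OF sequentially_bot, of "\<lambda>n. \<integral>\<^sup>+x. ?i n x \<partial>M" X] le by simp
  finally show ?thesis .
qed

lemma fatou_nn:
  fixes u :: "nat \<Rightarrow> 'a \<Rightarrow> ennreal"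
  assumes "\<And>n. u n \<in> borel_measurable M"
    and lim: "\<And>x. x \<in> space M \<Longrightarrow> (\<lambda>n. u n x) \<longlonglongrightarrow> v x"
    and le: "eventually (\<lambda>n. (\<integral>\<^sup>+x. u n x \<partial>M) \<le> X) sequentially"
  shows "(\<integral>\<^sup>+x. v x \<partial>M) \<le> X"
proof -
  have "(\<integral>\<^sup>+x. v x \<partial>M) = (\<integral>\<^sup>+x. liminf (\<lambda>n. u n x) \<partial>M)"
    by (intro nn_integral_cong) (simp add: lim_imp_Liminf[OF sequentially_bot lim])
  also have "\<dots> \<le> liminf (\<lambda>n. \<integral>\<^sup>+x. u n x \<partial>M)" by (rule nn_integral_liminf) fact
  also have "\<dots> \<le> X" by (rule Liminf_le[OF sequentially_bot le])
  finally show ?thesis .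
qed

subsection \<open>Maximal functions and the Garsia-Neveu inequality\<close>

lemma nn_integral_powr_interval:
  fixes a s :: real
  assumes "0 < s" "0 \<le> a"
  shows "(NN l. indicator {0<..<a} l * ennreal (s * l powr (s - 1))) = ennreal (a powr s)"
proof -
  have "((\<lambda>l. s * l powr (s - 1)) has_integral (s * (a powr (s - 1 + 1) / (s - 1 + 1)))) {0..a}"
    by (intro has_integral_mult_right has_integral_powr_from_0) (use assms in auto)
  then have "((\<lambda>l. s * l powr (s - 1)) has_integral (a powr s)) {0..a}" using assms by simp
  from nn_integral_has_integral_lebesgue[OF _ this]
  have "(NN l. ennreal (indicator {0..a} l * (s * l powr (s - 1)))) = ennreal (a powr s)"
    using assms by simp
  moreover have "(NN l. indicator {0<..<a} l * ennreal (s * l powr (s - 1)))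
      = (NN l. ennreal (indicator {0..a} l * (s * l powr (s - 1))))"
  proof (rule nn_integral_cong_AE)
    have "AE l in lborel. l \<noteq> 0 \<and> l \<noteq> a" using AE_lborel_singleton[of 0] AE_lborel_singleton[of a] by eventually_elim simp
    then show "AE l in lborel. indicator {0<..<a} l * ennreal (s * l powr (s - 1)) = ennreal (indicator {0..a} l * (s * l powr (s - 1)))"
      by eventually_elim (auto simp: indicator_def)
  qed
  ultimately show ?thesis by simp
qed

text \<open>The weight is there because \<open>MS_Lq\<close> and \<open>garsia\<close> integrate a
  density over level sets.\<close>

lemma layer_cake:
  fixes g :: "real^'n \<Rightarrow> real" and w :: "real^'n \<Rightarrow> ennreal"
  assumes [measurable]: "g \<in> \<B>" "w \<in> \<B>" and s: "0 < s" and g: "\<And>x. 0 \<le> g x"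
  shows "(NN x. w x * ennreal (g x powr s)) =
    (NN l. indicator {0<..} l * ennreal (s * l powr (s - 1)) * (NN x. indicator {x. l < g x} x * w x))"
proof -
  have "(NN x. w x * ennreal (g x powr s))
     = (NN x. NN l. w x * (indicator {0<..<g x} l * ennreal (s * l powr (s - 1))))"
    by (intro nn_integral_cong) (subst nn_integral_cmult, measurable, simp add: nn_integral_powr_interval s g)
  also have "\<dots> = (NN x. NN l. (if 0 < l \<and> l < g x then w x * ennreal (s * l powr (s - 1)) else 0))"
    by (intro nn_integral_cong) (auto simp: indicator_def)
  also have "\<dots> = (NN l. NN x. (if 0 < l \<and> l < g x then w x * ennreal (s * l powr (s - 1)) else 0))"
    by (rule pair_sigma_finite.Fubini'[symmetric]) (auto intro!: pair_sigma_finite.intro sigma_finite_lborel simp: case_prod_unfold)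
  also have "\<dots> = (NN l. indicator {0<..} l * ennreal (s * l powr (s - 1)) * (NN x. indicator {x. l < g x} x * w x))"
    by (intro nn_integral_cong, subst nn_integral_cmult[symmetric], measurable)
      (auto intro!: nn_integral_cong simp: indicator_def ac_simps)
  finally show ?thesis .
qed

lemma nav_nav:
  fixes g :: "real^'n \<Rightarrow> ennreal"
  assumes [measurable]: "g \<in> \<B>" and jk: "j \<le> k"
  shows "nav (\<lambda>_. k) (nav (\<lambda>_. j) g) x = nav (\<lambda>_. k) g x"
proof -
  have "sat (\<lambda>_. j) (\<lambda>y. ennreal (ker (\<lambda>_. k) x y))"
    unfolding sat_def
  proof (intro allI impI)
    fix y z :: "real^'n" assume "gr j z = gr j y"
    from gr_mono[OF this jk] show "ennreal (ker (\<lambda>_. k) x z) = ennreal (ker (\<lambda>_. k) x y)" by (simp add: ker_def)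
  qed
  from nn_integral_sat[OF stp_const this assms(1)] show ?thesis by (simp add: nav_def)
qed

text \<open>For \<open>N = 0\<close> this is the dyadic maximal function from level \<open>m\<close>
  upwards; a larger \<open>N\<close> lets each cube see its neighbours, as averages over dilates
  do.\<close>

definition MS :: "int \<Rightarrow> int \<Rightarrow> (real^'n \<Rightarrow> ennreal) \<Rightarrow> real^'n \<Rightarrow> ennreal" where
  "MS N m g x = (SUP k\<in>{m..}. tav N k g x)"

lemma MS_measurable [measurable]: "MS N m g \<in> \<B>"
  unfolding MS_def by (rule borel_measurable_SUP) auto

lemma MS_ge: "m \<le> k \<Longrightarrow> tav N k g x \<le> MS N m g x"
  unfolding MS_def by (rule SUP_upper) simp

lemma MS_less: "t < MS N m g x \<longleftrightarrow> (\<exists>k\<ge>m. t < tav N k g x)"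
  by (auto simp: MS_def less_SUP_iff)

lemma MS_bound:
  assumes N: "0 \<le> N" and "\<And>y. g y \<le> ennreal B"
  shows "MS N m g (x::real^'n) \<le> ennreal ((2 * of_int N + 1) ^ CARD('n)) * ennreal B"
  unfolding MS_def
  by (intro SUP_least order_trans[OF tav_mono tav_const] assms)

lemma tav_nav:
  fixes g :: "real^'n \<Rightarrow> ennreal"
  assumes [measurable]: "g \<in> \<B>"
  shows "tav N k g x = tav N k (nav (\<lambda>_. k) g) x"
proof -
  have "sat (\<lambda>_. k) (\<lambda>y. ennreal (nker N k x y))" by (auto simp: sat_def nker_def near_def)
  from nn_integral_sat[OF stp_const this assms] show ?thesis by (simp add: tav_def)
qed

lemma tav_0: "tav 0 k g x = nav (\<lambda>_. k) g (x :: real^'n)"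
proof -
  have "near 0 k x y \<longleftrightarrow> gr k y = gr k x" for y by (auto simp: near_def vec_eq_iff)
  then show ?thesis by (simp add: tav_def nav_def nker_def ker_def)
qed

text \<open>The part of \<open>g\<close> below l = t/(2M) contributes at most t/2 to the averages.
  So the part \<open>h\<close> above \<open>l\<close> must have average more than \<open>l\<close>
  on some neighbouring cube, and the enlarged stopping cubes of \<open>h\<close> at height
  \<open>l\<close> cover the level set. Keeping only the values with t < 2 M g on the right makes
  the integration in \<open>t\<close> possible.\<close>

lemma MS_weak:
  fixes g :: "real^'n \<Rightarrow> real"
  assumes g [measurable]: "g \<in> \<B>" and g0: "\<And>x. 0 \<le> g x" and fin: "(NN x. ennreal (g x)) < \<infinity>"
    and N: "0 \<le> N" and t: "0 < t"
  defines "M \<equiv> (2 * of_int N + 1 :: real) ^ CARD('n)"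
  shows "emeasure lborel {x. ennreal t < MS N m (\<lambda>y. ennreal (g y)) x} \<le>
    ennreal (2 * M\<^sup>2 / t) * (NN x. indicator {x. t < 2 * M * g x} x * ennreal (g x))"
proof -
  have M: "1 \<le> M" using N by (simp add: M_def one_le_power)
  define l where "l = t / (2 * M)"
  have l: "0 < l" using t M by (simp add: l_def)
  define h where "h y = indicator {x. t < 2 * M * g x} y * ennreal (g y)" for y
  have [measurable]: "h \<in> \<B>" unfolding h_def by measurable
  have "(NN x. h x) \<le> (NN x. ennreal (g x))"
    by (intro nn_integral_mono) (auto simp: h_def indicator_def)
  then have hfin: "(NN x. h x) < \<infinity>" using fin by (rule le_less_trans)
  let ?P = "\<lambda>k x. nav (\<lambda>_. k) h x > ennreal l"
  interpret stopping m ?P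
  proof
    show "\<exists>K. \<forall>k>K. \<forall>x. \<not> ?P k x" using nav_small[OF _ hfin l] by (simp add: not_less)
  next
    fix k and x y :: "real^'n" assume "gr k x = gr k y"
    from nav_const_cell[OF this] show "?P k x = ?P k y" by (simp only:)
  qed
  have sub: "{x. ennreal t < MS N m (\<lambda>y. ennreal (g y)) x} \<subseteq> enl N"
  proof
    fix x assume "x \<in> {x. ennreal t < MS N m (\<lambda>y. ennreal (g y)) x}"
    then obtain k where k: "m \<le> k" "ennreal t < tav N k (\<lambda>y. ennreal (g y)) x" by (auto simp: MS_less)
    have "\<exists>y. near N k x y \<and> ennreal l < nav (\<lambda>_. k) h y"
    proof (rule ccontr)
      assume "\<not> ?thesis"
      then have le: "nav (\<lambda>_. k) h y \<le> ennreal l" if "near N k x y" for y using that by (auto simp: not_less[symmetric])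
      have "ennreal (g y) \<le> ennreal l + h y" for y
        using M g0[of y] by (auto simp: h_def indicator_def l_def field_simps intro!: ennreal_leI)
      then have "tav N k (\<lambda>y. ennreal (g y)) x \<le> tav N k (\<lambda>y. ennreal l + h y) x" by (intro tav_mono)
      also have "\<dots> = tav N k (\<lambda>_. ennreal l) x + tav N k h x" by (rule tav_add) measurable
      also have "tav N k h x = tav N k (nav (\<lambda>_. k) h) x" by (rule tav_nav) measurable
      also have "\<dots> \<le> tav N k (\<lambda>_. ennreal l) x" by (intro tav_mono le)
      also have "tav N k (\<lambda>_. ennreal l) x + \<dots> \<le> ennreal M * ennreal l + ennreal M * ennreal l"
        unfolding M_def by (intro add_mono tav_const N)
      also have "\<dots> = ennreal t" using M l t by (simp add: ennreal_mult[symmetric] ennreal_plus[symmetric] l_def del: ennreal_plus)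
      finally show False using k(2) by simp
    qed
    then obtain y where y: "near N k x y" "ennreal l < nav (\<lambda>_. k) h y" by auto
    have "k \<le> \<kappa> y" "y \<in> \<Omega>" using lev_max[OF k(1), of y] y(2) by auto
    with near_mono[OF y(1) _ N] show "x \<in> enl N" by (auto simp: enl_def)
  qed
  have "emeasure lborel {x. ennreal t < MS N m (\<lambda>y. ennreal (g y)) x} \<le> emeasure lborel (enl N)"
    by (rule emeasure_mono[OF sub]) simp
  also have "\<dots> \<le> ennreal M * emeasure lborel \<Omega>" unfolding M_def by (rule enl_measure[OF N])
  also have "\<dots> = ennreal (M / l) * (ennreal l * emeasure lborel \<Omega>)"
    using M l by (simp add: mult.assoc[symmetric] ennreal_mult[symmetric])
  also have "\<dots> \<le> ennreal (M / l) * (NN x. indicator \<Omega> x * h x)"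
    using weak_type(1)[OF _ hfin l, of m] by (intro mult_left_mono) auto
  also have "\<dots> \<le> ennreal (M / l) * (NN x. h x)"
    by (intro mult_left_mono nn_integral_mono) (auto simp: indicator_def)
  also have "M / l = 2 * M\<^sup>2 / t" using M t by (simp add: l_def power2_eq_square)
  finally show ?thesis by (simp add: h_def)
qed

text \<open>Integrates \<open>MS_weak\<close> against q t^(q-1); its factor 1/t leaves the exponent
  q - 2, which is integrable at 0 because q > 1.\<close>

lemma MS_Lq:
  fixes g :: "real^'n \<Rightarrow> real"
  assumes g [measurable]: "g \<in> \<B>" and g0: "\<And>x. 0 \<le> g x" and fin: "(NN x. ennreal (g x)) < \<infinity>"
    and N: "0 \<le> N" and q: "1 < q"
  defines "M \<equiv> (2 * of_int N + 1 :: real) ^ CARD('n)"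
  shows "(NN x. ennreal (enn2real (MS N m (\<lambda>y. ennreal (g y)) x) powr q)) \<le>
    ennreal (2 * M\<^sup>2 * q / (q - 1) * (2 * M) powr (q - 1)) * (NN x. ennreal (g x powr q))"
proof -
  have M: "1 \<le> M" using N by (simp add: M_def one_le_power)
  let ?m = "\<lambda>x. enn2real (MS N m (\<lambda>y. ennreal (g y)) x)"
  have "(NN x. ennreal (?m x powr q)) = (NN x. 1 * ennreal (?m x powr q))" by simp
  also have "\<dots> = (NN l. indicator {0<..} l * ennreal (q * l powr (q - 1)) * (NN x. indicator {x. l < ?m x} x * 1))"
    by (rule layer_cake) (use q in auto)
  also have "\<dots> \<le> (NN l. ennreal (2 * M\<^sup>2 * q / (q - 1)) * (indicator {0<..} l * ennreal ((q - 1) * l powr (q - 1 - 1)) *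
      (NN x. indicator {x. l < 2 * M * g x} x * ennreal (g x))))"
  proof (intro nn_integral_mono)
    fix l :: real
    show "indicator {0<..} l * ennreal (q * l powr (q - 1)) * (NN x. indicator {x. l < ?m x} x * 1)
      \<le> ennreal (2 * M\<^sup>2 * q / (q - 1)) * (indicator {0<..} l * ennreal ((q - 1) * l powr (q - 1 - 1)) *
      (NN x. indicator {x. l < 2 * M * g x} x * ennreal (g x)))"
    proof (cases "0 < l")
      case True
      let ?I = "\<integral>\<^sup>+x. indicator {x. l < 2 * M * g x} x * ennreal (g x) \<partial>lborel"
      have "(NN x. indicator {x. l < ?m x} x * 1) = emeasure lborel {x. l < ?m x}" by simp
      also have "\<dots> \<le> emeasure lborel {x. ennreal l < MS N m (\<lambda>y. ennreal (g y)) x}"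
      proof (rule emeasure_mono)
        show "{x. l < ?m x} \<subseteq> {x. ennreal l < MS N m (\<lambda>y. ennreal (g y)) x}"
        proof clarify
          fix x assume "l < ?m x"
          then show "ennreal l < MS N m (\<lambda>y. ennreal (g y)) x"
            using True by (cases "MS N m (\<lambda>y. ennreal (g y)) x") (auto simp: ennreal_lessI)
        qed
      qed measurable
      also have "\<dots> \<le> ennreal (2 * M\<^sup>2 / l) * ?I" unfolding M_def by (rule MS_weak[OF g g0 fin N True])
      finally have "ennreal (q * l powr (q - 1)) * (NN x. indicator {x. l < ?m x} x * 1) \<le> ennreal (q * l powr (q - 1)) * (ennreal (2 * M\<^sup>2 / l) * ?I)"
        by (intro mult_left_mono) auto
      also have "\<dots> = ennreal (q * l powr (q - 1) * (2 * M\<^sup>2 / l)) * ?I"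
        using q True by (subst ennreal_mult) (auto simp: mult.assoc)
      also have "q * l powr (q - 1) * (2 * M\<^sup>2 / l) = 2 * M\<^sup>2 * q / (q - 1) * ((q - 1) * l powr (q - 1 - 1))"
      proof -
        have "l powr (q - 1 - 1) = l powr (q - 1) / l" using True powr_diff[of l "q - 1" 1] by simp
        then show ?thesis using q by simp
      qed
      also have "ennreal (2 * M\<^sup>2 * q / (q - 1) * ((q - 1) * l powr (q - 1 - 1))) * ?I = ennreal (2 * M\<^sup>2 * q / (q - 1)) * (ennreal ((q - 1) * l powr (q - 1 - 1)) * ?I)"
        using q by (subst ennreal_mult) (auto simp: mult.assoc)
      finally show ?thesis using True by simp
    qed simp
  qed
  also have "\<dots> = ennreal (2 * M\<^sup>2 * q / (q - 1)) * (NN l. (indicator {0<..} l * ennreal ((q - 1) * l powr (q - 1 - 1)) *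
      (NN x. indicator {x. l < 2 * M * g x} x * ennreal (g x))))"
  proof (rule nn_integral_cmult)
    have "(\<lambda>p. indicator {p. fst p < 2 * M * g (snd p)} p * ennreal (g (snd p))) \<in> borel_measurable (borel \<Otimes>\<^sub>M borel)"
      by measurable
    then have [measurable]: "(\<lambda>(l, x). indicator {x. l < 2 * M * g x} x * ennreal (g x)) \<in> borel_measurable (borel \<Otimes>\<^sub>M lborel)"
      by (simp add: case_prod_unfold indicator_def cong: if_cong)
    have [measurable]: "(\<lambda>l. \<integral>\<^sup>+x. indicator {x. l < 2 * M * g x} x * ennreal (g x) \<partial>lborel) \<in> \<B>"
      by (rule sigma_finite_measure.borel_measurable_nn_integral[OF sigma_finite_lborel]) fact
    show "(\<lambda>l. indicator {0<..} l * ennreal ((q - 1) * l powr (q - 1 - 1)) * (NN x. indicator {x. l < 2 * M * g x} x * ennreal (g x))) \<in> borel_measurable lborel"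
      by measurable
  qed
  also have "(NN l. (indicator {0<..} l * ennreal ((q - 1) * l powr (q - 1 - 1)) *
      (NN x. indicator {x. l < 2 * M * g x} x * ennreal (g x))))
     = (NN x. ennreal (g x) * ennreal ((2 * M * g x) powr (q - 1)))"
    by (rule layer_cake[symmetric]) (use q M g0 in auto)
  also have "\<dots> = (NN x. ennreal ((2 * M) powr (q - 1)) * ennreal (g x powr q))"
  proof (intro nn_integral_cong)
    fix x
    have "g x * (2 * M * g x) powr (q - 1) = (2 * M) powr (q - 1) * (g x * g x powr (q - 1))"
      using M g0[of x] by (simp add: powr_mult)
    also have "g x * g x powr (q - 1) = g x powr q"
      using g0[of x] by (cases "g x = 0") (auto simp: powr_diff)
    finally show "ennreal (g x) * ennreal ((2 * M * g x) powr (q - 1)) = ennreal ((2 * M) powr (q - 1)) * ennreal (g x powr q)"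
      using g0[of x] by (simp add: ennreal_mult[symmetric])
  qed
  also have "\<dots> = ennreal ((2 * M) powr (q - 1)) * (NN x. ennreal (g x powr q))"
    by (rule nn_integral_cmult) measurable
  also have "ennreal (2 * M\<^sup>2 * q / (q - 1)) * \<dots> = ennreal (2 * M\<^sup>2 * q / (q - 1) * (2 * M) powr (q - 1)) * (NN x. ennreal (g x powr q))"
    using q by (subst ennreal_mult[of "2 * M\<^sup>2 * q / (q - 1)"]) (auto simp: mult.assoc)
  finally show ?thesis .
qed

text \<open>Stopping at height \<open>l\<close> bounds the integral of the positive part of v - l by
  that of \<Theta> over the set where the maximal function exceeds \<open>l\<close>. Multiplied by
  l^(q-2) and integrated in \<open>l\<close>, this bounds the integral of v^q by that of \<Theta>
  Mx^(q-1); Young's inequality and the maximal inequality then absorb Mx. Averaging \<open>u\<close>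
  at level \<open>m\<close> first makes the maximal function from level \<open>m\<close> upwards one
  of \<open>v\<close>.\<close>

lemma garsia:
  fixes u \<Theta> :: "real^'n \<Rightarrow> real"
  assumes u [measurable]: "u \<in> \<B>" and u0: "\<And>x. 0 \<le> u x" and ub: "\<And>x. u x \<le> B"
    and fin: "(NN x. ennreal (u x)) < \<infinity>"
    and \<Theta> [measurable]: "\<Theta> \<in> \<B>" and \<Theta>0: "\<And>x. 0 \<le> \<Theta> x"
    and osc: "\<And>k x. m \<le> k \<Longrightarrow> \<exists>a. nav (\<lambda>_. k) (\<lambda>y. ennreal \<bar>u y - a\<bar>) x \<le> ennreal (\<Theta> x)"
    and q: "1 < q"
  defines "d \<equiv> (2::real) ^ CARD('n) + 1" and "CD \<equiv> 2 * q / (q - 1) * 2 powr (q - 1)"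
  shows "(NN x. ennreal (enn2real (nav (\<lambda>_. m) (\<lambda>y. ennreal (u y)) x) powr q))
    \<le> ennreal (2 powr (q + 1) * d * (2 powr (q + 1) * d * CD) powr (q - 1)) * (NN x. ennreal (\<Theta> x powr q))"
proof -
  let ?u = "\<lambda>y. ennreal (u y)"
  define v where "v x = enn2real (nav (\<lambda>_. m) ?u x)" for x
  define Mx where "Mx x = enn2real (MS 0 m ?u x)" for x
  have B0: "0 \<le> B" using u0 ub order_trans by blast
  have d1: "1 \<le> d" by (simp add: d_def)
  have CD0: "0 \<le> CD" using q by (simp add: CD_def)
  have nb: "nav (\<lambda>_. k) ?u x \<le> ennreal B" for k x
    using nav_mono[of ?u "\<lambda>_. ennreal B" "\<lambda>_. k" x] ub by (simp add: nav_const ennreal_leI)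
  have [measurable]: "nav (\<lambda>_. m) ?u \<in> \<B>" by (rule nav_measurable[OF stp_const])
  have v [measurable]: "v \<in> \<B>" unfolding v_def by measurable
  have [measurable]: "Mx \<in> \<B>" unfolding Mx_def by measurable
  have ve: "ennreal (v x) = nav (\<lambda>_. m) ?u x" for x
    unfolding v_def using le_less_trans[OF nb[of m x]] by (intro ennreal_enn2real) auto
  have v0: "0 \<le> v x" and M0: "0 \<le> Mx x" for x by (simp_all add: v_def Mx_def)
  have vB: "v x \<le> B" for x using nb[of m x] B0 by (simp add: ve[symmetric])
  have Mb: "MS 0 m ?u x < top" for x
    using le_less_trans[OF MS_bound[of 0 ?u B m x]] ub by (simp add: ennreal_leI)
  have vfin: "(NN x. ennreal (v x)) < \<infinity>"
    unfolding ve using nn_integral_nav[OF stp_const, of ?u m] fin by simp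
  have MSv: "MS 0 m ?u x = MS 0 m (\<lambda>y. ennreal (v y)) x" for x
    unfolding MS_def by (intro SUP_cong refl) (simp add: tav_0 ve nav_nav)
  have level: "(NN x. ennreal (v x - l)) \<le> ennreal d * (NN x. indicator {x. l < Mx x} x * ennreal (\<Theta> x))"
    if l: "0 < l" for l
  proof -
    let ?P = "\<lambda>k x. nav (\<lambda>_. k) ?u x > ennreal l"
    interpret stopping m ?P
    proof
      show "\<exists>K. \<forall>k>K. \<forall>x. \<not> ?P k x" using nav_small[OF _ fin l] by (simp add: not_less)
    next
      fix k and x y :: "real^'n" assume "gr k x = gr k y"
      from nav_const_cell[OF this] show "?P k x = ?P k y" by (simp only:)
    qed
    \<comment> \<open>\<open>ennreal\<close> sends negative values to 0, so this is the positive
      part.\<close>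
    let ?p = "\<lambda>y. ennreal (u y - l)"
    have Om: "x \<in> \<Omega> \<longleftrightarrow> l < Mx x" for x
    proof -
      have "x \<in> \<Omega> \<longleftrightarrow> ennreal l < MS 0 m ?u x" by (simp add: stopped_def MS_less tav_0)
      also have "\<dots> \<longleftrightarrow> l < Mx x" using Mb[of x] l unfolding Mx_def
        by (cases "MS 0 m ?u x") (auto simp: ennreal_less_iff)
      finally show ?thesis .
    qed
    have jen: "ennreal (v x - l) \<le> nav (\<lambda>_. m) ?p x" for x
    proof -
      have "ennreal (u y) \<le> ?p y + ennreal l" for y
        using l by (cases "u y \<le> l") (auto simp: ennreal_plus[symmetric] ennreal_neg intro!: ennreal_leI simp del: ennreal_plus)
      then have "nav (\<lambda>_. m) ?u x \<le> nav (\<lambda>_. m) (\<lambda>y. ?p y + ennreal l) x" by (rule nav_mono)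
      also have "\<dots> = nav (\<lambda>_. m) ?p x + ennreal l" by (subst nav_add) (auto simp: nav_const)
      finally have *: "ennreal (v x) \<le> nav (\<lambda>_. m) ?p x + ennreal l" by (simp add: ve)
      show ?thesis
        using * l v0[of x] by (cases "nav (\<lambda>_. m) ?p x") (auto simp: ennreal_plus[symmetric] intro!: ennreal_leI simp del: ennreal_plus)
    qed
    have out: "ennreal (v x - l) = 0" if "x \<notin> \<Omega>" for x
    proof -
      have "\<not> ?P m x" using that lev_max(2)[of m x] by auto
      then have "v x \<le> l" using l by (simp add: ve[symmetric] not_less)
      then show ?thesis by (simp add: ennreal_neg)
    qed
    \<comment> \<open>On the parent of the stopping cube \<open>u\<close> has average at most
      \<open>l\<close> and oscillates by at most \<Theta> around some \<open>a\<close>, so a - l <=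
      \<Theta>. Restricting |u - a| from the parent to the cube costs 2^d; together this gives
      \<open>d\<close>.\<close>
    have stopb: "nav \<kappa> ?p x \<le> ennreal d * ennreal (\<Theta> x)" if x: "x \<in> \<Omega>" for x
    proof -
      let ?k = "\<kappa> x + 1"
      have mk: "m \<le> ?k" using lev_ge[of x] by simp
      obtain a where a: "nav (\<lambda>_. ?k) (\<lambda>y. ennreal \<bar>u y - a\<bar>) x \<le> ennreal (\<Theta> x)" using osc[OF mk] by blast
      have par: "nav (\<lambda>_. ?k) ?u x \<le> ennreal l" using not_above[of x ?k] by (simp add: not_less)
      have al: "ennreal (a - l) \<le> ennreal (\<Theta> x)"
      proof (cases "a \<le> l")
        case False
        have "ennreal a \<le> ennreal \<bar>u y - a\<bar> + ennreal (u y)" for y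
          using u0[of y] by (simp add: ennreal_plus[symmetric] ennreal_leI del: ennreal_plus)
        then have "nav (\<lambda>_. ?k) (\<lambda>_. ennreal a) x \<le> nav (\<lambda>_. ?k) (\<lambda>y. ennreal \<bar>u y - a\<bar> + ennreal (u y)) x" by (rule nav_mono)
        also have "\<dots> = nav (\<lambda>_. ?k) (\<lambda>y. ennreal \<bar>u y - a\<bar>) x + nav (\<lambda>_. ?k) ?u x" by (rule nav_add) measurable
        also have "\<dots> \<le> ennreal (\<Theta> x) + ennreal l" by (intro add_mono a par)
        finally show ?thesis using \<Theta>0[of x] l by (auto simp: nav_const ennreal_plus[symmetric] intro!: ennreal_leI simp del: ennreal_plus)
      qed (simp add: ennreal_neg)
      have "?p y \<le> ennreal \<bar>u y - a\<bar> + ennreal (a - l)" for y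
        by (cases "a \<le> l") (auto simp: ennreal_neg ennreal_plus[symmetric] intro!: ennreal_leI simp del: ennreal_plus)
      then have "nav \<kappa> ?p x \<le> nav \<kappa> (\<lambda>y. ennreal \<bar>u y - a\<bar> + ennreal (a - l)) x" by (rule nav_mono)
      also have "\<dots> = nav (\<lambda>_. \<kappa> x) (\<lambda>y. ennreal \<bar>u y - a\<bar>) x + ennreal (a - l)"
        by (subst nav_add) (auto simp: nav_const nav_level[of \<kappa>])
      also have "\<dots> \<le> ennreal (2 ^ CARD('n)) * ennreal (\<Theta> x) + ennreal (\<Theta> x)"
        using al by (intro add_mono order_trans[OF nav_parent mult_left_mono[OF a]]) auto
      also have "\<dots> = ennreal d * ennreal (\<Theta> x)" by (simp add: d_def distrib_right)
      finally show ?thesis .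
    qed
    have m_sat: "sat (\<lambda>_. m) (\<lambda>x. indicator \<Omega> x :: ennreal)"
      unfolding sat_def
    proof (intro allI impI)
      fix x y :: "real^'n" assume "gr m y = gr m x"
      then have "y \<in> \<Omega> \<longleftrightarrow> x \<in> \<Omega>"
        using stp_fine(1)[OF stp, of x y] stopped_sat[of x y] by simp
      then show "indicator \<Omega> y = (indicator \<Omega> x :: ennreal)" by (simp add: indicator_def)
    qed
    have "(NN x. ennreal (v x - l)) \<le> (NN x. indicator \<Omega> x * nav (\<lambda>_. m) ?p x)"
      using jen out by (intro nn_integral_mono) (auto simp: indicator_def)
    also have "\<dots> = (NN x. indicator \<Omega> x * ?p x)"
      by (rule nn_integral_sat[OF stp_const m_sat]) auto
    also have "\<dots> = (NN x. indicator \<Omega> x * nav \<kappa> ?p x)"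
      by (rule nn_integral_sat[OF stp sat_stopped, symmetric]) auto
    also have "\<dots> \<le> (NN x. ennreal d * (indicator {x. l < Mx x} x * ennreal (\<Theta> x)))"
      using stopb Om by (intro nn_integral_mono) (auto simp: indicator_def)
    also have "\<dots> = ennreal d * (NN x. indicator {x. l < Mx x} x * ennreal (\<Theta> x))"
      by (rule nn_integral_cmult) measurable
    finally show ?thesis .
  qed
  define IV where "IV = (NN x. ennreal (v x powr q))"
  define IT where "IT = (NN x. ennreal (\<Theta> x powr q))"
  have IM: "(NN x. ennreal (Mx x powr q)) \<le> ennreal CD * IV"
    using MS_Lq[OF v v0 vfin order_refl q, of m] by (simp add: Mx_def MSv CD_def IV_def)
  \<comment> \<open>Finiteness is what permits the absorption at the end; it comes from
    \<open>u\<close> being bounded and integrable.\<close>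
  have IVfin: "IV < top"
  proof -
    have "IV \<le> (NN x. ennreal (B powr (q - 1)) * ennreal (v x))"
      unfolding IV_def
    proof (intro nn_integral_mono)
      fix x
      have "v x powr q = v x powr (q - 1) * v x" using v0[of x] by (cases "v x = 0") (auto simp: powr_diff)
      also have "\<dots> \<le> B powr (q - 1) * v x" using v0[of x] vB[of x] q by (intro mult_right_mono powr_mono2) auto
      finally show "ennreal (v x powr q) \<le> ennreal (B powr (q - 1)) * ennreal (v x)"
        using v0[of x] by (simp add: ennreal_mult[symmetric] ennreal_leI)
    qed
    also have "\<dots> < top" using vfin by (simp add: nn_integral_cmult ennreal_mult_less_top)
    finally show ?thesis .
  qed
  define A where "A = 2 powr (q + 1) * d * CD + 1"
  \<comment> \<open>Where l < v/2, one has v/2 <= v - l, so integrating \<open>level\<close> over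
    \<open>l\<close> produces (v/2)^q on the left.\<close>
  have main: "(NN x. ennreal (v x / 2) * ennreal ((v x / 2) powr (q - 1))) \<le>
      ennreal d * (NN x. ennreal (\<Theta> x) * ennreal (Mx x powr (q - 1)))"
  proof -
    have "(NN x. ennreal (v x / 2) * ennreal ((v x / 2) powr (q - 1)))
      = (NN l. indicator {0<..} l * ennreal ((q - 1) * l powr (q - 1 - 1)) * (NN x. indicator {x. l < v x / 2} x * ennreal (v x / 2)))"
      by (rule layer_cake) (use q v0 in auto)
    also have "\<dots> \<le> (NN l. ennreal d * (indicator {0<..} l * ennreal ((q - 1) * l powr (q - 1 - 1)) * (NN x. indicator {x. l < Mx x} x * ennreal (\<Theta> x))))"
    proof (intro nn_integral_mono)
      fix l :: real
      have "(NN x. indicator {x. l < v x / 2} x * ennreal (v x / 2)) \<le> (NN x. ennreal (v x - l))"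
        by (intro nn_integral_mono) (auto simp: indicator_def intro!: ennreal_leI)
      then have "(NN x. indicator {x. l < v x / 2} x * ennreal (v x / 2)) \<le> ennreal d * (NN x. indicator {x. l < Mx x} x * ennreal (\<Theta> x))" if "0 < l"
        using level[OF that] order_trans by blast
      then show "indicator {0<..} l * ennreal ((q - 1) * l powr (q - 1 - 1)) * (NN x. indicator {x. l < v x / 2} x * ennreal (v x / 2))
         \<le> ennreal d * (indicator {0<..} l * ennreal ((q - 1) * l powr (q - 1 - 1)) * (NN x. indicator {x. l < Mx x} x * ennreal (\<Theta> x)))"
        by (cases "0 < l") (auto simp: mult.left_commute[of "ennreal d"] intro!: mult_left_mono)
    qed
    also have "\<dots> = ennreal d * (NN l. indicator {0<..} l * ennreal ((q - 1) * l powr (q - 1 - 1)) * (NN x. indicator {x. l < Mx x} x * ennreal (\<Theta> x)))"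
    proof (rule nn_integral_cmult)
      have "(\<lambda>p. indicator {p. fst p < Mx (snd p)} p * ennreal (\<Theta> (snd p))) \<in> borel_measurable (borel \<Otimes>\<^sub>M borel)"
        by measurable
      then have [measurable]: "(\<lambda>(l, x). indicator {x. l < Mx x} x * ennreal (\<Theta> x)) \<in> borel_measurable (borel \<Otimes>\<^sub>M lborel)"
        by (simp add: case_prod_unfold indicator_def cong: if_cong)
      have [measurable]: "(\<lambda>l. \<integral>\<^sup>+x. indicator {x. l < Mx x} x * ennreal (\<Theta> x) \<partial>lborel) \<in> \<B>"
        by (rule sigma_finite_measure.borel_measurable_nn_integral[OF sigma_finite_lborel]) fact
      show "(\<lambda>l. indicator {0<..} l * ennreal ((q - 1) * l powr (q - 1 - 1)) * (NN x. indicator {x. l < Mx x} x * ennreal (\<Theta> x))) \<in> borel_measurable lborel"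
        by measurable
    qed
    also have "(NN l. indicator {0<..} l * ennreal ((q - 1) * l powr (q - 1 - 1)) * (NN x. indicator {x. l < Mx x} x * ennreal (\<Theta> x)))
       = (NN x. ennreal (\<Theta> x) * ennreal (Mx x powr (q - 1)))"
      by (rule layer_cake[symmetric]) (use q M0 in auto)
    finally show ?thesis .
  qed
  have young: "\<Theta> x * Mx x powr (q - 1) \<le> a powr (q - 1) * \<Theta> x powr q + Mx x powr q / a" if a: "0 < a" for a x
  proof (cases "Mx x \<le> a * \<Theta> x")
    case True
    have "\<Theta> x * Mx x powr (q - 1) \<le> \<Theta> x * (a * \<Theta> x) powr (q - 1)"
      using True M0[of x] \<Theta>0[of x] q by (intro mult_left_mono powr_mono2) auto
    also have "\<dots> = a powr (q - 1) * (\<Theta> x * \<Theta> x powr (q - 1))" using a \<Theta>0[of x] by (simp add: powr_mult)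
    also have "\<Theta> x * \<Theta> x powr (q - 1) = \<Theta> x powr q" using \<Theta>0[of x] by (cases "\<Theta> x = 0") (auto simp: powr_diff)
    finally show ?thesis using a by (simp add: add_increasing2)
  next
    case False
    then have "\<Theta> x \<le> Mx x / a" using a by (simp add: field_simps)
    then have "\<Theta> x * Mx x powr (q - 1) \<le> Mx x / a * Mx x powr (q - 1)" by (intro mult_right_mono) auto
    also have "\<dots> = Mx x powr q / a" using M0[of x] by (cases "Mx x = 0") (auto simp: powr_diff)
    finally show ?thesis by (simp add: add_increasing)
  qed
  have CDpos: "0 < CD" using q by (simp add: CD_def)
  \<comment> \<open>Chosen so that d CD / a is half of 2^(-q), the coefficient on the left
    side.\<close>
  define a where "a = 2 powr (q + 1) * d * CD"
  have a: "0 < a" using CDpos d1 by (simp add: a_def)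
  have "ennreal (2 powr (- q)) * IV = (NN x. ennreal (v x / 2) * ennreal ((v x / 2) powr (q - 1)))"
  proof -
    have "v x / 2 * (v x / 2) powr (q - 1) = 2 powr (- q) * v x powr q" for x
    proof -
      have "v x / 2 * (v x / 2) powr (q - 1) = (v x / 2) powr q"
        using v0[of x] by (cases "v x = 0") (auto simp: powr_diff)
      also have "\<dots> = 2 powr (- q) * v x powr q" using v0[of x] by (simp add: powr_divide powr_minus_divide)
      finally show ?thesis .
    qed
    then have "ennreal (v x / 2) * ennreal ((v x / 2) powr (q - 1)) = ennreal (2 powr (- q)) * ennreal (v x powr q)" for x
      using v0[of x] by (simp add: ennreal_mult[symmetric])
    then show ?thesis unfolding IV_def by (simp add: nn_integral_cmult)
  qed
  also note main
  also have "ennreal d * (NN x. ennreal (\<Theta> x) * ennreal (Mx x powr (q - 1)))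
      \<le> ennreal d * (NN x. ennreal (a powr (q - 1)) * ennreal (\<Theta> x powr q) + ennreal (1 / a) * ennreal (Mx x powr q))"
    using young[OF a] \<Theta>0 a
    by (intro mult_left_mono nn_integral_mono) (auto simp: ennreal_mult[symmetric] ennreal_plus[symmetric] intro!: ennreal_leI simp del: ennreal_plus)
  also have "\<dots> = ennreal d * (ennreal (a powr (q - 1)) * IT + ennreal (1 / a) * (NN x. ennreal (Mx x powr q)))"
    unfolding IT_def by (simp add: nn_integral_add nn_integral_cmult)
  also have "\<dots> \<le> ennreal d * (ennreal (a powr (q - 1)) * IT + ennreal (1 / a) * (ennreal CD * IV))"
    by (intro mult_left_mono add_left_mono IM) auto
  finally have fin_ineq: "ennreal (2 powr (- q)) * IV \<le> ennreal d * (ennreal (a powr (q - 1)) * IT + ennreal (1 / a) * (ennreal CD * IV))" .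
  have goal: "IV \<le> ennreal (2 powr (q + 1) * d * a powr (q - 1)) * IT"
  proof (cases "IT")
    case (real t)
    obtain s where s: "IV = ennreal s" "0 \<le> s" using IVfin by (cases IV) auto
    have "ennreal d * (ennreal (a powr (q - 1)) * ennreal t + ennreal (1 / a) * (ennreal CD * ennreal s)) = ennreal (d * (a powr (q - 1) * t + 1 / a * (CD * s)))"
      using real s d1 CD0 a by (simp add: ennreal_mult[symmetric] ennreal_plus[symmetric] del: ennreal_plus)
    moreover have "ennreal (2 powr (- q)) * ennreal s = ennreal (2 powr (- q) * s)"
      using s by (simp add: ennreal_mult[symmetric])
    ultimately have "ennreal (2 powr (- q) * s) \<le> ennreal (d * (a powr (q - 1) * t + 1 / a * (CD * s)))"
      using fin_ineq unfolding real(2) s(1) by (simp only:)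
    then have "2 powr (- q) * s \<le> d * (a powr (q - 1) * t + 1 / a * (CD * s))"
      using real s d1 CD0 a by (subst (asm) ennreal_le_iff) (auto intro!: add_nonneg_nonneg mult_nonneg_nonneg)
    also have "\<dots> = d * a powr (q - 1) * t + (d * CD / a) * s" by (simp add: algebra_simps)
    also have "d * CD / a = 2 powr (- q) / 2"
      using CDpos d1 by (simp add: a_def powr_add powr_minus_divide)
    finally have "2 powr (- q) * s \<le> 2 * (d * a powr (q - 1) * t)" by simp
    then have "2 powr q * (2 powr (- q) * s) \<le> 2 powr q * (2 * (d * a powr (q - 1) * t))" by (intro mult_left_mono) auto
    then have "s \<le> 2 powr (q + 1) * d * a powr (q - 1) * t" by (simp add: powr_minus powr_add mult.assoc[symmetric])
    then show ?thesis using real s d1 by (simp add: ennreal_mult[symmetric] ennreal_leI)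
  next
    case top
    have "0 < 2 powr (q + 1) * d * a powr (q - 1)" using d1 a by simp
    then show ?thesis using top d1 a by (simp add: ennreal_mult_top)
  qed
  then show ?thesis by (simp add: IV_def IT_def v_def a_def)
qed

subsection \<open>The oscillation of the square function on a cube\<close>

text \<open>Subadditivity follows from t <= t^(1/4) on [0,1], applied to the shares of
  \<open>a\<close> and \<open>b\<close> in \<open>a + b\<close>.\<close>

lemma powr_quarter_diff:
  fixes a b :: real
  assumes "0 \<le> a" "0 \<le> b"
  shows "(a + b) powr (1/4) \<le> a powr (1/4) + b powr (1/4)"
proof (cases "a = 0 \<or> b = 0")
  case False
  then have ab: "0 < a" "0 < b" using assms by auto
  have "a / (a + b) \<le> (a / (a + b)) powr (1/4)" "b / (a + b) \<le> (b / (a + b)) powr (1/4)"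
    using ab powr_mono'[of "1/4" 1 "a / (a + b)"] powr_mono'[of "1/4" 1 "b / (a + b)"] by auto
  then have "a / (a + b) + b / (a + b) \<le> (a powr (1/4) + b powr (1/4)) / (a + b) powr (1/4)"
    using ab by (simp add: powr_divide add_divide_distrib)
  moreover have "a / (a + b) + b / (a + b) = 1" using ab by (simp add: add_divide_distrib[symmetric])
  ultimately show ?thesis using ab by (simp add: le_divide_eq)
qed (use assms in auto)

lemma powr_quarter_abs:
  fixes a b :: real
  assumes "0 \<le> a" "0 \<le> b"
  shows "\<bar>a powr (1/4) - b powr (1/4)\<bar> \<le> \<bar>a - b\<bar> powr (1/4)"
proof -
  have *: "a powr (1/4) - b powr (1/4) \<le> \<bar>a - b\<bar> powr (1/4)" if "0 \<le> a" "0 \<le> b" for a b :: real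
  proof -
    have "a powr (1/4) \<le> (\<bar>a - b\<bar> + b) powr (1/4)" using that by (intro powr_mono2) auto
    also have "\<dots> \<le> \<bar>a - b\<bar> powr (1/4) + b powr (1/4)" using that by (intro powr_quarter_diff) auto
    finally show ?thesis by simp
  qed
  from *[OF assms] *[OF assms(2,1)] show ?thesis by (simp add: abs_le_iff abs_minus_commute)
qed

text \<open>
  Replaces Hoelder's inequality on boundary layers: \<open>\<tau>\<close> is charged to the small measure of the layer, the
  other term to the whole cube.
\<close>

lemma young_split:
  fixes F :: real
  assumes tau: "0 < \<tau>" and r: "1 < r" and F: "0 \<le> F"
  shows "F \<le> \<tau> + \<tau> powr (1 - r) * F powr r"
proof (cases "F \<le> \<tau>")
  case False
  then have "\<tau> powr (r - 1) \<le> F powr (r - 1)" using tau r by (intro powr_mono2) auto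
  then have "F * \<tau> powr (r - 1) \<le> F * F powr (r - 1)" using F by (rule mult_left_mono)
  also have "F * F powr (r - 1) = F powr r" using False tau by (simp add: powr_diff)
  finally have "F \<le> F powr r / \<tau> powr (r - 1)" using tau by (simp add: le_divide_eq)
  also have "\<dots> = \<tau> powr (1 - r) * F powr r" using powr_minus_divide[of \<tau> "r - 1"] by simp
  finally show ?thesis using tau by simp
qed (simp add: add_increasing2)

lemma ennreal_term_le_suminf: "f i \<le> suminf (f :: nat \<Rightarrow> ennreal)"
  using sum_le_suminf[of f "{i}"] by simp

text \<open>A tail of c 4^(-n) at height 2^n is summable against the layer heights 2^(n+1), with sum
  4 c; values up to 1 account for the summand 1.\<close>

lemma kolmogorov:
  fixes g :: "real^'n \<Rightarrow> real"
  assumes [measurable]: "g \<in> \<B>" and c: "0 \<le> c"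
    and le: "\<And>n. nav \<kappa> (indicator {y. 2 ^ n < g y}) x \<le> ennreal (c / 4 ^ n)"
  shows "nav \<kappa> (\<lambda>y. ennreal (g y)) x \<le> ennreal (1 + 4 * c)"
proof -
  have pt: "ennreal (g y) \<le> 1 + (\<Sum>n. ennreal (2 ^ (n + 1)) * indicator {y. 2 ^ n < g y} y)" for y
  proof (cases "g y \<le> 1")
    case True
    then have "ennreal (g y) \<le> 1 + 0" by (simp add: ennreal_leI flip: ennreal_1 del: ennreal_1)
    also have "\<dots> \<le> 1 + (\<Sum>n. ennreal (2 ^ (n + 1)) * indicator {y. 2 ^ n < g y} y)" by (intro add_left_mono) auto
    finally show ?thesis .
  next
    case False
    define n where "n = (LEAST n. g y \<le> 2 ^ n)"
    obtain n' where "g y < 2 ^ n'" using real_arch_pow[of 2 "g y"] by auto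
    then have n: "g y \<le> 2 ^ n" unfolding n_def using LeastI[of "\<lambda>n. g y \<le> 2 ^ n" n'] by simp
    have "n \<noteq> 0" using n False by (cases n) auto
    then obtain i where i: "n = Suc i" by (cases n) auto
    have "\<not> g y \<le> 2 ^ i" using not_less_Least[of i "\<lambda>n. g y \<le> 2 ^ n"] i by (simp add: n_def)
    then have "ennreal (g y) \<le> ennreal (2 ^ (i + 1)) * indicator {y. 2 ^ i < g y} y"
      using n i by (simp add: ennreal_leI)
    also have "\<dots> \<le> (\<Sum>n. ennreal (2 ^ (n + 1)) * indicator {y. 2 ^ n < g y} y)"
      by (rule ennreal_term_le_suminf[of "\<lambda>n. ennreal (2 ^ (n + 1)) * indicator {y. 2 ^ n < g y} y" i])
    finally show ?thesis by (simp add: add_increasing)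
  qed
  have "nav \<kappa> (\<lambda>y. ennreal (g y)) x \<le> nav \<kappa> (\<lambda>y. 1 + (\<Sum>n. ennreal (2 ^ (n + 1)) * indicator {y. 2 ^ n < g y} y)) x"
    by (intro nav_mono pt)
  also have "\<dots> = 1 + nav \<kappa> (\<lambda>y. \<Sum>n. ennreal (2 ^ (n + 1)) * indicator {y. 2 ^ n < g y} y) x"
    by (subst nav_add) (auto simp: nav_const)
  also have "nav \<kappa> (\<lambda>y. \<Sum>n. ennreal (2 ^ (n + 1)) * indicator {y. 2 ^ n < g y} y) x
     = (\<Sum>n. ennreal (2 ^ (n + 1)) * nav \<kappa> (indicator {y. 2 ^ n < g y}) x)"
  proof -
    have "nav \<kappa> (\<lambda>y. \<Sum>n. ennreal (2 ^ (n + 1)) * indicator {y. 2 ^ n < g y} y) x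
      = (NN y. (\<Sum>n. ennreal (2 ^ (n + 1)) * (ennreal (ker \<kappa> x y) * indicator {y. 2 ^ n < g y} y)))"
      unfolding nav_def
    proof (rule nn_integral_cong)
      fix y
      have "ennreal (ker \<kappa> x y) * (\<Sum>n. ennreal (2 ^ (n + 1)) * indicator {y. 2 ^ n < g y} y)
         = (\<Sum>n. ennreal (ker \<kappa> x y) * (ennreal (2 ^ (n + 1)) * indicator {y. 2 ^ n < g y} y))"
        by (rule ennreal_suminf_cmult[symmetric])
      then show "ennreal (ker \<kappa> x y) * (\<Sum>n. ennreal (2 ^ (n + 1)) * indicator {y. 2 ^ n < g y} y)
         = (\<Sum>n. ennreal (2 ^ (n + 1)) * (ennreal (ker \<kappa> x y) * indicator {y. 2 ^ n < g y} y))"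
        by (simp only: mult.left_commute)
    qed
    also have "\<dots> = (\<Sum>n. \<integral>\<^sup>+y. ennreal (2 ^ (n + 1)) * (ennreal (ker \<kappa> x y) * indicator {y. 2 ^ n < g y} y) \<partial>lborel)"
      by (rule nn_integral_suminf) measurable
    also have "\<dots> = (\<Sum>n. ennreal (2 ^ (n + 1)) * nav \<kappa> (indicator {y. 2 ^ n < g y}) x)"
      unfolding nav_def by (intro suminf_cong nn_integral_cmult) measurable
    finally show ?thesis .
  qed
  also have "\<dots> \<le> (\<Sum>n. ennreal (2 * c * (1 / 2) ^ n))"
  proof (intro suminf_le)
    fix n
    have "ennreal (2 ^ (n + 1)) * nav \<kappa> (indicator {y. 2 ^ n < g y}) x \<le> ennreal (2 ^ (n + 1)) * ennreal (c / 4 ^ n)"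
      by (intro mult_left_mono le) auto
    also have "\<dots> = ennreal (2 ^ (n + 1) * (c / 4 ^ n))" using c by (intro ennreal_mult[symmetric]) auto
    also have "2 ^ (n + 1) * (c / 4 ^ n) = 2 * c * (1 / 2) ^ n"
    proof -
      have "(4::real) ^ n = 2 ^ n * 2 ^ n" by (simp add: power_mult_distrib[symmetric])
      then show ?thesis by (simp add: power_one_over)
    qed
    finally show "ennreal (2 ^ (n + 1)) * nav \<kappa> (indicator {y. 2 ^ n < g y}) x \<le> ennreal (2 * c * (1 / 2) ^ n)" .
  qed auto
  also have "\<dots> = ennreal (4 * c)"
  proof -
    have "(\<lambda>n. 2 * c * (1 / 2) ^ n) sums (2 * c * (1 / (1 - 1 / 2)))" by (intro sums_mult geometric_sums) auto
    then have s: "(\<lambda>n. 2 * c * (1 / 2) ^ n) sums (4 * c)" by simp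
    show ?thesis by (rule suminf_ennreal_eq[OF _ s]) (use c in auto)
  qed
  finally show ?thesis using c ennreal_plus[of 1 "4 * c"] by (simp del: ennreal_plus)
qed

section \<open>Scaling, locality and dependence on the base point\<close>

context body
begin

lemma A_scale: "A k (\<lambda>x. c1 * f1 x) (\<lambda>x. c2 * f2 x) x = c1 * c2 * A k f1 f2 x"
proof -
  have "(\<lambda>z. indicator {z. z - (x, x) \<in> R k} z * (c1 * f1 (fst z) * (c2 * f2 (snd z))))
     = (\<lambda>z. (c1 * c2) * (indicator {z. z - (x, x) \<in> R k} z * (f1 (fst z) * f2 (snd z))))" by (simp add: fun_eq_iff ac_simps)
  then show ?thesis unfolding A_def by (simp only: integral_mult_right_zero) simp
qed

lemma av_scale: "av \<kappa> (\<lambda>x. c * f x) x = c * av \<kappa> f x"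
  by (rule av_sat_mult) (simp add: sat_def)

lemma SF_scale: "SF I (\<lambda>x. c1 * f1 x) (\<lambda>x. c2 * f2 x) x = norm (c1 * c2) * SF I f1 f2 x"
proof -
  have "DD k (\<lambda>x. c1 * f1 x) (\<lambda>x. c2 * f2 x) x = (c1 * c2) * DD k f1 f2 x" for k
    by (simp add: DD_def A_scale av_scale algebra_simps)
  then show ?thesis by (simp add: SF_def norm_mult L2_set_right_distrib)
qed

lemma DD_cong_near:
  assumes "\<And>y. near N k x y \<Longrightarrow> f1 y = g1 y" "\<And>y. near N k x y \<Longrightarrow> f2 y = g2 y"
  shows "DD k f1 f2 x = DD k g1 g2 x"
proof -
  have "A k f1 f2 x = A k g1 g2 x"
    unfolding A_def
  proof (rule arg_cong2[where f = "(*)"], rule refl, rule Bochner_Integration.integral_cong, rule refl)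
    fix z :: "(real^'n) \<times> (real^'n)"
    show "indicator {z. z - (x, x) \<in> R k} z * (f1 (fst z) * f2 (snd z)) = indicator {z. z - (x, x) \<in> R k} z * (g1 (fst z) * g2 (snd z))"
      using R_near[of z x k] assms by (auto simp: indicator_def)
  qed
  have av_eq: "av (\<lambda>_. k) f x = av (\<lambda>_. k) g x" if "\<And>y. near N k x y \<Longrightarrow> f y = g y" for f g
    unfolding av_def
  proof (rule Bochner_Integration.integral_cong, rule refl)
    fix y
    have "near N k x y" if "gr k y = gr k x" using that N0 by (simp add: near_def)
    with that show "of_real (ker (\<lambda>_. k) x y) * f y = of_real (ker (\<lambda>_. k) x y) * g y" by (simp add: ker_def)
  qed
  from \<open>A k f1 f2 x = A k g1 g2 x\<close> show ?thesis unfolding DD_def by (simp only: av_eq[of f1 g1, OF assms(1)] av_eq[of f2 g2, OF assms(2)])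
qed

lemma A_bound:
  assumes f: "integrable lborel f1" "integrable lborel f2" and B: "\<And>x. norm (f1 x) \<le> B" "\<And>x. norm (f2 x) \<le> B"
  shows "norm (A k f1 f2 x) \<le> B\<^sup>2"
proof -
  let ?W = "{z. z - (x, x) \<in> R k}"
  have B0: "0 \<le> B" using B(1) norm_ge_zero order_trans by blast
  have int: "integrable lborel (\<lambda>z. indicator ?W z * (f1 (fst z) * f2 (snd z)))"
    by (rule integrable_tensor'[OF f]) measurable
  have "ennreal (norm (A k f1 f2 x)) = ennreal (wt k) * ennreal (norm (\<integral>z. indicator ?W z * (f1 (fst z) * f2 (snd z)) \<partial>lborel))"
    unfolding A_def using wt[of k] by (simp add: norm_mult ennreal_mult)
  also have "\<dots> \<le> ennreal (wt k) * (NN z. ennreal (norm (indicator ?W z * (f1 (fst z) * f2 (snd z)))))"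
    by (intro mult_left_mono integral_norm_bound_ennreal int) auto
  also have "\<dots> \<le> ennreal (wt k) * (NN z. ennreal (B\<^sup>2) * indicator ?W z)"
    using B B0 by (intro mult_left_mono nn_integral_mono) (auto simp: indicator_def norm_mult power2_eq_square intro!: ennreal_leI mult_mono)
  also have "\<dots> = ennreal (B\<^sup>2) * (ennreal (wt k) * emeasure lborel (R k))"
    by (simp add: nn_integral_cmult_indicator shift_R_measure ac_simps)
  also have "\<dots> = ennreal (B\<^sup>2)" by (simp add: R_measure)
  finally show ?thesis by simp
qed

lemma SF_bound:
  assumes f: "integrable lborel f1" "integrable lborel f2" and B: "\<And>x. norm (f1 x) \<le> B" "\<And>x. norm (f2 x) \<le> B"
  shows "SF I f1 f2 x \<le> real (card I) * (2 * B\<^sup>2)"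
proof -
  have B0: "0 \<le> B" using B(1) norm_ge_zero order_trans by blast
  have "norm (DD k f1 f2 x) \<le> 2 * B\<^sup>2" for k
  proof -
    have "norm (DD k f1 f2 x) \<le> norm (A k f1 f2 x) + norm (av (\<lambda>_. k) f1 x * av (\<lambda>_. k) f2 x)"
      unfolding DD_def by (rule norm_triangle_ineq4)
    moreover have "norm (av (\<lambda>_. k) f1 x * av (\<lambda>_. k) f2 x) \<le> B * B"
      unfolding norm_mult using B0 by (intro mult_mono norm_av_bound B) auto
    ultimately show ?thesis using A_bound[OF f B, of k x] by (simp add: power2_eq_square)
  qed
  then have "(\<Sum>k\<in>I. norm (DD k f1 f2 x)) \<le> (\<Sum>k\<in>I. 2 * B\<^sup>2)" by (intro sum_mono)
  moreover have "SF I f1 f2 x \<le> (\<Sum>k\<in>I. norm (DD k f1 f2 x))" unfolding SF_def by (rule L2_set_le_sum) auto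
  ultimately show ?thesis by simp
qed

lemma tav_set: "tav N k g x = ennreal (1 / (2 powi k) ^ CARD('n)) * (NN y. indicator {y. near N k x y} y * g y)"
  if [measurable]: "g \<in> \<B>" for g :: "real^'n \<Rightarrow> ennreal"
  unfolding tav_def by (subst nn_integral_cmult[symmetric]) (auto intro!: nn_integral_cong simp: nker_def)

lemma SF_split:
  assumes I: "finite I"
  shows "SF I f1 f2 x \<le> SF {k\<in>I. k \<le> j} f1 f2 x + SF {k\<in>I. j < k} f1 f2 x" "SF {k\<in>I. j < k} f1 f2 x \<le> SF I f1 f2 x"
proof -
  let ?n = "\<lambda>k. (norm (DD k f1 f2 x))\<^sup>2"
  have "(\<Sum>k\<in>I. ?n k) = (\<Sum>k\<in>{k\<in>I. k \<le> j}. ?n k) + (\<Sum>k\<in>{k\<in>I. j < k}. ?n k)"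
    using I by (subst sum.union_disjoint[symmetric]) (auto intro!: sum.cong)
  then show "SF I f1 f2 x \<le> SF {k\<in>I. k \<le> j} f1 f2 x + SF {k\<in>I. j < k} f1 f2 x"
    unfolding SF_def L2_set_def by (simp add: sqrt_add_le_add_sqrt sum_nonneg)
  show "SF {k\<in>I. j < k} f1 f2 x \<le> SF I f1 f2 x"
    unfolding SF_def L2_set_def using I by (intro real_sqrt_le_mono sum_mono2) auto
qed

text \<open>The two points share a cube of level \<open>j\<close>, so at scales above
  \<open>j\<close> their conditional expectations agree and only the averages over dilates can
  change. Scales up to \<open>j\<close> are kept as they are.\<close>

lemma SF_close:
  assumes I: "finite I" and xx: "gr j x = gr j x0"
  shows "\<bar>SF I f1 f2 x - SF {k\<in>I. j < k} f1 f2 x0\<bar> \<le> SF {k\<in>I. k \<le> j} f1 f2 x + (\<Sum>k\<in>{k\<in>I. j < k}. norm (A k f1 f2 x - A k f1 f2 x0))"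
proof -
  let ?J = "{k\<in>I. j < k}"
  have D: "DD k f1 f2 x - DD k f1 f2 x0 = A k f1 f2 x - A k f1 f2 x0" if "k \<in> ?J" for k
  proof -
    have "gr k x = gr k x0" using gr_mono[OF xx, of k] that by simp
    then have "av (\<lambda>_. k) f x = av (\<lambda>_. k) f x0" for f by (simp add: av_def ker_def)
    then show ?thesis by (simp add: DD_def)
  qed
  have 1: "L2_set (\<lambda>k. norm (DD k f1 f2 x - DD k f1 f2 x0)) ?J \<le> (\<Sum>k\<in>?J. norm (A k f1 f2 x - A k f1 f2 x0))"
    by (rule order_trans[OF L2_set_le_sum]) (auto simp: D intro!: sum_mono)
  have 2: "L2_set (\<lambda>k. norm (DD k f1 f2 x0 - DD k f1 f2 x)) ?J \<le> (\<Sum>k\<in>?J. norm (A k f1 f2 x - A k f1 f2 x0))"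
    using 1 by (simp add: norm_minus_commute)
  have 3: "SF ?J f1 f2 x \<le> SF ?J f1 f2 x0 + (\<Sum>k\<in>?J. norm (A k f1 f2 x - A k f1 f2 x0))"
    unfolding SF_def using L2_set_norm_le[of "\<lambda>k. DD k f1 f2 x" ?J "\<lambda>k. DD k f1 f2 x0"] 1 by linarith
  have 4: "SF ?J f1 f2 x0 \<le> SF ?J f1 f2 x + (\<Sum>k\<in>?J. norm (A k f1 f2 x - A k f1 f2 x0))"
    unfolding SF_def using L2_set_norm_le[of "\<lambda>k. DD k f1 f2 x0" ?J "\<lambda>k. DD k f1 f2 x"] 2 by linarith
  have "0 \<le> SF {k\<in>I. k \<le> j} f1 f2 x" by simp
  with 3 4 SF_split(1)[OF I, of f1 f2 x j] SF_split(2)[OF I, of j f1 f2 x] show ?thesis by linarith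
qed

text \<open>Moving the base point inside a cube of level \<open>j\<close> shifts the region by at
  most the width of \<open>L k j\<close>, so the symmetric difference of the two regions lies in
  that layer.\<close>

lemma A_diff_layer:
  assumes f: "integrable lborel f1" "integrable lborel f2" and xx: "gr j x = gr j x0" and jk: "j \<le> k"
  shows "ennreal (norm (A k f1 f2 x - A k f1 f2 x0)) \<le> ennreal (wt k) * (NN z. indicator {z. z - (x0, x0) \<in> L k j} z *
    ((indicator {y. near N k x0 y} (fst z) * ennreal (norm (f1 (fst z)))) * (indicator {y. near N k x0 y} (snd z) * ennreal (norm (f2 (snd z))))))"
proof -
  let ?W = "{z. z - (x, x) \<in> R k}" and ?V = "{z. z - (x0, x0) \<in> R k}"
  let ?F = "\<lambda>z. f1 (fst z) * f2 (snd z)"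
  have i1: "integrable lborel (\<lambda>z. indicator ?W z * ?F z)"
    by (rule integrable_tensor'[OF f]) measurable
  have i2: "integrable lborel (\<lambda>z. indicator ?V z * ?F z)"
    by (rule integrable_tensor'[OF f]) measurable
  have gk: "gr k x = gr k x0" using gr_mono[OF xx jk] .
  have nd: "norm ((x, x) - (x0, x0)) \<le> 2 * real CARD('n) * 2 powi j" by (rule norm_pair_cell) (use xx in auto)
  have inL: "z - (x0, x0) \<in> L k j" "near N k x0 (fst z)" "near N k x0 (snd z)" if "(z \<in> ?W) \<noteq> (z \<in> ?V)" for z
  proof -
    have e: "z - (x0, x0) - (z - (x, x)) = (x, x) - (x0, x0)" by simp
    have p: "0 \<le> 2 * real CARD('n) * 2 powi j" by simp
    show "z - (x0, x0) \<in> L k j"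
    proof (cases "z \<in> ?W")
      case True
      then have "z - (x, x) \<in> R k" "z - (x0, x0) \<notin> R k" using that by auto
      then show ?thesis by (rule L_I) (unfold e, rule nd, use p in simp)
    next
      case False
      then have "z - (x0, x0) \<in> R k" "z - (x, x) \<notin> R k" using that by auto
      then show ?thesis by (rule L_I) (use p in simp, unfold e, rule nd)
    qed
    have "near N k x (fst z) \<and> near N k x (snd z) \<or> near N k x0 (fst z) \<and> near N k x0 (snd z)"
      using that R_near[of z x k] R_near[of z x0 k] by blast
    then show "near N k x0 (fst z)" "near N k x0 (snd z)" using gk by (auto simp: near_def)
  qed
  have "ennreal (norm (A k f1 f2 x - A k f1 f2 x0)) = ennreal (wt k) * ennreal (norm (\<integral>z. indicator ?W z * ?F z - indicator ?V z * ?F z \<partial>lborel))"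
  proof -
    have "A k f1 f2 x - A k f1 f2 x0 = of_real (wt k) * (\<integral>z. indicator ?W z * ?F z - indicator ?V z * ?F z \<partial>lborel)"
    proof -
      have eq: "(\<integral>z. indicator ?W z * ?F z - indicator ?V z * ?F z \<partial>lborel) = (\<integral>z. indicator ?W z * ?F z \<partial>lborel) - (\<integral>z. indicator ?V z * ?F z \<partial>lborel)"
        by (rule Bochner_Integration.integral_diff[OF i1 i2])
      show ?thesis unfolding A_def right_diff_distrib[symmetric] eq ..
    qed
    then show ?thesis using wt[of k] by (simp only: norm_mult norm_of_real) (simp add: ennreal_mult)
  qed
  also have "\<dots> \<le> ennreal (wt k) * (NN z. ennreal (norm (indicator ?W z * ?F z - indicator ?V z * ?F z)))"
    by (intro mult_left_mono integral_norm_bound_ennreal Bochner_Integration.integrable_diff i1 i2) auto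
  also have "\<dots> \<le> ennreal (wt k) * (NN z. indicator {z. z - (x0, x0) \<in> L k j} z *
    ((indicator {y. near N k x0 y} (fst z) * ennreal (norm (f1 (fst z)))) * (indicator {y. near N k x0 y} (snd z) * ennreal (norm (f2 (snd z))))))"
  proof (intro mult_left_mono nn_integral_mono)
    fix z
    show "ennreal (norm (indicator ?W z * ?F z - indicator ?V z * ?F z)) \<le> indicator {z. z - (x0, x0) \<in> L k j} z *
    ((indicator {y. near N k x0 y} (fst z) * ennreal (norm (f1 (fst z)))) * (indicator {y. near N k x0 y} (snd z) * ennreal (norm (f2 (snd z)))))"
    proof (cases "(z \<in> ?W) = (z \<in> ?V)")
      case True
      then have "(indicator ?W z :: complex) = indicator ?V z" by (simp add: indicator_def)
      then show ?thesis by simp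
    next
      case False
      have "norm (indicator ?W z * ?F z - indicator ?V z * ?F z) = norm (?F z)" using False by (auto simp: indicator_def)
      then show ?thesis using inL[OF False] by (simp add: norm_mult ennreal_mult)
    qed
  qed auto
  finally show ?thesis .
qed

definition CF :: real where "CF = C1 + 1 / vG"

lemma CF: "0 \<le> CF" using C1 vG by (simp add: CF_def)

text \<open>The small measure of the layer, of order s = 2^(j-k), is played off against averages of
  r-th powers through \<open>young_split\<close>. An exponent r > 1 leaves a gain s^(1 - 1/r), which
  makes the sum over coarse scales converge.\<close>

lemma A_diff_le:
  assumes f: "integrable lborel f1" "integrable lborel f2" and xx: "gr j x = gr j x0" and jk: "j \<le> k"
    and r: "1 < r" and th: "0 < \<theta>1" "0 < \<theta>2"
    and T: "tav N k (\<lambda>y. ennreal (norm (f1 y) powr r)) x0 \<le> ennreal (\<theta>1 powr r)" "tav N k (\<lambda>y. ennreal (norm (f2 y) powr r)) x0 \<le> ennreal (\<theta>2 powr r)"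
  shows "norm (A k f1 f2 x - A k f1 f2 x0) \<le> CF * (\<theta>1 * \<theta>2) * (2 powr (- (1 - 1 / r))) ^ nat (k - j)"
proof -
  define s :: real where "s = 2 powi (j - k)"
  define \<theta> where "\<theta> = \<theta>1 * \<theta>2"
  \<comment> \<open>Balances the two terms: \<tau> s and \<tau>^(1-r) \<theta>^r both become
    \<theta> s^(1 - 1/r).\<close>
  define \<tau> where "\<tau> = \<theta> * s powr (- (1 / r))"
  have s: "0 < s" by (simp add: s_def)
  have th0: "0 < \<theta>" using th by (simp add: \<theta>_def)
  have tau: "0 < \<tau>" using s th0 by (simp add: \<tau>_def)
  have [measurable]: "f1 \<in> \<B>" "f2 \<in> \<B>" using f by auto
  let ?A = "{y. near N k x0 y}" and ?S = "{z. z - (x0, x0) \<in> L k j}"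
  let ?g1 = "\<lambda>y. ennreal (norm (f1 y) powr r)" and ?g2 = "\<lambda>y. ennreal (norm (f2 y) powr r)"
  let ?h = "\<lambda>z. (indicator ?A (fst z) * ?g1 (fst z)) * (indicator ?A (snd z) * ?g2 (snd z))"
  have "?h \<in> borel_measurable (borel \<Otimes>\<^sub>M borel)" by measurable
  then have hm: "?h \<in> \<B>" by (simp add: borel_prod)
  have "ennreal (norm (A k f1 f2 x - A k f1 f2 x0)) \<le> ennreal (wt k) * (NN z. indicator ?S z *
    ((indicator ?A (fst z) * ennreal (norm (f1 (fst z)))) * (indicator ?A (snd z) * ennreal (norm (f2 (snd z))))))"
    by (rule A_diff_layer[OF f xx jk])
  also have "\<dots> \<le> ennreal (wt k) * (NN z. ennreal \<tau> * indicator ?S z + ennreal (\<tau> powr (1 - r)) * ?h z)"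
  proof (intro mult_left_mono nn_integral_mono)
    fix z :: "(real^'n) \<times> (real^'n)"
    have "ennreal (norm (f1 (fst z)) * norm (f2 (snd z))) \<le> ennreal (\<tau> + \<tau> powr (1 - r) * (norm (f1 (fst z)) * norm (f2 (snd z))) powr r)"
      by (intro ennreal_leI young_split tau r) auto
    also have "\<dots> = ennreal \<tau> + ennreal (\<tau> powr (1 - r)) * (?g1 (fst z) * ?g2 (snd z))"
      using tau by (simp add: powr_mult ennreal_mult)
    finally have "ennreal (norm (f1 (fst z))) * ennreal (norm (f2 (snd z))) \<le> ennreal \<tau> + ennreal (\<tau> powr (1 - r)) * (?g1 (fst z) * ?g2 (snd z))"
      by (simp add: ennreal_mult)
    then show "indicator ?S z * ((indicator ?A (fst z) * ennreal (norm (f1 (fst z)))) * (indicator ?A (snd z) * ennreal (norm (f2 (snd z)))))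
      \<le> ennreal \<tau> * indicator ?S z + ennreal (\<tau> powr (1 - r)) * ?h z"
      by (auto simp: indicator_def)
  qed auto
  also have "(NN z. ennreal \<tau> * indicator ?S z + ennreal (\<tau> powr (1 - r)) * ?h z)
     = ennreal \<tau> * emeasure lborel (L k j) + ennreal (\<tau> powr (1 - r)) * (NN z. ?h z)"
    using hm by (subst nn_integral_add) (auto simp: nn_integral_cmult shift_L_measure)
  also have "(NN z. ?h z) = (NN y. indicator ?A y * ?g1 y) * (NN y. indicator ?A y * ?g2 y)"
    by (subst nn_integral_lborel_pair(1)[OF hm]) (simp add: nn_integral_cmult nn_integral_multc)
  also have "ennreal (wt k) * (ennreal \<tau> * emeasure lborel (L k j) + ennreal (\<tau> powr (1 - r)) * ((NN y. indicator ?A y * ?g1 y) * (NN y. indicator ?A y * ?g2 y)))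
     = ennreal \<tau> * (ennreal (wt k) * emeasure lborel (L k j)) + ennreal (\<tau> powr (1 - r)) * (ennreal (1 / vG) * (tav N k ?g1 x0 * tav N k ?g2 x0))"
  proof -
    have "ennreal (wt k) = ennreal (1 / vG) * (ennreal (1 / (2 powi k) ^ CARD('n)) * ennreal (1 / (2 powi k) ^ CARD('n)))"
      using vG by (simp add: ennreal_mult[symmetric] wt_def mult_2 power_add)
    then show ?thesis unfolding tav_set[of ?g1, simplified] tav_set[of ?g2, simplified] by (simp add: distrib_left ac_simps)
  qed
  also have "\<dots> \<le> ennreal \<tau> * ennreal (C1 * s) + ennreal (\<tau> powr (1 - r)) * (ennreal (1 / vG) * (ennreal (\<theta>1 powr r) * ennreal (\<theta>2 powr r)))"
    unfolding s_def by (intro add_mono mult_left_mono mult_mono L_measure jk T) auto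
  also have "\<dots> = ennreal (\<tau> * (C1 * s) + \<tau> powr (1 - r) * (1 / vG * (\<theta>1 powr r * \<theta>2 powr r)))"
    using tau C1 s vG by (simp add: ennreal_mult[symmetric] ennreal_plus[symmetric] del: ennreal_plus)
  finally have "norm (A k f1 f2 x - A k f1 f2 x0) \<le> \<tau> * (C1 * s) + \<tau> powr (1 - r) * (1 / vG * (\<theta>1 powr r * \<theta>2 powr r))"
    using tau C1 s vG by (subst (asm) ennreal_le_iff) auto
  also have "\<tau> * (C1 * s) = C1 * (\<theta> * s powr (1 - 1 / r))"
    using s by (simp add: \<tau>_def powr_diff powr_minus_divide)
  also have "\<tau> powr (1 - r) * (1 / vG * (\<theta>1 powr r * \<theta>2 powr r)) = 1 / vG * (\<theta> * s powr (1 - 1 / r))"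
  proof -
    have "\<theta>1 powr r * \<theta>2 powr r = \<theta> powr r" using th by (simp add: \<theta>_def powr_mult)
    moreover have "\<tau> powr (1 - r) = \<theta> powr (1 - r) * s powr (1 - 1 / r)"
    proof -
      have "- (1 / r) * (1 - r) = 1 - 1 / r" using r by (simp add: field_simps)
      then show ?thesis using th0 s by (simp add: \<tau>_def powr_mult powr_powr)
    qed
    moreover have "\<theta> powr (1 - r) * \<theta> powr r = \<theta>" using th0 by (simp add: powr_add[symmetric])
    ultimately show ?thesis by (simp add: ac_simps)
  qed
  also have "C1 * (\<theta> * s powr (1 - 1 / r)) + 1 / vG * (\<theta> * s powr (1 - 1 / r)) = CF * \<theta> * s powr (1 - 1 / r)"
    by (simp add: CF_def algebra_simps)
  also have "s powr (1 - 1 / r) = (2 powr (- (1 - 1 / r))) ^ nat (k - j)"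
  proof -
    have "s = 2 powr (- real (nat (k - j)))"
      using jk by (simp add: s_def powr_real_of_int'[symmetric] flip: powr_realpow)
    then have "s powr (1 - 1 / r) = 2 powr (- (1 - 1 / r) * real (nat (k - j)))"
      by (simp add: powr_powr algebra_simps)
    then show ?thesis by (simp only: powr_powr[symmetric]) (simp add: powr_realpow)
  qed
  finally show ?thesis by (simp add: \<theta>_def)
qed

end

section \<open>Oscillation of the fourth root\<close>

context body
begin

lemma integrable_ind:
  fixes f :: "real^'n \<Rightarrow> complex"
  assumes "integrable lborel f" "B \<in> sets borel"
  shows "integrable lborel (\<lambda>x. indicator B x * f x)"
proof (rule Bochner_Integration.integrable_bound[OF assms(1)])
  show "(\<lambda>x. indicator B x * f x) \<in> borel_measurable lborel" using assms by measurable
qed (auto simp: indicator_def)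

lemma mdl_1_scale:
  assumes [measurable]: "f \<in> \<B>"
  shows "mdl 1 (\<lambda>x. c * f x) = ennreal (norm c) * mdl 1 f"
  by (simp add: mdl_1 norm_mult ennreal_mult nn_integral_cmult)

text \<open>Scales up to \<open>j\<close> do not see beyond the neighbourhood of the cube at level
  \<open>j\<close>, so the functions may be cut off there.\<close>

lemma SF_local:
  assumes "gr j x = gr j x0"
  shows "SF {k\<in>I. k \<le> j} f1 f2 x
    = SF {k\<in>I. k \<le> j} (\<lambda>y. indicator {y. near N j x0 y} y * f1 y) (\<lambda>y. indicator {y. near N j x0 y} y * f2 y) x"
  unfolding SF_def
proof (intro L2_set_cong refl arg_cong[where f = norm])
  fix k assume k: "k \<in> {k\<in>I. k \<le> j}"
  have "near N j x0 y" if "near N k x y" for y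
    using near_mono[OF that _ N0, of j] k assms by (simp add: near_def)
  then show "DD k f1 f2 x = DD k (\<lambda>y. indicator {y. near N j x0 y} y * f1 y) (\<lambda>y. indicator {y. near N j x0 y} y * f2 y) x"
    by (intro DD_cong_near) auto
qed

text \<open>
  The weak endpoint bound gives level sets of size \<open>\<lambda> powr (-1/2)\<close> only, hence the power \<open>1/4 < 1/2\<close>.
\<close>

lemma local_quarter:
  assumes f: "integrable lborel f1" "integrable lborel f2"
    and const: "\<And>x y. gr m x = gr m y \<Longrightarrow> f1 x = f1 y" "\<And>x y. gr m x = gr m y \<Longrightarrow> f2 x = f2 y"
    and I: "finite I" and t: "0 < t1" "0 < t2"
    and T: "tav N j (\<lambda>y. ennreal (norm (f1 y))) x0 \<le> ennreal t1" "tav N j (\<lambda>y. ennreal (norm (f2 y))) x0 \<le> ennreal t2"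
  shows "nav (\<lambda>_. j) (\<lambda>x. ennreal (SF {k\<in>I. k \<le> j} f1 f2 x powr (1/4))) x0 \<le> ennreal ((2 * (t1 * t2)) powr (1/4) * (1 + 8 * CS))"
proof -
  have [measurable]: "f1 \<in> \<B>" "f2 \<in> \<B>" using f by auto
  let ?B = "{y. near N j x0 y}" and ?J = "{k\<in>I. k \<le> j}"
  define F where "F f x = indicator ?B x * f x" for f :: "real^'n \<Rightarrow> complex" and x
  \<comment> \<open>The functions cut off near the cube are constant only on cubes of level at most
    \<open>m\<close> and \<open>j\<close>, and \<open>star1\<close> also wants every scale at or
    above the level of constancy.\<close>
  define m' where "m' = Min (insert m (insert j I))"
  have m': "m' \<le> m" "m' \<le> j" "\<And>k. k \<in> ?J \<Longrightarrow> m' \<le> k" unfolding m'_def using I by (auto intro!: Min_le simp del: Min_insert)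
  have Fi: "integrable lborel (F f1)" "integrable lborel (F f2)"
    unfolding F_def by (intro integrable_ind f, measurable)+
  have Fc: "F f x = F f y" if c: "\<And>x y. gr m x = gr m y \<Longrightarrow> f x = f y" and xy: "gr m' x = gr m' y" for f x y
  proof -
    have "f x = f y" using c gr_mono[OF xy m'(1)] by blast
    moreover have "near N j x0 x = near N j x0 y" using gr_mono[OF xy m'(2)] by (simp add: near_def)
    ultimately show ?thesis by (simp add: F_def indicator_def)
  qed
  have loc: "SF ?J f1 f2 x = SF ?J (F f1) (F f2) x" if x: "gr j x = gr j x0" for x
    unfolding F_def[abs_def] by (rule SF_local[OF x])
  define c where "c = 2 * (t1 * t2)"
  have c: "0 < c" using t by (simp add: c_def)
  define \<omega> where "\<omega> x = (SF ?J f1 f2 x / c) powr (1/4)" for x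
  have [measurable]: "\<omega> \<in> \<B>" unfolding \<omega>_def by measurable
  let ?v = "(2 powi j) ^ CARD('n) :: real"
  have mF: "mdl 1 (F f) = ennreal ?v * tav N j (\<lambda>y. ennreal (norm (f y))) x0"
    if [measurable]: "f \<in> \<B>" for f
  proof -
    have "mdl 1 (F f) = (NN y. indicator ?B y * ennreal (norm (f y)))"
      unfolding mdl_1 F_def by (intro nn_integral_cong) (auto simp: indicator_def)
    then show ?thesis by (subst tav_set) (auto simp: mult.assoc[symmetric] ennreal_mult[symmetric])
  qed
  have "nav (\<lambda>_. j) (\<lambda>x. ennreal (\<omega> x)) x0 \<le> ennreal (1 + 4 * (2 * CS))"
  proof (rule kolmogorov)
    show "0 \<le> 2 * CS" using CS by simp
    fix n
    \<comment> \<open>With this scaling the set where \<omega> exceeds 2^n, that is where the square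
      function exceeds 2 t1 t2 16^n, becomes the level set at height 2 of \<open>star1\<close>, and
      each modular is at most the volume of the cube divided by 4^n.\<close>
    define a1 where "a1 = 1 / (t1 * 4 ^ n)"
    define a2 where "a2 = 1 / (t2 * 4 ^ n)"
    have a: "0 < a1" "0 < a2" using t by (auto simp: a1_def a2_def)
    let ?g1 = "\<lambda>x. of_real a1 * F f1 x" and ?g2 = "\<lambda>x. of_real a2 * F f2 x"
    have gi: "integrable lborel ?g1" "integrable lborel ?g2" using Fi by auto
    let ?S = "{x. SF ?J ?g1 ?g2 x > 2}"
    have [measurable]: "F f1 \<in> \<B>" "F f2 \<in> \<B>" using Fi by auto
    have sub: "indicator {y. 2 ^ n < \<omega> y} x \<le> (indicator ?S x :: ennreal)" if x: "gr j x = gr j x0" for x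
    proof (cases "2 ^ n < \<omega> x")
      case True
      let ?h = "SF ?J f1 f2 x"
      have "(2 ^ n) powr 4 < \<omega> x powr 4" using True by (intro powr_less_mono2) auto
      also have "\<omega> x powr 4 = ?h / c" using c by (simp add: \<omega>_def powr_powr)
      also have "((2::real) ^ n) powr 4 = 16 ^ n"
        by (simp add: powr_numeral power_mult[symmetric] mult.commute[of n] power_mult)
      finally have "2 * (t1 * t2 * 16 ^ n) < ?h" using c by (simp add: less_divide_eq c_def ac_simps)
      moreover have "SF ?J ?g1 ?g2 x = a1 * a2 * ?h"
        using a loc[OF x] by (simp add: SF_scale norm_mult)
      moreover have "a1 * a2 = 1 / (t1 * t2 * 16 ^ n)"
        by (simp add: a1_def a2_def power_mult_distrib[symmetric])
      moreover have "0 < t1 * t2 * 16 ^ n" using t by simp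
      ultimately have "SF ?J ?g1 ?g2 x > 2" by (simp add: less_divide_eq)
      then show ?thesis by (simp add: indicator_def)
    qed (simp add: indicator_def)
    have "nav (\<lambda>_. j) (indicator {y. 2 ^ n < \<omega> y}) x0 \<le> nav (\<lambda>_. j) (indicator ?S) x0"
      by (intro nav_mono_cell sub) simp
    also have "\<dots> \<le> ennreal (1 / ?v) * (NN x. indicator ?S x)"
      by (rule nav_le_integral) measurable
    also have "(NN x. indicator ?S x) = emeasure lborel ?S" by simp
    also have "\<dots> \<le> ennreal CS * (mdl 1 ?g1 + mdl 1 ?g2)"
    proof (rule star1[OF gi, of m'])
      show "of_real a1 * F f1 x = of_real a1 * F f1 y" if "gr m' x = gr m' y" for x y
        by (simp only: Fc[OF const(1) that])
      show "of_real a2 * F f2 x = of_real a2 * F f2 y" if "gr m' x = gr m' y" for x y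
        by (simp only: Fc[OF const(2) that])
      show "finite ?J" using I by simp
    qed (rule m'(3))
    also have "\<dots> \<le> ennreal CS * (ennreal (?v / 4 ^ n) + ennreal (?v / 4 ^ n))"
    proof (intro mult_left_mono add_mono)
      have "mdl 1 ?g1 = ennreal a1 * (ennreal ?v * tav N j (\<lambda>y. ennreal (norm (f1 y))) x0)"
        using a by (simp add: mdl_1_scale mF)
      also have "\<dots> \<le> ennreal a1 * (ennreal ?v * ennreal t1)" by (intro mult_left_mono T) auto
      also have "\<dots> = ennreal (?v / 4 ^ n)" using a t by (simp add: ennreal_mult[symmetric] a1_def)
      finally show "mdl 1 ?g1 \<le> ennreal (?v / 4 ^ n)" .
      have "mdl 1 ?g2 = ennreal a2 * (ennreal ?v * tav N j (\<lambda>y. ennreal (norm (f2 y))) x0)"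
        using a by (simp add: mdl_1_scale mF)
      also have "\<dots> \<le> ennreal a2 * (ennreal ?v * ennreal t2)" by (intro mult_left_mono T) auto
      also have "\<dots> = ennreal (?v / 4 ^ n)" using a t by (simp add: ennreal_mult[symmetric] a2_def)
      finally show "mdl 1 ?g2 \<le> ennreal (?v / 4 ^ n)" .
    qed auto
    also have "ennreal (1 / ?v) * (ennreal CS * (ennreal (?v / 4 ^ n) + ennreal (?v / 4 ^ n))) = ennreal (1 / ?v * (CS * (?v / 4 ^ n + ?v / 4 ^ n)))"
      using CS by (simp add: ennreal_mult[symmetric] ennreal_plus[symmetric] del: ennreal_plus)
    also have "1 / ?v * (CS * (?v / 4 ^ n + ?v / 4 ^ n)) = 2 * CS / 4 ^ n" by (simp add: field_simps)
    finally show "nav (\<lambda>_. j) (indicator {y. 2 ^ n < \<omega> y}) x0 \<le> ennreal (2 * CS / 4 ^ n)"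
      by (simp add: mult_left_mono)
  qed measurable
  then have "ennreal (c powr (1/4)) * nav (\<lambda>_. j) (\<lambda>x. ennreal (\<omega> x)) x0 \<le> ennreal (c powr (1/4)) * ennreal (1 + 8 * CS)"
    by (intro mult_left_mono) auto
  moreover have "nav (\<lambda>_. j) (\<lambda>x. ennreal (SF ?J f1 f2 x powr (1/4))) x0 = ennreal (c powr (1/4)) * nav (\<lambda>_. j) (\<lambda>x. ennreal (\<omega> x)) x0"
  proof -
    have "SF ?J f1 f2 x powr (1/4) = c powr (1/4) * \<omega> x" for x using c by (simp add: \<omega>_def powr_divide)
    then show ?thesis by (simp add: ennreal_mult nav_cmult \<omega>_def)
  qed
  ultimately show ?thesis using CS by (simp add: c_def ennreal_mult)
qed

text \<open>The mass of the kernel is bounded by \<open>MN\<close> and not by 1;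
  \<open>young_split\<close> at \<tau> = \<theta> replaces Jensen's inequality at the price of the
  factor \<open>MN + 1\<close>.\<close>

lemma tav_jensen:
  fixes f :: "real^'n \<Rightarrow> complex"
  assumes [measurable]: "f \<in> \<B>" and r: "1 < r" and th: "0 < \<theta>"
    and T: "tav N k (\<lambda>y. ennreal (norm (f y) powr r)) x \<le> ennreal (\<theta> powr r)"
  shows "tav N k (\<lambda>y. ennreal (norm (f y))) x \<le> ennreal ((MN + 1) * \<theta>)"
proof -
  have "tav N k (\<lambda>y. ennreal (norm (f y))) x \<le> tav N k (\<lambda>y. ennreal \<theta> + ennreal (\<theta> powr (1 - r)) * ennreal (norm (f y) powr r)) x"
    using young_split[OF th r] th
    by (intro tav_mono) (auto simp: ennreal_mult[symmetric] ennreal_plus[symmetric] intro!: ennreal_leI simp del: ennreal_plus)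
  also have "\<dots> = tav N k (\<lambda>_. ennreal \<theta>) x + ennreal (\<theta> powr (1 - r)) * tav N k (\<lambda>y. ennreal (norm (f y) powr r)) x"
    by (simp add: tav_add tav_cmult)
  also have "\<dots> \<le> ennreal MN * ennreal \<theta> + ennreal (\<theta> powr (1 - r)) * ennreal (\<theta> powr r)"
    unfolding MN_def by (intro add_mono mult_left_mono T tav_const N0) auto
  also have "\<dots> = ennreal (MN * \<theta> + \<theta> powr (1 - r) * \<theta> powr r)"
    using MN th by (simp add: ennreal_mult[symmetric] ennreal_plus[symmetric] del: ennreal_plus)
  also have "\<theta> powr (1 - r) * \<theta> powr r = \<theta>" using th by (simp add: powr_add[symmetric])
  finally show ?thesis by (simp add: algebra_simps)
qed

definition CH :: "real \<Rightarrow> real" where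
  "CH r = (2 * (MN + 1)\<^sup>2) powr (1/4) * (1 + 8 * CS) + (CF * (2 / (1 - 2 powr (- (1 - 1 / r))))) powr (1/4)"

lemma rho:
  assumes "1 < r" shows "0 \<le> (2::real) powr (- (1 - 1 / r))" "(2::real) powr (- (1 - 1 / r)) < 1"
  using assms by (auto simp: powr_less_one)

text \<open>Fine scales are controlled by \<open>local_quarter\<close>; coarse ones vary little over
  the cube, by the geometric sum of the bounds from \<open>A_diff_le\<close>. The constant
  subtracted is the fourth root of the coarse part at \<open>x0\<close>.\<close>

lemma sharp:
  assumes f: "integrable lborel f1" "integrable lborel f2"
    and const: "\<And>x y. gr m x = gr m y \<Longrightarrow> f1 x = f1 y" "\<And>x y. gr m x = gr m y \<Longrightarrow> f2 x = f2 y"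
    and I: "finite I" and r: "1 < r" and th: "0 < \<theta>1" "0 < \<theta>2"
    and T: "\<And>k. j \<le> k \<Longrightarrow> tav N k (\<lambda>y. ennreal (norm (f1 y) powr r)) x0 \<le> ennreal (\<theta>1 powr r)"
      "\<And>k. j \<le> k \<Longrightarrow> tav N k (\<lambda>y. ennreal (norm (f2 y) powr r)) x0 \<le> ennreal (\<theta>2 powr r)"
  shows "\<exists>a. nav (\<lambda>_. j) (\<lambda>x. ennreal \<bar>SF I f1 f2 x powr (1/4) - a\<bar>) x0 \<le> ennreal (CH r * (\<theta>1 * \<theta>2) powr (1/4))"
proof -
  have [measurable]: "f1 \<in> \<B>" "f2 \<in> \<B>" using f by auto
  define a where "a = SF {k\<in>I. j < k} f1 f2 x0"
  define \<rho> :: real where "\<rho> = 2 powr (- (1 - 1 / r))"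
  define e where "e = CF * (\<theta>1 * \<theta>2) * (2 / (1 - \<rho>))"
  have rh: "0 \<le> \<rho>" "\<rho> < 1" using rho[OF r] by (auto simp: \<rho>_def)
  have e0: "0 \<le> e" using CF th rh by (simp add: e_def)
  have pt: "\<bar>SF I f1 f2 x powr (1/4) - a powr (1/4)\<bar> \<le> SF {k\<in>I. k \<le> j} f1 f2 x powr (1/4) + e powr (1/4)" if x: "gr j x = gr j x0" for x
  proof -
    have "(\<Sum>k\<in>{k\<in>I. j < k}. norm (A k f1 f2 x - A k f1 f2 x0)) \<le> (\<Sum>k\<in>{k\<in>I. j < k}. CF * (\<theta>1 * \<theta>2) * \<rho> ^ nat \<bar>j - k\<bar>)"
    proof (rule sum_mono)
      fix k assume "k \<in> {k\<in>I. j < k}"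
      then have k: "j \<le> k" "nat \<bar>j - k\<bar> = nat (k - j)" by auto
      show "norm (A k f1 f2 x - A k f1 f2 x0) \<le> CF * (\<theta>1 * \<theta>2) * \<rho> ^ nat \<bar>j - k\<bar>"
        unfolding k(2) \<rho>_def by (rule A_diff_le[OF f x k(1) r th T(1)[OF k(1)] T(2)[OF k(1)]])
    qed
    also have "\<dots> = CF * (\<theta>1 * \<theta>2) * (\<Sum>k\<in>{k\<in>I. j < k}. \<rho> ^ nat \<bar>j - k\<bar>)" by (simp add: sum_distrib_left)
    also have "\<dots> \<le> e" unfolding e_def using CF th by (intro mult_left_mono geom_int_sum rh) (use I in auto)
    finally have "\<bar>SF I f1 f2 x - a\<bar> \<le> SF {k\<in>I. k \<le> j} f1 f2 x + e"
      using SF_close[OF I x, of f1 f2] by (simp add: a_def)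
    then have "\<bar>SF I f1 f2 x - a\<bar> powr (1/4) \<le> (SF {k\<in>I. k \<le> j} f1 f2 x + e) powr (1/4)" by (intro powr_mono2) auto
    also have "\<dots> \<le> SF {k\<in>I. k \<le> j} f1 f2 x powr (1/4) + e powr (1/4)" by (intro powr_quarter_diff e0) simp
    finally show ?thesis using powr_quarter_abs[of "SF I f1 f2 x" a] by (simp add: a_def)
  qed
  have "nav (\<lambda>_. j) (\<lambda>x. ennreal \<bar>SF I f1 f2 x powr (1/4) - a powr (1/4)\<bar>) x0
     \<le> nav (\<lambda>_. j) (\<lambda>x. ennreal (SF {k\<in>I. k \<le> j} f1 f2 x powr (1/4)) + ennreal (e powr (1/4))) x0"
    using pt by (intro nav_mono_cell) (simp add: ennreal_plus[symmetric] ennreal_leI del: ennreal_plus)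
  also have "\<dots> = nav (\<lambda>_. j) (\<lambda>x. ennreal (SF {k\<in>I. k \<le> j} f1 f2 x powr (1/4))) x0 + ennreal (e powr (1/4))"
    by (subst nav_add) (auto simp: nav_const)
  also have "\<dots> \<le> ennreal ((2 * (((MN + 1) * \<theta>1) * ((MN + 1) * \<theta>2))) powr (1/4) * (1 + 8 * CS)) + ennreal (e powr (1/4))"
    by (intro add_right_mono local_quarter[OF f const I] tav_jensen[OF _ r]) (use MN th T in auto)
  also have "\<dots> = ennreal ((2 * (((MN + 1) * \<theta>1) * ((MN + 1) * \<theta>2))) powr (1/4) * (1 + 8 * CS) + e powr (1/4))"
    using CS by (intro ennreal_plus[symmetric]) auto
  also have "(2 * (((MN + 1) * \<theta>1) * ((MN + 1) * \<theta>2))) powr (1/4) * (1 + 8 * CS) + e powr (1/4) = CH r * (\<theta>1 * \<theta>2) powr (1/4)"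
  proof -
    have h1: "(2 * (((MN + 1) * \<theta>1) * ((MN + 1) * \<theta>2))) = (2 * (MN + 1)\<^sup>2) * (\<theta>1 * \<theta>2)" by (simp add: power2_eq_square)
    have h2: "e = (CF * (2 / (1 - \<rho>))) * (\<theta>1 * \<theta>2)" by (simp add: e_def)
    have h3: "((2 * (MN + 1)\<^sup>2) * (\<theta>1 * \<theta>2)) powr (1/4) = (2 * (MN + 1)\<^sup>2) powr (1/4) * (\<theta>1 * \<theta>2) powr (1/4)"
      by (rule powr_mult)
    have h4: "((CF * (2 / (1 - \<rho>))) * (\<theta>1 * \<theta>2)) powr (1/4) = (CF * (2 / (1 - \<rho>))) powr (1/4) * (\<theta>1 * \<theta>2) powr (1/4)"
      by (rule powr_mult)
    have h5: "a * t * b + c * t = (a * b + c) * t" for a b c t :: real by (simp add: algebra_simps)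
    show ?thesis unfolding h1 h2 h3 h4 CH_def \<rho>_def[symmetric] h5 ..
  qed
  finally show ?thesis by (rule exI)
qed

lemma CH: "1 < r \<Longrightarrow> 0 \<le> CH r"
  using CS by (simp add: CH_def)

text \<open>\<open>B + 1\<close> instead of \<open>B\<close> keeps the bound positive, as
  \<open>A_diff_le\<close> asks of \<theta>1 and \<theta>2.\<close>

lemma tav_bounded:
  assumes B: "\<And>x. norm (f x) \<le> B" "0 \<le> B" and r: "1 < r"
  shows "tav N k (\<lambda>y. ennreal (norm (f y :: complex) powr r)) (x::real^'n) \<le> ennreal ((MN * (B + 1)) powr r)"
proof -
  have "tav N k (\<lambda>y. ennreal (norm (f y) powr r)) x \<le> tav N k (\<lambda>_. ennreal ((B + 1) powr r)) x"
  proof (intro tav_mono ennreal_leI powr_mono2)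
    show "norm (f y) \<le> B + 1" for y using B(1)[of y] by simp
  qed (use r in auto)
  also have "\<dots> \<le> ennreal MN * ennreal ((B + 1) powr r)" unfolding MN_def by (rule tav_const[OF N0])
  also have "\<dots> = ennreal (MN * (B + 1) powr r)" using MN by (simp add: ennreal_mult)
  also have "\<dots> \<le> ennreal ((MN * (B + 1)) powr r)"
  proof (rule ennreal_leI)
    have "MN powr 1 \<le> MN powr r" using MN r by (intro powr_mono) auto
    then have "MN \<le> MN powr r" using MN by simp
    then have "MN * (B + 1) powr r \<le> MN powr r * (B + 1) powr r" by (intro mult_right_mono) auto
    also have "\<dots> = (MN * (B + 1)) powr r" using MN B by (simp add: powr_mult)
    finally show "MN * (B + 1) powr r \<le> (MN * (B + 1)) powr r" .
  qed
  finally show ?thesis .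
qed

text \<open>On cubes below all scales of \<open>I\<close> the conditional expectations are constant,
  and by \<open>A_diff_le\<close> with r = 2 the averages over dilates vary there by
  O(\<rho>^(k+n)). Convergence therefore holds at every point.\<close>

lemma quarter_conv:
  assumes f: "integrable lborel f1" "integrable lborel f2" and B: "\<And>x. norm (f1 x) \<le> B" "\<And>x. norm (f2 x) \<le> B" and I: "finite I"
  shows "(\<lambda>n. enn2real (nav (\<lambda>_. - int n) (\<lambda>y. ennreal (SF I f1 f2 y powr (1/4))) x)) \<longlonglongrightarrow> SF I f1 f2 x powr (1/4)"
proof -
  have B0: "0 \<le> B" using B(1) norm_ge_zero order_trans by blast
  have [measurable]: "f1 \<in> \<B>" "f2 \<in> \<B>" using f by auto
  define t where "t = MN * (B + 1)"
  have t: "0 < t" using MN B0 by (simp add: t_def)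
  define \<rho> :: real where "\<rho> = 2 powr (- (1 - 1 / 2))"
  have rh: "0 \<le> \<rho>" "\<rho> < 1" using rho[of 2] by (auto simp: \<rho>_def)
  define e where "e n = (\<Sum>k\<in>I. CF * (t * t) * \<rho> ^ nat (k + int n))" for n
  obtain n0 where n0: "\<And>k. k \<in> I \<Longrightarrow> - int n0 < k"
  proof
    fix k assume "k \<in> I"
    then have "- \<bar>k\<bar> \<ge> - (\<Sum>k\<in>I. \<bar>k\<bar>)" using member_le_sum[of k I "\<lambda>k. \<bar>k\<bar>"] I by auto
    then show "- int (nat (1 + (\<Sum>k\<in>I. \<bar>k\<bar>))) < k" using sum_nonneg[of I "\<lambda>k. \<bar>k\<bar>"] by auto
  qed
  let ?u = "\<lambda>y. SF I f1 f2 y powr (1/4)"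
  have cl: "\<bar>?u y - ?u x\<bar> \<le> e n powr (1/4)" if n: "n0 \<le> n" and y: "gr (- int n) y = gr (- int n) x" for n y
  proof -
    have J: "{k\<in>I. k \<le> - int n} = {}" "{k\<in>I. - int n < k} = I" using n0 n by force+
    have "(\<Sum>k\<in>I. norm (A k f1 f2 y - A k f1 f2 x)) \<le> e n"
      unfolding e_def
    proof (rule sum_mono)
      fix k assume k: "k \<in> I"
      have "- int n \<le> k" using n0[OF k] n by simp
      from A_diff_le[OF f y this, of 2 t t] t tav_bounded[OF B(1) B0, of 2] tav_bounded[OF B(2) B0, of 2]
      show "norm (A k f1 f2 y - A k f1 f2 x) \<le> CF * (t * t) * \<rho> ^ nat (k + int n)"
        by (simp add: t_def \<rho>_def)
    qed
    then have "\<bar>SF I f1 f2 y - SF I f1 f2 x\<bar> \<le> e n"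
      using SF_close[OF I y, of f1 f2] unfolding J by (simp add: SF_def)
    then have "\<bar>SF I f1 f2 y - SF I f1 f2 x\<bar> powr (1/4) \<le> e n powr (1/4)" by (intro powr_mono2) auto
    then show ?thesis using powr_quarter_abs[of "SF I f1 f2 y" "SF I f1 f2 x"] by simp
  qed
  have e0: "e \<longlonglongrightarrow> 0"
  proof -
    have "(\<lambda>n. CF * (t * t) * \<rho> ^ nat (k + int n)) \<longlonglongrightarrow> 0" for k
    proof -
      have "(\<lambda>n. \<rho> ^ nat (k + int (n + nat \<bar>k\<bar>))) \<longlonglongrightarrow> 0"
      proof -
        have "(\<lambda>n. \<rho> ^ n * \<rho> ^ nat (k + \<bar>k\<bar>)) \<longlonglongrightarrow> 0 * \<rho> ^ nat (k + \<bar>k\<bar>)"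
          by (intro tendsto_mult tendsto_const LIMSEQ_realpow_zero rh)
        moreover have "nat (k + int (n + nat \<bar>k\<bar>)) = n + nat (k + \<bar>k\<bar>)" for n by auto
        ultimately show ?thesis by (simp add: power_add)
      qed
      then have "(\<lambda>n. \<rho> ^ nat (k + int n)) \<longlonglongrightarrow> 0" by (rule LIMSEQ_offset)
      then show ?thesis by (rule tendsto_mult_right_zero)
    qed
    then have "(\<lambda>n. \<Sum>k\<in>I. CF * (t * t) * \<rho> ^ nat (k + int n)) \<longlonglongrightarrow> (\<Sum>k\<in>I. 0)" by (intro tendsto_sum)
    then show ?thesis by (simp add: e_def[abs_def])
  qed
  have e1: "(\<lambda>n. e n powr (1/4)) \<longlonglongrightarrow> 0"
  proof -
    have "0 \<le> e n" for n unfolding e_def using CF rh by (intro sum_nonneg) auto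
    then have "(\<lambda>n. e n powr (1/4)) \<longlonglongrightarrow> 0 powr (1/4)" using e0 by (intro tendsto_powr2) auto
    then show ?thesis by simp
  qed
  have close: "\<bar>enn2real (nav (\<lambda>_. - int n) (\<lambda>y. ennreal (?u y)) x) - ?u x\<bar> \<le> e n powr (1/4)" if n: "n0 \<le> n" for n
  proof -
    let ?v = "nav (\<lambda>_. - int n) (\<lambda>y. ennreal (?u y)) x" and ?d = "e n powr (1/4)"
    have "?v \<le> nav (\<lambda>_. - int n) (\<lambda>_. ennreal (?u x + ?d)) x"
    proof (intro nav_mono_cell ennreal_leI)
      fix y assume "gr (- int n) y = gr (- int n) x"
      from cl[OF n this] show "?u y \<le> ?u x + ?d" by linarith
    qed
    then have up: "?v \<le> ennreal (?u x + ?d)" by (simp add: nav_const)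
    have "nav (\<lambda>_. - int n) (\<lambda>_. ennreal (?u x)) x \<le> nav (\<lambda>_. - int n) (\<lambda>y. ennreal (?u y) + ennreal ?d) x"
    proof (intro nav_mono_cell)
      fix y assume "gr (- int n) y = gr (- int n) x"
      from cl[OF n this] have "?u x \<le> ?u y + ?d" by linarith
      then show "ennreal (?u x) \<le> ennreal (?u y) + ennreal ?d" by (simp add: ennreal_plus[symmetric] ennreal_leI del: ennreal_plus)
    qed
    also have "\<dots> = ?v + ennreal ?d" by (subst nav_add) (auto simp: nav_const)
    finally have lo: "ennreal (?u x) \<le> ?v + ennreal ?d" by (simp add: nav_const)
    from up obtain v where v: "?v = ennreal v" "0 \<le> v" by (cases ?v) (auto simp: top_unique)
    have "v \<le> ?u x + ?d" using up v by (simp add: ennreal_plus[symmetric] del: ennreal_plus)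
    moreover have "?u x \<le> v + ?d" using lo v by (simp add: ennreal_plus[symmetric] del: ennreal_plus)
    ultimately show ?thesis using v by (simp add: abs_le_iff)
  qed
  have "(\<lambda>n. enn2real (nav (\<lambda>_. - int n) (\<lambda>y. ennreal (?u y)) x) - ?u x) \<longlonglongrightarrow> 0"
  proof (rule Lim_null_comparison[OF _ e1])
    show "\<forall>\<^sub>F n in sequentially. norm (enn2real (nav (\<lambda>_. - int n) (\<lambda>y. ennreal (?u y)) x) - ?u x) \<le> e n powr (1/4)"
      using close by (auto simp: eventually_sequentially)
  qed
  then show ?thesis by (rule LIM_zero_cancel)
qed

end

subsection \<open>Strong and weak bounds\<close>

lemma near_of_Zs:
  fixes x y :: "real^'n"
  assumes "x \<in> Zs n" "y \<in> Zs n" "int n + 2 \<le> k"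
  shows "near 2 k x y"
proof -
  have *: "near 1 k 0 y" if "y \<in> Zs n" for y :: "real^'n"
  proof -
    have "near 1 (int n + 2) 0 y"
      unfolding near_def
    proof
      fix i
      have "gr (int n + 2) y $ i = gr (int n) y $ i div 4" using gr_div[of "int n" "int n + 2" y i] by simp
      moreover have "gr (int n + 2) (0::real^'n) $ i = 0" "gr (int n) (0::real^'n) $ i = 0" by (auto simp: gr_def)
      moreover have "\<bar>gr (int n) y $ i\<bar> \<le> 2" using that by (auto simp: Zs_def near_def gr_def)
      ultimately show "\<bar>gr (int n + 2) 0 $ i - gr (int n + 2) y $ i\<bar> \<le> 1" by (simp only:)
    qed
    then show ?thesis by (rule near_mono) (use assms in auto)
  qed
  have "near 1 k x 0" using *[OF assms(1)] by (simp add: near_sym)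
  from near_trans[OF this *[OF assms(2)]] show ?thesis by simp
qed

definition stepf :: "int \<Rightarrow> nat \<Rightarrow> real \<Rightarrow> (real^'n \<Rightarrow> complex) \<Rightarrow> bool" where
  "stepf m n B f \<longleftrightarrow> integrable lborel f \<and> (\<forall>x y. gr m x = gr m y \<longrightarrow> f x = f y) \<and> (\<forall>x. norm (f x) \<le> B) \<and> (\<forall>x. f x \<noteq> 0 \<longrightarrow> x \<in> Zs n)"

lemma stepfD:
  assumes "stepf m n B f"
  shows "integrable lborel f" "f \<in> \<B>" "gr m x = gr m y \<Longrightarrow> f x = f y" "norm (f x) \<le> B" "f x \<noteq> 0 \<Longrightarrow> x \<in> Zs n"
proof -
  show i: "integrable lborel f" using assms unfolding stepf_def by blast
  then show "f \<in> \<B>" by auto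
qed (use assms in \<open>unfold stepf_def, blast+\<close>)

lemma stepf_appr: "locint f \<Longrightarrow> \<exists>B. stepf (- int n) n B (appr n f)"
  using appr_props[of f n] unfolding stepf_def by blast

lemma stepf_powr_fin:
  assumes "stepf m n B f" "1 < r"
  shows "(NN x. ennreal (norm (f x) powr r)) < \<infinity>"
proof -
  have [measurable]: "f \<in> \<B>" and i: "integrable lborel f" using stepfD(1,2)[OF assms(1)] by auto
  have B: "norm (f x) \<le> B" for x using assms(1) by (rule stepfD)
  have "(NN x. ennreal (norm (f x) powr r)) \<le> (NN x. ennreal (B powr (r - 1)) * ennreal (norm (f x)))"
  proof (intro nn_integral_mono)
    fix x
    have "norm (f x) powr r = norm (f x) powr (r - 1) * norm (f x)" by (cases "f x = 0") (auto simp: powr_diff)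
    also have "\<dots> \<le> B powr (r - 1) * norm (f x)" using assms B[of x] by (intro mult_right_mono powr_mono2) auto
    finally show "ennreal (norm (f x) powr r) \<le> ennreal (B powr (r - 1)) * ennreal (norm (f x))"
      by (simp add: ennreal_mult[symmetric] ennreal_leI)
  qed
  also have "\<dots> = ennreal (B powr (r - 1)) * (NN x. ennreal (norm (f x)))" by (simp add: nn_integral_cmult)
  also have "\<dots> < \<infinity>" using i by (simp add: integrable_iff_bounded ennreal_mult_less_top)
  finally show ?thesis .
qed

context body
begin

text \<open>\<open>r\<close> is the exponent of \<open>A_diff_le\<close>; the root restores
  homogeneity, so that \<open>mx\<close> can serve as \<theta>1 and \<theta>2 in
  \<open>sharp\<close>.\<close>

definition mx :: "real \<Rightarrow> int \<Rightarrow> (real^'n \<Rightarrow> complex) \<Rightarrow> real^'n \<Rightarrow> real" where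
  "mx r m f x = enn2real (MS N m (\<lambda>y. ennreal (norm (f y) powr r)) x) powr (1 / r)"

lemma mx_measurable [measurable]: "mx r m f \<in> \<B>"
  unfolding mx_def by measurable

lemma mx_nonneg: "0 \<le> mx r m f x" by (simp add: mx_def)

lemma MS_mx:
  assumes "\<And>x. norm (f x) \<le> B" and r: "1 < r"
  shows "MS N m (\<lambda>y. ennreal (norm (f y) powr r)) x = ennreal (mx r m f x powr r)"
proof -
  have "MS N m (\<lambda>y. ennreal (norm (f y) powr r)) x \<le> ennreal MN * ennreal (B powr r)"
    unfolding MN_def using assms by (intro MS_bound N0 ennreal_leI powr_mono2) auto
  also have "\<dots> < top" by (simp add: ennreal_mult_less_top)
  finally show ?thesis using r by (simp add: mx_def powr_powr)
qed

text \<open>At a level so coarse that the neighbourhood of \<open>x\<close> contains the support,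
  the average is positive. \<open>sharp\<close> asks for positive \<theta>1 and \<theta>2; functions
  vanishing almost everywhere are left to \<open>SF_zero\<close>.\<close>

lemma mx_pos:
  assumes f: "stepf m n B f" and r: "1 < r" and nz: "\<not> (AE x in lborel. f x = 0)"
  shows "0 < mx r j f x"
proof -
  have [measurable]: "f \<in> \<B>" by (rule stepfD[OF f])
  obtain n0 where n0: "\<forall>n\<ge>n0. - int n \<le> 0 \<and> (\<forall>y. near N 0 x y \<longrightarrow> y \<in> Zs n)" using near_in_Zs[of 0 N x] by blast
  define n1 where "n1 = max n n0"
  have x: "x \<in> Zs n1" using n0 N0 by (simp add: n1_def)
  have supp: "y \<in> Zs n1" if "f y \<noteq> 0" for y
  proof -
    have "near 2 (int n) 0 y" using stepfD(5)[OF f that] by (simp add: Zs_def)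
    then show ?thesis unfolding Zs_def using near_mono[of 2 "int n" 0 y "int n1"] by (simp add: n1_def)
  qed
  define k where "k = max j (int n1 + 2)"
  have near: "near N k x y" if "f y \<noteq> 0" for y
  proof -
    have "near 2 k x y" by (rule near_of_Zs[OF x supp[OF that]]) (simp add: k_def)
    then show ?thesis using N by (auto simp: near_def intro: order_trans)
  qed
  let ?g = "\<lambda>y. ennreal (norm (f y) powr r)"
  have "(NN y. ?g y) \<noteq> 0"
    using nz r by (subst nn_integral_0_iff_AE) auto
  moreover have "(NN y. indicator {y. near N k x y} y * ?g y) = (NN y. ?g y)"
  proof (rule nn_integral_cong)
    fix y show "indicator {y. near N k x y} y * ?g y = ?g y"
      using near[of y] by (cases "f y = 0") (auto simp: indicator_def)
  qed
  ultimately have "tav N k ?g x \<noteq> 0" by (simp add: tav_set)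
  moreover have "tav N k ?g x \<le> MS N j ?g x" by (rule MS_ge) (simp add: k_def)
  ultimately have "MS N j ?g x \<noteq> 0" by auto
  moreover have "MS N j ?g x = ennreal (mx r j f x powr r)" by (rule MS_mx[OF stepfD(4)[OF f] r])
  ultimately have "mx r j f x \<noteq> 0" by auto
  with mx_nonneg[of r j f x] show ?thesis by linarith
qed

lemma SF_zero:
  assumes "(AE x in lborel. f1 x = 0) \<or> (AE x in lborel. f2 x = 0)"
    and [measurable]: "f1 \<in> \<B>" "f2 \<in> \<B>"
  shows "SF I f1 f2 x = 0"
proof -
  have "DD k f1 f2 x = 0" for k
  proof -
    have null: "AE z in lborel. f1 (fst z) * f2 (snd z) = 0"
    proof -
      have m: "(\<lambda>z. ennreal (norm (f1 (fst z))) * ennreal (norm (f2 (snd z)))) \<in> \<B>" by measurable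
      have "(NN z. ennreal (norm (f1 (fst z))) * ennreal (norm (f2 (snd z))))
         = (NN y. ennreal (norm (f1 y))) * (NN y. ennreal (norm (f2 y)))"
        by (subst nn_integral_lborel_pair(1)[OF m]) (simp add: nn_integral_cmult nn_integral_multc)
      also have "\<dots> = 0"
      proof -
        have "(NN y. ennreal (norm (f y))) = 0" if "AE x in lborel. f x = 0" for f :: "real^'n \<Rightarrow> complex"
        proof -
          have "(NN y. ennreal (norm (f y))) = (NN (y::real^'n). 0)" by (rule nn_integral_cong_AE) (use that in auto)
          then show ?thesis by simp
        qed
        then show ?thesis using assms(1) by auto
      qed
      finally have "AE z in lborel. ennreal (norm (f1 (fst z))) * ennreal (norm (f2 (snd z))) = 0"
        using m by (subst (asm) nn_integral_0_iff_AE) auto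
      then show ?thesis by eventually_elim simp
    qed
    have "A k f1 f2 x = 0"
    proof -
      have "(\<integral>z. indicator {z. z - (x, x) \<in> R k} z * (f1 (fst z) * f2 (snd z)) \<partial>lborel) = 0"
        by (rule integral_eq_zero_AE) (use null in \<open>eventually_elim, simp\<close>)
      then show ?thesis by (simp add: A_def)
    qed
    moreover have "av (\<lambda>_. k) f x = 0" if "AE x in lborel. f x = 0" for f
      unfolding av_def by (rule integral_eq_zero_AE) (use that in \<open>eventually_elim, simp\<close>)
    ultimately show ?thesis using assms(1) by (auto simp: DD_def)
  qed
  then show ?thesis by (simp add: SF_def L2_set_def)
qed

text \<open>Finitely many scales reach only a bounded distance from the support of
  \<open>f1\<close>. With boundedness this yields the integrability of the fourth root that
  \<open>garsia\<close> asks for.\<close>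

lemma SF_support:
  assumes f: "stepf m n B f1" and I: "finite I"
  shows "\<exists>k. \<forall>x. SF I f1 f2 x \<noteq> 0 \<longrightarrow> near (N + 2) k x 0"
proof -
  define k where "k = Max (insert (int n) I)"
  have k: "int n \<le> k" "\<And>i. i \<in> I \<Longrightarrow> i \<le> k" unfolding k_def using I by (auto intro!: Max_ge simp del: Max_insert)
  have "near (N + 2) k x 0" if nz: "SF I f1 f2 x \<noteq> 0" for x
  proof -
    have "\<exists>i\<in>I. DD i f1 f2 x \<noteq> 0"
    proof (rule ccontr)
      assume "\<not> ?thesis"
      then have "SF I f1 f2 x = 0" by (simp add: SF_def L2_set_def)
      with nz show False ..
    qed
    then obtain i where i: "i \<in> I" "DD i f1 f2 x \<noteq> 0" by blast
    have "\<exists>y. near N i x y \<and> f1 y \<noteq> 0"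
    proof (rule ccontr)
      assume "\<not> ?thesis"
      then have "DD i f1 f2 x = DD i (\<lambda>_. 0) f2 x" by (intro DD_cong_near) auto
      then show False using i by (simp add: DD_def A_def av_def)
    qed
    then obtain y where y: "near N i x y" "f1 y \<noteq> 0" by blast
    have 1: "near N k x y" by (rule near_mono[OF y(1) k(2)[OF i(1)] N0])
    have "near 2 (int n) 0 y" using stepfD(5)[OF f y(2)] by (simp add: Zs_def)
    then have "near 2 k y 0" using near_mono[of 2 "int n" 0 y k] k(1) near_sym[of 2 k y 0] by simp
    from near_trans[OF 1 this] show ?thesis .
  qed
  then show ?thesis by blast
qed

definition CG :: "real \<Rightarrow> real" where
  "CG q = 2 powr (q + 1) * (2 ^ CARD('n) + 1) * (2 powr (q + 1) * (2 ^ CARD('n) + 1) * (2 * q / (q - 1) * 2 powr (q - 1))) powr (q - 1)"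

text \<open>\<open>garsia\<close> is applied with exponent 4p to the fourth root, with \<Theta>
  taken from \<open>sharp\<close> and maximal functions. The level \<open>- int n\<close> of its
  averaging is unrelated to \<open>m\<close> and is sent to minus infinity by Fatou's lemma.\<close>

lemma strong_core:
  assumes f1: "stepf m n B f1" and f2: "stepf m n B f2" and I: "finite I" and r: "1 < r" and p: "1 / 2 < p"
    and X: "\<And>n. (NN x. ennreal ((mx r (- int n) f1 x * mx r (- int n) f2 x) powr p)) \<le> X"
  shows "(NN x. ennreal (SF I f1 f2 x powr p)) \<le> ennreal (CG (4 * p) * CH r powr (4 * p)) * X"
proof (cases "(AE x in lborel. f1 x = 0) \<or> (AE x in lborel. f2 x = 0)")
  case True
  have "f1 \<in> \<B>" "f2 \<in> \<B>" using stepfD(2)[OF f1] stepfD(2)[OF f2] by auto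
  from SF_zero[OF True this] show ?thesis by simp
next
  case False
  have f: "integrable lborel f1" "integrable lborel f2" using stepfD(1)[OF f1] stepfD(1)[OF f2] by auto
  have c: "f1 x = f1 y" "f2 x = f2 y" if "gr m x = gr m y" for x y using stepfD(3)[OF f1 that] stepfD(3)[OF f2 that] by auto
  have B: "norm (f1 x) \<le> B" "norm (f2 x) \<le> B" for x using stepfD(4)[OF f1] stepfD(4)[OF f2] by auto
  have [measurable]: "f1 \<in> \<B>" "f2 \<in> \<B>" using f by auto
  define u where "u x = SF I f1 f2 x powr (1/4)" for x
  have um [measurable]: "u \<in> \<B>" unfolding u_def by measurable
  define U where "U = (real (card I) * (2 * B\<^sup>2)) powr (1/4)"
  have ub: "u x \<le> U" for x unfolding u_def U_def by (intro powr_mono2 SF_bound f B) auto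
  have ufin: "(NN x. ennreal (u x)) < \<infinity>"
  proof -
    obtain k where k: "\<forall>x. SF I f1 f2 x \<noteq> 0 \<longrightarrow> near (N + 2) k x 0" using SF_support[OF f1 I] by blast
    have "(NN x. ennreal (u x)) \<le> (NN x. ennreal U * indicator {x::real^'n. near (N + 2) k 0 x} x)"
    proof (intro nn_integral_mono)
      fix x
      show "ennreal (u x) \<le> ennreal U * indicator {x. near (N + 2) k 0 x} x"
      proof (cases "SF I f1 f2 x = 0")
        case False
        then have "near (N + 2) k 0 x" using k near_sym[of "N + 2" k 0 x] by simp
        then show ?thesis using ub[of x] by (simp add: ennreal_leI)
      qed (simp add: u_def)
    qed
    also have "\<dots> = ennreal U * emeasure lborel {x::real^'n. near (N + 2) k 0 x}" by (rule nn_integral_cmult_indicator) measurable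
    also have "\<dots> < \<infinity>"
    proof -
      have "emeasure lborel {x::real^'n. near (N + 2) k 0 x} < top"
        by (rule le_less_trans[OF near_measure]) (use N0 in auto)
      then show ?thesis by (simp add: ennreal_mult_less_top)
    qed
    finally show ?thesis .
  qed
  have "(NN x. ennreal (enn2real (nav (\<lambda>_. - int n) (\<lambda>y. ennreal (u y)) x) powr (4 * p)))
     \<le> ennreal (CG (4 * p) * CH r powr (4 * p)) * X" for n
  proof -
    let ?m = "mx r (- int n)"
    define \<Theta> where "\<Theta> x = CH r * (?m f1 x * ?m f2 x) powr (1/4)" for x
    have Tm: "\<Theta> \<in> \<B>" unfolding \<Theta>_def by measurable
    have T0: "0 \<le> \<Theta> x" for x using CH[OF r] by (simp add: \<Theta>_def)
    have osc: "\<exists>a. nav (\<lambda>_. k) (\<lambda>y. ennreal \<bar>u y - a\<bar>) x \<le> ennreal (\<Theta> x)" if k: "- int n \<le> k" for k x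
      unfolding u_def \<Theta>_def
    proof (rule sharp[OF f c I r])
      show "0 < ?m f1 x" "0 < ?m f2 x" using mx_pos[OF f1 r] mx_pos[OF f2 r] False by auto
      fix j assume "k \<le> j"
      then have j: "- int n \<le> j" using k by simp
      show "tav N j (\<lambda>y. ennreal (norm (f1 y) powr r)) x \<le> ennreal (?m f1 x powr r)"
        "tav N j (\<lambda>y. ennreal (norm (f2 y) powr r)) x \<le> ennreal (?m f2 x powr r)"
        unfolding MS_mx[OF B(1) r, symmetric] MS_mx[OF B(2) r, symmetric] by (rule MS_ge[OF j])+
    qed
    have "(NN x. ennreal (enn2real (nav (\<lambda>_. - int n) (\<lambda>y. ennreal (u y)) x) powr (4 * p)))
      \<le> ennreal (CG (4 * p)) * (NN x. ennreal (\<Theta> x powr (4 * p)))"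
      unfolding CG_def by (rule garsia[OF um _ ub ufin Tm T0 osc]) (use p in \<open>auto simp: u_def\<close>)
    also have "\<dots> = ennreal (CG (4 * p)) * (ennreal (CH r powr (4 * p)) * (NN x. ennreal ((?m f1 x * ?m f2 x) powr p)))"
    proof -
      have "\<Theta> x powr (4 * p) = CH r powr (4 * p) * (?m f1 x * ?m f2 x) powr p" for x
        using CH[OF r] mx_nonneg by (simp add: \<Theta>_def powr_mult powr_powr)
      then show ?thesis by (subst nn_integral_cmult[symmetric]) (auto simp: ennreal_mult)
    qed
    also have "\<dots> \<le> ennreal (CG (4 * p)) * (ennreal (CH r powr (4 * p)) * X)" by (intro mult_left_mono X) auto
    also have "\<dots> = ennreal (CG (4 * p) * CH r powr (4 * p)) * X" using p by (simp add: ennreal_mult CG_def mult.assoc)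
    finally show ?thesis .
  qed
  moreover have "(\<lambda>n. ennreal (enn2real (nav (\<lambda>_. - int n) (\<lambda>y. ennreal (u y)) x) powr (4 * p))) \<longlonglongrightarrow> ennreal (SF I f1 f2 x powr p)" for x
  proof -
    have "(\<lambda>n. enn2real (nav (\<lambda>_. - int n) (\<lambda>y. ennreal (u y)) x)) \<longlonglongrightarrow> u x"
      unfolding u_def by (rule quarter_conv[OF f B I])
    then have "(\<lambda>n. enn2real (nav (\<lambda>_. - int n) (\<lambda>y. ennreal (u y)) x) powr (4 * p)) \<longlonglongrightarrow> u x powr (4 * p)"
      using p by (intro tendsto_powr2) auto
    moreover have "u x powr (4 * p) = SF I f1 f2 x powr p" by (simp add: u_def powr_powr)
    ultimately show ?thesis by (intro tendsto_ennrealI) simp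
  qed
  moreover have [measurable]: "nav (\<lambda>_. - int n) (\<lambda>y. ennreal (u y)) \<in> \<B>" for n
    by (rule nav_measurable[OF stp_const])
  ultimately show ?thesis
    by (intro fatou_nn[where u = "\<lambda>n x. ennreal (enn2real (nav (\<lambda>_. - int n) (\<lambda>y. ennreal (u y)) x) powr (4 * p))"]) auto
qed

end

lemma prod_young:
  fixes a b :: real
  assumes "0 \<le> a" "0 \<le> b" "0 < p1" "0 < p2" "0 < p" "1 / p = 1 / p1 + 1 / p2"
  shows "(a * b) powr p \<le> a powr p1 + b powr p2"
proof (cases "a = 0 \<or> b = 0")
  case False
  then have ab: "0 < a" "0 < b" using assms by auto
  have s: "p / p1 + p / p2 = 1"
  proof -
    have "p / p1 + p / p2 = p * (1 / p1 + 1 / p2)" by (simp add: algebra_simps)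
    also have "\<dots> = p * (1 / p)" by (simp only: assms(6))
    finally show ?thesis using assms(5) by simp
  qed
  have nn: "0 \<le> p / p1" "0 \<le> p / p2" using assms(3-5) by auto
  then have le: "p / p1 \<le> 1" "p / p2 \<le> 1" using s by linarith+
  have "(a powr p1) powr (p / p1) * (b powr p2) powr (p / p2) \<le> p / p1 * a powr p1 + p / p2 * b powr p2"
    by (rule Youngs_inequality_0) (use nn ab s in auto)
  also have "\<dots> \<le> 1 * a powr p1 + 1 * b powr p2" using le by (intro add_mono mult_right_mono) auto
  finally show ?thesis using assms(3,4) ab by (simp add: powr_powr powr_mult)
qed auto

lemma stepf_mono:
  assumes f: "stepf m n B f" and "B \<le> B'"
  shows "stepf m n B' f"
  unfolding stepf_def
  using stepfD(1,3,5)[OF f] order_trans[OF stepfD(4)[OF f] assms(2)] by blast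

lemma appr_measurable:
  assumes "locint f"
  shows "appr n f \<in> \<B>"
  using appr_props(1)[OF assms, of n] by auto

lemma mdl_interpolate:
  assumes [measurable]: "g \<in> \<B>"
    and g: "\<And>x. norm (g x) \<le> d" and pq: "1 \<le> p" "p \<le> q" "q < top"
  shows "mdl q g \<le> ennreal (d powr (enn2real q - enn2real p)) * mdl p g"
proof -
  have pt: "p < top" using pq by auto
  have le: "enn2real p \<le> enn2real q" using pq by (intro enn2real_mono) auto
  have "norm (g x) powr enn2real q \<le> d powr (enn2real q - enn2real p) * norm (g x) powr enn2real p" for x
  proof (cases "g x = 0")
    case False
    have "norm (g x) powr enn2real q = norm (g x) powr (enn2real q - enn2real p) * norm (g x) powr enn2real p"
      using False by (simp add: powr_add[symmetric])
    also have "\<dots> \<le> d powr (enn2real q - enn2real p) * norm (g x) powr enn2real p"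
      using le g by (intro mult_right_mono powr_mono2) auto
    finally show ?thesis .
  qed simp
  moreover have "p \<noteq> top" "q \<noteq> top" using pt pq(3) by auto
  ultimately show ?thesis
    by (simp add: mdl_def nn_integral_cmult[symmetric] ennreal_mult[symmetric] nn_integral_mono ennreal_leI)
qed

context body
begin

definition CQ :: "real \<Rightarrow> real" where "CQ s = 2 * MN\<^sup>2 * s / (s - 1) * (2 * MN) powr (s - 1)"

lemma CQ: "1 < s \<Longrightarrow> 0 \<le> CQ s" by (simp add: CQ_def)

lemma mx_Lq:
  assumes f: "stepf m n B f" and r: "1 < r" "r < q"
  shows "(NN x. ennreal (mx r j f x powr q)) \<le> ennreal (CQ (q / r)) * (NN x. ennreal (norm (f x) powr q))"
proof -
  have [measurable]: "f \<in> \<B>" by (rule stepfD[OF f])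
  have "(NN x. ennreal (enn2real (MS N j (\<lambda>y. ennreal (norm (f y) powr r)) x) powr (q / r)))
    \<le> ennreal (CQ (q / r)) * (NN x. ennreal ((norm (f x) powr r) powr (q / r)))"
    unfolding CQ_def MN_def by (rule MS_Lq) (use r stepf_powr_fin[OF f r(1)] N0 in auto)
  then show ?thesis using r by (simp add: mx_def powr_powr)
qed

lemma mx_le_MN:
  assumes "\<And>x. norm (f x) \<le> 1" and r: "1 < r"
  shows "mx r j f x \<le> MN"
proof -
  have "MS N j (\<lambda>y. ennreal (norm (f y) powr r)) x \<le> ennreal MN * ennreal 1"
    unfolding MN_def using assms by (intro MS_bound N0 ennreal_leI) (auto simp: powr_le1)
  then have "enn2real (MS N j (\<lambda>y. ennreal (norm (f y) powr r)) x) \<le> MN"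
    using MN by (metis enn2real_leI ennreal_1 mult.right_neutral)
  then have "mx r j f x \<le> MN powr (1 / r)" unfolding mx_def using r by (intro powr_mono2) auto
  also have "\<dots> \<le> MN powr 1" using r MN by (intro powr_mono) auto
  finally show ?thesis using MN by simp
qed

text \<open>
  The hypothesis covers \<open>p2 = top\<close>, since then \<open>1 / enn2real p2 = 1 / 0 = 0\<close>.
\<close>

lemma strong_simple:
  assumes p1: "1 < p1" "p1 < top" and p2: "1 < p2" and p: "0 < p" "1 / p = 1 / enn2real p1 + 1 / enn2real p2"
  obtains C where "0 \<le> C" "\<And>I f1 f2 m n B. \<lbrakk>finite I; stepf m n B f1; stepf m n B f2\<rbrakk> \<Longrightarrow>
    (NN x. ennreal (SF I f1 f2 x powr p)) \<le> ennreal C * (mdl p1 f1 + mdl p2 f2)"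
proof -
  define a1 where "a1 = enn2real p1"
  define a2 where "a2 = enn2real p2"
  have a1: "1 < a1" using p1 unfolding a1_def by (cases p1) (auto simp: ennreal_less_iff[of 1, simplified])
  have a2: "1 < a2" if "p2 \<noteq> top" using p2 that unfolding a2_def by (cases p2) (auto simp: ennreal_less_iff[of 1, simplified])
  have a20: "a2 = 0" if "p2 = top" using that by (simp add: a2_def)
  \<comment> \<open>Halfway between 1 and the smallest finite exponent: above 1 for
    \<open>A_diff_le\<close>, and below the exponents to which the maximal inequality is
    applied.\<close>
  define r where "r = (if p2 = top then (1 + a1) / 2 else (1 + min a1 a2) / 2)"
  have r: "1 < r" "r < a1" "p2 \<noteq> top \<Longrightarrow> r < a2" using a1 a2 by (auto simp: r_def min_def field_simps)
  have p12: "1 / 2 < p"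
  proof -
    have "1 / a1 < 1" "1 / a2 \<le> 1" using a1 a2 a20 by (cases "p2 = top"; simp add: field_simps)+
    then have "1 / p < 2" using p(2) by (simp add: a1_def a2_def)
    then show ?thesis using p(1) by (simp add: field_simps)
  qed
  define D where "D = 1 + MN powr p * CQ (a1 / r) + (if p2 = top then 0 else CQ (a1 / r) + CQ (a2 / r))"
  have q1: "0 \<le> CQ (a1 / r)" using r by (intro CQ) (simp add: field_simps)
  have q2: "0 \<le> CQ (a2 / r)" if "p2 \<noteq> top" using r that by (intro CQ) (simp add: field_simps)
  have q3: "0 \<le> MN powr p * CQ (a1 / r)" using q1 by simp
  have D: "1 \<le> D" "MN powr p * CQ (a1 / r) \<le> D" "p2 \<noteq> top \<Longrightarrow> CQ (a1 / r) \<le> D" "p2 \<noteq> top \<Longrightarrow> CQ (a2 / r) \<le> D"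
    unfolding D_def using q1 q2 q3 by (cases "p2 = top"; simp)+
  have D0: "0 \<le> D" using D(1) by simp
  have X: "(NN x. ennreal ((mx r j f1 x * mx r j f2 x) powr p)) \<le> ennreal D * (mdl p1 f1 + mdl p2 f2)"
    if f1: "stepf m n B f1" and f2: "stepf m n B f2" for f1 f2 m n B j
  proof (cases "p2 = top")
    case True
    have pa: "p = a1" using p a20[OF True] by (simp add: a1_def a2_def)
    show ?thesis
    proof (cases "mdl p2 f2 = top")
      case True
      then have "ennreal D * (mdl p1 f1 + mdl p2 f2) = top" using D(1) by (simp add: ennreal_mult_eq_top_iff)
      then show ?thesis by simp
    next
      case False
      then have f2le: "norm (f2 x) \<le> 1" for x using mdl_top_bound[of f2 x] True by (simp add: less_top)
      have "(NN x. ennreal ((mx r j f1 x * mx r j f2 x) powr p)) \<le> (NN x. ennreal (MN powr p) * ennreal (mx r j f1 x powr p))"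
      proof (intro nn_integral_mono)
        fix x
        have "(mx r j f1 x * mx r j f2 x) powr p \<le> (mx r j f1 x * MN) powr p"
          using p mx_nonneg mx_le_MN[OF f2le r(1)] by (intro powr_mono2 mult_left_mono mult_nonneg_nonneg) auto
        also have "\<dots> = MN powr p * mx r j f1 x powr p" by (simp add: powr_mult mult.commute)
        finally show "ennreal ((mx r j f1 x * mx r j f2 x) powr p) \<le> ennreal (MN powr p) * ennreal (mx r j f1 x powr p)"
          by (simp add: ennreal_mult[symmetric] ennreal_leI)
      qed
      also have "\<dots> = ennreal (MN powr p) * (NN x. ennreal (mx r j f1 x powr a1))" by (simp add: nn_integral_cmult pa)
      also have "\<dots> \<le> ennreal (MN powr p) * (ennreal (CQ (a1 / r)) * (NN x. ennreal (norm (f1 x) powr a1)))"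
        by (intro mult_left_mono mx_Lq[OF f1] r) auto
      also have "\<dots> = ennreal (MN powr p * CQ (a1 / r)) * mdl p1 f1"
        using q1 p1 by (simp add: ennreal_mult mult.assoc mdl_def a1_def)
      also have "\<dots> \<le> ennreal D * (mdl p1 f1 + mdl p2 f2)"
        by (intro mult_mono ennreal_leI D) auto
      finally show ?thesis .
    qed
  next
    case False
    have [measurable]: "f1 \<in> \<B>" "f2 \<in> \<B>" using stepfD(2)[OF f1] stepfD(2)[OF f2] by auto
    have "(NN x. ennreal ((mx r j f1 x * mx r j f2 x) powr p))
      \<le> (NN x. ennreal (mx r j f1 x powr a1) + ennreal (mx r j f2 x powr a2))"
    proof (intro nn_integral_mono)
      fix x
      have "(mx r j f1 x * mx r j f2 x) powr p \<le> mx r j f1 x powr a1 + mx r j f2 x powr a2"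
        using a1 a2[OF False] p mx_nonneg by (intro prod_young) (auto simp: a1_def a2_def)
      then show "ennreal ((mx r j f1 x * mx r j f2 x) powr p) \<le> ennreal (mx r j f1 x powr a1) + ennreal (mx r j f2 x powr a2)"
        by (simp add: ennreal_plus[symmetric] ennreal_leI del: ennreal_plus)
    qed
    also have "\<dots> = (NN x. ennreal (mx r j f1 x powr a1)) + (NN x. ennreal (mx r j f2 x powr a2))"
      by (rule nn_integral_add) measurable
    also have "\<dots> \<le> ennreal (CQ (a1 / r)) * mdl p1 f1 + ennreal (CQ (a2 / r)) * mdl p2 f2"
      using mx_Lq[OF f1 r(1,2), of j] mx_Lq[OF f2 r(1) r(3)[OF False], of j] p1 False
      by (intro add_mono) (auto simp: mdl_def a1_def a2_def)
    also have "\<dots> \<le> ennreal D * mdl p1 f1 + ennreal D * mdl p2 f2"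
      by (intro add_mono mult_right_mono ennreal_leI D False) auto
    finally show ?thesis by (simp add: distrib_left)
  qed
  show ?thesis
  proof (rule that)
    show "0 \<le> CG (4 * p) * CH r powr (4 * p) * D" using D0 p12 by (simp add: CG_def)
    fix I :: "int set" and f1 f2 :: "real^'n \<Rightarrow> complex" and m n B
    assume I: "finite I" and f: "stepf m n B f1" "stepf m n B f2"
    have "(NN x. ennreal (SF I f1 f2 x powr p)) \<le> ennreal (CG (4 * p) * CH r powr (4 * p)) * (ennreal D * (mdl p1 f1 + mdl p2 f2))"
      by (rule strong_core[OF f I r(1) p12 X[OF f]])
    also have "\<dots> = ennreal (CG (4 * p) * CH r powr (4 * p) * D) * (mdl p1 f1 + mdl p2 f2)"
      using D0 by (subst ennreal_mult) (use p12 in \<open>auto simp: mult.assoc CG_def\<close>)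
    finally show "(NN x. ennreal (SF I f1 f2 x powr p)) \<le> ennreal (CG (4 * p) * CH r powr (4 * p) * D) * (mdl p1 f1 + mdl p2 f2)" .
  qed
qed

text \<open>Approximation does not increase the modulars and the square functions converge
  everywhere, so Fatou's lemma carries the bound over.\<close>

lemma strong:
  assumes p1: "1 < p1" "p1 < top" and p2: "1 < p2" and p: "0 < p" "1 / p = 1 / enn2real p1 + 1 / enn2real p2"
  obtains C where "0 \<le> C" "\<And>I f1 f2. \<lbrakk>finite I; f1 \<in> \<B>; f2 \<in> \<B>; mdl p1 f1 < top; mdl p2 f2 < top\<rbrakk> \<Longrightarrow>
    (NN x. ennreal (SF I f1 f2 x powr p)) \<le> ennreal C * (mdl p1 f1 + mdl p2 f2)"
proof -
  obtain C where C: "0 \<le> C" "\<And>I f1 f2 m n B. \<lbrakk>finite I; stepf m n B f1; stepf m n B f2\<rbrakk> \<Longrightarrow>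
    (NN x. ennreal (SF I f1 f2 x powr p)) \<le> ennreal C * (mdl p1 f1 + mdl p2 f2)"
    using strong_simple[OF p1 p2 p] by blast
  show ?thesis
  proof (rule that[OF C(1)])
    fix I :: "int set" and f1 f2 :: "real^'n \<Rightarrow> complex"
    assume I: "finite I" and [measurable]: "f1 \<in> \<B>" "f2 \<in> \<B>"
      and m: "mdl p1 f1 < top" "mdl p2 f2 < top"
    have le: "1 \<le> p1" "1 \<le> p2" using p1 p2 by auto
    have l: "locint f1" "locint f2" using locint_mdl[OF _ le(1) m(1)] locint_mdl[OF _ le(2) m(2)] by auto
    have [measurable]: "appr n f1 \<in> \<B>" "appr n f2 \<in> \<B>" for n using l by (auto intro: appr_measurable)
    have "(NN x. ennreal (SF I (appr n f1) (appr n f2) x powr p)) \<le> ennreal C * (mdl p1 f1 + mdl p2 f2)" for n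
    proof -
      obtain B1 B2 where B: "stepf (- int n) n B1 (appr n f1)" "stepf (- int n) n B2 (appr n f2)"
        using stepf_appr[OF l(1)] stepf_appr[OF l(2)] by blast
      have "(NN x. ennreal (SF I (appr n f1) (appr n f2) x powr p)) \<le> ennreal C * (mdl p1 (appr n f1) + mdl p2 (appr n f2))"
        by (rule C(2)[OF I stepf_mono[OF B(1)] stepf_mono[OF B(2)], of "max B1 B2"]) auto
      also have "\<dots> \<le> ennreal C * (mdl p1 f1 + mdl p2 f2)"
        by (intro mult_left_mono add_mono mdl_appr le) auto
      finally show ?thesis .
    qed
    moreover have "(\<lambda>n. ennreal (SF I (appr n f1) (appr n f2) x powr p)) \<longlonglongrightarrow> ennreal (SF I f1 f2 x powr p)" for x
      using SF_conv[OF l, of I x] p(1) by (intro tendsto_ennrealI tendsto_powr2) auto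
    ultimately show "(NN x. ennreal (SF I f1 f2 x powr p)) \<le> ennreal C * (mdl p1 f1 + mdl p2 f2)"
      by (intro fatou_nn[where u = "\<lambda>n x. ennreal (SF I (appr n f1) (appr n f2) x powr p)"]) auto
  qed
qed

text \<open>The averaged functions are bounded by \<open>dC\<close>, so their modulars for L^2 and
  for L^q with q >= 2 are controlled by the given ones. The strong bound for these exponents,
  through a Markov estimate, fills the hypothesis of \<open>cz_cor\<close>.\<close>

lemma weak:
  assumes p2: "1 \<le> p2"
  obtains C where "0 \<le> C" "\<And>I f1 f2. \<lbrakk>finite I; f1 \<in> \<B>; f2 \<in> \<B>; mdl 1 f1 < top; mdl p2 f2 < top\<rbrakk> \<Longrightarrow>
    emeasure lborel {x. SF I f1 f2 x > 2} \<le> ennreal C * (mdl 1 f1 + mdl p2 f2)"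
proof -
  \<comment> \<open>At least 2, equal to \<open>top\<close> together with \<open>p2\<close>, and at
    most p2 + 1 otherwise, so that the interpolation constant is at most \<open>dC\<close>.\<close>
  define q where "q = max p2 2"
  have q: "1 < q" "2 \<le> q" "p2 \<le> q" by (auto simp: q_def less_max_iff_disj)
  define p where "p = 1 / (1 / 2 + 1 / enn2real q)"
  have p: "0 < p" "1 / p = 1 / enn2real 2 + 1 / enn2real q"
  proof -
    have "0 < 1 / 2 + 1 / enn2real q" by (intro add_pos_nonneg) auto
    then show "0 < p" "1 / p = 1 / enn2real 2 + 1 / enn2real q" by (auto simp: p_def)
  qed
  obtain C where C: "0 \<le> C" "\<And>I f1 f2. \<lbrakk>finite I; f1 \<in> \<B>; f2 \<in> \<B>; mdl 2 f1 < top; mdl q f2 < top\<rbrakk> \<Longrightarrow>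
    (NN x. ennreal (SF I f1 f2 x powr p)) \<le> ennreal C * (mdl 2 f1 + mdl q f2)"
    using strong[of 2 q p, OF _ _ q(1) p] by auto
  have interp: "mdl 2 g \<le> ennreal dC * mdl 1 g" "mdl q g \<le> ennreal dC * mdl p2 g"
    if [measurable]: "g \<in> \<B>" and g: "\<And>x. norm (g x) \<le> dC" for g
  proof -
    have "mdl 2 g \<le> ennreal (dC powr (enn2real 2 - enn2real 1)) * mdl 1 g"
      by (rule mdl_interpolate) (use g in auto)
    then show "mdl 2 g \<le> ennreal dC * mdl 1 g" using dC by simp
    show "mdl q g \<le> ennreal dC * mdl p2 g"
    proof (cases "p2 = top")
      case True
      then have "q = top" by (simp add: q_def max_def top_unique)
      have "1 * mdl p2 g \<le> ennreal dC * mdl p2 g" using dC by (intro mult_right_mono) (auto simp: ennreal_ge_1)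
      then show ?thesis using \<open>q = top\<close> True by simp
    next
      case False
      then have qt: "q < top" by (simp add: q_def less_top)
      have "mdl q g \<le> ennreal (dC powr (enn2real q - enn2real p2)) * mdl p2 g"
        by (rule mdl_interpolate[OF _ g p2 q(3) qt]) auto
      also have "\<dots> \<le> ennreal (dC powr 1) * mdl p2 g"
      proof (intro mult_right_mono ennreal_leI powr_mono)
        have "1 \<le> enn2real p2" using p2 False by (rule enn2real_ge_1)
        then show "enn2real q - enn2real p2 \<le> 1" by (auto simp: q_def max_def)
      qed (use dC in auto)
      finally show ?thesis using dC by simp
    qed
  qed
  define D where "D = C * dC + CZC"
  have D: "0 \<le> D" using C(1) dC CZC by (simp add: D_def)
  have simple: "emeasure lborel {x. SF I f1 f2 x > 2} \<le> ennreal D * (mdl 1 f1 + mdl p2 f2)"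
    if I: "finite I" and f: "stepf m n B f1" "stepf m n B f2" and fin: "mdl 1 f1 < top" "mdl p2 f2 < top" for I f1 f2 m n B
  proof -
    define m' where "m' = Min (insert m I)"
    have m': "m' \<le> m" "\<And>k. k \<in> I \<Longrightarrow> m' \<le> k" unfolding m'_def using I by (auto intro!: Min_le simp del: Min_insert)
    have "emeasure lborel {x. SF I f1 f2 x > 2} \<le> ennreal (C * dC) * (mdl 1 f1 + mdl p2 f2) + ennreal CZC * (mdl 1 f1 + mdl p2 f2)"
    proof (rule cz_cor[of f1 f2 m' I 1 p2])
      show "f1 x = f1 y" "f2 x = f2 y" if "gr m' x = gr m' y" for x y
        using stepfD(3)[OF f(1) gr_mono[OF that m'(1)]] stepfD(3)[OF f(2) gr_mono[OF that m'(1)]] by auto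
    next
      fix g1 g2 :: "real^'n \<Rightarrow> complex"
      assume g: "\<And>x. norm (g1 x) \<le> dC" "\<And>x. norm (g2 x) \<le> dC" "integrable lborel g1" "integrable lborel g2"
        and le: "mdl 1 g1 \<le> mdl 1 f1" "mdl p2 g2 \<le> mdl p2 f2"
      have [measurable]: "g1 \<in> \<B>" "g2 \<in> \<B>" using g by auto
      have i: "mdl 2 g1 \<le> ennreal dC * mdl 1 f1" "mdl q g2 \<le> ennreal dC * mdl p2 f2"
        using order_trans[OF interp(1)[of g1] mult_left_mono[OF le(1)]] order_trans[OF interp(2)[of g2] mult_left_mono[OF le(2)]] g by auto
      have t: "mdl 2 g1 < top" "mdl q g2 < top"
        using i fin by (auto intro: le_less_trans simp: ennreal_mult_less_top)
      have "emeasure lborel {x. SF I g1 g2 x > 1} = (NN x. indicator {x. SF I g1 g2 x > 1} x)" by simp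
      also have "\<dots> \<le> (NN x. ennreal (SF I g1 g2 x powr p))"
        using p(1) by (intro nn_integral_mono) (auto simp: indicator_def ennreal_ge_1 ge_one_powr_ge_zero)
      also have "\<dots> \<le> ennreal C * (mdl 2 g1 + mdl q g2)" by (rule C(2)[OF I _ _ t]) auto
      also have "\<dots> \<le> ennreal C * (ennreal dC * mdl 1 f1 + ennreal dC * mdl p2 f2)" by (intro mult_left_mono add_mono i) auto
      also have "\<dots> = ennreal (C * dC) * (mdl 1 f1 + mdl p2 f2)"
        using C(1) dC by (simp add: ennreal_mult distrib_left mult.assoc)
      finally show "emeasure lborel {x. SF I g1 g2 x > 1} \<le> ennreal (C * dC) * (mdl 1 f1 + mdl p2 f2)" .
    qed (use I m'(2) p2 stepfD(1)[OF f(1)] stepfD(1)[OF f(2)] in auto)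
    also have "\<dots> = ennreal D * (mdl 1 f1 + mdl p2 f2)"
      using C(1) dC CZC by (simp add: D_def distrib_right)
    finally show ?thesis .
  qed
  show ?thesis
  proof (rule that[OF D])
    fix I :: "int set" and f1 f2 :: "real^'n \<Rightarrow> complex"
    assume I: "finite I" and [measurable]: "f1 \<in> \<B>" "f2 \<in> \<B>"
      and m: "mdl 1 f1 < top" "mdl p2 f2 < top"
    have l: "locint f1" "locint f2" using locint_mdl[OF _ order_refl m(1)] locint_mdl[OF _ p2 m(2)] by auto
    have [measurable]: "appr n f1 \<in> \<B>" "appr n f2 \<in> \<B>" for n using l by (auto intro: appr_measurable)
    have "emeasure lborel {x\<in>space lborel. SF I (appr n f1) (appr n f2) x > 2} \<le> ennreal D * (mdl 1 f1 + mdl p2 f2)" for n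
    proof -
      obtain B1 B2 where B: "stepf (- int n) n B1 (appr n f1)" "stepf (- int n) n B2 (appr n f2)"
        using stepf_appr[OF l(1)] stepf_appr[OF l(2)] by blast
      have a: "mdl 1 (appr n f1) \<le> mdl 1 f1" "mdl p2 (appr n f2) \<le> mdl p2 f2" by (auto intro!: mdl_appr p2)
      have "emeasure lborel {x. SF I (appr n f1) (appr n f2) x > 2} \<le> ennreal D * (mdl 1 (appr n f1) + mdl p2 (appr n f2))"
        by (rule simple[OF I stepf_mono[OF B(1)] stepf_mono[OF B(2)], of "max B1 B2"]) (use a m in \<open>auto intro: le_less_trans\<close>)
      also have "\<dots> \<le> ennreal D * (mdl 1 f1 + mdl p2 f2)" by (intro mult_left_mono add_mono a) auto
      finally show ?thesis by simp
    qed
    then have "emeasure lborel {x\<in>space lborel. SF I f1 f2 x > 2} \<le> ennreal D * (mdl 1 f1 + mdl p2 f2)"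
      using SF_conv[OF l] by (intro fatou_level[where u = "\<lambda>n x. SF I (appr n f1) (appr n f2) x"]) auto
    then show "emeasure lborel {x. SF I f1 f2 x > 2} \<le> ennreal D * (mdl 1 f1 + mdl p2 f2)" by simp
  qed
qed

end

subsection \<open>The full square function\<close>

lemma ennreal_powr_SUP:
  assumes r: "0 < r" and s: "\<And>n::nat. 0 \<le> s n"
  shows "ennreal_powr (SUP n. ennreal (s n)) r = (SUP n. ennreal (s n powr r))"
proof (rule antisym)
  show "(SUP n. ennreal (s n powr r)) \<le> ennreal_powr (SUP n. ennreal (s n)) r"
  proof (cases "(SUP n. ennreal (s n)) = top")
    case False
    then obtain y where y: "(SUP n. ennreal (s n)) = ennreal y" "0 \<le> y" by (cases "SUP n. ennreal (s n)") auto
    have "s n \<le> y" for n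
    proof -
      have "ennreal (s n) \<le> ennreal y" unfolding y(1)[symmetric] by (rule SUP_upper) simp
      then show ?thesis using y by simp
    qed
    then show ?thesis unfolding y(1) ennreal_powr_def using y r s
      by (auto intro!: SUP_least ennreal_leI powr_mono2)
  qed (simp add: ennreal_powr_def)
  show "ennreal_powr (SUP n. ennreal (s n)) r \<le> (SUP n. ennreal (s n powr r))"
  proof (cases "(SUP n. ennreal (s n powr r)) = top")
    case False
    then obtain z where z: "(SUP n. ennreal (s n powr r)) = ennreal z" "0 \<le> z" by (cases "SUP n. ennreal (s n powr r)") auto
    have "s n \<le> z powr (1 / r)" for n
    proof -
      have "ennreal (s n powr r) \<le> ennreal z" unfolding z(1)[symmetric] by (rule SUP_upper) simp
      then have "(s n powr r) powr (1 / r) \<le> z powr (1 / r)" using z r by (intro powr_mono2) auto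
      then show ?thesis using r s[of n] by (simp add: powr_powr)
    qed
    then have le: "(SUP n. ennreal (s n)) \<le> ennreal (z powr (1 / r))" by (intro SUP_least ennreal_leI)
    then obtain y where y: "(SUP n. ennreal (s n)) = ennreal y" "0 \<le> y" by (cases "SUP n. ennreal (s n)") (auto simp: top_unique)
    have "y \<le> z powr (1 / r)" using le y by simp
    then have "y powr r \<le> (z powr (1 / r)) powr r" using y r by (intro powr_mono2) auto
    also have "\<dots> = z" using r z by (simp add: powr_powr)
    finally show ?thesis unfolding z(1) y(1) using y by (simp add: ennreal_powr_def ennreal_leI)
  next
    case True
    show ?thesis unfolding True by simp
  qed
qed

lemma ennreal_powr_cmult:
  assumes "0 \<le> c" "0 < r"
  shows "ennreal_powr (ennreal c * X) r = ennreal (c powr r) * ennreal_powr X r"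
proof (cases "c = 0")
  case True
  then show ?thesis using assms by (simp add: ennreal_powr_def)
next
  case False
  then show ?thesis using assms
    by (cases X) (auto simp: ennreal_powr_def ennreal_mult[symmetric] powr_mult ennreal_mult_top ennreal_mult_eq_top_iff)
qed

lemma ennreal_powr_mono:
  assumes "x \<le> y" "0 < r"
  shows "ennreal_powr x r \<le> ennreal_powr y r"
proof (cases "y = top")
  case False
  then have "x \<noteq> top" using assms(1) by (auto simp: top_unique)
  with False show ?thesis using assms
    by (auto simp: ennreal_powr_def less_top intro!: ennreal_leI powr_mono2 enn2real_mono)
qed (simp add: ennreal_powr_def)

lemma mdl_scale:
  assumes [measurable]: "f \<in> \<B>" and p: "p < top" and c: "0 \<le> c"
  shows "mdl p (\<lambda>x. of_real c * f x) = ennreal (c powr enn2real p) * mdl p f"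
  using p c by (simp add: mdl_def norm_mult powr_mult ennreal_mult nn_integral_cmult)

context body
begin

text \<open>The sum over all scales as a limit of increasing finite ones;
  \<open>square_fun_LF\<close> identifies it with the square function of the statement.\<close>

definition LF :: "(real^'n \<Rightarrow> complex) \<Rightarrow> (real^'n \<Rightarrow> complex) \<Rightarrow> real^'n \<Rightarrow> ennreal" where
  "LF f1 f2 x = (SUP n. ennreal (SF {- int n..int n} f1 f2 x))"

lemma LF_measurable [measurable]:
  assumes [measurable]: "f1 \<in> \<B>" "f2 \<in> \<B>"
  shows "LF f1 f2 \<in> \<B>"
  unfolding LF_def by measurable

lemma SF_mono: "finite J \<Longrightarrow> I \<subseteq> J \<Longrightarrow> SF I f1 f2 x \<le> SF J f1 f2 x"
  unfolding SF_def L2_set_def by (intro real_sqrt_le_mono sum_mono2) auto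

lemma LF_scale: "LF (\<lambda>x. c1 * f1 x) (\<lambda>x. c2 * f2 x) x = ennreal (norm (c1 * c2)) * LF f1 f2 x"
  unfolding LF_def by (simp add: SF_scale ennreal_mult SUP_mult_left_ennreal)

lemma LF_unscale:
  fixes n1 n2 :: real
  assumes "0 < n1" "0 < n2"
  shows "LF f1 f2 x = ennreal (n1 * n2) * LF (\<lambda>x. of_real (1 / n1) * f1 x) (\<lambda>x. of_real (1 / n2) * f2 x) x"
  unfolding LF_scale using assms by (simp add: norm_mult norm_divide mult.assoc[symmetric] ennreal_mult[symmetric])

lemma LF_zero:
  assumes "(AE x in lborel. f1 x = 0) \<or> (AE x in lborel. f2 x = 0)"
    and "f1 \<in> \<B>" "f2 \<in> \<B>"
  shows "LF f1 f2 x = 0"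
  by (simp add: LF_def SF_zero[OF assms])

lemma LF_strong:
  assumes p1: "1 < p1" "p1 < top" and p2: "1 < p2" and p: "0 < p" "1 / p = 1 / enn2real p1 + 1 / enn2real p2"
  obtains C where "0 \<le> C" "\<And>f1 f2. \<lbrakk>f1 \<in> \<B>; f2 \<in> \<B>; mdl p1 f1 < top; mdl p2 f2 < top\<rbrakk> \<Longrightarrow>
    (NN x. ennreal_powr (LF f1 f2 x) p) \<le> ennreal C * (mdl p1 f1 + mdl p2 f2)"
proof -
  obtain C where C: "0 \<le> C" "\<And>I f1 f2. \<lbrakk>finite I; f1 \<in> \<B>; f2 \<in> \<B>; mdl p1 f1 < top; mdl p2 f2 < top\<rbrakk> \<Longrightarrow>
    (NN x. ennreal (SF I f1 f2 x powr p)) \<le> ennreal C * (mdl p1 f1 + mdl p2 f2)"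
    using strong[OF p1 p2 p] by blast
  show ?thesis
  proof (rule that[OF C(1)])
    fix f1 f2 :: "real^'n \<Rightarrow> complex"
    assume f [measurable]: "f1 \<in> \<B>" "f2 \<in> \<B>"
      and m: "mdl p1 f1 < top" "mdl p2 f2 < top"
    have "(NN x. ennreal_powr (LF f1 f2 x) p) = (NN x. (SUP n. ennreal (SF {- int n..int n} f1 f2 x powr p)))"
      unfolding LF_def by (simp add: ennreal_powr_SUP[OF p(1)])
    also have "\<dots> = (SUP n. \<integral>\<^sup>+x. ennreal (SF {- int n..int n} f1 f2 x powr p) \<partial>lborel)"
      using p(1) by (intro nn_integral_monotone_convergence_SUP) (auto simp: incseq_def le_fun_def intro!: ennreal_leI powr_mono2 SF_mono)
    also have "\<dots> \<le> ennreal C * (mdl p1 f1 + mdl p2 f2)" by (intro SUP_least C(2) f m) simp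
    finally show "(NN x. ennreal_powr (LF f1 f2 x) p) \<le> ennreal C * (mdl p1 f1 + mdl p2 f2)" .
  qed
qed

text \<open>For functions of modular at most 1 the sum of the modulars is at most 2; homogeneity
  then produces the product \<open>n1 * n2\<close>.\<close>

lemma LF_strong_norm:
  assumes p1: "1 < p1" "p1 < top" and p2: "1 < p2" and p: "0 < p" "1 / p = 1 / enn2real p1 + 1 / enn2real p2"
  obtains C :: real where "\<And>f1 f2 n1 n2. \<lbrakk>f1 \<in> \<B>; f2 \<in> \<B>; 0 < n1; 0 < n2;
      mdl p1 (\<lambda>x. of_real (1 / n1) * f1 x) \<le> 1; mdl p2 (\<lambda>x. of_real (1 / n2) * f2 x) \<le> 1\<rbrakk> \<Longrightarrow>
    ennreal_powr (NN x. ennreal_powr (LF f1 f2 x) p) (1 / p) \<le> ennreal C * ennreal n1 * ennreal n2"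
proof -
  obtain C where C: "0 \<le> C" "\<And>f1 f2. \<lbrakk>f1 \<in> \<B>; f2 \<in> \<B>; mdl p1 f1 < top; mdl p2 f2 < top\<rbrakk> \<Longrightarrow>
    (NN x. ennreal_powr (LF f1 f2 x) p) \<le> ennreal C * (mdl p1 f1 + mdl p2 f2)"
    using LF_strong[OF p1 p2 p] by blast
  show ?thesis
  proof (rule that)
    fix f1 f2 :: "real^'n \<Rightarrow> complex" and n1 n2 :: real
    assume [measurable]: "f1 \<in> \<B>" "f2 \<in> \<B>" and n: "0 < n1" "0 < n2"
      and m: "mdl p1 (\<lambda>x. of_real (1 / n1) * f1 x) \<le> 1" "mdl p2 (\<lambda>x. of_real (1 / n2) * f2 x) \<le> 1"
    let ?h1 = "\<lambda>x. of_real (1 / n1) * f1 x" and ?h2 = "\<lambda>x. of_real (1 / n2) * f2 x"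
    have [measurable]: "(\<lambda>x. ennreal_powr (LF ?h1 ?h2 x) p) \<in> \<B>" unfolding ennreal_powr_def by measurable
    have "(NN x. ennreal_powr (LF f1 f2 x) p) = (NN x. ennreal ((n1 * n2) powr p) * ennreal_powr (LF ?h1 ?h2 x) p)"
      unfolding LF_unscale[OF n, of f1 f2] using n p by (simp add: ennreal_powr_cmult)
    also have "\<dots> = ennreal ((n1 * n2) powr p) * (NN x. ennreal_powr (LF ?h1 ?h2 x) p)"
      by (rule nn_integral_cmult) measurable
    also have "\<dots> \<le> ennreal ((n1 * n2) powr p) * (ennreal C * (mdl p1 ?h1 + mdl p2 ?h2))"
    proof (intro mult_left_mono C(2))
      show "mdl p1 ?h1 < top" "mdl p2 ?h2 < top" by (rule le_less_trans[OF m(1)], simp, rule le_less_trans[OF m(2)], simp)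
    qed auto
    also have "\<dots> \<le> ennreal ((n1 * n2) powr p) * (ennreal C * (1 + 1))" by (intro mult_left_mono add_mono m) auto
    also have "\<dots> = ennreal ((n1 * n2) powr p * (C * 2))" using C(1) by (simp add: ennreal_mult)
    finally have "ennreal_powr (NN x. ennreal_powr (LF f1 f2 x) p) (1 / p) \<le> ennreal_powr (ennreal ((n1 * n2) powr p * (C * 2))) (1 / p)"
      using p(1) by (intro ennreal_powr_mono) auto
    also have "\<dots> = ennreal ((C * 2) powr (1 / p)) * ennreal n1 * ennreal n2"
      using n p(1) C(1) by (simp add: ennreal_powr_def powr_mult powr_powr ennreal_mult[symmetric] ac_simps)
    finally show "ennreal_powr (NN x. ennreal_powr (LF f1 f2 x) p) (1 / p) \<le> ennreal ((C * 2) powr (1 / p)) * ennreal n1 * ennreal n2" .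
  qed
qed

lemma LF_level:
  assumes [measurable]: "f1 \<in> \<B>" "f2 \<in> \<B>"
    and le: "\<And>n. emeasure lborel {x. SF {- int n..int n} f1 f2 x > \<alpha>} \<le> X" and \<alpha>: "0 < \<alpha>"
  shows "emeasure lborel {x. LF f1 f2 x > ennreal \<alpha>} \<le> X"
proof -
  have "{x. LF f1 f2 x > ennreal \<alpha>} = (\<Union>n. {x. SF {- int n..int n} f1 f2 x > \<alpha>})"
    using \<alpha> by (auto simp: LF_def less_SUP_iff ennreal_less_iff)
  also have "emeasure lborel \<dots> = (SUP n. emeasure lborel {x. SF {- int n..int n} f1 f2 x > \<alpha>})"
  proof (rule SUP_emeasure_incseq[symmetric])
    show "incseq (\<lambda>n. {x. SF {- int n..int n} f1 f2 x > \<alpha>})"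
      by (auto simp: incseq_def intro: less_le_trans[OF _ SF_mono])
  qed auto
  also have "\<dots> \<le> X" by (intro SUP_least le)
  finally show ?thesis .
qed

text \<open>The inequality at hand concerns height 2. The functions are scaled so that both modulars
  are at most \<open>t\<close> and the height \<alpha> becomes 2, which forces t t^(1/p2) = t^(1/p)
  = 2 n1 n2 / \<alpha>.\<close>

lemma LF_weak_norm:
  assumes p2: "1 \<le> p2" and p: "0 < p" "1 / p = 1 + 1 / enn2real p2"
  obtains C :: real where "\<And>f1 f2 n1 n2 \<alpha>. \<lbrakk>f1 \<in> \<B>; f2 \<in> \<B>; 0 < n1; 0 < n2;
      mdl 1 (\<lambda>x. of_real (1 / n1) * f1 x) \<le> 1; mdl p2 (\<lambda>x. of_real (1 / n2) * f2 x) \<le> 1; 0 < \<alpha>\<rbrakk> \<Longrightarrow>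
    ennreal \<alpha> * ennreal_powr (emeasure lborel {x. LF f1 f2 x > ennreal \<alpha>}) (1 / p) \<le> ennreal C * ennreal n1 * ennreal n2"
proof -
  obtain C where C: "0 \<le> C" "\<And>I f1 f2. \<lbrakk>finite I; f1 \<in> \<B>; f2 \<in> \<B>; mdl 1 f1 < top; mdl p2 f2 < top\<rbrakk> \<Longrightarrow>
    emeasure lborel {x. SF I f1 f2 x > 2} \<le> ennreal C * (mdl 1 f1 + mdl p2 f2)"
    using weak[OF p2] by blast
  show ?thesis
  proof (rule that)
    fix f1 f2 :: "real^'n \<Rightarrow> complex" and n1 n2 \<alpha> :: real
    assume [measurable]: "f1 \<in> \<B>" "f2 \<in> \<B>" and n: "0 < n1" "0 < n2"
      and m: "mdl 1 (\<lambda>x. of_real (1 / n1) * f1 x) \<le> 1" "mdl p2 (\<lambda>x. of_real (1 / n2) * f2 x) \<le> 1" and \<alpha>: "0 < \<alpha>"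
    let ?h1 = "\<lambda>x. of_real (1 / n1) * f1 x" and ?h2 = "\<lambda>x. of_real (1 / n2) * f2 x"
    define t where "t = (2 * (n1 * n2) / \<alpha>) powr p"
    have t: "0 < t" using n \<alpha> by (simp add: t_def)
    \<comment> \<open>For \<open>p2 = top\<close> the exponent is 1/0 = 0, so \<open>c\<close> is 1
      and the normalised second function is not scaled further.\<close>
    define c where "c = t powr (1 / enn2real p2)"
    have c: "0 < c" using t by (simp add: c_def)
    let ?g1 = "\<lambda>x. of_real t * ?h1 x" and ?g2 = "\<lambda>x. of_real c * ?h2 x"
    have m1: "mdl 1 ?g1 \<le> ennreal t"
    proof -
      have "mdl 1 ?g1 = ennreal t * mdl 1 ?h1" using t mdl_1_scale[of ?h1 "of_real t"] by simp
      also have "\<dots> \<le> ennreal t * 1" by (intro mult_left_mono m) auto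
      finally show ?thesis by simp
    qed
    have m2: "mdl p2 ?g2 \<le> ennreal t"
    proof (cases "p2 = top")
      case True
      then have "c = 1" using t by (simp add: c_def)
      moreover have "norm (?h2 x) \<le> 1" for x
        by (rule mdl_top_bound) (use True m(2) in \<open>auto intro: le_less_trans\<close>)
      ultimately show ?thesis using True by (simp add: mdl_def)
    next
      case False
      then have "1 \<le> enn2real p2" using p2 by (intro enn2real_ge_1)
      then have "c powr enn2real p2 = t" using t by (simp add: c_def powr_powr)
      then have "mdl p2 ?g2 = ennreal t * mdl p2 ?h2" using False c by (subst mdl_scale) (auto simp: less_top)
      also have "\<dots> \<le> ennreal t * 1" by (intro mult_left_mono m) auto
      finally show ?thesis by simp
    qed
    have tc: "t * c = 2 * (n1 * n2) / \<alpha>"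
    proof -
      have "t * c = t powr (1 + 1 / enn2real p2)" using t by (simp add: c_def powr_add)
      also have "\<dots> = t powr (1 / p)" by (simp only: p(2))
      also have "\<dots> = 2 * (n1 * n2) / \<alpha>" using p(1) n \<alpha> by (simp add: t_def powr_powr)
      finally show ?thesis .
    qed
    have "emeasure lborel {x. LF f1 f2 x > ennreal \<alpha>} \<le> ennreal (C * (2 * t))"
    proof (rule LF_level)
      fix k
      let ?I = "{- int k..int k}"
      have "SF ?I ?g1 ?g2 x = (t * c) * (SF ?I f1 f2 x / (n1 * n2))" for x
        unfolding SF_scale using n t c by (simp add: norm_mult norm_divide)
      then have "SF ?I f1 f2 x > \<alpha> \<longleftrightarrow> SF ?I ?g1 ?g2 x > 2" for x
      proof -
        assume e: "\<And>x. SF ?I ?g1 ?g2 x = (t * c) * (SF ?I f1 f2 x / (n1 * n2))"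
        have "SF ?I ?g1 ?g2 x = 2 * SF ?I f1 f2 x / \<alpha>" unfolding e tc using n by simp
        then show ?thesis using \<alpha> by (simp only: less_divide_eq) simp
      qed
      then have "emeasure lborel {x. SF ?I f1 f2 x > \<alpha>} = emeasure lborel {x. SF ?I ?g1 ?g2 x > 2}" by presburger
      also have "\<dots> \<le> ennreal C * (mdl 1 ?g1 + mdl p2 ?g2)"
      proof (rule C(2))
        show "mdl 1 ?g1 < top" "mdl p2 ?g2 < top" by (rule le_less_trans[OF m1], simp, rule le_less_trans[OF m2], simp)
      qed auto
      also have "\<dots> \<le> ennreal C * (ennreal t + ennreal t)" by (intro mult_left_mono add_mono m1 m2) auto
      also have "\<dots> = ennreal (C * (2 * t))" using t C(1) by (simp add: ennreal_mult[symmetric] ennreal_plus[symmetric] del: ennreal_plus)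
      finally show "emeasure lborel {x. SF ?I f1 f2 x > \<alpha>} \<le> ennreal (C * (2 * t))" .
    qed (use \<alpha> in auto)
    then have "ennreal \<alpha> * ennreal_powr (emeasure lborel {x. LF f1 f2 x > ennreal \<alpha>}) (1 / p) \<le> ennreal \<alpha> * ennreal_powr (ennreal (C * (2 * t))) (1 / p)"
      using p(1) by (intro mult_left_mono ennreal_powr_mono) auto
    also have "\<dots> = ennreal (\<alpha> * ((2 * C) powr (1 / p) * t powr (1 / p)))"
      using t C(1) \<alpha> by (simp add: ennreal_powr_def ennreal_mult[symmetric] powr_mult ac_simps)
    also have "t powr (1 / p) = 2 * (n1 * n2) / \<alpha>" using p(1) n \<alpha> by (simp add: t_def powr_powr)
    also have "\<alpha> * ((2 * C) powr (1 / p) * (2 * (n1 * n2) / \<alpha>)) = ((2 * C) powr (1 / p) * 2) * n1 * n2" using \<alpha> by simp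
    also have "ennreal \<dots> = ennreal ((2 * C) powr (1 / p) * 2) * ennreal n1 * ennreal n2" using n by (simp add: ennreal_mult)
    finally show "ennreal \<alpha> * ennreal_powr (emeasure lborel {x. LF f1 f2 x > ennreal \<alpha>}) (1 / p) \<le> ennreal ((2 * C) powr (1 / p) * 2) * ennreal n1 * ennreal n2" .
  qed
qed

end

subsection \<open>The BMO bound\<close>

lemma e2ennreal_abs_diff_le:
  fixes L :: ennreal and a b :: real
  assumes "0 \<le> a" "L \<le> ennreal a + b'" "ennreal a \<le> L + b'"
  shows "e2ennreal \<bar>enn2ereal L - ereal a\<bar> \<le> b'"
proof (cases b')
  case b: (real b)
  then obtain l where l: "L = ennreal l" "0 \<le> l" using assms(2) assms(1) by (cases L) (auto simp: top_unique)
  have "\<bar>l - a\<bar> \<le> b"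
    using assms b l by (auto simp: ennreal_plus[symmetric] abs_le_iff simp del: ennreal_plus)
  moreover have "e2ennreal \<bar>enn2ereal L - ereal a\<bar> = ennreal \<bar>l - a\<bar>"
  proof -
    have "enn2ereal L = ereal l" using l by (simp add: enn2ereal_ennreal)
    then show ?thesis by (simp add: e2ennreal_ereal)
  qed
  ultimately show ?thesis using b by (simp add: ennreal_leI)
qed simp

context body
begin

text \<open>Fine scales see only a neighbourhood of the cube, and a bounded function cut off there
  has L^2 modular bounded by the volume. The bound from L^2 x L^\<infinity> to L^2 then gives the
  L^1 estimate through s <= 1 + s^2.\<close>

lemma bmo_local:
  obtains C where "0 \<le> C" "\<And>I h1 h2 j x0. \<lbrakk>finite I; h1 \<in> \<B>; h2 \<in> \<B>;
      \<And>x. norm (h1 x) \<le> 1; \<And>x. norm (h2 x) \<le> 1\<rbrakk> \<Longrightarrow>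
    (NN x. indicator {x. gr j x = gr j x0} x * ennreal (SF {k\<in>I. k \<le> j} h1 h2 x)) \<le> ennreal (C * (2 powi j) ^ CARD('n))"
proof -
  obtain C where C: "0 \<le> C" "\<And>I f1 f2. \<lbrakk>finite I; f1 \<in> \<B>; f2 \<in> \<B>; mdl 2 f1 < top; mdl top f2 < top\<rbrakk> \<Longrightarrow>
    (NN x. ennreal (SF I f1 f2 x powr 2)) \<le> ennreal C * (mdl 2 f1 + mdl top f2)"
    by (rule strong[of 2 top 2]) (auto simp: less_top)
  show ?thesis
  proof (rule that)
    show "0 \<le> 1 + C * MN" using C(1) MN by simp
    fix I :: "int set" and h1 h2 :: "real^'n \<Rightarrow> complex" and j and x0 :: "real^'n"
    assume I: "finite I" and [measurable]: "h1 \<in> \<B>" "h2 \<in> \<B>"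
      and h: "\<And>x. norm (h1 x) \<le> 1" "\<And>x. norm (h2 x) \<le> 1"
    let ?Q = "{x. gr j x = gr j x0}" and ?B = "{y. near N j x0 y}" and ?J = "{k\<in>I. k \<le> j}"
    let ?v = "(2 powi j) ^ CARD('n) :: real"
    define g1 where "g1 y = indicator ?B y * h1 y" for y
    define g2 where "g2 y = indicator ?B y * h2 y" for y
    have [measurable]: "g1 \<in> \<B>" "g2 \<in> \<B>" unfolding g1_def g2_def by measurable
    have m1: "mdl 2 g1 \<le> ennreal (MN * ?v)"
    proof -
      have "mdl 2 g1 = (NN x. ennreal (norm (g1 x) powr 2))" by (simp add: mdl_def)
      also have "\<dots> \<le> (NN x. indicator ?B x)"
      proof (intro nn_integral_mono)
        fix x
        have "norm (h1 x) powr 2 \<le> 1" by (rule powr_le1) (use h(1) in auto)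
        then show "ennreal (norm (g1 x) powr 2) \<le> indicator ?B x" by (simp add: g1_def indicator_def)
      qed
      also have "\<dots> = emeasure lborel ?B" by (rule nn_integral_indicator) measurable
      also have "\<dots> \<le> ennreal (MN * ?v)" unfolding MN_def by (rule near_measure[OF N0])
      finally show ?thesis .
    qed
    have m2: "mdl top g2 = 0" using h(2) by (auto simp: mdl_def g2_def indicator_def)
    have "(NN x. indicator ?Q x * ennreal (SF ?J h1 h2 x)) \<le> (NN x. indicator ?Q x + ennreal (SF ?J g1 g2 x powr 2))"
    proof (intro nn_integral_mono)
      fix x
      show "indicator ?Q x * ennreal (SF ?J h1 h2 x) \<le> indicator ?Q x + ennreal (SF ?J g1 g2 x powr 2)"
      proof (cases "gr j x = gr j x0")
        case True
        define s where "s = SF ?J g1 g2 x"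
        have s: "SF ?J h1 h2 x = s" "0 \<le> s" using SF_local[OF True, of I h1 h2] by (auto simp: s_def g1_def[abs_def] g2_def[abs_def])
        have "s \<le> 1 + s powr 2"
        proof -
          have "0 \<le> (s - 1)\<^sup>2 + s\<^sup>2 + 1" by simp
          then show ?thesis using s by (simp add: power2_eq_square algebra_simps powr_numeral)
        qed
        then have "ennreal s \<le> 1 + ennreal (s powr 2)" using ennreal_leI ennreal_plus[of 1 "s powr 2"] by fastforce
        then show ?thesis using True s(1) by (simp add: s_def)
      qed simp
    qed
    also have "\<dots> = emeasure lborel ?Q + (NN x. ennreal (SF ?J g1 g2 x powr 2))"
      by (subst nn_integral_add) auto
    also have "\<dots> \<le> ennreal ?v + ennreal C * (mdl 2 g1 + mdl top g2)"
    proof (intro add_mono C(2))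
      show "emeasure lborel ?Q \<le> ennreal ?v" by (simp add: cell_measure)
      show "mdl 2 g1 < top" by (rule le_less_trans[OF m1]) simp
    qed (use I m2 in auto)
    also have "\<dots> \<le> ennreal ?v + ennreal C * ennreal (MN * ?v)" unfolding m2 using m1 by (intro add_mono mult_left_mono) auto
    also have "\<dots> = ennreal ((1 + C * MN) * ?v)"
      using C(1) MN by (simp add: ennreal_mult[symmetric] ennreal_plus[symmetric] algebra_simps del: ennreal_plus)
    finally show "(NN x. indicator ?Q x * ennreal (SF ?J h1 h2 x)) \<le> ennreal ((1 + C * MN) * ?v)" .
  qed
qed

text \<open>The geometric series of bounds from \<open>A_diff_le\<close> for r = 2;
  \<open>MN * 2\<close> is the bound of \<open>tav_bounded\<close> for functions bounded by
  1.\<close>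

definition CE :: real where "CE = CF * ((MN * 2) * (MN * 2)) * (2 / (1 - 2 powr (- (1 / 2))))"

lemma CE: "0 \<le> CE"
  using CF MN powr_less_one[of 2 "- (1 / 2)"] by (simp add: CE_def)

lemma bmo_far:
  assumes f: "integrable lborel f1" "integrable lborel f2" and I: "finite I"
    and h: "\<And>x. norm (f1 x) \<le> 1" "\<And>x. norm (f2 x) \<le> 1" and x: "gr j x = gr j x0"
  shows "\<bar>SF I f1 f2 x - SF {k\<in>I. j < k} f1 f2 x0\<bar> \<le> SF {k\<in>I. k \<le> j} f1 f2 x + CE"
proof -
  define \<rho> :: real where "\<rho> = 2 powr (- (1 - 1 / 2))"
  define t where "t = MN * 2"
  have t: "0 < t" using MN by (simp add: t_def)
  have rh: "0 \<le> \<rho>" "\<rho> < 1" using rho[of 2] by (auto simp: \<rho>_def)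
  have "(\<Sum>k\<in>{k\<in>I. j < k}. norm (A k f1 f2 x - A k f1 f2 x0)) \<le> (\<Sum>k\<in>{k\<in>I. j < k}. CF * (t * t) * \<rho> ^ nat \<bar>j - k\<bar>)"
  proof (rule sum_mono)
    fix k assume "k \<in> {k\<in>I. j < k}"
    then have k: "j \<le> k" "nat \<bar>j - k\<bar> = nat (k - j)" by auto
    have T: "tav N k (\<lambda>y. ennreal (norm (f y) powr 2)) x0 \<le> ennreal (t powr 2)" if "\<And>x. norm (f x) \<le> 1" for f :: "real^'n \<Rightarrow> complex"
      using tav_bounded[of f 1 2 k x0] that by (simp add: t_def)
    show "norm (A k f1 f2 x - A k f1 f2 x0) \<le> CF * (t * t) * \<rho> ^ nat \<bar>j - k\<bar>"
      unfolding k(2) \<rho>_def by (rule A_diff_le[OF f x k(1) _ t t T[OF h(1)] T[OF h(2)]]) simp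
  qed
  also have "\<dots> = CF * (t * t) * (\<Sum>k\<in>{k\<in>I. j < k}. \<rho> ^ nat \<bar>j - k\<bar>)" by (simp add: sum_distrib_left)
  also have "\<dots> \<le> CF * (t * t) * (2 / (1 - \<rho>))" using CF t by (intro mult_left_mono geom_int_sum rh) (use I in auto)
  also have "\<dots> = CE" by (simp add: CE_def t_def \<rho>_def)
  finally show ?thesis using SF_close[OF I x, of f1 f2] by linarith
qed

text \<open>Up to scaling, the constant subtracted is the supremum over n of the coarse parts at a
  single point. It is finite if the full square function is finite at that point, so the point
  \<open>x1\<close> is chosen accordingly.\<close>

lemma LF_bmo:
  obtains C :: real where "0 \<le> C" "\<And>f1 f2 n1 n2 j x0. \<lbrakk>integrable lborel f1; integrable lborel f2; mdl 2 f1 < top; 0 < n1; 0 < n2;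
      \<And>x. norm (f1 x) \<le> n1; \<And>x. norm (f2 x) \<le> n2\<rbrakk> \<Longrightarrow>
    \<exists>a::real. (NN x. indicator {x. gr j x = gr j x0} x * e2ennreal \<bar>enn2ereal (LF f1 f2 x) - ereal a\<bar>)
      \<le> ennreal (C * n1 * n2 * (2 powi j) ^ CARD('n))"
proof -
  obtain C where C: "0 \<le> C" "\<And>I h1 h2 j x0. \<lbrakk>finite I; h1 \<in> \<B>; h2 \<in> \<B>;
      \<And>x. norm (h1 x) \<le> 1; \<And>x. norm (h2 x) \<le> 1\<rbrakk> \<Longrightarrow>
    (NN x. indicator {x. gr j x = gr j x0} x * ennreal (SF {k\<in>I. k \<le> j} h1 h2 x)) \<le> ennreal (C * (2 powi j) ^ CARD('n))"
    using bmo_local by blast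
  obtain C2 where C2: "0 \<le> C2" "\<And>f1 f2. \<lbrakk>f1 \<in> \<B>; f2 \<in> \<B>; mdl 2 f1 < top; mdl top f2 < top\<rbrakk> \<Longrightarrow>
    (NN x. ennreal_powr (LF f1 f2 x) 2) \<le> ennreal C2 * (mdl 2 f1 + mdl top f2)"
    by (rule LF_strong[of 2 top 2]) (auto simp: less_top)
  show ?thesis
  proof (rule that)
    show "0 \<le> C + CE" using C(1) CE by simp
    fix f1 f2 :: "real^'n \<Rightarrow> complex" and n1 n2 :: real and j :: int and x0 :: "real^'n"
    assume f: "integrable lborel f1" "integrable lborel f2" and f2: "mdl 2 f1 < top" and n: "0 < n1" "0 < n2"
      and le: "\<And>x. norm (f1 x) \<le> n1" "\<And>x. norm (f2 x) \<le> n2"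
    have [measurable]: "f1 \<in> \<B>" "f2 \<in> \<B>" using f by auto
    let ?h1 = "\<lambda>x. of_real (1 / n1) * f1 x" and ?h2 = "\<lambda>x. of_real (1 / n2) * f2 x"
    let ?Q = "{x. gr j x = gr j x0}"
    let ?v = "(2 powi j) ^ CARD('n) :: real"
    define c where "c = n1 * n2"
    have c: "0 < c" using n by (simp add: c_def)
    have hi: "integrable lborel ?h1" "integrable lborel ?h2" using f by auto
    have hm [measurable]: "?h1 \<in> \<B>" "?h2 \<in> \<B>" by measurable
    have h: "norm (?h1 x) \<le> 1" "norm (?h2 x) \<le> 1" for x
      using n le(1)[of x] le(2)[of x] by (auto simp: norm_divide divide_le_eq)
    \<comment> \<open>The bound from L^2 x L^\<infinity> gives finiteness almost everywhere, hence
      somewhere in the cube, which has positive measure.\<close>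
    have fin: "AE x in lborel. LF ?h1 ?h2 x \<noteq> top"
    proof -
      have m: "mdl 2 ?h1 < top" using f2 mdl_scale[of f1 2 "1 / n1"] n by (simp add: ennreal_mult_less_top)
      have m': "mdl top ?h2 < top" using h(2) by (simp add: mdl_def)
      have "(NN x. ennreal_powr (LF ?h1 ?h2 x) 2) \<le> ennreal C2 * (mdl 2 ?h1 + mdl top ?h2)"
        by (rule C2(2)[OF hm m m'])
      also have "\<dots> < top" using m m' by (simp add: ennreal_mult_less_top)
      finally have "(NN x. ennreal_powr (LF ?h1 ?h2 x) 2) \<noteq> \<infinity>" by simp
      then have "AE x in lborel. ennreal_powr (LF ?h1 ?h2 x) 2 \<noteq> \<infinity>"
        by (intro nn_integral_PInf_AE) (auto simp: ennreal_powr_def)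
      then show ?thesis by eventually_elim (auto simp: ennreal_powr_def)
    qed
    have "\<exists>x1\<in>?Q. LF ?h1 ?h2 x1 \<noteq> top"
    proof (rule ccontr)
      assume "\<not> ?thesis"
      then have "AE x in lborel. x \<notin> ?Q" using fin by (auto elim!: eventually_mono)
      then have "emeasure lborel ?Q = 0" by (subst (asm) AE_iff_measurable[of ?Q]) auto
      then show False by (simp add: cell_measure)
    qed
    then obtain x1 where x1: "gr j x1 = gr j x0" "LF ?h1 ?h2 x1 \<noteq> top" by auto
    define I where "I n = {- int n..int n}" for n :: nat
    have I: "finite (I n)" for n by (simp add: I_def)
    have Imono: "I n \<subseteq> I m" if "n \<le> m" for n m using that by (auto simp: I_def)
    define a where "a n = SF {k\<in>I n. j < k} ?h1 ?h2 x1" for n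
    obtain l where l: "LF ?h1 ?h2 x1 = ennreal l" "0 \<le> l" using x1(2) by (cases "LF ?h1 ?h2 x1") auto
    have a: "a n \<le> l" "0 \<le> a n" for n
    proof -
      have "ennreal (SF (I n) ?h1 ?h2 x1) \<le> ennreal l" unfolding l(1)[symmetric] LF_def I_def by (rule SUP_upper) simp
      then have "SF (I n) ?h1 ?h2 x1 \<le> l" using l by simp
      moreover have "a n \<le> SF (I n) ?h1 ?h2 x1" unfolding a_def using I by (intro SF_mono) auto
      ultimately show "a n \<le> l" by simp
    qed (simp add: a_def)
    define b where "b = (SUP n. a n)"
    have bdd: "bdd_above (range a)" by (rule bdd_aboveI2[of UNIV a l]) (rule a(1))
    have ab: "a n \<le> b" for n unfolding b_def by (rule cSUP_upper[OF _ bdd]) simp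
    have b0: "0 \<le> b" using a(2)[of 0] ab[of 0] by linarith
    \<comment> \<open>The fine scales alone, whose integral over the cube is bounded by
      \<open>bmo_local\<close>.\<close>
    define D where "D x = (SUP n. ennreal (SF {k\<in>I n. k \<le> j} ?h1 ?h2 x))" for x
    have [measurable]: "D \<in> \<B>" unfolding D_def by measurable
    have pt: "e2ennreal \<bar>enn2ereal (LF f1 f2 x) - ereal (c * b)\<bar> \<le> ennreal c * (D x + ennreal CE)" if x: "gr j x = gr j x0" for x
    proof (rule e2ennreal_abs_diff_le)
      have close: "\<bar>SF (I n) ?h1 ?h2 x - a n\<bar> \<le> SF {k\<in>I n. k \<le> j} ?h1 ?h2 x + CE" for n
        unfolding a_def by (rule bmo_far[OF hi I h]) (simp add: x x1)
      have Dn: "ennreal (SF {k\<in>I n. k \<le> j} ?h1 ?h2 x + CE) \<le> D x + ennreal CE" for n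
      proof -
        have "ennreal (SF {k\<in>I n. k \<le> j} ?h1 ?h2 x) \<le> D x" unfolding D_def by (rule SUP_upper) simp
        then show ?thesis using CE by (simp add: add_right_mono)
      qed
      have 1: "LF ?h1 ?h2 x \<le> ennreal b + (D x + ennreal CE)"
        unfolding LF_def
      proof (rule SUP_least)
        fix n
        have "SF (I n) ?h1 ?h2 x \<le> b + (SF {k\<in>I n. k \<le> j} ?h1 ?h2 x + CE)" using close[of n] ab[of n] by linarith
        then have "ennreal (SF (I n) ?h1 ?h2 x) \<le> ennreal (b + (SF {k\<in>I n. k \<le> j} ?h1 ?h2 x + CE))" by (rule ennreal_leI)
        also have "\<dots> = ennreal b + ennreal (SF {k\<in>I n. k \<le> j} ?h1 ?h2 x + CE)" using b0 CE by (intro ennreal_plus) auto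
        also have "\<dots> \<le> ennreal b + (D x + ennreal CE)" by (intro add_left_mono Dn)
        finally show "ennreal (SF {- int n..int n} ?h1 ?h2 x) \<le> ennreal b + (D x + ennreal CE)" by (simp only: I_def)
      qed
      have 2: "ennreal b \<le> LF ?h1 ?h2 x + (D x + ennreal CE)"
      proof (cases "LF ?h1 ?h2 x + (D x + ennreal CE)")
        case (real w)
        have "a n \<le> w" for n
        proof -
          have "ennreal (a n) \<le> ennreal (SF (I n) ?h1 ?h2 x + (SF {k\<in>I n. k \<le> j} ?h1 ?h2 x + CE))" using close[of n] by (intro ennreal_leI) linarith
          also have "\<dots> = ennreal (SF (I n) ?h1 ?h2 x) + ennreal (SF {k\<in>I n. k \<le> j} ?h1 ?h2 x + CE)" using CE by (intro ennreal_plus) auto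
          also have "\<dots> \<le> LF ?h1 ?h2 x + (D x + ennreal CE)"
            unfolding LF_def I_def[symmetric] by (intro add_mono Dn SUP_upper) simp
          finally show ?thesis using real by simp
        qed
        then have "b \<le> w" unfolding b_def by (intro cSUP_least) auto
        then show ?thesis using real by (simp add: ennreal_leI)
      next
        case top
        show ?thesis unfolding top by simp
      qed
      have L: "LF f1 f2 x = ennreal c * LF ?h1 ?h2 x" unfolding c_def by (rule LF_unscale[OF n])
      show "LF f1 f2 x \<le> ennreal (c * b) + ennreal c * (D x + ennreal CE)"
        unfolding L using mult_left_mono[OF 1, of "ennreal c"] c b0 by (simp add: ennreal_mult distrib_left)
      show "ennreal (c * b) \<le> LF f1 f2 x + ennreal c * (D x + ennreal CE)"
        unfolding L using mult_left_mono[OF 2, of "ennreal c"] c b0 by (simp add: ennreal_mult distrib_left)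
      show "0 \<le> c * b" using c b0 by simp
    qed
    have "(NN x. indicator ?Q x * e2ennreal \<bar>enn2ereal (LF f1 f2 x) - ereal (c * b)\<bar>)
       \<le> (NN x. ennreal c * (indicator ?Q x * D x + ennreal CE * indicator ?Q x))"
      using pt by (intro nn_integral_mono) (auto simp: indicator_def)
    also have "\<dots> = ennreal c * ((NN x. indicator ?Q x * D x) + ennreal CE * emeasure lborel ?Q)"
      by (subst nn_integral_cmult, measurable, subst nn_integral_add, auto simp: nn_integral_cmult_indicator)
    also have "(NN x. indicator ?Q x * D x) = (SUP n. \<integral>\<^sup>+x. indicator ?Q x * ennreal (SF {k\<in>I n. k \<le> j} ?h1 ?h2 x) \<partial>lborel)"
    proof -
      have "indicator ?Q x * D x = (SUP n. indicator ?Q x * ennreal (SF {k\<in>I n. k \<le> j} ?h1 ?h2 x))" for x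
        unfolding D_def by (rule SUP_mult_left_ennreal)
      then have "(NN x. indicator ?Q x * D x) = (NN x. (SUP n. indicator ?Q x * ennreal (SF {k\<in>I n. k \<le> j} ?h1 ?h2 x)))" by simp
      also have "\<dots> = (SUP n. \<integral>\<^sup>+x. indicator ?Q x * ennreal (SF {k\<in>I n. k \<le> j} ?h1 ?h2 x) \<partial>lborel)"
      proof (rule nn_integral_monotone_convergence_SUP)
        show "incseq (\<lambda>n x. indicator ?Q x * ennreal (SF {k\<in>I n. k \<le> j} ?h1 ?h2 x))"
          unfolding incseq_def le_fun_def using Imono I by (intro allI impI mult_left_mono ennreal_leI SF_mono) auto
      qed measurable
      finally show ?thesis .
    qed
    also have "ennreal c * ((SUP n. \<integral>\<^sup>+x. indicator ?Q x * ennreal (SF {k\<in>I n. k \<le> j} ?h1 ?h2 x) \<partial>lborel) + ennreal CE * emeasure lborel ?Q)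
        \<le> ennreal c * (ennreal (C * ?v) + ennreal CE * ennreal ?v)"
      by (intro mult_left_mono add_mono SUP_least C(2) I hm h) (auto simp: cell_measure)
    also have "\<dots> = ennreal ((C + CE) * n1 * n2 * ?v)"
      using C(1) CE c n by (simp add: c_def ennreal_mult[symmetric] ennreal_plus[symmetric] algebra_simps del: ennreal_plus)
    finally show "\<exists>a::real. (NN x. indicator ?Q x * e2ennreal \<bar>enn2ereal (LF f1 f2 x) - ereal a\<bar>) \<le> ennreal ((C + CE) * n1 * n2 * ?v)"
      by (rule exI)
  qed
qed

end

subsection \<open>Lebesgue measurable functions\<close>

lemma lebesgue_measurable_AE:
  fixes f g :: "'a::euclidean_space \<Rightarrow> 'b::topological_space"
  assumes g: "g \<in> borel_measurable lborel" and ae: "AE x in lborel. f x = g x"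
  shows "f \<in> borel_measurable lebesgue"
proof (rule measurableI)
  fix B :: "'b set" assume B: "B \<in> sets borel"
  show "f -` B \<inter> space lebesgue \<in> sets lebesgue"
  proof (rule completion.in_sets_AE)
    show "AE x in lebesgue. x \<in> g -` B \<inter> space lebesgue \<longleftrightarrow> x \<in> f -` B \<inter> space lebesgue"
      using AE_completion[OF ae] by eventually_elim auto
    show "g -` B \<inter> space lebesgue \<in> sets lebesgue" using measurable_sets[OF measurable_completion[OF g] B] by simp
  qed auto
qed auto

lemma lebesgue_integral_AE:
  fixes f g :: "'a::euclidean_space \<Rightarrow> complex"
  assumes g: "g \<in> borel_measurable lborel" and ae: "AE x in lborel. f x = g x"
  shows "(\<integral>x. f x \<partial>lebesgue) = (\<integral>x. g x \<partial>lborel)"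
proof -
  have "(\<integral>x. f x \<partial>lebesgue) = (\<integral>x. g x \<partial>lebesgue)"
    by (rule integral_cong_AE[OF lebesgue_measurable_AE[OF g ae] measurable_completion[OF g] AE_completion[OF ae]])
  then show ?thesis by (simp add: integral_completion[OF g])
qed

lemma lebesgue_borel_rep:
  fixes f :: "'a::euclidean_space \<Rightarrow> complex"
  assumes "f \<in> borel_measurable lebesgue"
  shows "\<exists>g\<in>\<B>. AE x in lborel. f x = g x"
proof -
  have "(\<lambda>x. Re (f x)) \<in> borel_measurable lebesgue" "(\<lambda>x. Im (f x)) \<in> borel_measurable lebesgue"
    using assms by (auto simp: borel_measurable_complex_iff)
  from this[THEN completion_ex_borel_measurable_real]
  obtain u v where uv: "u \<in> borel_measurable lborel" "v \<in> borel_measurable lborel"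
    and ae: "AE x in lborel. Re (f x) = u x" "AE x in lborel. Im (f x) = v x" by blast
  have "(\<lambda>x. Complex (u x) (v x)) \<in> \<B>" using uv by (simp add: borel_measurable_complex_iff)
  moreover have "AE x in lborel. f x = Complex (u x) (v x)" using ae by eventually_elim (simp add: complex_eq_iff)
  ultimately show ?thesis by (intro bexI[where x = "\<lambda>x. Complex (u x) (v x)"])
qed

text \<open>Under either coordinate the preimage of a null set is null in the product, by
  Fubini.\<close>

lemma AE_shift_pair:
  fixes x :: "real^'n"
  assumes "AE y in lborel. P y"
  shows "AE z in lborel. P (x + fst z) \<and> P (x + snd z)" (is "AE z in ?M. _")
proof -
  obtain M where M: "M \<in> null_sets lborel" "\<And>y. y \<notin> M \<Longrightarrow> P y"
    using assms by (auto simp: eventually_ae_filter)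
  have Ms [measurable]: "M \<in> sets borel" and M0: "emeasure lborel M = 0" using M(1) by (auto simp: null_sets_def)
  have z: "(NN y. indicator M (x + y)) = (0::ennreal)"
    by (subst nn_integral_shift(2)) (auto simp: M0)
  have 1: "(\<lambda>z::(real^'n) \<times> (real^'n). indicator M (x + fst z) + indicator M (x + snd z) :: ennreal) \<in> \<B>"
  proof -
    have m: "(\<lambda>y. indicator M (x + y) :: ennreal) \<in> \<B>" by measurable
    show ?thesis using borel_measurable_fst_snd(1)[OF m] borel_measurable_fst_snd(2)[OF m] by measurable
  qed
  have "(\<integral>\<^sup>+z. indicator M (x + fst z) + indicator M (x + snd z) \<partial>(lborel :: ((real^'n) \<times> (real^'n)) measure)) = 0"
  proof -
    have m: "(\<lambda>y. indicator M (x + y) :: ennreal) \<in> \<B>" by measurable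
    have "(\<integral>\<^sup>+z. indicator M (x + fst z) \<partial>(lborel :: ((real^'n) \<times> (real^'n)) measure)) = (0::ennreal)"
      by (subst nn_integral_lborel_pair(2)[OF borel_measurable_fst_snd(1)[OF m]]) (simp add: z)
    moreover have "(\<integral>\<^sup>+z. indicator M (x + snd z) \<partial>(lborel :: ((real^'n) \<times> (real^'n)) measure)) = (0::ennreal)"
      by (subst nn_integral_lborel_pair(1)[OF borel_measurable_fst_snd(2)[OF m]]) (simp add: z)
    ultimately show ?thesis
      using borel_measurable_fst_snd(1)[OF m, where 'c = "real^'n"] borel_measurable_fst_snd(2)[OF m, where 'a = "real^'n"]
      by (subst nn_integral_add) auto
  qed
  then have "AE z in (lborel :: ((real^'n) \<times> (real^'n)) measure). indicator M (x + fst z) + indicator M (x + snd z) = (0::ennreal)"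
    using 1 by (subst (asm) nn_integral_0_iff_AE) auto
  then show ?thesis by eventually_elim (auto simp: indicator_def M(2) split: if_splits)
qed

lemma gr_cube:
  fixes m :: "'n::finite \<Rightarrow> int"
  shows "{x::real^'n. \<forall>i. 2 powi k * of_int (m i) \<le> x $ i \<and> x $ i < 2 powi k * of_int (m i + 1)} = {x. gr k x = (\<chi> i. m i)}"
proof -
  have "(2 powi k * of_int (m i) \<le> x $ i \<and> x $ i < 2 powi k * of_int (m i + 1)) \<longleftrightarrow> \<lfloor>x $ i / 2 powi k\<rfloor> = m i" for x :: "real^'n" and i
  proof -
    have p: "(0::real) < 2 powi k" by simp
    have "\<lfloor>x $ i / 2 powi k\<rfloor> = m i \<longleftrightarrow> of_int (m i) \<le> x $ i / 2 powi k \<and> x $ i / 2 powi k < of_int (m i) + 1"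
      by (rule floor_eq_iff)
    then show ?thesis using p by (simp only: le_divide_eq divide_less_eq) (simp add: mult.commute)
  qed
  then show ?thesis by (simp add: gr_def vec_eq_iff)
qed

lemma dyadic_cubes_gr: "(dyadic_cubes k :: (real^'n) set set) = (\<lambda>x0. {x. gr k x = gr k x0}) ` UNIV"
proof -
  have e: "gr k ((\<chi> i. 2 powi k * of_int (m i)) :: real^'n) = (\<chi> i. m i)" for m :: "'n \<Rightarrow> int"
    by (simp add: gr_def vec_eq_iff)
  show ?thesis
  proof (intro set_eqI iffI)
    fix Q :: "(real^'n) set" assume "Q \<in> dyadic_cubes k"
    then obtain m where "Q = {x. gr k x = (\<chi> i. m i)}" unfolding dyadic_cubes_def gr_cube by blast
    then have "Q = {x. gr k x = gr k ((\<chi> i. 2 powi k * of_int (m i)) :: real^'n)}" by (simp only: e)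
    then show "Q \<in> (\<lambda>x0. {x. gr k x = gr k x0}) ` UNIV" by (rule image_eqI) simp
  next
    fix Q :: "(real^'n) set" assume "Q \<in> (\<lambda>x0. {x. gr k x = gr k x0}) ` UNIV"
    then obtain x0 where "Q = {x. gr k x = gr k x0}" by blast
    then have "Q = {x. gr k x = (\<chi> i. gr k x0 $ i)}" by simp
    then show "Q \<in> dyadic_cubes k" unfolding dyadic_cubes_def gr_cube by blast
  qed
qed

lemma dyadic_expectation_av:
  fixes x :: "real^'n"
  assumes g [measurable]: "g \<in> \<B>" and ae: "AE x in lborel. f x = g x"
  shows "dyadic_expectation k f x = av (\<lambda>_. k) g x"
proof -
  let ?Q = "{y. gr k y = gr k x}"
  have "dyadic_expectation k f x = average ?Q f * indicator ?Q x"
    unfolding dyadic_expectation_def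
  proof -
    have "(\<Sum>\<^sub>\<infinity>Q\<in>dyadic_cubes k. average Q f * indicator Q x) = (\<Sum>\<^sub>\<infinity>Q\<in>{?Q}. average Q f * indicator Q x)"
      by (rule infsum_cong_neutral) (auto simp: dyadic_cubes_gr indicator_def)
    then show "(\<Sum>\<^sub>\<infinity>Q\<in>dyadic_cubes k. average Q f * indicator Q x) = average ?Q f * indicator ?Q x" by simp
  qed
  also have "\<dots> = (\<integral>y. indicator ?Q y *\<^sub>R f y \<partial>lebesgue) /\<^sub>R measure lebesgue ?Q"
    by (simp add: average_def set_lebesgue_integral_def)
  also have "(\<integral>y. indicator ?Q y *\<^sub>R f y \<partial>lebesgue) = (\<integral>y. indicator ?Q y *\<^sub>R g y \<partial>lborel)"
    by (rule lebesgue_integral_AE) (use ae in \<open>measurable, auto\<close>)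
  also have "measure lebesgue ?Q = (2 powi k) ^ CARD('n)"
    by (simp add: measure_def cell_measure)
  also have "(\<integral>y. indicator ?Q y *\<^sub>R g y \<partial>lborel) /\<^sub>R (2 powi k) ^ CARD('n) = av (\<lambda>_. k) g x"
  proof -
    have "(\<integral>y. indicator ?Q y *\<^sub>R g y \<partial>lborel) /\<^sub>R (2 powi k) ^ CARD('n) = (\<integral>y. inverse ((2 powi k) ^ CARD('n)) *\<^sub>R (indicator ?Q y *\<^sub>R g y) \<partial>lborel)"
      by (rule integral_scaleR_right[symmetric])
    also have "\<dots> = av (\<lambda>_. k) g x"
      unfolding av_def by (rule Bochner_Integration.integral_cong) (auto simp: ker_def indicator_def scaleR_conv_of_real inverse_eq_divide)
    finally show ?thesis .
  qed
  finally show ?thesis .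
qed

lemma infsum_int_SUP:
  fixes f :: "int \<Rightarrow> real"
  assumes "\<And>k. 0 \<le> f k"
  shows "(\<Sum>\<^sub>\<infinity>k. ennreal (f k)) = (SUP n. ennreal (\<Sum>k\<in>{- int n..int n}. f k))"
proof -
  have "(\<Sum>\<^sub>\<infinity>k. ennreal (f k)) = (SUP F\<in>{F. finite F \<and> F \<subseteq> UNIV}. \<Sum>k\<in>F. ennreal (f k))"
    by (rule nonneg_infsum_complete) simp
  also have "\<dots> = (SUP n. ennreal (\<Sum>k\<in>{- int n..int n}. f k))"
  proof (rule antisym)
    show "(SUP F\<in>{F. finite F \<and> F \<subseteq> UNIV}. \<Sum>k\<in>F. ennreal (f k)) \<le> (SUP n. ennreal (\<Sum>k\<in>{- int n..int n}. f k))"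
    proof (rule SUP_mono)
      fix F :: "int set" assume F: "F \<in> {F. finite F \<and> F \<subseteq> UNIV}"
      define n where "n = nat (\<Sum>k\<in>F. \<bar>k\<bar>)"
      have "F \<subseteq> {- int n..int n}"
      proof
        fix k assume "k \<in> F"
        then have "\<bar>k\<bar> \<le> (\<Sum>k\<in>F. \<bar>k\<bar>)" using F by (intro member_le_sum) auto
        then show "k \<in> {- int n..int n}" by (auto simp: n_def)
      qed
      then have "(\<Sum>k\<in>F. ennreal (f k)) \<le> (\<Sum>k\<in>{- int n..int n}. ennreal (f k))" by (intro sum_mono2) auto
      then show "\<exists>n\<in>UNIV. (\<Sum>k\<in>F. ennreal (f k)) \<le> ennreal (\<Sum>k\<in>{- int n..int n}. f k)"
        using assms by (auto simp: sum_ennreal)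
    qed
    show "(SUP n. ennreal (\<Sum>k\<in>{- int n..int n}. f k)) \<le> (SUP F\<in>{F. finite F \<and> F \<subseteq> UNIV}. \<Sum>k\<in>F. ennreal (f k))"
    proof (rule SUP_least)
      fix n
      have "ennreal (\<Sum>k\<in>{- int n..int n}. f k) = (\<Sum>k\<in>{- int n..int n}. ennreal (f k))" using assms by (simp add: sum_ennreal)
      also have "\<dots> \<le> (SUP F\<in>{F. finite F \<and> F \<subseteq> UNIV}. \<Sum>k\<in>F. ennreal (f k))" by (rule SUP_upper) simp
      finally show "ennreal (\<Sum>k\<in>{- int n..int n}. f k) \<le> (SUP F\<in>{F. finite F \<and> F \<subseteq> UNIV}. \<Sum>k\<in>F. ennreal (f k))" .
    qed
  qed
  finally show ?thesis .
qed

section \<open>Identification of the square function through Borel representatives\<close>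

context body
begin

text \<open>Changing almost everywhere to Borel functions does not affect the integral, and
  translating by (x, x) moves the shift from the functions to the region.\<close>

lemma bilinear_avg_A:
  assumes g [measurable]: "g1 \<in> \<B>" "g2 \<in> \<B>"
    and ae: "AE x in lborel. f1 x = g1 x" "AE x in lborel. f2 x = g2 x"
  shows "bilinear_avg G (2 powi k) f1 f2 x = A k g1 g2 x"
proof -
  let ?H = "\<lambda>z. indicator (R k) z *\<^sub>R (g1 (x + fst z) * g2 (x + snd z))"
  have m: "(\<lambda>y. g1 (x + y)) \<in> \<B>" "(\<lambda>y. g2 (x + y)) \<in> \<B>" by measurable
  note mm [measurable] = borel_measurable_fst_snd(1)[OF m(1), where 'c = "real^'n"] borel_measurable_fst_snd(2)[OF m(2), where 'a = "real^'n"]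
  have H: "?H \<in> borel_measurable lborel" by measurable
  have "bilinear_avg G (2 powi k) f1 f2 x
     = (\<integral>z. indicator (R k) z *\<^sub>R (case z of (y1, y2) \<Rightarrow> f1 (x + y1) * f2 (x + y2)) \<partial>lebesgue) /\<^sub>R measure lebesgue (R k)"
    by (simp add: bilinear_avg_def average_def set_lebesgue_integral_def R_def)
  also have "(\<integral>z. indicator (R k) z *\<^sub>R (case z of (y1, y2) \<Rightarrow> f1 (x + y1) * f2 (x + y2)) \<partial>lebesgue) = (\<integral>z. ?H z \<partial>lborel)"
  proof (rule lebesgue_integral_AE[OF H])
    show "AE z in lborel. indicator (R k) z *\<^sub>R (case z of (y1, y2) \<Rightarrow> f1 (x + y1) * f2 (x + y2)) = ?H z"
      using AE_shift_pair[OF ae(1), of x] AE_shift_pair[OF ae(2), of x] by eventually_elim (simp add: case_prod_beta)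
  qed
  also have "measure lebesgue (R k) = 1 / wt k"
  proof -
    have e: "ennreal (wt k) * emeasure lborel (R k) = 1" by (rule R_measure)
    then obtain r where r: "emeasure lborel (R k) = ennreal r" "0 \<le> r"
      using wt[of k] by (cases "emeasure lborel (R k)") (auto simp: ennreal_mult_top)
    have "wt k * r = 1" using e wt[of k] r by (simp add: ennreal_mult[symmetric])
    then have "r = 1 / wt k" using wt[of k] by (simp add: field_simps)
    then show ?thesis using r by (simp add: measure_def)
  qed
  also have "(\<integral>z. ?H z \<partial>lborel) = (\<integral>z. indicator {z. z - (x, x) \<in> R k} z * (g1 (fst z) * g2 (snd z)) \<partial>lborel)"
  proof -
    let ?F = "\<lambda>z. indicator {z. z - (x, x) \<in> R k} z * (g1 (fst z) * g2 (snd z))"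
    have F: "?F \<in> \<B>" by measurable
    have "(\<integral>z. ?F z \<partial>lborel) = (\<integral>z. ?F z \<partial>(distr lborel borel ((+) (x, x))))" by (simp only: lborel_distr_plus)
    also have "\<dots> = (\<integral>z. ?F ((x, x) + z) \<partial>lborel)" by (rule integral_distr) (use F in auto)
    also have "\<dots> = (\<integral>z. ?H z \<partial>lborel)" by (rule Bochner_Integration.integral_cong) (auto simp: indicator_def)
    finally show ?thesis by simp
  qed
  finally show ?thesis by (simp add: A_def scaleR_conv_of_real)
qed

lemma square_fun_LF:
  assumes g [measurable]: "g1 \<in> \<B>" "g2 \<in> \<B>"
    and ae: "AE x in lborel. f1 x = g1 x" "AE x in lborel. f2 x = g2 x"
  shows "square_fun G f1 f2 x = LF g1 g2 x"
proof -
  have D: "bilinear_avg G (2 powi k) f1 f2 x - dyadic_expectation k f1 x * dyadic_expectation k f2 x = DD k g1 g2 x" for k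
    by (simp add: DD_def bilinear_avg_A[OF g ae] dyadic_expectation_av[OF g(1) ae(1)] dyadic_expectation_av[OF g(2) ae(2)])
  have s: "(\<Sum>k\<in>I. (norm (DD k g1 g2 x))\<^sup>2) = (SF I g1 g2 x)\<^sup>2" for I
    by (simp add: SF_def L2_set_def sum_nonneg)
  have "square_fun G f1 f2 x = ennreal_powr (SUP n. ennreal ((SF {- int n..int n} g1 g2 x)\<^sup>2)) (1 / 2)"
    unfolding square_fun_def D by (simp add: infsum_int_SUP s)
  also have "\<dots> = LF g1 g2 x" by (simp add: ennreal_powr_SUP LF_def powr_half_sqrt)
  finally show ?thesis .
qed

end

text \<open>
  \<open>g\<close> is a Borel representative of \<open>f\<close> and \<open>n\<close> its norm.  For \<open>p = top\<close> and \<open>n > 0\<close> the last clause bounds \<open>g\<close> by \<open>n\<close> everywhere.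
\<close>

definition Lp_repr :: "ennreal \<Rightarrow> (real^'n \<Rightarrow> complex) \<Rightarrow> (real^'n \<Rightarrow> complex) \<Rightarrow> real \<Rightarrow> bool" where
  "Lp_repr p f g n \<longleftrightarrow> g \<in> \<B> \<and> (AE x in lborel. f x = g x) \<and> 0 \<le> n \<and> Lp_norm_complex p f = ennreal n \<and>
    (n = 0 \<longrightarrow> (AE x in lborel. g x = 0)) \<and> (0 < n \<longrightarrow> mdl p (\<lambda>x. of_real (1 / n) * g x) \<le> 1)"

lemma Lp_reprD:
  assumes "Lp_repr p f g n"
  shows "g \<in> \<B>" "AE x in lborel. f x = g x" "0 \<le> n" "Lp_norm_complex p f = ennreal n"
    "n = 0 \<Longrightarrow> AE x in lborel. g x = 0" "0 < n \<Longrightarrow> mdl p (\<lambda>x. of_real (1 / n) * g x) \<le> 1"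
  using assms unfolding Lp_repr_def by blast+

lemma Lp_rep:
  fixes f :: "real^'n \<Rightarrow> complex"
  assumes f: "f \<in> Lp_space p" and p: "1 \<le> p"
  shows "\<exists>g n. Lp_repr p f g n"
proof -
  have fm: "f \<in> borel_measurable lebesgue" and fin: "Lp_norm_complex p f < top" using f by (auto simp: Lp_space_def)
  obtain g where g [measurable]: "g \<in> \<B>" and ae: "AE x in lborel. f x = g x"
    using lebesgue_borel_rep[OF fm] by (elim bexE)
  have repr: "\<exists>g n. Lp_repr p f g n"
    if "g \<in> \<B>" "AE x in lborel. f x = g x" "0 \<le> n" "Lp_norm_complex p f = ennreal n"
      "n = 0 \<Longrightarrow> AE x in lborel. g x = 0" "0 < n \<Longrightarrow> mdl p (\<lambda>x. of_real (1 / n) * g x) \<le> 1" for g n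
    using that unfolding Lp_repr_def by blast
  show ?thesis
  proof (cases "p = top")
    case True
    obtain n where n: "Lp_norm_complex p f = ennreal n" "0 \<le> n" using fin by (cases "Lp_norm_complex p f") auto
    have "AE x in lebesgue. ennreal (norm (f x)) \<le> ennreal n"
      using esssup_AE[of "\<lambda>x. ennreal (norm (f x))" lebesgue] n(1) True by (simp add: Lp_norm_def)
    then have le: "AE x in lborel. norm (f x) \<le> n" using n(2) by (simp add: AE_completion_iff)
    \<comment> \<open>\<open>mdl top\<close> looks at every point, so the representative is set to 0
      on the null set where it exceeds the essential supremum.\<close>
    define h where "h x = (if norm (g x) \<le> n then g x else 0)" for x
    have hm: "h \<in> \<B>" unfolding h_def by measurable
    have hle: "norm (h x) \<le> n" for x using n(2) by (simp add: h_def)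
    show ?thesis
    proof (rule repr[OF hm _ n(2) n(1)])
      show "AE x in lborel. f x = h x" using ae le by eventually_elim (simp add: h_def)
      show "AE x in lborel. h x = 0" if "n = 0" using hle that by simp
      show "mdl p (\<lambda>x. of_real (1 / n) * h x) \<le> 1" if "0 < n"
      proof -
        have "norm (of_real (1 / n) * h x) \<le> 1" for x using hle[of x] that by (simp add: norm_divide divide_le_eq)
        then show ?thesis using True by (simp add: mdl_def)
      qed
    qed
  next
    case False
    define q where "q = enn2real p"
    have q: "1 \<le> q" unfolding q_def using p False by (rule enn2real_ge_1)
    have "(\<integral>\<^sup>+x. ennreal_powr (ennreal (norm (f x))) q \<partial>lebesgue) = mdl p g"
    proof -
      have "(NN x. ennreal_powr (ennreal (norm (f x))) q) = (NN x. ennreal (norm (g x) powr q))"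
      proof (rule nn_integral_cong_AE)
        show "AE x in lborel. ennreal_powr (ennreal (norm (f x))) q = ennreal (norm (g x) powr q)"
          using ae by eventually_elim (simp add: ennreal_powr_def)
      qed
      then show ?thesis using False by (simp add: nn_integral_completion mdl_def q_def)
    qed
    then have nf: "Lp_norm_complex p f = ennreal_powr (mdl p g) (1 / q)" using False by (simp add: Lp_norm_def q_def)
    have "mdl p g \<noteq> top" using fin unfolding nf by (auto simp: ennreal_powr_def)
    then obtain J where J: "mdl p g = ennreal J" "0 \<le> J" by (cases "mdl p g") auto
    define n where "n = J powr (1 / q)"
    show ?thesis
    proof (rule repr[OF g ae])
      show "0 \<le> n" by (simp add: n_def)
      show "Lp_norm_complex p f = ennreal n" unfolding nf J(1) using J(2) by (simp add: ennreal_powr_def n_def)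
      show "AE x in lborel. g x = 0" if "n = 0"
      proof -
        have "J = 0" using that J by (simp add: n_def)
        then have "(NN x. ennreal (norm (g x) powr q)) = 0" using J(1) False by (simp add: mdl_def q_def)
        then have "AE x in lborel. ennreal (norm (g x) powr q) = 0" by (subst (asm) nn_integral_0_iff_AE) auto
        then show ?thesis by eventually_elim simp
      qed
      show "mdl p (\<lambda>x. of_real (1 / n) * g x) \<le> 1" if "0 < n"
      proof -
        have "0 < J" using that J by (auto simp: n_def less_le)
        then have "(1 / n) powr q * J = 1" using q by (simp add: n_def powr_divide powr_powr)
        then have "ennreal ((1 / n) powr q) * ennreal J = 1" using J(2) by (simp add: ennreal_mult[symmetric])
        moreover have "mdl p (\<lambda>x. of_real (1 / n) * g x) = ennreal ((1 / n) powr q) * mdl p g"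
          unfolding q_def by (rule mdl_scale) (use that False in \<open>auto simp: less_top\<close>)
        ultimately show ?thesis by (simp add: J(1))
      qed
    qed
  qed
qed

text \<open>Passes from \<open>ennreal\<close> to real exponents. For \<open>b = top\<close> both
  conventions agree: 1/b = 0 and 1 / enn2real b = 1/0 = 0.\<close>

lemma exponent_conv:
  fixes p a b :: ennreal
  assumes "1 \<le> a" "a < top" "1 \<le> b" "1 / p = 1 / a + 1 / b"
  shows "p \<noteq> top" "0 < enn2real p" "1 / enn2real p = 1 / enn2real a + 1 / enn2real b"
proof -
  obtain u where u: "a = ennreal u" "1 \<le> u" using assms(1,2) by (cases a) (auto simp: ennreal_1[symmetric] simp del: ennreal_1)
  have ia: "1 / a = ennreal (1 / u)" using u by (simp add: divide_ennreal[symmetric])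
  obtain w where w: "1 / b = ennreal w" "0 \<le> w" "w = 1 / enn2real b"
  proof (cases "b = top")
    case True
    then show ?thesis by (intro that[of 0]) auto
  next
    case False
    then obtain v where v: "b = ennreal v" "1 \<le> v" using assms(3) by (cases b) (auto simp: ennreal_1[symmetric] simp del: ennreal_1)
    show ?thesis by (rule that[of "1 / v"]) (use v in \<open>auto simp: divide_ennreal[symmetric]\<close>)
  qed
  have e: "1 / p = ennreal (1 / u + w)" unfolding assms(4) ia w(1) using u w(2) by simp
  have pos: "0 < 1 / u + w" using u w(2) by (simp add: add_pos_nonneg)
  show pt: "p \<noteq> top" using e pos by auto
  then obtain r where r: "p = ennreal r" "0 \<le> r" by (cases p) auto
  have r0: "r \<noteq> 0" using e r by auto
  then have "1 / p = ennreal (1 / r)" using r by (simp add: divide_ennreal[symmetric])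
  then have "1 / r = 1 / u + w" using e pos r by (simp add: ennreal_inj)
  then show "0 < enn2real p" "1 / enn2real p = 1 / enn2real a + 1 / enn2real b" using r r0 u w(3) by auto
qed

lemma body_exists:
  fixes G :: "((real^'n) \<times> (real^'n)) set"
  assumes G: "G \<noteq> {}" "bounded G" "convex G" "open G"
  shows "\<exists>N K C0. body G N K C0"
proof -
  obtain B where B: "\<And>z. z \<in> G \<Longrightarrow> norm z \<le> B" using G(2) by (auto simp: bounded_iff)
  \<comment> \<open>The summand 1 compensates \<open>N - 1\<close> in the locale; the minimum 2
    makes \<open>near N\<close> at least as wide as the relation \<open>near 2\<close> behind
    \<open>Zs\<close>, which \<open>mx_pos\<close> uses.\<close>
  define N where "N = max 2 (\<lceil>B\<rceil> + 1)"
  have "\<bar>fst z $ i\<bar> \<le> of_int N - 1 \<and> \<bar>snd z $ i\<bar> \<le> of_int N - 1" if "z \<in> G" for z i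
  proof -
    have "\<bar>fst z $ i\<bar> \<le> norm z" "\<bar>snd z $ i\<bar> \<le> norm z"
      using component_le_norm_cart[of "fst z" i] component_le_norm_cart[of "snd z" i] norm_fst_le[of "fst z" "snd z"] norm_snd_le[of "snd z" "fst z"] by auto
    moreover have "B \<le> of_int N - 1" using le_of_int_ceiling[of B] by (simp add: N_def) linarith
    ultimately show ?thesis using B[OF that] by linarith
  qed
  moreover obtain K :: "real \<Rightarrow> ((real^'n) \<times> (real^'n)) set" and C where "0 \<le> C" "\<forall>s. K s \<in> sets borel"
    "\<forall>s. 0 < s \<longrightarrow> s \<le> 2 * real CARD('n) \<longrightarrow> emeasure lborel (K s) \<le> ennreal (C * s)"
    "\<forall>s u v w. 0 < s \<longrightarrow> u \<in> G \<longrightarrow> v \<notin> G \<longrightarrow> dist w u \<le> s \<longrightarrow> dist w v \<le> s \<longrightarrow> w \<in> K s"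
    using layer_exists[OF G, of "2 * real CARD('n)"] by auto
  ultimately have "body G N K C" using G by unfold_locales (auto simp: N_def)
  then show ?thesis by blast
qed

context body
begin

lemma square_fun_measurable:
  assumes g: "g1 \<in> \<B>" "g2 \<in> \<B>"
    and ae: "AE x in lborel. f1 x = g1 x" "AE x in lborel. f2 x = g2 x"
  shows "square_fun G f1 f2 = LF g1 g2" "square_fun G f1 f2 \<in> borel_measurable lebesgue"
proof -
  show e: "square_fun G f1 f2 = LF g1 g2" using square_fun_LF[OF g ae] by (simp add: fun_eq_iff)
  have "LF g1 g2 \<in> borel_measurable lborel" using LF_measurable[OF g] by simp
  then show "square_fun G f1 f2 \<in> borel_measurable lebesgue" unfolding e by (rule measurable_completion)
qed

lemma strong_type:
  fixes p1 p2 p :: ennreal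
  assumes p1: "1 < p1" "p1 < top" and p2: "1 < p2" and p: "1 / p = 1 / p1 + 1 / p2"
  shows "\<exists>C::real. \<forall>f1 \<in> Lp_space p1. \<forall>f2 \<in> Lp_space p2.
          square_fun G f1 f2 \<in> borel_measurable lebesgue \<and>
          Lp_norm p (square_fun G f1 f2) \<le> ennreal C * Lp_norm_complex p1 f1 * Lp_norm_complex p2 f2"
proof -
  have le: "1 \<le> p1" "1 \<le> p2" using p1 p2 by auto
  note q = exponent_conv[OF le(1) p1(2) le(2) p]
  obtain C :: real where C: "\<And>f1 f2 n1 n2. \<lbrakk>f1 \<in> \<B>; f2 \<in> \<B>; 0 < n1; 0 < n2;
      mdl p1 (\<lambda>x. of_real (1 / n1) * f1 x) \<le> 1; mdl p2 (\<lambda>x. of_real (1 / n2) * f2 x) \<le> 1\<rbrakk> \<Longrightarrow>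
    ennreal_powr (NN x. ennreal_powr (LF f1 f2 x) (enn2real p)) (1 / enn2real p) \<le> ennreal C * ennreal n1 * ennreal n2"
    using LF_strong_norm[OF p1 p2 q(2,3)] by metis
  show ?thesis
  proof (intro exI[of _ C] ballI conjI)
    fix f1 f2 :: "real^'n \<Rightarrow> complex" assume f1: "f1 \<in> Lp_space p1" and f2: "f2 \<in> Lp_space p2"
    obtain g1 n1 where "Lp_repr p1 f1 g1 n1" using Lp_rep[OF f1 le(1)] by blast
    note g1 = Lp_reprD[OF this]
    obtain g2 n2 where "Lp_repr p2 f2 g2 n2" using Lp_rep[OF f2 le(2)] by blast
    note g2 = Lp_reprD[OF this]
    note sq = square_fun_measurable[OF g1(1) g2(1) g1(2) g2(2)]
    show "square_fun G f1 f2 \<in> borel_measurable lebesgue" by (rule sq)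
    have N: "Lp_norm p (square_fun G f1 f2) = ennreal_powr (NN x. ennreal_powr (LF g1 g2 x) (enn2real p)) (1 / enn2real p)"
      using q(1) by (simp add: Lp_norm_def sq(1) nn_integral_completion)
    show "Lp_norm p (square_fun G f1 f2) \<le> ennreal C * Lp_norm_complex p1 f1 * Lp_norm_complex p2 f2"
    proof (cases "n1 = 0 \<or> n2 = 0")
      case True
      \<comment> \<open>A function of norm 0 cannot be normalised, but it vanishes almost
        everywhere, and then the square function is 0 at every point.\<close>
      then have "LF g1 g2 x = 0" for x using g1 g2 by (intro LF_zero) auto
      then have "Lp_norm p (square_fun G f1 f2) = 0" unfolding N by (simp add: ennreal_powr_def)
      then show ?thesis by simp
    next
      case False
      then have n: "0 < n1" "0 < n2" using g1(3) g2(3) by auto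
      show ?thesis unfolding N g1(4) g2(4) by (rule C[OF g1(1) g2(1) n g1(6)[OF n(1)] g2(6)[OF n(2)]])
    qed
  qed
qed

lemma weak_type_norm:
  fixes p2 p :: ennreal
  assumes p2: "1 \<le> p2" and p: "1 / p = 1 + 1 / p2"
  shows "\<exists>C::real. \<forall>f1 \<in> Lp_space 1. \<forall>f2 \<in> Lp_space p2.
          square_fun G f1 f2 \<in> borel_measurable lebesgue \<and>
          weak_Lp_norm p (square_fun G f1 f2) \<le> ennreal C * Lp_norm_complex 1 f1 * Lp_norm_complex p2 f2"
proof -
  have "1 / p = 1 / 1 + 1 / p2" using p by simp
  note q' = exponent_conv[OF order_refl _ p2 this]
  have q: "0 < enn2real p" "1 / enn2real p = 1 + 1 / enn2real p2" using q' by auto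
  obtain C :: real where C: "\<And>f1 f2 n1 n2 \<alpha>. \<lbrakk>f1 \<in> \<B>; f2 \<in> \<B>; 0 < n1; 0 < n2;
      mdl 1 (\<lambda>x. of_real (1 / n1) * f1 x) \<le> 1; mdl p2 (\<lambda>x. of_real (1 / n2) * f2 x) \<le> 1; 0 < \<alpha>\<rbrakk> \<Longrightarrow>
    ennreal \<alpha> * ennreal_powr (emeasure lborel {x. LF f1 f2 x > ennreal \<alpha>}) (1 / enn2real p) \<le> ennreal C * ennreal n1 * ennreal n2"
    using LF_weak_norm[OF p2 q] by metis
  show ?thesis
  proof (intro exI[of _ C] ballI conjI)
    fix f1 f2 :: "real^'n \<Rightarrow> complex" assume f1: "f1 \<in> Lp_space 1" and f2: "f2 \<in> Lp_space p2"
    obtain g1 n1 where "Lp_repr 1 f1 g1 n1" using Lp_rep[OF f1 order_refl] by blast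
    note g1 = Lp_reprD[OF this]
    obtain g2 n2 where "Lp_repr p2 f2 g2 n2" using Lp_rep[OF f2 p2] by blast
    note g2 = Lp_reprD[OF this]
    note sq = square_fun_measurable[OF g1(1) g2(1) g1(2) g2(2)]
    show "square_fun G f1 f2 \<in> borel_measurable lebesgue" by (rule sq)
    have [measurable]: "LF g1 g2 \<in> \<B>" by (rule LF_measurable[OF g1(1) g2(1)])
    have "ennreal \<alpha> * ennreal_powr (emeasure lebesgue {x. square_fun G f1 f2 x > ennreal \<alpha>}) (1 / enn2real p)
       \<le> ennreal C * Lp_norm_complex 1 f1 * Lp_norm_complex p2 f2" if \<alpha>: "0 < \<alpha>" for \<alpha>
    proof -
      have N: "emeasure lebesgue {x. square_fun G f1 f2 x > ennreal \<alpha>} = emeasure lborel {x. LF g1 g2 x > ennreal \<alpha>}"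
        unfolding sq(1) by simp
      show ?thesis
      proof (cases "n1 = 0 \<or> n2 = 0")
        case True
        then have "LF g1 g2 x = 0" for x using g1 g2 by (intro LF_zero) auto
        then show ?thesis unfolding N by (simp add: ennreal_powr_def)
      next
        case False
        then have n: "0 < n1" "0 < n2" using g1(3) g2(3) by auto
        show ?thesis unfolding N g1(4) g2(4) by (rule C[OF g1(1) g2(1) n g1(6)[OF n(1)] g2(6)[OF n(2)] \<alpha>])
      qed
    qed
    then show "weak_Lp_norm p (square_fun G f1 f2) \<le> ennreal C * Lp_norm_complex 1 f1 * Lp_norm_complex p2 f2"
      unfolding weak_Lp_norm_def by (intro SUP_least) auto
  qed
qed

lemma bmo_type:
  "\<exists>C::real. \<forall>f1 \<in> Linf_c. \<forall>f2 \<in> Linf_c.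
          square_fun G f1 f2 \<in> borel_measurable lebesgue \<and>
          BMO_dyadic_norm (\<lambda>x. enn2ereal (square_fun G f1 f2 x))
            \<le> ennreal C * Lp_norm_complex top f1 * Lp_norm_complex top f2"
proof -
  obtain C :: real where C0: "0 \<le> C" and C: "\<And>f1 f2 n1 n2 j x0. \<lbrakk>integrable lborel f1; integrable lborel f2; mdl 2 f1 < top; 0 < n1; 0 < n2;
      \<And>x. norm (f1 x) \<le> n1; \<And>x. norm (f2 x) \<le> n2\<rbrakk> \<Longrightarrow>
    \<exists>a::real. (NN x. indicator {x. gr j x = gr j x0} x * e2ennreal \<bar>enn2ereal (LF f1 f2 x) - ereal a\<bar>)
      \<le> ennreal (C * n1 * n2 * (2 powi j) ^ CARD('n))"
    using LF_bmo by blast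
  show ?thesis
  proof (intro exI[of _ C] ballI conjI)
    fix f1 f2 :: "real^'n \<Rightarrow> complex" assume fc: "f1 \<in> Linf_c" "f2 \<in> Linf_c"
    then have f1: "f1 \<in> Lp_space top" and f2: "f2 \<in> Lp_space top" by (auto simp: Linf_c_def)
    obtain g1 n1 where "Lp_repr top f1 g1 n1" using Lp_rep[OF f1 top_greatest] by blast
    note g1 = Lp_reprD[OF this]
    obtain g2 n2 where "Lp_repr top f2 g2 n2" using Lp_rep[OF f2 top_greatest] by blast
    note g2 = Lp_reprD[OF this]
    note sq = square_fun_measurable[OF g1(1) g2(1) g1(2) g2(2)]
    show "square_fun G f1 f2 \<in> borel_measurable lebesgue" by (rule sq)
    have bound: "norm (g x) \<le> n" if "0 < n" "mdl top (\<lambda>x. of_real (1 / n) * g x) \<le> 1" for g :: "real^'n \<Rightarrow> complex" and n x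
    proof -
      have "norm (of_real (1 / n) * g x) \<le> 1" by (rule mdl_top_bound) (use that(2) in \<open>auto intro: le_less_trans\<close>)
      then show ?thesis using that(1) by (simp add: norm_divide divide_le_eq)
    qed
    \<comment> \<open>Boundedness and compact support put the representative into all L^q;
      \<open>LF_bmo\<close> uses integrability and L^2.\<close>
    have supp: "integrable lborel g \<and> mdl 2 g < top"
      if f: "f \<in> Linf_c" and gm: "g \<in> \<B>" and ae: "AE x in lborel. f x = g x" and le: "\<And>x. norm (g x) \<le> n"
      for f g :: "real^'n \<Rightarrow> complex" and n
    proof -
      have n0: "0 \<le> n" using le norm_ge_zero order_trans by blast
      have [measurable]: "g \<in> \<B>" by (rule gm)
      obtain Z where Z: "compact Z" "AE x in lebesgue. x \<notin> Z \<longrightarrow> f x = 0" using f by (auto simp: Linf_c_def)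
      have Zs [measurable]: "Z \<in> sets borel" using Z(1) by (simp add: borel_compact)
      have Zf: "emeasure lborel Z < top" using emeasure_compact_finite[OF Z(1)] by (simp add: less_top)
      have g0: "AE x in lborel. x \<notin> Z \<longrightarrow> g x = 0" using Z(2)[unfolded AE_completion_iff] ae by eventually_elim simp
      have fin: "(NN x. ennreal (norm (g x) powr q)) < top" if q: "0 < q" for q
      proof -
        have "(NN x. ennreal (norm (g x) powr q)) \<le> (NN x. ennreal (n powr q) * indicator Z x)"
        proof (rule nn_integral_mono_AE)
          show "AE x in lborel. ennreal (norm (g x) powr q) \<le> ennreal (n powr q) * indicator Z x"
            using g0
          proof eventually_elim
            case (elim x)
            have "norm (g x) powr q \<le> n powr q" using le q by (intro powr_mono2) auto
            then show ?case using elim by (cases "x \<in> Z") (auto simp: ennreal_leI)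
          qed
        qed
        also have "\<dots> = ennreal (n powr q) * emeasure lborel Z" by (rule nn_integral_cmult_indicator) simp
        also have "\<dots> < top" using Zf by (simp add: ennreal_mult_less_top)
        finally show ?thesis .
      qed
      have "integrable lborel g" using fin[of 1] by (simp add: integrable_iff_bounded)
      moreover have "mdl 2 g < top" using fin[of 2] by (simp add: mdl_def)
      ultimately show ?thesis by simp
    qed
    show "BMO_dyadic_norm (\<lambda>x. enn2ereal (square_fun G f1 f2 x)) \<le> ennreal C * Lp_norm_complex top f1 * Lp_norm_complex top f2"
      unfolding BMO_dyadic_norm_def sq(1) g1(4) g2(4)
    proof (rule SUP_least)
      fix Q :: "(real^'n) set" assume "Q \<in> (\<Union>k. dyadic_cubes k)"
      then obtain k x0 where Q: "Q = {x. gr k x = gr k x0}" by (auto simp: dyadic_cubes_gr)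
      let ?v = "(2 powi k) ^ CARD('n) :: real"
      have v: "0 < ?v" by simp
      have "\<exists>a::real. (NN x. indicator Q x * e2ennreal \<bar>enn2ereal (LF g1 g2 x) - ereal a\<bar>) \<le> ennreal (C * n1 * n2 * ?v)"
      proof (cases "n1 = 0 \<or> n2 = 0")
        case True
        then have "LF g1 g2 x = 0" for x using g1 g2 by (intro LF_zero) auto
        then show ?thesis by (intro exI[of _ 0]) (simp add: zero_ennreal.rep_eq e2ennreal_neg)
      next
        case False
        then have n: "0 < n1" "0 < n2" using g1(3) g2(3) by auto
        have b: "norm (g1 x) \<le> n1" "norm (g2 x) \<le> n2" for x using bound[OF n(1) g1(6)[OF n(1)]] bound[OF n(2) g2(6)[OF n(2)]] by auto
        have s: "integrable lborel g1" "mdl 2 g1 < top" "integrable lborel g2"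
          using supp[OF fc(1) g1(1,2) b(1)] supp[OF fc(2) g2(1,2) b(2)] by auto
        show ?thesis unfolding Q by (rule C[OF s(1,3,2) n b])
      qed
      then obtain a where a: "(NN x. indicator Q x * e2ennreal \<bar>enn2ereal (LF g1 g2 x) - ereal a\<bar>) \<le> ennreal (C * n1 * n2 * ?v)" ..
      have Qm: "emeasure lebesgue Q = ennreal ?v" unfolding Q by (simp add: cell_measure)
      have "(INF a. (\<integral>\<^sup>+x\<in>Q. e2ennreal \<bar>enn2ereal (LF g1 g2 x) - ereal a\<bar> \<partial>lebesgue) / emeasure lebesgue Q)
         \<le> (\<integral>\<^sup>+x\<in>Q. e2ennreal \<bar>enn2ereal (LF g1 g2 x) - ereal a\<bar> \<partial>lebesgue) / emeasure lebesgue Q"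
        by (rule INF_lower) simp
      also have "\<dots> \<le> ennreal (C * n1 * n2 * ?v) / ennreal ?v"
        unfolding Qm using a by (intro divide_right_mono_ennreal) (simp add: nn_integral_completion mult.commute)
      also have "\<dots> = ennreal C * ennreal n1 * ennreal n2"
        using v C0 g1(3) g2(3) by (subst divide_ennreal) (auto simp: ennreal_mult)
      finally show "(INF a. (\<integral>\<^sup>+x\<in>Q. e2ennreal \<bar>enn2ereal (LF g1 g2 x) - ereal a\<bar> \<partial>lebesgue) / emeasure lebesgue Q) \<le> ennreal C * ennreal n1 * ennreal n2" .
    qed
  qed
qed

end

theorem theorem7p1:
  fixes G :: "((real^'n) \<times> (real^'n)) set"
  assumes "G \<noteq> {}" and "bounded G" and "convex G" and "open G"
  shows
    "(\<forall>p1 p2 p :: ennreal. 1 < p1 \<and> p1 < top \<and> 1 < p2 \<and> p2 < top \<and> 1 / p = 1 / p1 + 1 / p2 \<longrightarrow>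
        (\<exists>C::real. \<forall>f1 \<in> Lp_space p1. \<forall>f2 \<in> Lp_space p2.
          square_fun G f1 f2 \<in> borel_measurable lebesgue \<and>
          Lp_norm p (square_fun G f1 f2)
            \<le> ennreal C * Lp_norm_complex p1 f1 * Lp_norm_complex p2 f2))
     \<and> (\<exists>C::real. \<forall>f1 \<in> Linf_c. \<forall>f2 \<in> Linf_c.
          square_fun G f1 f2 \<in> borel_measurable lebesgue \<and>
          BMO_dyadic_norm (\<lambda>x. enn2ereal (square_fun G f1 f2 x))
            \<le> ennreal C * Lp_norm_complex top f1 * Lp_norm_complex top f2)
     \<and> (\<forall>p2 p :: ennreal. 1 \<le> p2 \<and> 1 / p = 1 + 1 / p2 \<longrightarrow>
        (\<exists>C::real. \<forall>f1 \<in> Lp_space 1. \<forall>f2 \<in> Lp_space p2.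
          square_fun G f1 f2 \<in> borel_measurable lebesgue \<and>
          weak_Lp_norm p (square_fun G f1 f2)
            \<le> ennreal C * Lp_norm_complex 1 f1 * Lp_norm_complex p2 f2))"
proof -
  obtain N K C0 where "body G N K C0" using body_exists[OF assms] by blast
  then interpret body G N K C0 .
  show ?thesis using strong_type bmo_type weak_type_norm by blast
qed

end
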